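(* Let $H$ be a semisimple finite dimensional Hopf algebra over a field $k$, and let $A$ be an $H$-semiprime $H$-module algebra which has a right artinian classical right quotient ring $Q$; equip $Q$ with the unique $H$-module algebra structure extending that of $A$. Let $\Sigma$ be the set of regular elements of the ring $A^H$. For a right ideal $I$ of $A$ let $I_H$ be the largest $H$-stable right ideal of $A$ contained in $I$, and let $\mathcal{E}$ be the set of those right ideals $I$ of $A$ which satisfy the following two conditions (which are equivalent to each other): (a) $I_H$ is an essential right ideal of $A$; (b) $I$ contains a regular element of $A$. Then: (i) The algebra $A^H$ is semiprime right Goldie. (ii) $\Sigma$ is a right Ore subset of regular elements of $A$ (that is, $\Sigma$ consists of regular elements of $A$ and satisfies the right Ore condition in $A$). (iii) $Q$ is canonically isomorphic with the right localization of $A$ at $\Sigma$. (iv) The classical right quotient ring of $A^H$ is isomorphic with $Q^H$. (v) $I\cap\Sigma\neq\varnothing$ for each right ideal $I\in\mathcal{E}$.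
   Context: All algebras are associative and unital. An $H$-module algebra is a $k$-algebra $A$ with a left $H$-module structure such that the multiplication map $A\otimes_k A\to A$ is $H$-linear, where $H$ acts on $A\otimes_k A$ via its comultiplication. Its subalgebra of invariants is $A^H=\{a\in A\mid ha=\varepsilon(h)a \text{ for all } h\in H\}$, where $\varepsilon$ is the counit of $H$. $A$ is $H$-semiprime if it contains no nonzero nilpotent $H$-stable two-sided ideals. An element of a ring is regular if it is neither a left nor a right zero divisor. A classical right quotient ring of a ring $R$ is a ring $Q$ containing $R$ as a subring such that all regular elements of $R$ are invertible in $Q$ and each $q\in Q$ can be written as $q=as^{-1}$ with $a,s\in R$, $s$ regular. It is known that if $A$ has a right artinian classical right quotient ring $Q$, then the $H$-module structure on $A$ extends uniquely to $Q$ so that $Q$ becomes an $H$-module algebra. A right ideal of a ring is essential if it has nonzero intersection with each nonzero right ideal of the ring. *)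

theory Defs
  imports "HOL-Algebra.Algebra"
begin

section \<open>Noncommutative rings\<close>

text \<open>Rings are those of HOL-Algebra: unital, associative, not necessarily commutative
  (and possibly zero).\<close>

definition right_ideal :: "'a set \<Rightarrow> ('a, 'm) ring_scheme \<Rightarrow> bool" where
  "right_ideal I R \<longleftrightarrow> additive_subgroup I R \<and> (\<forall>a\<in>I. \<forall>x\<in>carrier R. a \<otimes>\<^bsub>R\<^esub> x \<in> I)"

definition left_ideal :: "'a set \<Rightarrow> ('a, 'm) ring_scheme \<Rightarrow> bool" where
  "left_ideal I R \<longleftrightarrow> additive_subgroup I R \<and> (\<forall>a\<in>I. \<forall>x\<in>carrier R. x \<otimes>\<^bsub>R\<^esub> a \<in> I)"

text \<open>A ring is semisimple if its left regular module is, i.e. every submodule is a direct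
  summand.\<close>

definition semisimple_ring :: "('a, 'm) ring_scheme \<Rightarrow> bool" where
  "semisimple_ring R \<longleftrightarrow> ring R \<and>
     (\<forall>I. left_ideal I R \<longrightarrow>
        (\<exists>J. left_ideal J R \<and> I \<inter> J = {\<zero>\<^bsub>R\<^esub>} \<and> I <+>\<^bsub>R\<^esub> J = carrier R))"

definition right_artinian :: "('a, 'm) ring_scheme \<Rightarrow> bool" where
  "right_artinian R \<longleftrightarrow> ring R \<and>
     (\<forall>I :: nat \<Rightarrow> 'a set. (\<forall>n. right_ideal (I n) R \<and> I (Suc n) \<subseteq> I n) \<longrightarrow>
        (\<exists>N. \<forall>n\<ge>N. I n = I N))"

primrec ideal_pow :: "('a, 'm) ring_scheme \<Rightarrow> 'a set \<Rightarrow> nat \<Rightarrow> 'a set" where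
  "ideal_pow R I 0 = carrier R"
| "ideal_pow R I (Suc n) = ideal_prod R (ideal_pow R I n) I"

definition nilpotent_ideal :: "'a set \<Rightarrow> ('a, 'm) ring_scheme \<Rightarrow> bool" where
  "nilpotent_ideal I R \<longleftrightarrow> ideal I R \<and> (\<exists>n. ideal_pow R I n = {\<zero>\<^bsub>R\<^esub>})"

definition semiprime_ring :: "('a, 'm) ring_scheme \<Rightarrow> bool" where
  "semiprime_ring R \<longleftrightarrow> ring R \<and> (\<forall>I. nilpotent_ideal I R \<longrightarrow> I = {\<zero>\<^bsub>R\<^esub>})"

definition right_annihilator :: "('a, 'm) ring_scheme \<Rightarrow> 'a set \<Rightarrow> 'a set" where
  "right_annihilator R S = {a \<in> carrier R. \<forall>x\<in>S. x \<otimes>\<^bsub>R\<^esub> a = \<zero>\<^bsub>R\<^esub>}"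

definition independent_right_ideals :: "('a, 'm) ring_scheme \<Rightarrow> (nat \<Rightarrow> 'a set) \<Rightarrow> bool" where
  "independent_right_ideals R I \<longleftrightarrow>
     (\<forall>n. right_ideal (I n) R) \<and>
     (\<forall>N x. (\<forall>i<N. x i \<in> I i) \<and> (\<Oplus>\<^bsub>R\<^esub>i\<in>{..<N}. x i) = \<zero>\<^bsub>R\<^esub> \<longrightarrow> (\<forall>i<N. x i = \<zero>\<^bsub>R\<^esub>))"

text \<open>Right Goldie: no infinite direct sums of nonzero right ideals, and the ascending chain
  condition on right annihilators.\<close>

definition right_goldie :: "('a, 'm) ring_scheme \<Rightarrow> bool" where
  "right_goldie R \<longleftrightarrow> ring R \<and>
     \<not> (\<exists>I :: nat \<Rightarrow> 'a set. independent_right_ideals R I \<and> (\<forall>n. I n \<noteq> {\<zero>\<^bsub>R\<^esub>})) \<and>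
     (\<forall>S :: nat \<Rightarrow> 'a set.
        (\<forall>n. S n \<subseteq> carrier R \<and> right_annihilator R (S n) \<subseteq> right_annihilator R (S (Suc n))) \<longrightarrow>
        (\<exists>N. \<forall>n\<ge>N. right_annihilator R (S n) = right_annihilator R (S N)))"

definition essential_right_ideal :: "'a set \<Rightarrow> ('a, 'm) ring_scheme \<Rightarrow> bool" where
  "essential_right_ideal I R \<longleftrightarrow> right_ideal I R \<and>
     (\<forall>J. right_ideal J R \<and> J \<noteq> {\<zero>\<^bsub>R\<^esub>} \<longrightarrow> I \<inter> J \<noteq> {\<zero>\<^bsub>R\<^esub>})"

definition regular_elements :: "('a, 'm) ring_scheme \<Rightarrow> 'a set" where
  "regular_elements R = {s \<in> carrier R. \<forall>a\<in>carrier R.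
     (s \<otimes>\<^bsub>R\<^esub> a = \<zero>\<^bsub>R\<^esub> \<longrightarrow> a = \<zero>\<^bsub>R\<^esub>) \<and> (a \<otimes>\<^bsub>R\<^esub> s = \<zero>\<^bsub>R\<^esub> \<longrightarrow> a = \<zero>\<^bsub>R\<^esub>)}"

text \<open>The containment of a ring in its classical right quotient ring is given by an injective
  ring homomorphism \<open>\<iota>\<close>, so that the two rings may have different element types.\<close>

definition classical_right_quotient_ring ::
    "('a, 'm) ring_scheme \<Rightarrow> ('a \<Rightarrow> 'b) \<Rightarrow> ('b, 'n) ring_scheme \<Rightarrow> bool" where
  "classical_right_quotient_ring R \<iota> Q \<longleftrightarrow>
     ring R \<and> ring Q \<and> \<iota> \<in> ring_hom R Q \<and> inj_on \<iota> (carrier R) \<and>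
     (\<forall>s\<in>regular_elements R. \<iota> s \<in> Units Q) \<and>
     (\<forall>q\<in>carrier Q. \<exists>a\<in>carrier R. \<exists>s\<in>regular_elements R. q = \<iota> a \<otimes>\<^bsub>Q\<^esub> inv\<^bsub>Q\<^esub> (\<iota> s))"

definition right_ore_set :: "('a, 'm) ring_scheme \<Rightarrow> 'a set \<Rightarrow> bool" where
  "right_ore_set R S \<longleftrightarrow>
     S \<subseteq> carrier R \<and> \<one>\<^bsub>R\<^esub> \<in> S \<and> (\<forall>s\<in>S. \<forall>t\<in>S. s \<otimes>\<^bsub>R\<^esub> t \<in> S) \<and>
     (\<forall>a\<in>carrier R. \<forall>s\<in>S. \<exists>b\<in>carrier R. \<exists>t\<in>S. a \<otimes>\<^bsub>R\<^esub> t = s \<otimes>\<^bsub>R\<^esub> b)"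

text \<open>\<open>L\<close> together with \<open>l\<close> is a right localization (right ring of fractions) of \<open>R\<close> at \<open>S\<close>.\<close>

definition right_localization ::
    "('a, 'm) ring_scheme \<Rightarrow> 'a set \<Rightarrow> ('a \<Rightarrow> 'b) \<Rightarrow> ('b, 'n) ring_scheme \<Rightarrow> bool" where
  "right_localization R S l L \<longleftrightarrow>
     ring R \<and> ring L \<and> l \<in> ring_hom R L \<and>
     (\<forall>s\<in>S. l s \<in> Units L) \<and>
     (\<forall>q\<in>carrier L. \<exists>a\<in>carrier R. \<exists>s\<in>S. q = l a \<otimes>\<^bsub>L\<^esub> inv\<^bsub>L\<^esub> (l s)) \<and>
     (\<forall>a\<in>carrier R. l a = \<zero>\<^bsub>L\<^esub> \<longleftrightarrow> (\<exists>s\<in>S. a \<otimes>\<^bsub>R\<^esub> s = \<zero>\<^bsub>R\<^esub>))"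


section \<open>Algebras over a field and their tensor products\<close>

text \<open>The library's locale \<open>algebra\<close> is restricted to commutative algebras.\<close>

locale algebra_over_field = K: field K + module K A + A: ring A
  for K :: "('k, 'm) ring_scheme" and A :: "('k, 'a, 'n) module_scheme" +
  assumes smult_mult_left: "\<lbrakk>c \<in> carrier K; x \<in> carrier A; y \<in> carrier A\<rbrakk> \<Longrightarrow>
      (c \<odot>\<^bsub>A\<^esub> x) \<otimes>\<^bsub>A\<^esub> y = c \<odot>\<^bsub>A\<^esub> (x \<otimes>\<^bsub>A\<^esub> y)"
    and smult_mult_right: "\<lbrakk>c \<in> carrier K; x \<in> carrier A; y \<in> carrier A\<rbrakk> \<Longrightarrow>
      x \<otimes>\<^bsub>A\<^esub> (c \<odot>\<^bsub>A\<^esub> y) = c \<odot>\<^bsub>A\<^esub> (x \<otimes>\<^bsub>A\<^esub> y)"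

definition finite_dimensional ::
    "('k, 'm) ring_scheme \<Rightarrow> ('k, 'a, 'n) module_scheme \<Rightarrow> bool" where
  "finite_dimensional K V \<longleftrightarrow>
     (\<exists>B. finite B \<and> B \<subseteq> carrier V \<and>
        (\<forall>v\<in>carrier V. \<exists>c \<in> B \<rightarrow> carrier K. v = (\<Oplus>\<^bsub>V\<^esub>b\<in>B. c b \<odot>\<^bsub>V\<^esub> b)))"

definition linear_maps ::
    "('k, 'm) ring_scheme \<Rightarrow> ('k, 'a, 'n) module_scheme \<Rightarrow> ('k, 'b, 'p) module_scheme \<Rightarrow> ('a \<Rightarrow> 'b) set"
  where
  "linear_maps K V W = {f \<in> carrier V \<rightarrow> carrier W.
     (\<forall>x\<in>carrier V. \<forall>y\<in>carrier V. f (x \<oplus>\<^bsub>V\<^esub> y) = f x \<oplus>\<^bsub>W\<^esub> f y) \<and>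
     (\<forall>c\<in>carrier K. \<forall>x\<in>carrier V. f (c \<odot>\<^bsub>V\<^esub> x) = c \<odot>\<^bsub>W\<^esub> f x)}"

definition algebra_homs ::
    "('k, 'm) ring_scheme \<Rightarrow> ('k, 'a, 'n) module_scheme \<Rightarrow> ('k, 'b, 'p) module_scheme \<Rightarrow> ('a \<Rightarrow> 'b) set"
  where
  "algebra_homs K A B = ring_hom A B \<inter> linear_maps K A B"

text \<open>The tensor product \<open>V \<otimes>\<^sub>K W\<close> is the quotient of the free abelian group on
  \<open>V \<times> W\<close> by the subgroup generated by the relations of a balanced biadditive map; its
  elements are cosets of formal integer combinations of pairs.\<close>

definition tensor_relations ::
    "('k, 'm) ring_scheme \<Rightarrow> ('k, 'a, 'n) module_scheme \<Rightarrow> ('k, 'b, 'p) module_scheme \<Rightarrow>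
     ('a \<times> 'b \<Rightarrow>\<^sub>0 int) set" where
  "tensor_relations K V W =
     {frag_of (x \<oplus>\<^bsub>V\<^esub> x', y) - frag_of (x, y) - frag_of (x', y) | x x' y.
        x \<in> carrier V \<and> x' \<in> carrier V \<and> y \<in> carrier W} \<union>
     {frag_of (x, y \<oplus>\<^bsub>W\<^esub> y') - frag_of (x, y) - frag_of (x, y') | x y y'.
        x \<in> carrier V \<and> y \<in> carrier W \<and> y' \<in> carrier W} \<union>
     {frag_of (c \<odot>\<^bsub>V\<^esub> x, y) - frag_of (x, c \<odot>\<^bsub>W\<^esub> y) | c x y.
        c \<in> carrier K \<and> x \<in> carrier V \<and> y \<in> carrier W}"

definition tensor_null ::
    "('k, 'm) ring_scheme \<Rightarrow> ('k, 'a, 'n) module_scheme \<Rightarrow> ('k, 'b, 'p) module_scheme \<Rightarrow>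
     ('a \<times> 'b \<Rightarrow>\<^sub>0 int) set" where
  "tensor_null K V W =
     generate (free_Abelian_group (carrier V \<times> carrier W)) (tensor_relations K V W)"

definition tensor_group ::
    "('k, 'm) ring_scheme \<Rightarrow> ('k, 'a, 'n) module_scheme \<Rightarrow> ('k, 'b, 'p) module_scheme \<Rightarrow>
     ('a \<times> 'b \<Rightarrow>\<^sub>0 int) set monoid" where
  "tensor_group K V W = free_Abelian_group (carrier V \<times> carrier W) Mod tensor_null K V W"

definition pure_tensor ::
    "('k, 'm) ring_scheme \<Rightarrow> ('k, 'a, 'n) module_scheme \<Rightarrow> ('k, 'b, 'p) module_scheme \<Rightarrow>
     'a \<Rightarrow> 'b \<Rightarrow> ('a \<times> 'b \<Rightarrow>\<^sub>0 int) set" where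
  "pure_tensor K V W x y =
     tensor_null K V W #>\<^bsub>free_Abelian_group (carrier V \<times> carrier W)\<^esub> frag_of (x, y)"

text \<open>The additive map \<open>V \<otimes>\<^sub>K W \<rightarrow> G\<close> induced by a balanced biadditive map \<open>f\<close>,
  where \<open>G\<close> is an abelian group in multiplicative notation. The value does not depend on the chosen
  representative precisely because \<open>f\<close> is balanced and biadditive; in Sweedler notation,
  \<open>tensor_lift G f (\<Delta> h)\<close> is \<open>\<Sum> f h\<^sub>1 h\<^sub>2\<close>.\<close>

definition tensor_lift ::
    "('g, 'q) monoid_scheme \<Rightarrow> ('a \<Rightarrow> 'b \<Rightarrow> 'g) \<Rightarrow> ('a \<times> 'b \<Rightarrow>\<^sub>0 int) set \<Rightarrow> 'g" where
  "tensor_lift G f t =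
     (let p = (SOME p. p \<in> t)
      in finprod G (\<lambda>(x, y). f x y [^]\<^bsub>G\<^esub> Poly_Mapping.lookup p (x, y)) (Poly_Mapping.keys p))"

definition tensor_algebra ::
    "('k, 'm) ring_scheme \<Rightarrow> ('k, 'a, 'n) module_scheme \<Rightarrow> ('k, 'b, 'p) module_scheme \<Rightarrow>
     ('k, ('a \<times> 'b \<Rightarrow>\<^sub>0 int) set) module" where
  "tensor_algebra K A B =
     \<lparr>carrier = carrier (tensor_group K A B),
      monoid.mult = (\<lambda>s t. tensor_lift (tensor_group K A B) (\<lambda>x y.
         tensor_lift (tensor_group K A B) (\<lambda>x' y'.
           pure_tensor K A B (x \<otimes>\<^bsub>A\<^esub> x') (y \<otimes>\<^bsub>B\<^esub> y')) t) s),
      one = pure_tensor K A B \<one>\<^bsub>A\<^esub> \<one>\<^bsub>B\<^esub>,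
      ring.zero = \<one>\<^bsub>tensor_group K A B\<^esub>,
      ring.add = monoid.mult (tensor_group K A B),
      smult = (\<lambda>c. tensor_lift (tensor_group K A B) (\<lambda>x y. pure_tensor K A B (c \<odot>\<^bsub>A\<^esub> x) y))\<rparr>"

text \<open>The map \<open>f \<otimes> g\<close> with values in \<open>V' \<otimes>\<^sub>K W'\<close>.\<close>

definition tensor_map ::
    "('k, 'm) ring_scheme \<Rightarrow> ('k, 'c, 'n) module_scheme \<Rightarrow> ('k, 'd, 'p) module_scheme \<Rightarrow>
     ('a \<Rightarrow> 'c) \<Rightarrow> ('b \<Rightarrow> 'd) \<Rightarrow> ('a \<times> 'b \<Rightarrow>\<^sub>0 int) set \<Rightarrow> ('c \<times> 'd \<Rightarrow>\<^sub>0 int) set" where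
  "tensor_map K V' W' f g =
     tensor_lift (tensor_group K V' W') (\<lambda>x y. pure_tensor K V' W' (f x) (g y))"

text \<open>The canonical map \<open>(U \<otimes> V) \<otimes> W \<rightarrow> U \<otimes> (V \<otimes> W)\<close>.\<close>

definition tensor_assoc ::
    "('k, 'm) ring_scheme \<Rightarrow> ('k, 'a, 'n) module_scheme \<Rightarrow> ('k, 'b, 'p) module_scheme \<Rightarrow>
     ('k, 'c, 'q) module_scheme \<Rightarrow>
     (('a \<times> 'b \<Rightarrow>\<^sub>0 int) set \<times> 'c \<Rightarrow>\<^sub>0 int) set \<Rightarrow> ('a \<times> ('b \<times> 'c \<Rightarrow>\<^sub>0 int) set \<Rightarrow>\<^sub>0 int) set" where
  "tensor_assoc K U V W =
     tensor_lift (tensor_group K U (tensor_algebra K V W)) (\<lambda>t z.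
       tensor_lift (tensor_group K U (tensor_algebra K V W)) (\<lambda>x y.
         pure_tensor K U (tensor_algebra K V W) x (pure_tensor K V W y z)) t)"


section \<open>Hopf algebras and module algebras\<close>

record ('k, 'h) hopf = "('k, 'h) module" +
  comult :: "'h \<Rightarrow> ('h \<times> 'h \<Rightarrow>\<^sub>0 int) set"
  counit :: "'h \<Rightarrow> 'k"
  antipode :: "'h \<Rightarrow> 'h"

locale hopf_algebra = H: algebra_over_field K H
  for K :: "('k, 'm) ring_scheme" and H :: "('k, 'h, 'n) hopf_scheme" +
  assumes comult_hom: "comult H \<in> algebra_homs K H (tensor_algebra K H H)"
    and counit_hom: "counit H \<in> ring_hom H K"
    and counit_smult: "\<lbrakk>c \<in> carrier K; h \<in> carrier H\<rbrakk> \<Longrightarrow>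
      counit H (c \<odot>\<^bsub>H\<^esub> h) = c \<otimes>\<^bsub>K\<^esub> counit H h"
    and coassoc: "h \<in> carrier H \<Longrightarrow>
      tensor_assoc K H H H (tensor_map K (tensor_algebra K H H) H (comult H) id (comult H h)) =
      tensor_map K H (tensor_algebra K H H) id (comult H) (comult H h)"
    and counit_left: "h \<in> carrier H \<Longrightarrow>
      tensor_lift (add_monoid H) (\<lambda>x y. counit H x \<odot>\<^bsub>H\<^esub> y) (comult H h) = h"
    and counit_right: "h \<in> carrier H \<Longrightarrow>
      tensor_lift (add_monoid H) (\<lambda>x y. counit H y \<odot>\<^bsub>H\<^esub> x) (comult H h) = h"
    and antipode_linear: "antipode H \<in> linear_maps K H H"
    and antipode_left: "h \<in> carrier H \<Longrightarrow>
      tensor_lift (add_monoid H) (\<lambda>x y. antipode H x \<otimes>\<^bsub>H\<^esub> y) (comult H h) =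
      counit H h \<odot>\<^bsub>H\<^esub> \<one>\<^bsub>H\<^esub>"
    and antipode_right: "h \<in> carrier H \<Longrightarrow>
      tensor_lift (add_monoid H) (\<lambda>x y. x \<otimes>\<^bsub>H\<^esub> antipode H y) (comult H h) =
      counit H h \<odot>\<^bsub>H\<^esub> \<one>\<^bsub>H\<^esub>"

text \<open>\<open>act_mult\<close> says that the multiplication map \<open>A \<otimes>\<^sub>K A \<rightarrow> A\<close> commutes with
  the action of \<open>H\<close>, where \<open>h \<in> H\<close> acts on \<open>A \<otimes>\<^sub>K A\<close> as
  \<open>\<Sum> h\<^sub>1 \<otimes> h\<^sub>2\<close>. The identity \<open>act h \<one> = \<epsilon>(h) \<one>\<close> need not be
  assumed: it follows by means of the antipode.\<close>

locale hopf_module_algebra = hopf_algebra K H + A: algebra_over_field K A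
  for K :: "('k, 'm) ring_scheme" and H :: "('k, 'h, 'n) hopf_scheme"
    and A :: "('k, 'a, 'p) module_scheme" and act :: "'h \<Rightarrow> 'a \<Rightarrow> 'a" +
  assumes act_linear: "h \<in> carrier H \<Longrightarrow> act h \<in> linear_maps K A A"
    and act_linear_left: "a \<in> carrier A \<Longrightarrow> (\<lambda>h. act h a) \<in> linear_maps K H A"
    and act_one: "a \<in> carrier A \<Longrightarrow> act \<one>\<^bsub>H\<^esub> a = a"
    and act_assoc: "\<lbrakk>g \<in> carrier H; h \<in> carrier H; a \<in> carrier A\<rbrakk> \<Longrightarrow>
      act (g \<otimes>\<^bsub>H\<^esub> h) a = act g (act h a)"
    and act_mult: "\<lbrakk>h \<in> carrier H; t \<in> carrier (tensor_algebra K A A)\<rbrakk> \<Longrightarrow>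
      tensor_lift (add_monoid A) (\<lambda>a b. a \<otimes>\<^bsub>A\<^esub> b)
        (tensor_lift (tensor_group K A A) (\<lambda>x y. tensor_map K A A (act x) (act y) t) (comult H h)) =
      act h (tensor_lift (add_monoid A) (\<lambda>a b. a \<otimes>\<^bsub>A\<^esub> b) t)"

definition invariant_subalgebra ::
    "('k, 'h, 'n) hopf_scheme \<Rightarrow> ('k, 'a) module \<Rightarrow> ('h \<Rightarrow> 'a \<Rightarrow> 'a) \<Rightarrow> ('k, 'a) module" where
  "invariant_subalgebra H A act =
     A\<lparr>carrier := {a \<in> carrier A. \<forall>h\<in>carrier H. act h a = counit H h \<odot>\<^bsub>A\<^esub> a}\<rparr>"

definition H_stable :: "('k, 'h, 'n) hopf_scheme \<Rightarrow> ('h \<Rightarrow> 'a \<Rightarrow> 'a) \<Rightarrow> 'a set \<Rightarrow> bool" where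
  "H_stable H act I \<longleftrightarrow> (\<forall>h\<in>carrier H. \<forall>a\<in>I. act h a \<in> I)"

definition H_semiprime ::
    "('k, 'h, 'n) hopf_scheme \<Rightarrow> ('k, 'a) module \<Rightarrow> ('h \<Rightarrow> 'a \<Rightarrow> 'a) \<Rightarrow> bool" where
  "H_semiprime H A act \<longleftrightarrow>
     (\<forall>I. nilpotent_ideal I A \<and> H_stable H act I \<longrightarrow> I = {\<zero>\<^bsub>A\<^esub>})"

text \<open>The largest \<open>H\<close>-stable right ideal of \<open>A\<close> contained in \<open>I\<close>.\<close>

definition H_core ::
    "('k, 'h, 'n) hopf_scheme \<Rightarrow> ('k, 'a) module \<Rightarrow> ('h \<Rightarrow> 'a \<Rightarrow> 'a) \<Rightarrow> 'a set \<Rightarrow> 'a set" where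
  "H_core H A act I = (GREATEST J. right_ideal J A \<and> H_stable H act J \<and> J \<subseteq> I)"

definition E_ideals ::
    "('k, 'h, 'n) hopf_scheme \<Rightarrow> ('k, 'a) module \<Rightarrow> ('h \<Rightarrow> 'a \<Rightarrow> 'a) \<Rightarrow> 'a set set" where
  "E_ideals H A act = {I. right_ideal I A \<and>
     essential_right_ideal (H_core H A act I) A \<and> I \<inter> regular_elements A \<noteq> {}}"

end

theory Submission imports Defs begin

text \<open>The matrix coefficients \<open>u i j\<close> of a basis of \<open>H\<close> turn the action on \<open>Q\<close> into a ring
 homomorphism \<open>x \<mapsto> (u i j x)\<close> from \<open>Q\<close> to matrices over \<open>Q\<close>, and semisimplicity gives a
 two-sided integral \<open>t\<close> of counit \<open>1\<close>, which acts as a projection onto the invariants.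

 The main step is that every stable right ideal of \<open>Q\<close> has an invariant left identity. Consider
 stable right ideals \<open>I \<subseteq> Y\<close> and a primitive idempotent \<open>g\<close>. The homomorphisms from \<open>Y / I\<close> to
 the simple top of \<open>gQ\<close>, combined with the matrix coefficients, give linearly independent rows over a
 division ring; counting them bounds the number of generators of \<open>Y / I\<close> of type \<open>g\<close> by those of the
 other types. If \<open>g\<close> maximizes the ratio of this number to the multiplicity of \<open>g\<close> in \<open>Q\<close>, equality
 holds, and then the relations between minimal generators have coefficients in the largest stable
 ideal which kills the top of \<open>gQ\<close>. For a minimal stable right ideal \<open>V\<close> this shows, with \<open>I = 0\<close> and
 \<open>Y = V\<close>, that \<open>V\<close> is annihilated by a maximal stable ideal, and then, with \<open>I = V\<close> and \<open>Y = Q\<close>, that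
 \<open>V\<close> is a direct summand of \<open>Q\<close> and has a left identity; applying \<open>t\<close> makes it invariant.

 For regular \<open>s \<in> A\<close> the trace form is nondegenerate: \<open>t(sA) x = 0\<close> implies \<open>x = 0\<close>. Together with
 the left identities this shows that a stable right ideal of \<open>A\<close> which contains a regular element
 contains an invariant one, from which all the claims follow.\<close>

text \<open>Nothing says at the outset that \<open>Q\<close> is semisimple, so right ideals of
  \<open>Q\<close> cannot be assumed to have complements, and averaging with the integral only
  improves a left identity that is already known. Hence the existence of a left identity is
  extracted from a count of dimensions. The count lives on simple tops, which are vector spaces over
  division rings; no quotient module is formed, and everything is phrased by congruences and by
  spans modulo a subgroup. Comultiplication enters only through the coefficients in
  \<open>D (b i) = sum of b c (x) u c i\<close>. Once these are known, the ring theory works with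
  the operators \<open>u i j\<close> and their antipodes \<open>v i j\<close>, and no tensor occurs
  in it. Identities with \<open>v\<close> are useful only if the \<open>v i j\<close> also span all
  operators, that is, if the antipode is surjective; this too is proved from the integral.
  \<open>A\<close> is carried into \<open>Q\<close> by \<open>\<iota>\<close>, so that elements and
  fractions share one carrier.\<close>

notation monoid.mult (infixl "**\<index>" 70)

section \<open>Closures with the exchange property\<close>

text \<open>The axioms of a matroid closure, except that closures need not be generated by finite
  subsets; finiteness enters through explicit finite spanning sets.\<close>

locale exchange_closure =
 fixes C :: "'a set" and cl :: "'a set => 'a set"
 assumes cl_closed: "S <= C ==> cl S <= C"
  and cl_extensive: "S <= C ==> S <= cl S"
  and cl_mono: "S <= T ==> T <= C ==> cl S <= cl T"
  and cl_idem: "S <= C ==> cl (cl S) <= cl S"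
  and exchange: "[|S <= C; x : C; y : cl (insert x S); y ~: cl S|] ==> x : cl (insert y S)"
begin

definition indep :: "'a set => bool" where
 "indep I \<longleftrightarrow> I <= C & (\<forall>x\<in>I. x ~: cl (I - {x}))"

lemma cl_least: "[|S <= cl T; T <= C|] ==> cl S <= cl T"
 using cl_mono[of S "cl T"] cl_closed cl_idem by blast

lemma indep_subset:
 assumes "indep I" "J <= I" shows "indep J"
 unfolding indep_def
proof (intro conjI ballI)
 show "J <= C" using assms unfolding indep_def by blast
 fix x assume "x : J"
 have "cl (J - {x}) <= cl (I - {x})"
  using assms unfolding indep_def by (intro cl_mono) auto
 then show "x ~: cl (J - {x})" using assms `x : J` unfolding indep_def by blast
qed

text \<open>Steinitz exchange: the members of \<open>I\<close> enter one at a time, each displaces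
  one member of \<open>J\<close>, and the survivors \<open>J'\<close> still span together with
  \<open>I\<close>.\<close>

lemma exchange_basis:
 assumes J: "finite J" "J <= C" and I: "finite I"
 shows "indep I ==> I <= cl J ==> \<exists>J'\<subseteq>J. card J' + card I = card J & J <= cl (I \<union> J')"
 using I
proof (induction I rule: finite_induct)
 case empty
 then show ?case using cl_extensive[OF J(2)] by (intro exI[of _ J]) auto
next
 case (insert x I)
 have iI: "indep I" using insert.prems(1) by (rule indep_subset) blast
 then obtain J' where J': "J' <= J" "card J' + card I = card J" "J <= cl (I \<union> J')"
  using insert by blast
 have C: "I <= C" "x : C" using insert.prems(1) unfolding indep_def by auto
 have xI: "x ~: cl I" using insert.prems(1) insert.hyps(2) unfolding indep_def by auto
 have fJ': "finite J'" "J' <= C" using J' J by (auto intro: finite_subset)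
 have "x : cl (I \<union> J')"
  using insert.prems(2) cl_least[OF J'(3)] C fJ' by blast
 then have "\<exists>F. finite F & F <= J' & x : cl (I \<union> F)" using fJ' by blast
 \<comment> \<open>A smallest \<open>F\<close> with \<open>x\<close> in the closure of
   \<open>I \<union> F\<close> loses \<open>x\<close> as soon as some \<open>y\<close> is removed.
   This is the situation of \<open>exchange\<close>, and \<open>y\<close> is the element to be
   displaced.\<close>
 define n where "n = (LEAST n. \<exists>F. finite F & F <= J' & x : cl (I \<union> F) & card F = n)"
 have "\<exists>F. finite F & F <= J' & x : cl (I \<union> F) & card F = n"
  unfolding n_def by (rule LeastI_ex) (use `\<exists>F. _` in blast)
 then obtain F where F: "finite F" "F <= J'" "x : cl (I \<union> F)" "card F = n" by blast
 have "F ~= {}" using F(3) xI by auto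
 then obtain y where y: "y : F" by blast
 have "card (F - {y}) < n" using F y by (metis card_Diff1_less)
 then have nx: "x ~: cl (I \<union> (F - {y}))"
  using not_less_Least[of "card (F - {y})" "%n. \<exists>F. finite F & F <= J' & x : cl (I \<union> F) & card F = n"]
   F unfolding n_def by blast
 have FC: "I \<union> (F - {y}) <= C" using C F fJ' by auto
 have eq: "insert y (I \<union> (F - {y})) = I \<union> F" using y by auto
 have "y : cl (insert x (I \<union> (F - {y})))"
  using exchange[OF FC _ _ nx, of y] F y fJ' eq by auto
 also have "... <= cl (insert x I \<union> (J' - {y}))"
  using F C fJ' by (intro cl_mono) auto
 finally have ycl: "y : cl (insert x I \<union> (J' - {y}))" .
 have sub: "insert x I \<union> (J' - {y}) <= C" using C fJ' by auto
 have "I \<union> J' <= cl (insert x I \<union> (J' - {y}))"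
  using cl_extensive[OF sub] ycl by auto
 then have "J <= cl (insert x I \<union> (J' - {y}))"
  using cl_least[OF _ sub] J'(3) by blast
 moreover have "card (J' - {y}) + card (insert x I) = card J"
 proof -
  have yJ: "y : J'" using y F by auto
  then have "card J' > 0" using fJ' card_gt_0_iff by blast
  then show ?thesis using J'(2) insert.hyps yJ fJ' by (simp add: card_Diff_singleton)
 qed
 ultimately show ?case using J'(1) by blast
qed

lemma indep_card_le:
 assumes "finite J" "J <= C" "finite I" "indep I" "I <= cl J"
 shows "card I <= card J"
 using exchange_basis[OF assms] by auto

text \<open>If the cardinalities agree, the exchange displaces all of \<open>J\<close>. This
  equality case later turns a count into information about relations.\<close>

lemma indep_card_eq:
 assumes "finite J" "J <= C" "finite I" "indep I" "I <= cl J" "card J <= card I"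
 shows "J <= cl I"
proof -
 obtain J' where J': "J' <= J" "card J' + card I = card J" "J <= cl (I \<union> J')"
  using exchange_basis[OF assms(1-5)] by blast
 then have "card J' = 0" using assms(6) by linarith
 then have "J' = {}" using J' assms(1) by (auto simp: finite_subset)
 then show ?thesis using J' by simp
qed

text \<open>The bound on the cardinality comes from a finite spanning set of the ambient space.\<close>

lemma finite_basis_exists:
 assumes J: "finite J" "J <= C" and Y: "Y <= cl J"
 shows "\<exists>B. finite B & B <= Y & indep B & Y <= cl B"
proof -
 define P where "P n \<longleftrightarrow> (\<exists>B. finite B & B <= Y & indep B & card B = n)" for n
 have P0: "P 0" unfolding P_def indep_def by (intro exI[of _ "{}"]) auto
 have bd: "n <= card J" if "P n" for n
  using that Y indep_card_le[OF J] unfolding P_def by blast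
 obtain n where n: "P n" "!!m. P m ==> m <= n"
  using Nat.ex_has_greatest_nat[of P 0 "card J"] P0 bd by blast
 then obtain B where B: "finite B" "B <= Y" "indep B" "card B = n" unfolding P_def by blast
 have "x : cl B" if "x : Y" for x
 proof (rule ccontr)
  assume nx: "x ~: cl B"
  have BC: "B <= C" using B unfolding indep_def by blast
  have xC: "x : C" using that Y cl_closed[OF J(2)] by blast
  have xB: "x ~: B" using nx cl_extensive[OF BC] by blast
  have "indep (insert x B)"
   unfolding indep_def
  proof (intro conjI ballI)
   show "insert x B <= C" using BC xC by auto
   fix y assume "y : insert x B"
   show "y ~: cl (insert x B - {y})"
   proof (cases "y = x")
    case True then show ?thesis using nx xB by simp
   next
    case False
    then have yB: "y : B" using `y : insert x B` by simp
    have e: "insert x B - {y} = insert x (B - {y})" using False by auto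
    show ?thesis
    proof
     assume "y : cl (insert x B - {y})"
     then have "x : cl (insert y (B - {y}))"
      using exchange[of "B - {y}" x y] BC xC yB B(3) unfolding e indep_def by blast
     then show False using nx yB by (simp add: insert_absorb)
    qed
   qed
  qed
  then have "P (Suc n)"
   unfolding P_def using B that xB by (intro exI[of _ "insert x B"]) auto
  then show False using n(2)[of "Suc n"] by simp
 qed
 then show ?thesis using B by blast
qed

end

text \<open>Spans in an abelian group \<open>G\<close> modulo a subgroup \<open>B\<close>, for a set \<open>Om\<close> of
 operators which acts on \<open>G / B\<close> like a division ring.\<close>

locale operator_span = abelian_group G for G (structure) +
 fixes B :: "'a set" and Om :: "('a => 'a) set"
 assumes B_zero: "\<zero> : B" and B_closed: "B <= carrier G"
  and B_add: "[|x : B; y : B|] ==> x \<oplus> y : B"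
  and Om_closed: "[|om : Om; x : carrier G|] ==> om x : carrier G"
  and Om_hom: "[|om : Om; x : carrier G; y : carrier G|] ==> om (x \<oplus> y) = om x \<oplus> om y"
  and Om_B: "[|om : Om; x : B|] ==> om x : B"
  and Om_zero: "\<exists>om\<in>Om. \<forall>x\<in>carrier G. om x = \<zero>"
  and Om_one: "\<exists>om\<in>Om. \<forall>x\<in>carrier G. om x = x"
  and Om_uminus: "\<exists>om\<in>Om. \<forall>x\<in>carrier G. om x = \<ominus> x"
  and Om_plus: "[|om : Om; om' : Om|] ==> \<exists>om''\<in>Om. \<forall>x\<in>carrier G. om'' x = om x \<oplus> om' x"
  and Om_comp: "[|om : Om; om' : Om|] ==> \<exists>om''\<in>Om. \<forall>x\<in>carrier G. om'' x = om (om' x)"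
  and Om_inverse: "om : Om ==>
   (\<forall>x\<in>carrier G. om x : B) | (\<exists>om'\<in>Om. \<forall>x\<in>carrier G. om' (om x) \<ominus> x : B)"
begin

inductive_set ospan :: "'a set => 'a set" for S where
 ospan_base: "x : B ==> x : ospan S"
| ospan_gen: "x : S ==> x : ospan S"
| ospan_add: "x : ospan S ==> y : ospan S ==> x \<oplus> y : ospan S"
| ospan_op: "om : Om ==> x : ospan S ==> om x : ospan S"

lemma ospan_closed: assumes "S <= carrier G" shows "ospan S <= carrier G"
proof
 fix x assume "x : ospan S" then show "x : carrier G"
  by induction (use assms B_closed Om_closed in auto)
qed

lemma ospan_uminus:
 assumes "S <= carrier G" "x : ospan S" shows "\<ominus> x : ospan S"
proof -
 obtain om where "om : Om" "\<forall>x\<in>carrier G. om x = \<ominus> x" using Om_uminus by blast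
 moreover have "x : carrier G" using ospan_closed assms by blast
 ultimately show ?thesis using ospan_op[of om x S] assms(2) by auto
qed

lemma ospan_insertE:
 assumes S: "S <= carrier G" "x : carrier G" and y: "y : ospan (insert x S)"
 obtains om s where "om : Om" "s : ospan S" "y = om x \<oplus> s"
proof -
 have sc: "s : carrier G" if "s : ospan S" for s using ospan_closed S(1) that by blast
 from y have "\<exists>om\<in>Om. \<exists>s\<in>ospan S. y = om x \<oplus> s"
 proof induction
  case (ospan_base z)
  obtain om where "om : Om" "\<forall>x\<in>carrier G. om x = \<zero>" using Om_zero by blast
  then show ?case using ospan_base S B_closed
   by (intro bexI[of _ om] bexI[of _ z]) (auto intro: ospan.ospan_base)
 next
  case (ospan_gen z)
  show ?case
  proof (cases "z = x")
   case True
   obtain om where "om : Om" "\<forall>x\<in>carrier G. om x = x" using Om_one by blast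
   then show ?thesis using True S B_zero
    by (intro bexI[of _ om] bexI[of _ \<zero>]) (auto intro: ospan.ospan_base)
  next
   case False
   obtain om where "om : Om" "\<forall>x\<in>carrier G. om x = \<zero>" using Om_zero by blast
   then show ?thesis using False ospan_gen S
    by (intro bexI[of _ om] bexI[of _ z]) (auto intro: ospan.ospan_gen)
  qed
 next
  case (ospan_add z z')
  then obtain om s om' s' where *: "om : Om" "s : ospan S" "z = om x \<oplus> s" "om' : Om" "s' : ospan S"
   "z' = om' x \<oplus> s'" by blast
  obtain om'' where "om'' : Om" "\<forall>x\<in>carrier G. om'' x = om x \<oplus> om' x" using Om_plus * by blast
  then show ?case using * S sc Om_closed
   by (intro bexI[of _ om''] bexI[of _ "s \<oplus> s'"]) (auto intro: ospan.ospan_add simp: a_ac)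
 next
  case (ospan_op om' z)
  then obtain om s where *: "om : Om" "s : ospan S" "z = om x \<oplus> s" by blast
  obtain om'' where "om'' : Om" "\<forall>x\<in>carrier G. om'' x = om' (om x)" using Om_comp * ospan_op by blast
  then show ?case using * S sc Om_closed ospan_op
   by (intro bexI[of _ om''] bexI[of _ "om' s"]) (auto intro: ospan.ospan_op simp: Om_hom)
 qed
 then show ?thesis using that by blast
qed

text \<open>If \<open>y = om x + s\<close> is not spanned by \<open>S\<close>, then
  \<open>om\<close> is nonzero modulo \<open>B\<close>, and \<open>Om_inverse\<close> allows the
  equation to be solved for \<open>x\<close>.\<close>

sublocale exchange_closure "carrier G" ospan
proof
 show "ospan S <= carrier G" if "S <= carrier G" for S using ospan_closed that .
 show "S <= ospan S" for S by (auto intro: ospan_gen)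
 have mono: "ospan S <= ospan T" if "S <= ospan T" for S T
 proof
  fix x assume "x : ospan S" then show "x : ospan T"
   by induction (use that in \<open>auto intro: ospan.intros\<close>)
 qed
 show "ospan S <= ospan T" if "S <= T" for S T
  using that by (intro mono) (auto intro: ospan_gen)
 show "ospan (ospan S) <= ospan S" for S by (rule mono) simp
 fix S x y
 assume S: "S <= carrier G" "x : carrier G" and y: "y : ospan (insert x S)" "y ~: ospan S"
 obtain om s where *: "om : Om" "s : ospan S" "y = om x \<oplus> s" using ospan_insertE[OF S y(1)] by blast
 have c: "s : carrier G" "y : carrier G" "om x : carrier G"
  using * subsetD[OF ospan_closed[OF S(1)]] S Om_closed by auto
 have "~ (\<forall>x\<in>carrier G. om x : B)"
  using y(2) * S by (auto intro: ospan_add ospan_base)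
 then obtain om' where om': "om' : Om" "\<forall>x\<in>carrier G. om' (om x) \<ominus> x : B" using Om_inverse * by blast
 have "om x = y \<ominus> s" using * c by (simp add: minus_eq a_assoc r_neg)
 moreover have "s : ospan (insert y S)"
  using * `!!T S. S <= T ==> ospan S <= ospan T`[of S "insert y S"] by blast
 ultimately have wx: "om x : ospan (insert y S)"
  unfolding minus_eq using ospan_add[OF ospan_gen ospan_uminus] S c by auto
 define b where "b = om' (om x) \<ominus> x"
 have b: "b : B" using om' S b_def by auto
 have "x = om' (om x) \<oplus> (\<ominus> b)"
  using S c om' Om_closed unfolding b_def by (simp add: minus_eq minus_add a_assoc[symmetric] r_neg)
 moreover have "\<ominus> b : ospan (insert y S)"
  using ospan_uminus[of "insert y S" b] S c b by (auto intro: ospan_base)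
 ultimately show "x : ospan (insert y S)"
  using ospan_add[OF ospan_op[OF om'(1) wx]] by metis
qed

end

section \<open>Right ideals and idempotents in right artinian rings\<close>

context ring begin

lemma right_idealI:
 assumes "I <= carrier R" "\<zero> : I" "!!x y. x : I ==> y : I ==> x \<oplus> y : I"
  and "!!x a. x : I ==> a : carrier R ==> x ** a : I"
 shows "right_ideal I R"
proof -
 have "\<ominus> x : I" if "x : I" for x
 proof -
  have "x : carrier R" using that assms(1) by auto
  then have "x ** (\<ominus> \<one>) = \<ominus> x" by (simp add: r_minus)
  then show ?thesis using assms(4)[OF that, of "\<ominus> \<one>"] by simp
 qed
 then have "subgroup I (add_monoid R)"
  using assms by (unfold_locales) (auto simp: a_inv_def[symmetric])
 then show ?thesis
  using assms(4) unfolding right_ideal_def additive_subgroup_def by blast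
qed

lemma right_idealD:
 assumes "right_ideal I R"
 shows "I <= carrier R" "\<zero> : I" "!!x y. x : I ==> y : I ==> x \<oplus> y : I"
  "!!x a. x : I ==> a : carrier R ==> x ** a : I"
  "!!x. x : I ==> \<ominus> x : I" "!!x y. x : I ==> y : I ==> x \<ominus> y : I"
proof -
 interpret additive_subgroup I R using assms unfolding right_ideal_def by blast
 show "I <= carrier R" "\<zero> : I" using a_subset by auto
 show "!!x y. x : I ==> y : I ==> x \<oplus> y : I" by (rule a_closed)
 show "!!x a. x : I ==> a : carrier R ==> x ** a : I"
  using assms unfolding right_ideal_def by blast
 show "!!x. x : I ==> \<ominus> x : I" by (rule a_inv_closed)
 then show "!!x y. x : I ==> y : I ==> x \<ominus> y : I"
  unfolding minus_eq using a_closed by blast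
qed

lemma ri_in: "right_ideal I R ==> x : I ==> x : carrier R"
 using right_idealD(1) by blast

lemmas ri_zero = right_idealD(2) and ri_add = right_idealD(3) and ri_mult = right_idealD(4)
 and ri_uminus = right_idealD(5) and ri_minus = right_idealD(6)

lemma right_ideal_carrier: "right_ideal (carrier R) R"
 by (rule right_idealI) auto

lemma right_ideal_zero: "right_ideal {\<zero>} R"
 by (rule right_idealI) auto

lemma right_ideal_Int: "[|right_ideal I R; right_ideal J R|] ==> right_ideal (I \<inter> J) R"
 by (rule right_idealI) (auto dest: right_idealD)

lemma artinian_minimal:
 assumes art: "right_artinian R" and ne: "F ~= {}" and F: "!!I. I : F ==> right_ideal I R"
 shows "\<exists>I\<in>F. \<forall>J\<in>F. J <= I --> J = I"
proof (rule ccontr)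
 assume "~ ?thesis"
 then have step: "\<exists>J. J : F & J \<subset> I" if "I : F" for I using that by blast
 obtain I0 where "I0 : F" using ne by blast
 have "\<exists>f :: nat => 'a set. \<forall>n. f n : F & f (Suc n) \<subset> f n"
  by (rule dependent_nat_choice) (use `I0 : F` step in blast)+
 then obtain f :: "nat => 'a set" where f: "!!n. f n : F" "!!n. f (Suc n) \<subset> f n" by blast
 obtain N where N: "\<forall>n\<ge>N. f n = f N"
  using art f F unfolding right_artinian_def by (meson psubset_imp_subset)
 have "f (Suc N) = f N" using N[rule_format, of "Suc N"] le_SucI[OF le_refl] by blast
 then show False using f(2)[of N] by blast
qed

lemma artinian_minimalE:
 assumes "right_artinian R" "P I0" "!!I. P I ==> right_ideal I R"
 obtains I where "P I" "!!J. P J ==> J <= I ==> J = I"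
 using artinian_minimal[OF assms(1), of "Collect P"] assms(2,3) by blast

section \<open>Generated right ideals and nilpotence\<close>

inductive_set rspan :: "'a set => 'a set" for S where
 rspan_zero: "\<zero> : rspan S"
| rspan_mult: "[|s : S; a : carrier R|] ==> s ** a : rspan S"
| rspan_add: "[|x : rspan S; y : rspan S|] ==> x \<oplus> y : rspan S"

lemma rspan_closed: assumes "S <= carrier R" shows "rspan S <= carrier R"
proof
 fix x assume "x : rspan S" then show "x : carrier R"
  by induction (use assms in auto)
qed

lemma right_ideal_rspan: assumes S: "S <= carrier R" shows "right_ideal (rspan S) R"
proof (rule right_idealI)
 show "rspan S <= carrier R" using S by (rule rspan_closed)
 fix x a assume "x : rspan S" and a: "a : carrier R"
 then show "x ** a : rspan S"
 proof induction
  case (rspan_mult s b)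
  then show ?case using S rspan.rspan_mult[of s S "b ** a"] a by (auto simp: m_assoc)
 next
  case (rspan_add x y)
  then have "x : carrier R" "y : carrier R" using rspan_closed[OF S] by auto
  then show ?case using rspan_add a by (auto simp: l_distr intro: rspan.intros)
 qed (use a in \<open>auto intro: rspan.intros\<close>)
qed (auto intro: rspan.intros)

lemma rspan_superset: assumes "S <= carrier R" shows "S <= rspan S"
proof
 fix x assume "x : S" then show "x : rspan S"
  using rspan_mult[of x S \<one>] assms by auto
qed

lemma rspan_least:
 assumes "right_ideal I R" "S <= I" shows "rspan S <= I"
proof
 fix x assume "x : rspan S" then show "x : I"
  by induction (use assms right_idealD[OF assms(1)] in auto)
qed

lemma rspan_mono: "S <= T ==> T <= carrier R ==> rspan S <= rspan T"
 using rspan_least[OF right_ideal_rspan] rspan_superset by blast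

definition pr :: "'a => 'a set" where "pr x = (%a. x ** a) ` carrier R"

lemma right_ideal_pr: "x : carrier R ==> right_ideal (pr x) R"
 unfolding pr_def
 by (rule right_idealI) (auto simp: r_distr[symmetric] m_assoc intro: image_eqI[of _ _ \<zero>])

lemma pr_self: "x : carrier R ==> x : pr x"
 unfolding pr_def by (force intro: image_eqI[of _ _ \<one>])

lemma pr_least: "[|right_ideal I R; x : I|] ==> pr x <= I"
 unfolding pr_def by (auto dest: right_idealD)

lemma pr_idem: "[|g : carrier R; g ** g = g|] ==> pr g = {x : carrier R. g ** x = x}"
 unfolding pr_def by (auto simp: m_assoc[symmetric]) (metis imageI)

text \<open>\<open>nil_layer I n\<close> consists of those \<open>y\<close> with \<open>I\<^sup>n y = 0\<close>.\<close>

primrec nil_layer :: "'a set => nat => 'a set" where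
 "nil_layer I 0 = {\<zero>}"
| "nil_layer I (Suc n) = {y : carrier R. \<forall>x\<in>I. x ** y : nil_layer I n}"

text \<open>Evaluated at \<open>1\<close>, the layers say that all products of \<open>n\<close>
  elements of \<open>I\<close> vanish; thus no powers of right ideals have to be formed.\<close>

definition nilp :: "'a set => bool" where "nilp I \<longleftrightarrow> (\<exists>n. \<one> : nil_layer I n)"

lemma nilp_pow:
 assumes "I <= carrier R" "nilp I" "x : I" shows "\<exists>n. x [^] (n::nat) = \<zero>"
proof -
 have x: "x : carrier R" using assms by auto
 have *: "y : nil_layer I n ==> y : carrier R ==> x [^] n ** y = \<zero>" for n y
  by (induction n arbitrary: y) (use x assms(3) in \<open>auto simp: m_assoc\<close>)
 obtain n where "\<one> : nil_layer I n" using assms(2) nilp_def by blast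
 then show ?thesis using *[of \<one> n] x by auto
qed

text \<open>One factor from the generated right ideal gives way to two factors from
  \<open>I\<close>, so the index at most doubles.\<close>

lemma nilp_square:
 assumes I: "I <= carrier R" and n: "nilp (rspan {x ** y | x y. x : I & y : I})"
 shows "nilp I"
proof -
 let ?J = "rspan {x ** y | x y. x : I & y : I}"
 have S: "{x ** y | x y. x : I & y : I} <= carrier R" using I by auto
 have *: "nil_layer ?J n <= nil_layer I (2 * n)" for n
 proof (induction n)
  case (Suc n)
  show ?case
  proof
   fix y assume y: "y : nil_layer ?J (Suc n)"
   have "x ** (x' ** y) : nil_layer I (2 * n)" if "x : I" "x' : I" for x x'
   proof -
    have "x ** x' : ?J" using rspan_superset[OF S] that by blast
    then have "(x ** x') ** y : nil_layer I (2 * n)" using y Suc by auto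
    then show ?thesis using that I y by (auto simp: m_assoc subset_iff)
   qed
   then show "y : nil_layer I (2 * Suc n)" using y I by auto
  qed
 qed auto
 then show ?thesis using n unfolding nilp_def by blast
qed

section \<open>Lifting idempotents\<close>

lemma minus_plus_cancel: "[|x : carrier R; y : carrier R; z : carrier R|] ==> x \<ominus> y \<oplus> (y \<oplus> z) = x \<oplus> z"
 by (simp add: minus_eq a_assoc r_neg1)

lemma minus_sum_cancel: "[|x : carrier R; y : carrier R|] ==> x \<ominus> (x \<oplus> y) = \<ominus> y"
 by (simp add: minus_eq minus_add a_assoc[symmetric] r_neg)

lemma plus_minus_cancel: "[|x : carrier R; y : carrier R; z : carrier R|] ==> (x \<oplus> y) \<ominus> (z \<oplus> y) = x \<ominus> z"
 by (simp add: minus_eq minus_add a_ac r_neg2)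

text \<open>One step of Newton's iteration \<open>c \<mapsto> 3c\<^sup>2 - 2c\<^sup>3\<close> for idempotents squares the defect
 \<open>d = c\<^sup>2 - c\<close>.\<close>

lemma newton_step:
 assumes c: "c : carrier R" and d_def: "d = c ** c \<ominus> c"
 shows "\<exists>w\<in>carrier R. d ** w = w ** d &
  (c ** (c \<oplus> c \<oplus> c \<ominus> (c ** c \<oplus> c ** c))) ** (c ** (c \<oplus> c \<oplus> c \<ominus> (c ** c \<oplus> c ** c))) \<ominus>
  c ** (c \<oplus> c \<oplus> c \<ominus> (c ** c \<oplus> c ** c)) = (d ** d) ** w"
proof -
 have d: "d : carrier R" using c d_def by simp
 have cc: "c ** c = c \<oplus> d"
  using c minus_plus_cancel[of "c ** c" c \<zero>] d unfolding d_def by (simp add: a_comm)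
 have cd: "c ** d = d ** c"
  unfolding d_def using c by (simp add: minus_eq l_distr r_distr l_minus r_minus m_assoc)
 \<comment> \<open>With \<open>w = 1 - 2c\<close> one has \<open>w w = 1 + 4d\<close>, and the new
   approximation is \<open>c + d w\<close>; its defect is \<open>d d\<close> times
   \<open>W = 4d - 3\<close>.\<close>
 define w f y W where "w = \<one> \<ominus> (c \<oplus> c)" and "f = d \<oplus> d \<oplus> d \<oplus> d" and "y = d ** w"
  and "W = \<one> \<oplus> f \<ominus> (\<one> \<oplus> \<one> \<oplus> \<one> \<oplus> \<one>)"
 have w: "w : carrier R" and f: "f : carrier R" and y: "y : carrier R" and W: "W : carrier R"
  unfolding w_def f_def y_def W_def using c d by simp_all
 have dw: "w ** d = d ** w"
  unfolding w_def using c d cd by (simp add: minus_eq l_distr r_distr l_minus r_minus)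
 have cw: "c ** w = w ** c"
  unfolding w_def using c by (simp add: minus_eq l_distr r_distr l_minus r_minus)
 have cy: "c ** y = y ** c"
  unfolding y_def using c d w cd cw by (metis m_assoc)
 have wc: "w ** c = \<ominus> (c \<oplus> d \<oplus> d)"
 proof -
  have "w ** c = c \<ominus> (c ** c \<oplus> c ** c)"
   unfolding w_def using c by (simp add: minus_eq l_distr l_minus)
  also have "... = c \<ominus> (c \<oplus> (c \<oplus> d \<oplus> d))" unfolding cc using c d by (simp add: a_ac)
  finally show ?thesis using c d by (simp add: minus_sum_cancel)
 qed
 have ww: "w ** w = \<one> \<oplus> f"
 proof -
  have "w ** w = w \<ominus> (w ** c \<oplus> w ** c)"
   using w c by (subst (2) w_def) (simp add: minus_eq r_distr r_minus)
  also have "... = \<one> \<ominus> (c \<oplus> c) \<oplus> ((c \<oplus> c) \<oplus> f)"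
   unfolding wc using c d by (simp add: minus_eq minus_add[symmetric] w_def f_def a_ac)
  finally show ?thesis using c f by (simp add: minus_plus_cancel)
 qed
 have yw: "y ** w = d \<oplus> d ** f" unfolding y_def using d w f by (simp add: m_assoc ww r_distr)
 have "y ** y = d ** ((w ** d) ** w)" unfolding y_def using d w by (simp add: m_assoc)
 also have "... = (d ** d) ** (w ** w)" unfolding dw using d w by (simp add: m_assoc)
 finally have yy: "y ** y = d ** d \<oplus> d ** d ** f" unfolding ww using d f by (simp add: r_distr)
 have c': "c ** (c \<oplus> c \<oplus> c \<ominus> (c ** c \<oplus> c ** c)) = c \<oplus> y"
 proof -
  have "c \<oplus> c \<oplus> c \<ominus> (c ** c \<oplus> c ** c) = (c \<oplus> c) \<oplus> c \<ominus> ((c \<oplus> d \<oplus> d) \<oplus> c)"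
   unfolding cc using c d by (simp add: a_ac)
  also have "... = c \<oplus> c \<ominus> ((d \<oplus> d) \<oplus> c)"
   using c d by (subst plus_minus_cancel) (simp_all add: a_ac)
  also have "... = c \<ominus> (d \<oplus> d)"
   using c d by (subst plus_minus_cancel) (simp_all add: a_ac)
  finally have "c ** (c \<oplus> c \<oplus> c \<ominus> (c ** c \<oplus> c ** c)) = c ** c \<ominus> (c ** d \<oplus> c ** d)"
   using c d by (simp add: minus_eq r_distr r_minus)
  also have "... = c \<oplus> (d \<ominus> (d ** c \<oplus> d ** c))"
   unfolding cc cd using c d by (simp add: minus_eq a_assoc)
  also have "d \<ominus> (d ** c \<oplus> d ** c) = y"
   unfolding y_def w_def using c d by (simp add: minus_eq r_distr r_minus)
  finally show ?thesis .
 qed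
 have "(c \<oplus> y) ** (c \<oplus> y) \<ominus> (c \<oplus> y) = (d \<oplus> y ** c \<oplus> y ** c \<oplus> y ** y) \<oplus> c \<ominus> (y \<oplus> c)"
  using c y d by (simp add: l_distr r_distr cc cy a_ac)
 also have "... = (d \<oplus> y ** c \<oplus> y ** c \<oplus> y ** y) \<ominus> y"
  using c y d by (intro plus_minus_cancel) simp_all
 also have "... = (d \<ominus> y ** w) \<oplus> y ** y"
  unfolding w_def using c y d by (simp add: minus_eq minus_add r_distr r_minus a_ac)
 also have "d \<ominus> y ** w = \<ominus> (d ** f)"
  unfolding yw using d f by (simp add: minus_sum_cancel)
 also have "\<ominus> (d ** f) \<oplus> y ** y = (d ** d) ** W"
  unfolding yy W_def f_def using d by (simp add: minus_eq minus_add r_distr r_minus a_ac m_assoc)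
 finally have "(c \<oplus> y) ** (c \<oplus> y) \<ominus> (c \<oplus> y) = (d ** d) ** W" .
 moreover have "d ** W = W ** d"
  unfolding W_def f_def using d by (simp add: minus_eq l_distr r_distr l_minus r_minus)
 ultimately show ?thesis unfolding c' using W by blast
qed

text \<open>The iterate is kept in the form \<open>c ** p\<close>, so it stays in every right ideal
  that contains \<open>c\<close>. The clause on \<open>b\<close> will show that the idempotent is
  nonzero.\<close>

lemma idempotent_lift:
 fixes k :: nat
 assumes "c : carrier R" "(c ** c \<ominus> c) [^] k = \<zero>"
 shows "\<exists>p\<in>carrier R. (c ** p) ** (c ** p) = c ** p &
  (\<forall>b\<in>carrier R. b ** c = b --> b ** (c ** p) = b)"
 using assms
proof (induction k arbitrary: c rule: less_induct)
 case (less k)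
 note c = less.prems(1)
 define d where "d = c ** c \<ominus> c"
 have d: "d : carrier R" unfolding d_def using c by simp
 show ?case
 proof (cases "k <= 1")
  case True
  have "d = \<zero>"
  proof (cases "k = 0")
   case True
   then have "\<one> = \<zero>" using less.prems(2) d d_def by simp
   then show ?thesis using d by (metis l_one l_null)
  next
   case False
   then show ?thesis using less.prems(2) True d d_def by (simp add: le_Suc_eq)
  qed
  then have "c ** c = c" unfolding d_def using c by simp
  then show ?thesis using c by (intro bexI[of _ \<one>]) auto
 next
  case False
  define p0 where "p0 = (c \<oplus> c \<oplus> c) \<ominus> (c ** c \<oplus> c ** c)"
  have p0: "p0 : carrier R" unfolding p0_def using c by simp
  define c' where "c' = c ** p0"
  obtain w where w: "w : carrier R" "d ** w = w ** d" "c' ** c' \<ominus> c' = (d ** d) ** w"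
   using newton_step[OF c d_def] unfolding c'_def p0_def by blast
  have c': "c' : carrier R" unfolding c'_def using c p0 by simp
  have "(d ** d) ** w = w ** (d ** d)" using w d by (metis m_assoc)
  then have "(c' ** c' \<ominus> c') [^] (k - 1) = (d ** d) [^] (k - 1) ** w [^] (k - 1)"
   unfolding w(3) using d w by (intro pow_mult_distrib) simp_all
  also have "(d ** d) [^] (k - 1) = d [^] (k + (k - 2))"
  proof -
   have "(d ** d) [^] (k - 1) = (d [^] (2::nat)) [^] (k - 1)"
    using d by (simp add: numeral_2_eq_2)
   also have "... = d [^] (2 * (k - 1))" using d by (simp add: nat_pow_pow)
   \<comment> \<open>For \<open>k >= 2\<close> the exponent \<open>2 (k - 1)\<close> is at least
     \<open>k\<close>, so the squared defect vanishes already at exponent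
     \<open>k - 1\<close>.\<close>
   also have "2 * (k - 1) = k + (k - 2)" using False by simp
   finally show ?thesis .
  qed
  also have "... = \<zero>" using less.prems(2) d by (simp add: nat_pow_mult[symmetric] d_def[symmetric])
  finally have z: "(c' ** c' \<ominus> c') [^] (k - 1) = \<zero>" using w by simp
  obtain p where p: "p : carrier R" "(c' ** p) ** (c' ** p) = c' ** p"
   "\<forall>b\<in>carrier R. b ** c' = b --> b ** (c' ** p) = b"
   using less.IH[OF _ c' z] False by auto
  have e: "c' ** p = c ** (p0 ** p)" unfolding c'_def using c p0 p by (simp add: m_assoc)
  have "b ** c' = b" if b: "b : carrier R" "b ** c = b" for b
  proof -
   have "b ** c' = (b ** c) ** p0" unfolding c'_def using m_assoc[OF b(1) c p0] by simp
   also have "... = b ** p0" using b by simp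
   also have "... = (b ** c \<oplus> b ** c \<oplus> b ** c) \<ominus> (b ** c ** c \<oplus> b ** c ** c)"
    unfolding p0_def using b(1) c by (simp add: minus_eq r_distr r_minus m_assoc)
   also have "... = b" unfolding b(2) using b(1) by (simp add: minus_eq minus_add a_ac r_neg2 r_neg)
   finally show ?thesis .
  qed
  then have "\<forall>b\<in>carrier R. b ** c = b --> b ** (c ** (p0 ** p)) = b"
   using p(3) unfolding e by blast
  moreover have "p0 ** p : carrier R" using p0 p(1) by simp
  ultimately show ?thesis using p(2) unfolding e by blast
 qed
qed

text \<open>Brauer's lemma. A minimal non-nilpotent right ideal \<open>I'\<close> is generated by
  its products, and a minimal \<open>J\<close> inside it with \<open>J I' ~= 0\<close> has the form
  \<open>x I'\<close>. So \<open>x = x a\<close> for some \<open>a\<close> in \<open>I'\<close>, and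
  the defect of \<open>a\<close> lies in the right annihilator of \<open>x\<close> in
  \<open>I'\<close>, which is nilpotent by minimality of \<open>I'\<close>.\<close>

lemma nonnil_has_idempotent:
 assumes art: "right_artinian R" and I: "right_ideal I R" "~ nilp I"
 shows "\<exists>e\<in>I. e ** e = e & e ~= \<zero>"
proof -
 obtain I' where I': "right_ideal I' R" "I' <= I" "~ nilp I'"
  and Imin: "!!J. right_ideal J R ==> J <= I' ==> ~ nilp J ==> J = I'"
 proof (rule artinian_minimalE[OF art, of "%J. right_ideal J R & J <= I & ~ nilp J" I])
  fix I' assume 1: "right_ideal I' R & I' <= I & ~ nilp I'"
   and 2: "!!J. right_ideal J R & J <= I & ~ nilp J ==> J <= I' ==> J = I'"
  show thesis
  proof (rule that[of I'])
   fix J assume "right_ideal J R" "J <= I'" "~ nilp J"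
   then show "J = I'" using 1 by (intro 2) auto
  qed (use 1 in auto)
 qed (use I in auto)
 note D = right_idealD[OF I'(1)]
 let ?S = "{x ** y | x y. x : I' & y : I'}"
 have S: "?S <= I'" using D by blast
 have sq: "rspan ?S = I'"
  using Imin[OF right_ideal_rspan rspan_least[OF I'(1) S]] nilp_square[OF D(1)] I'(3) S D(1) by blast
 define F where "F = {J. right_ideal J R & J <= I' & (\<exists>x\<in>J. \<exists>y\<in>I'. x ** y ~= \<zero>)}"
 have "I' : F"
 proof (rule ccontr)
  assume "I' ~: F"
  then have "\<forall>x\<in>I'. \<forall>y\<in>I'. x ** y = \<zero>" unfolding F_def using I' by blast
  then have "\<one> : nil_layer I' 2" using D(1) by (auto simp: numeral_2_eq_2 subset_iff)
  then show False using I'(3) nilp_def by blast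
 qed
 then obtain J where J: "J : F" "!!J'. J' : F ==> J' <= J ==> J' = J"
  using artinian_minimalE[OF art, of "%J. J : F" I'] unfolding F_def by (metis (mono_tags, lifting) mem_Collect_eq)
 then have JD: "right_ideal J R" "J <= I'" "\<exists>x\<in>J. \<exists>y\<in>I'. x ** y ~= \<zero>" unfolding F_def by auto
 then obtain x y where x: "x : J" and y: "y : I'" "x ** y ~= \<zero>" by blast
 have xc: "x : carrier R" using x JD(2) D(1) by blast
 define L where "L = (%a. x ** a) ` I'"
 have L: "right_ideal L R"
  unfolding L_def
 proof (rule right_idealI)
  show "\<zero> : (%a. x ** a) ` I'" using xc D(2) by (intro image_eqI[of _ _ \<zero>]) auto
  fix u v assume "u : (%a. x ** a) ` I'" "v : (%a. x ** a) ` I'"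
  then obtain u' v' where "u = x ** u'" "u' : I'" "v = x ** v'" "v' : I'" by blast
  then show "u \<oplus> v : (%a. x ** a) ` I'"
   using D(3) subsetD[OF D(1)] xc by (intro image_eqI[of _ _ "u' \<oplus> v'"]) (auto simp: r_distr)
 next
  fix u a assume "u : (%a. x ** a) ` I'" "a : carrier R"
  then obtain u' where "u = x ** u'" "u' : I'" by blast
  then show "u ** a : (%a. x ** a) ` I'"
   using D(4) subsetD[OF D(1)] xc `a : carrier R`
   by (intro image_eqI[of _ _ "u' ** a"]) (auto simp: m_assoc)
 qed (use xc D(1) in auto)
 have "L : F"
 proof (rule ccontr)
  assume "L ~: F"
  moreover have LJ: "L <= J" unfolding L_def using right_idealD(4)[OF JD(1) x] D(1) by blast
  ultimately have z: "(x ** a) ** b = \<zero>" if "a : I'" "b : I'" for a b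
   using L JD(2) that unfolding F_def L_def by blast
  have "x ** a = \<zero>" if "a : rspan ?S" for a using that
  proof induction
   case (rspan_mult s b)
   then obtain s1 s2 where s: "s = s1 ** s2" "s1 : I'" "s2 : I'" by blast
   then have "s2 ** b : I'" "s1 : carrier R" "s2 : carrier R"
    using D(4) D(1) rspan_mult(2) by auto
   then show ?case using z[of s1 "s2 ** b"] s rspan_mult(2) xc by (simp add: m_assoc)
  next
   case (rspan_add a b)
   then have "a : carrier R" "b : carrier R" using sq D(1) by auto
   then show ?case using rspan_add xc by (simp add: r_distr)
  qed (use xc in simp)
  then show False using y unfolding sq by blast
 qed
 moreover have "L <= J" unfolding L_def using ri_mult[OF JD(1) x] D(1) by blast
 ultimately have "L = J" using J(2) by blast
 then obtain a where a: "a : I'" "x = x ** a" using x unfolding L_def by blast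
 have ac: "a : carrier R" using a D by blast
 define N where "N = {z : I'. x ** z = \<zero>}"
 have N: "right_ideal N R" unfolding N_def
 proof (rule right_idealI)
  fix u v assume "u : {z : I'. x ** z = \<zero>}" "v : {z : I'. x ** z = \<zero>}"
  then show "u \<oplus> v : {z : I'. x ** z = \<zero>}"
   using D(3)[of u v] subsetD[OF D(1), of u] subsetD[OF D(1), of v] xc by (auto simp: r_distr)
 next
  fix u b assume "u : {z : I'. x ** z = \<zero>}" "b : carrier R"
  then show "u ** b : {z : I'. x ** z = \<zero>}"
   using D(4)[of u b] subsetD[OF D(1), of u] xc by (auto simp: m_assoc[symmetric])
 qed (use D(1,2) xc in auto)
 have "nilp N"
 proof (rule ccontr)
  assume "~ nilp N"
  then have "N = I'" using Imin N unfolding N_def by blast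
  then show False using y unfolding N_def by blast
 qed
 have "a ** a \<ominus> a : N"
 proof -
  have "x ** (a ** a \<ominus> a) = (x ** a) ** a \<ominus> x ** a" using xc ac by (simp add: minus_eq r_distr r_minus m_assoc)
  also have "... = \<zero>" unfolding a(2)[symmetric] using xc by simp
  finally show ?thesis unfolding N_def using D(6)[OF D(4)[OF a(1) ac] a(1)] by blast
 qed
 then obtain k :: nat where k: "(a ** a \<ominus> a) [^] k = \<zero>"
  using nilp_pow[OF right_idealD(1)[OF N] `nilp N`] by blast
 obtain p where p: "p : carrier R" "(a ** p) ** (a ** p) = a ** p" "x ** (a ** p) = x"
  using idempotent_lift[OF ac k] a(2) xc by auto
 have "x ~= \<zero>" using y D(1) by auto
 then have "a ** p ~= \<zero>" using p(3) xc r_null by metis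
 moreover have "a ** p : I" using D(4)[OF a(1) p(1)] I'(2) by blast
 ultimately show ?thesis using p(2) by blast
qed

end

section \<open>Primitive idempotents and the simple tops of their right ideals\<close>

context ring begin

lemma finsum_in_closed:
 assumes "M <= carrier R" "\<zero> : M" "!!x y. x : M ==> y : M ==> x \<oplus> y : M"
 shows "[|finite A; !!x. x : A ==> f x : M|] ==> finsum R f A : M"
proof (induction A rule: finite_induct)
 case (insert x A)
 then have "f : A \<rightarrow> carrier R" "f x : carrier R" using assms(1) by auto
 then show ?case using insert assms(3) by simp
qed (use assms in simp)

lemma ri_finsum:
 "[|right_ideal I R; finite A; !!x. x : A ==> f x : I|] ==> finsum R f A : I"
 using finsum_in_closed[of I A f] right_idealD by blast

lemma assoc_eq:
 "[|x ** y = z; x : carrier R; y : carrier R; w : carrier R|] ==> x ** (y ** w) = z ** w"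
 by (simp add: m_assoc[symmetric])

text \<open>A local idempotent is a primitive one; in a right artinian ring the proper right ideals inside
 \<open>gR\<close> are then exactly the nilpotent ones.\<close>

definition local_idem :: "'a => bool" where
 "local_idem g \<longleftrightarrow> g : carrier R & g ~= \<zero> & g ** g = g &
  (\<forall>I. right_ideal I R & I <= pr g & I ~= pr g --> nilp I)"

lemma local_idemD:
 assumes "local_idem g"
 shows "g : carrier R" "g ~= \<zero>" "g ** g = g"
  "!!x. x : pr g \<longleftrightarrow> x : carrier R & g ** x = x"
 using assms pr_idem unfolding local_idem_def by auto

lemma local_idem_proper_nilp:
 assumes "local_idem g" "right_ideal I R" "I <= pr g" "g ~: I"
 shows "nilp I"
proof -
 have "I ~= pr g" using pr_self local_idemD(1)[OF assms(1)] assms(4) by blast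
 then show ?thesis using assms unfolding local_idem_def by blast
qed

lemma pow_in_pr:
 assumes "y : carrier R" "g ** y = y" "g : carrier R" shows "g ** y [^] Suc k = y [^] Suc k"
proof -
 have "y [^] Suc k = y ** y [^] k" using assms(1) by (rule nat_pow_Suc2)
 then show ?thesis using assms m_assoc[of g y "y [^] k", symmetric] by simp
qed

text \<open>The elements of \<open>gR\<close> that do not generate it. For a local idempotent they
  form the largest proper right ideal inside \<open>gR\<close>, and the quotient is the simple
  top.\<close>

definition mx :: "'a => 'a set" where
 "mx g = {x : pr g. g ~: pr x}"

lemma mx_pr: "x : mx g ==> x : pr g"
 unfolding mx_def by blast

lemma mx_carrier: "local_idem g ==> x : mx g ==> x : carrier R"
 using mx_pr local_idemD by blast

lemma mx_nilp:
 assumes g: "local_idem g" and x: "x : mx g" shows "nilp (pr x)"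
proof (rule local_idem_proper_nilp[OF g right_ideal_pr])
 show "x : carrier R" using mx_carrier assms by blast
 show "pr x <= pr g" using pr_least[OF right_ideal_pr] local_idemD(1)[OF g] mx_pr[OF x] by blast
 show "g ~: pr x" using x unfolding mx_def by blast
qed

lemma mx_superset:
 assumes g: "local_idem g" and I: "right_ideal I R" "I <= pr g" "g ~: I"
 shows "I <= mx g"
 unfolding mx_def using pr_least[OF I(1)] I by blast

text \<open>If \<open>x + y\<close> generated \<open>gR\<close>, then \<open>g = x' + y'\<close>
  with \<open>x'\<close> in \<open>xR\<close> and \<open>y'\<close> in the nilpotent right ideal
  \<open>yR\<close>. Iterating this equation as a geometric series ends in \<open>g = x' z\<close>,
  so \<open>x\<close> alone would generate \<open>gR\<close>.\<close>

lemma right_ideal_mx: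
 assumes g: "local_idem g" shows "right_ideal (mx g) R"
proof (rule right_idealI)
 note gD = local_idemD[OF g]
 show "mx g <= carrier R" using mx_carrier[OF g] by blast
 show "\<zero> : mx g"
  unfolding mx_def pr_def using gD(1,2) by (auto intro!: image_eqI[of _ _ \<zero>])
 show "x ** a : mx g" if "x : mx g" "a : carrier R" for x a
 proof -
  have x: "x : carrier R" "g ** x = x" "g ~: pr x" using that(1) gD unfolding mx_def by auto
  have "x ** a : pr x" using that(2) unfolding pr_def by blast
  then have "pr (x ** a) <= pr x" using pr_least right_ideal_pr x(1) by blast
  then show ?thesis unfolding mx_def using x gD that(2) by (auto simp: m_assoc[symmetric])
 qed
 fix x y assume x: "x : mx g" and y: "y : mx g"
 have xc: "x : carrier R" "g ** x = x" "y : carrier R" "g ** y = y"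
  using gD(4) mx_pr[OF x] mx_pr[OF y] by auto
 show "x \<oplus> y : mx g"
 proof (rule ccontr)
  assume "x \<oplus> y ~: mx g"
  moreover have "x \<oplus> y : pr g" using gD xc by (simp add: r_distr)
  ultimately have "g : pr (x \<oplus> y)" unfolding mx_def by blast
  then obtain q where q: "q : carrier R" "g = (x \<oplus> y) ** q" unfolding pr_def by blast
  define x' y' where "x' = x ** q ** g" and "y' = y ** q ** g"
  have c: "x' : carrier R" "y' : carrier R" "g ** y' = y'" "g ** x' = x'"
   unfolding x'_def y'_def using xc q(1) gD(1) by (auto simp: m_assoc[symmetric])
  have "x' \<oplus> y' = (x \<oplus> y) ** q ** g" unfolding x'_def y'_def using xc q(1) gD(1)
   by (simp add: l_distr)
  then have sum: "x' \<oplus> y' = g" using q gD(3) by simp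
  have "\<exists>z\<in>carrier R. g = x' ** z \<oplus> y' [^] Suc n" for n
  proof (induction n)
   case 0 show ?case using sum c by (intro bexI[of _ \<one>]) auto
  next
   case (Suc n)
   then obtain z where z: "z : carrier R" "g = x' ** z \<oplus> y' [^] Suc n" by blast
   have "y' [^] Suc n = (x' \<oplus> y') ** y' [^] Suc n" using pow_in_pr[OF c(2,3) gD(1)] sum by simp
   also have "... = x' ** y' [^] Suc n \<oplus> y' [^] Suc (Suc n)"
    using c by (simp only: l_distr nat_pow_closed nat_pow_Suc2[of y' "Suc n"])
   finally have "g = x' ** (z \<oplus> y' [^] Suc n) \<oplus> y' [^] Suc (Suc n)"
    using z c by (metis a_assoc m_closed nat_pow_closed r_distr)
   then show ?case using z c by (intro bexI[of _ "z \<oplus> y' [^] Suc n"]) auto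
  qed note geom = this
  have "y' : pr y"
   unfolding y'_def pr_def using q xc gD(1) by (auto simp: m_assoc)
  then obtain n :: nat where n: "y' [^] n = \<zero>"
   using nilp_pow[OF right_idealD(1)[OF right_ideal_pr] mx_nilp[OF g y]] xc by blast
  obtain z where z: "z : carrier R" "g = x' ** z \<oplus> y' [^] Suc n" using geom by blast
  have "y' [^] Suc n = \<zero>" using n c by simp
  then have "g = x' ** z" using z c by simp
  also have "... = x ** (q ** g ** z)" unfolding x'_def using xc q gD(1) z by (simp add: m_assoc)
  finally have "g : pr x" unfolding pr_def using q gD(1) z by blast
  then show False using x unfolding mx_def by blast
 qed
qed

text \<open>If \<open>d x\<close> generated \<open>gR\<close>, there would be an \<open>x'\<close>
  in \<open>xR\<close> with \<open>d x' = g\<close>, hence \<open>d^n x'^n = g\<close> for all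
  \<open>n >= 1\<close>, although \<open>x'\<close> is nilpotent.\<close>

lemma corner_left_mx:
 assumes g: "local_idem g" and d: "d : carrier R" "g ** d = d" "d ** g = d" and x: "x : mx g"
 shows "d ** x : mx g"
proof (rule ccontr)
 note gD = local_idemD[OF g]
 assume a: "d ** x ~: mx g"
 have xc: "x : carrier R" "g ** x = x" using gD(4) mx_pr[OF x] by auto
 have "d ** x : pr g" using gD(4) d xc assoc_eq[OF d(2) gD(1) d(1) xc(1)] by simp
 then have "g : pr (d ** x)" using a unfolding mx_def by blast
 then obtain y where y: "y : carrier R" "g = d ** x ** y" unfolding pr_def by blast
 define x' where "x' = x ** (y ** g)"
 have x': "x' : carrier R" unfolding x'_def using xc y gD by simp
 have "d ** x' = d ** x ** y ** g"
  unfolding x'_def using d(1) xc(1) y(1) gD(1) by (simp add: m_assoc)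
 then have dx: "d ** x' = g" unfolding y(2)[symmetric] gD(3) .
 have gx': "g ** x' = x'" unfolding x'_def using xc y gD(1) by (simp add: m_assoc[symmetric])
 have pw: "d [^] Suc n ** x' [^] Suc n = g" for n
 proof (induction n)
  case 0 then show ?case using dx d x' by simp
 next
  case (Suc n)
  define u w where "u = d [^] Suc n" and "w = x' [^] Suc n"
  have uw: "u : carrier R" "w : carrier R" unfolding u_def w_def using d x' by simp_all
  have "d [^] Suc (Suc n) ** x' [^] Suc (Suc n) = (u ** d) ** (x' ** w)"
   unfolding u_def w_def nat_pow_Suc2[OF x', of "Suc n"] by simp
  also have "... = u ** (g ** w)"
   using d x' gD(1) uw by (simp add: m_assoc assoc_eq[OF dx])
  also have "... = g" using pow_in_pr[OF x' gx' gD(1)] Suc unfolding u_def w_def by simp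
  finally show ?case .
 qed
 have "x' : pr x" unfolding x'_def pr_def using y gD by blast
 then obtain n :: nat where "x' [^] n = \<zero>"
  using nilp_pow[OF right_idealD(1)[OF right_ideal_pr] mx_nilp[OF g x]] xc by blast
 then have "x' [^] Suc n = \<zero>" using x' by simp
 then have "g = \<zero>" using pw[of n] d by simp
 then show False using gD by blast
qed

text \<open>The corner \<open>gRg\<close> is a local ring, so it acts on the simple top as a
  division ring. Outside \<open>mx g\<close> there are right inverses; a right inverse is again
  outside \<open>mx g\<close>, and its own right inverse has to be \<open>d\<close>.\<close>

lemma corner_inverse:
 assumes g: "local_idem g" and d: "d : carrier R" "g ** d = d" "d ** g = d" and nd: "d ~: mx g"
 shows "\<exists>d'\<in>carrier R. g ** d' = d' & d' ** g = d' & d ** d' = g & d' ** d = g"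
proof -
 note gD = local_idemD[OF g]
 have right: "\<exists>d'\<in>carrier R. g ** d' = d' & d' ** g = d' & d ** d' = g"
  if d: "d : carrier R" "g ** d = d" "d ** g = d" and nd: "d ~: mx g" for d
 proof -
  have "g : pr d" using nd gD(4) d unfolding mx_def by blast
  then obtain y where y: "y : carrier R" "g = d ** y" unfolding pr_def by blast
  have "d ** (g ** y ** g) = d ** y ** g"
   using d y(1) gD(1) by (simp add: m_assoc assoc_eq[OF d(3)])
  also have "... = g" using y(2) gD(3) by simp
  finally show ?thesis using y(1) gD(1,3)
   by (intro bexI[of _ "g ** y ** g"]) (auto simp: m_assoc, simp add: m_assoc[symmetric])
 qed
 obtain d' where d': "d' : carrier R" "g ** d' = d'" "d' ** g = d'" "d ** d' = g"
  using right[OF d nd] by blast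
 have "d' ~: mx g"
 proof
  assume "d' : mx g"
  then have "d ** d' : mx g" by (rule corner_left_mx[OF g d])
  then show False using d'(4) pr_self[OF gD(1)] unfolding mx_def by auto
 qed
 then obtain d'' where d'': "d'' : carrier R" "g ** d'' = d''" "d' ** d'' = g"
  using right[OF d'(1-3)] by blast
 have "d = d ** (d' ** d'')" using d d'' by simp
 also have "... = d''" using assoc_eq[OF d'(4) d(1) d'(1) d''(1)] d''(2) by simp
 finally show ?thesis using d' d'' by blast
qed

text \<open>An isomorphism between the right ideals \<open>gR\<close> and \<open>pR\<close>: left
  multiplication by \<open>b\<close> in one direction and by \<open>a\<close> in the other.\<close>

definition idem_eqv :: "'a => 'a => bool" where
 "idem_eqv g p \<longleftrightarrow> (\<exists>a\<in>carrier R. \<exists>b\<in>carrier R. g ** a = a & a ** p = a & p ** b = b & b ** g = b &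
  a ** b = g & b ** a = p)"

lemma idem_eqv_refl: "local_idem g ==> idem_eqv g g"
 unfolding idem_eqv_def using local_idemD(1,3) by blast

lemma idem_eqv_sym: "idem_eqv g p ==> idem_eqv p g"
 unfolding idem_eqv_def by blast

lemma idem_eqv_trans:
 assumes "idem_eqv g p" "idem_eqv p s" shows "idem_eqv g s"
proof -
 obtain a b where ab: "a : carrier R" "b : carrier R" "g ** a = a" "a ** p = a" "p ** b = b"
  "b ** g = b" "a ** b = g" "b ** a = p" using assms(1) unfolding idem_eqv_def by blast
 obtain c d where cd: "c : carrier R" "d : carrier R" "p ** c = c" "c ** s = c" "s ** d = d"
  "d ** p = d" "c ** d = p" "d ** c = s" using assms(2) unfolding idem_eqv_def by blast
 have c: "g : carrier R" "s : carrier R" "p : carrier R" using ab cd by blast+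
 have "g ** (a ** c) = a ** c" using ab cd c by (simp add: m_assoc[symmetric])
 moreover have "a ** c ** s = a ** c" using ab cd c by (simp add: m_assoc)
 moreover have "s ** (d ** b) = d ** b" using ab cd c by (simp add: m_assoc[symmetric])
 moreover have "d ** b ** g = d ** b" using ab cd c by (simp add: m_assoc)
 moreover have "(a ** c) ** (d ** b) = a ** (c ** d) ** b" using ab(1,2) cd(1,2) by (simp add: m_assoc)
 then have "(a ** c) ** (d ** b) = g" using ab cd by simp
 moreover have "(d ** b) ** (a ** c) = d ** (b ** a) ** c" using ab(1,2) cd(1,2) by (simp add: m_assoc)
 then have "(d ** b) ** (a ** c) = s" using ab cd by simp
 ultimately show ?thesis unfolding idem_eqv_def using ab(1,2) cd(1,2) m_closed by blast
qed

text \<open>Left multiplication by \<open>x\<close> maps \<open>pR\<close> onto the projective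
  module \<open>gR\<close>, so it splits, and \<open>e = y x\<close> is a nonzero idempotent of the
  corner \<open>pRp\<close>. Since \<open>p\<close> is local, \<open>e = p\<close>.\<close>

lemma local_idem_eqvI:
 assumes g: "local_idem g" and p: "local_idem p"
  and x: "x : carrier R" "g ** x = x" "x ** p = x" and nx: "x ~: mx g"
 shows "idem_eqv g p"
proof -
 note gD = local_idemD[OF g] and pD = local_idemD[OF p]
 have "g : pr x" using nx gD(4) x unfolding mx_def by blast
 then obtain y0 where y0: "y0 : carrier R" "g = x ** y0" unfolding pr_def by blast
 define y where "y = p ** y0 ** g"
 have y: "y : carrier R" "p ** y = y" "y ** g = y"
  unfolding y_def using y0(1) gD(1) pD(1) gD(3) pD(3)
  by (auto simp: m_assoc, simp add: m_assoc[symmetric])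
 have "x ** y = (x ** p) ** y0 ** g" unfolding y_def using x(1) y0(1) gD(1) pD(1) by (simp add: m_assoc)
 also have "... = g" using x(3) y0(2) gD(3) by simp
 finally have xy: "x ** y = g" .
 define e where "e = y ** x"
 have e: "e : carrier R" "p ** e = e" "e ** p = e" unfolding e_def
  using y x pD(1) by (auto simp: m_assoc, simp add: m_assoc[symmetric])
 have "e ** e = y ** (x ** y) ** x" unfolding e_def using y(1) x(1) by (simp add: m_assoc)
 also have "... = e" unfolding e_def xy using y by simp
 finally have ee: "e ** e = e" .
 have "e ~= \<zero>"
 proof
  assume "e = \<zero>"
  have "g = g ** g" using gD by simp
  also have "... = x ** e ** y" unfolding e_def using xy x(1) y(1) by (metis m_assoc m_closed)
  finally show False using `e = \<zero>` x y gD by simp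
 qed
 have "e [^] Suc n = e" for n by (induction n) (use e ee in auto)
 then have enil: "e [^] n ~= \<zero>" for n :: nat
  using `e ~= \<zero>` e(1) by (cases n) (auto, metis l_null l_one)
 have "p : pr e"
 proof (rule ccontr)
  assume "p ~: pr e"
  then have "nilp (pr e)"
   using local_idem_proper_nilp[OF p right_ideal_pr[OF e(1)]]
    pr_least[OF right_ideal_pr[OF pD(1)], of e] e pD(4) by blast
  then show False
   using nilp_pow[OF right_idealD(1)[OF right_ideal_pr[OF e(1)]] _ pr_self[OF e(1)]] enil by blast
 qed
 then obtain z where z: "z : carrier R" "p = e ** z" unfolding pr_def by blast
 have "e ** p = p" using z e ee by (metis m_assoc)
 then have "e = p" using e by simp
 then show ?thesis
  unfolding idem_eqv_def using x y xy e_def by blast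
qed

text \<open>Schur's lemma: in the top of \<open>gR\<close> only the components at idempotents
  isomorphic to \<open>g\<close> survive.\<close>

lemma local_idem_eqv_mx:
 assumes g: "local_idem g" and p: "local_idem p" and "~ idem_eqv g p"
  and x: "x : carrier R" "g ** x = x"
 shows "x ** p : mx g"
proof -
 have "g ** (x ** p) = x ** p" "(x ** p) ** p = x ** p" "x ** p : carrier R"
  using x local_idemD(1)[OF g] local_idemD(1,3)[OF p] by (simp_all add: m_assoc, simp add: m_assoc[symmetric])
 then show ?thesis using local_idem_eqvI[OF g p] assms(3) by blast
qed

definition idem_decomp :: "'a => 'a set => bool" where
 "idem_decomp g Gm \<longleftrightarrow> finite Gm & (\<forall>p\<in>Gm. local_idem p & g ** p = p & p ** g = p) &
  (\<forall>p\<in>Gm. \<forall>p'\<in>Gm. p ~= p' --> p ** p' = \<zero>) & finsum R (%p. p) Gm = g"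

text \<open>Take a counterexample \<open>h\<close> with \<open>hR\<close> minimal. A non-nilpotent
  right ideal properly inside \<open>hR\<close> contains a nonzero idempotent, which splits
  \<open>h\<close> into two orthogonal parts with smaller right ideals.\<close>

lemma idem_decomp_exists:
 assumes art: "right_artinian R" and g: "g : carrier R" "g ** g = g"
 shows "\<exists>Gm. idem_decomp g Gm"
proof (rule ccontr)
 assume n: "\<nexists>Gm. idem_decomp g Gm"
 define P where "P I \<longleftrightarrow> (\<exists>h\<in>carrier R. h ** h = h & I = pr h & (\<nexists>Gm. idem_decomp h Gm))" for I
 have "P (pr g)" unfolding P_def using g n by blast
 moreover have "right_ideal I R" if "P I" for I using that right_ideal_pr unfolding P_def by blast
 ultimately obtain I where I: "P I" "!!J. P J ==> J <= I ==> J = I"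
  using artinian_minimalE[OF art, of P "pr g"] by metis
 then obtain h where h: "h : carrier R" "h ** h = h" "I = pr h" "\<nexists>Gm. idem_decomp h Gm"
  unfolding P_def by blast
 have "h ~= \<zero>"
 proof
  assume "h = \<zero>"
  then have "idem_decomp h {}" unfolding idem_decomp_def by simp
  then show False using h(4) by blast
 qed
 have "~ local_idem h"
 proof
  assume "local_idem h"
  then have "idem_decomp h {h}" unfolding idem_decomp_def using h by simp
  then show False using h(4) by blast
 qed
 then obtain J where J: "right_ideal J R" "J <= pr h" "J ~= pr h" "~ nilp J"
  using h(1,2) `h ~= \<zero>` unfolding local_idem_def by blast
 obtain u where u: "u : J" "u ** u = u" "u ~= \<zero>" using nonnil_has_idempotent[OF art J(1,4)] by blast
 have uc: "u : carrier R" "h ** u = u" using u J(2) pr_idem[OF h(1,2)] by auto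
 \<comment> \<open>\<open>u\<close> satisfies only \<open>h u = u\<close>. The product with
   \<open>h\<close> lies in the corner of \<open>h\<close>, and \<open>p u = u\<close> shows that it
   is a nonzero idempotent.\<close>
 define p where "p = u ** h"
 have p: "p : carrier R" "h ** p = p" "p ** h = p"
  unfolding p_def using uc h by (simp_all add: m_assoc assoc_eq[OF uc(2)])
 have pu: "p ** u = u" unfolding p_def using uc h u by (simp add: m_assoc)
 have "p ** p = (p ** u) ** h" using p(1) uc(1) h(1) by (subst (2) p_def) (simp add: m_assoc)
 then have pp: "p ** p = p" unfolding pu p_def[symmetric] .
 have "p ~= \<zero>" using pu u uc by auto
 have pJ: "p : J" unfolding p_def using ri_mult[OF J(1)] u h by blast
 define p' where "p' = h \<ominus> p"
 have mp: "x ** p' = x ** h \<ominus> x ** p" "p' ** x = h ** x \<ominus> p ** x"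
  if "x : carrier R" for x
  unfolding p'_def using that p h by (simp_all add: minus_eq l_distr r_distr l_minus r_minus)
 have p': "p' : carrier R" "h ** p' = p'" "p' ** h = p'" "p ** p' = \<zero>" "p' ** p = \<zero>"
  using mp[OF h(1)] mp[OF p(1)] p h(1,2) pp r_right_minus_eq[OF p(1) p(1)] unfolding p'_def
  by simp_all
 have "p' ** p' = h ** p' \<ominus> p ** p'"
  by (subst p'_def) (use p p' h in \<open>simp add: minus_eq l_distr l_minus\<close>)
 then have pp': "p' ** p' = p'" using p' by (simp add: minus_eq)
 have sum: "p \<oplus> p' = h" unfolding p'_def using p h by (simp add: minus_eq a_ac r_neg)
 have "pr p <= pr h" "pr p' <= pr h"
  using p p' h pr_least[OF right_ideal_pr[OF h(1)]] pr_idem[OF h(1,2)] by auto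
 have "pr p ~= pr h" using pr_least[OF J(1) pJ] J(2,3) by blast
 moreover have "pr p' ~= pr h"
 proof
  assume "pr p' = pr h"
  then have "p : pr p'" using p pr_idem[OF h(1,2)] by blast
  then have "p' ** p = p" using pr_idem[OF p'(1) pp'] by blast
  then show False using p' `p ~= \<zero>` by simp
 qed
 ultimately have "~ P (pr p)" "~ P (pr p')"
  using I(2) h(3) `pr p <= pr h` `pr p' <= pr h` by blast+
 then obtain Gm Gm' where Gm: "idem_decomp p Gm" "idem_decomp p' Gm'"
  unfolding P_def using p(1) pp p'(1) pp' by blast
 note G = Gm[unfolded idem_decomp_def]
 have cross: "x ** y = \<zero> & y ** x = \<zero>" if "x : Gm" "y : Gm'" for x y
 proof -
  have xy: "x : carrier R" "y : carrier R" "p ** x = x" "x ** p = x" "p' ** y = y" "y ** p' = y"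
   using G that local_idemD(1) by blast+
  have "x ** y = x ** (p ** p') ** y" using xy p p' by (metis m_assoc m_closed)
  moreover have "y ** x = y ** (p' ** p) ** x" using xy p p' by (metis m_assoc m_closed)
  ultimately show ?thesis using xy p' by simp
 qed
 have disj: "Gm \<inter> Gm' = {}"
 proof (rule ccontr)
  assume "Gm \<inter> Gm' ~= {}"
  then obtain x where "x : Gm" "x : Gm'" by blast
  then show False using cross[of x x] G local_idemD(2,3)[of x] by metis
 qed
 have Gc: "Gm <= carrier R" "Gm' <= carrier R" using G local_idemD(1) by blast+
 have "finsum R (%p. p) (Gm \<union> Gm') = h"
  using finsum_Un_disjoint[of Gm Gm' "%p. p"] G disj sum Gc by auto
 moreover have "h ** x = x & x ** h = x" if "x : Gm" for x
 proof -
  have "x : carrier R" "p ** x = x" "x ** p = x" using that G local_idemD(1) by blast+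
  then show ?thesis using p h by (metis m_assoc)
 qed
 moreover have "h ** x = x & x ** h = x" if "x : Gm'" for x
 proof -
  have "x : carrier R" "p' ** x = x" "x ** p' = x" using that G local_idemD(1) by blast+
  then show ?thesis using p' h by (metis m_assoc)
 qed
 ultimately have "idem_decomp h (Gm \<union> Gm')"
  unfolding idem_decomp_def
 proof (intro conjI ballI impI)
  fix x y assume "x : Gm \<union> Gm'" "y : Gm \<union> Gm'" "x ~= y"
  then show "x ** y = \<zero>" using G cross by blast
 qed (use G in auto)
 then show False using h(4) by blast
qed

end

section \<open>Finite sums in abelian groups\<close>

context abelian_group begin

lemma finsum_swap:
 assumes A: "finite A" and B: "finite B" and f: "!!i j. i : A ==> j : B ==> f i j : carrier G"
 shows "(\<Oplus>i\<in>A. \<Oplus>j\<in>B. f i j) = (\<Oplus>j\<in>B. \<Oplus>i\<in>A. f i j)"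
 using A f
proof (induction A rule: finite_induct)
 case empty then show ?case by simp
next
 case (insert x A)
 have "(\<Oplus>i\<in>insert x A. \<Oplus>j\<in>B. f i j) = (\<Oplus>j\<in>B. f x j) \<oplus> (\<Oplus>i\<in>A. \<Oplus>j\<in>B. f i j)"
  using insert by (intro finsum_insert) (auto intro!: finsum_closed)
 also have "(\<Oplus>i\<in>A. \<Oplus>j\<in>B. f i j) = (\<Oplus>j\<in>B. \<Oplus>i\<in>A. f i j)" using insert by auto
 also have "(\<Oplus>j\<in>B. f x j) \<oplus> (\<Oplus>j\<in>B. \<Oplus>i\<in>A. f i j) = (\<Oplus>j\<in>B. f x j \<oplus> (\<Oplus>i\<in>A. f i j))"
  using insert by (intro finsum_addf[symmetric]) (auto intro!: finsum_closed)
 also have "... = (\<Oplus>j\<in>B. \<Oplus>i\<in>insert x A. f i j)"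
  using insert by (intro finsum_cong') (auto intro!: finsum_closed finsum_insert[symmetric])
 finally show ?case .
qed

lemma finsum_hom:
 assumes w: "!!x. x : carrier G ==> w x : carrier G"
  "!!x y. [|x : carrier G; y : carrier G|] ==> w (x \<oplus> y) = w x \<oplus> w y"
  and A: "finite A" and f: "f : A \<rightarrow> carrier G"
 shows "w (finsum G f A) = (\<Oplus>i\<in>A. w (f i))"
 using A f
proof (induction A rule: finite_induct)
 case empty
 have "w \<zero> \<oplus> w \<zero> = w \<zero> \<oplus> \<zero>" using w(2)[of \<zero> \<zero>] w(1)[of \<zero>] by simp
 then show ?case using w(1)[of \<zero>] by (simp del: r_zero)
next
 case (insert x A)
 then have "w (finsum G f (insert x A)) = w (f x) \<oplus> w (finsum G f A)"
  using w by (auto intro!: finsum_closed)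
 also have "... = (\<Oplus>i\<in>insert x A. w (f i))"
  using insert w(1) by (subst finsum_insert) (auto simp: Pi_iff)
 finally show ?case .
qed

lemma finsum_delta:
 assumes "finite A" "j : A" "x : carrier G"
 shows "(\<Oplus>i\<in>A. if i = j then x else \<zero>) = x"
 using finsum_singleton[OF assms(2,1), of "%_. x"] assms(3) by (simp add: eq_commute)

end

section \<open>Congruence modulo the maximal submodule of \<open>gR\<close>\<close>

context ring begin

text \<open>Left multiplication by \<open>a\<close> is an isomorphism from \<open>pR\<close> to
  \<open>gR\<close>, so it respects the largest proper submodules.\<close>

lemma mx_left_transfer:
 assumes g: "local_idem g" and p: "local_idem p"
  and a: "a : carrier R" "g ** a = a" "b : carrier R" "b ** g = b" "a ** b = g" "b ** a = p"
  and x: "x : mx p"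
 shows "a ** x : mx g"
proof (rule ccontr)
 note gD = local_idemD[OF g] and pD = local_idemD[OF p]
 have xc: "x : carrier R" "p ** x = x" using pD(4) mx_pr[OF x] by auto
 assume "a ** x ~: mx g"
 moreover have "a ** x : pr g" using gD(4) a xc assoc_eq[OF a(2) gD(1) a(1) xc(1)] by simp
 ultimately have "g : pr (a ** x)" unfolding mx_def by blast
 then obtain y where y: "y : carrier R" "g = a ** x ** y" unfolding pr_def by blast
 have "b = b ** (a ** x ** y)" using a(4) y(2) by metis
 also have "... = p ** x ** y" using a(1,3) xc(1) y(1) by (simp add: m_assoc assoc_eq[OF a(6)] pD(1))
 finally have "b = x ** y" using xc by simp
 then have "p = x ** (y ** a)" using a(6,1) xc y(1) by (simp add: m_assoc)
 then have "p : pr x" using y a(1) unfolding pr_def by blast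
 then show False using x unfolding mx_def by blast
qed

text \<open>A congruence of representatives takes the place of the module \<open>gR / mx g\<close>,
  so maps into the top may be defined by arbitrary choices.\<close>

definition con :: "'a => 'a => 'a => bool" where
 "con g x y \<longleftrightarrow> x : pr g & y : pr g & x \<ominus> y : mx g"

context
 fixes g assumes g: "local_idem g"
begin

lemma pr_in_carrier: "x : pr g ==> x : carrier R"
 using local_idemD(4)[OF g] by blast

lemma right_ideal_prg: "right_ideal (pr g) R"
 using right_ideal_pr local_idemD(1)[OF g] by blast

lemma pr_corner: "[|d : carrier R; g ** d = d; x : carrier R|] ==> d ** x : pr g"
 using local_idemD(1,4)[OF g] assoc_eq[of g d d x] by simp

lemma con_refl: "x : pr g ==> con g x x"
 unfolding con_def using pr_in_carrier ri_zero[OF right_ideal_mx[OF g]]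
 by (simp add: r_right_minus_eq[THEN iffD2])

lemma con_zero_iff: "con g x \<zero> \<longleftrightarrow> x : mx g"
 unfolding con_def using mx_pr mx_carrier[OF g] ri_zero[OF right_ideal_prg] pr_in_carrier
 by (auto simp: minus_eq)

lemma con_sym: "con g x y ==> con g y x"
proof -
 assume a: "con g x y"
 then have "y \<ominus> x = \<ominus> (x \<ominus> y)"
  unfolding con_def using pr_in_carrier by (auto simp: minus_eq minus_add a_comm)
 then show ?thesis using a ri_uminus[OF right_ideal_mx[OF g]] unfolding con_def by metis
qed

lemma con_add: "[|con g x y; con g x' y'|] ==> con g (x \<oplus> x') (y \<oplus> y')"
proof -
 assume a: "con g x y" "con g x' y'"
 then have "(x \<oplus> x') \<ominus> (y \<oplus> y') = (x \<ominus> y) \<oplus> (x' \<ominus> y')"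
  unfolding con_def using pr_in_carrier by (auto simp: minus_eq minus_add a_ac)
 then show ?thesis
  using a ri_add[OF right_ideal_mx[OF g]] ri_add[OF right_ideal_prg] unfolding con_def by metis
qed

lemma con_trans: "[|con g x y; con g y z|] ==> con g x z"
proof -
 assume a: "con g x y" "con g y z"
 then have "x \<ominus> z = (x \<ominus> y) \<oplus> (y \<ominus> z)"
  unfolding con_def using pr_in_carrier by (auto simp: minus_eq a_assoc r_neg1)
 then show ?thesis
  using a ri_add[OF right_ideal_mx[OF g]] unfolding con_def by metis
qed

lemma con_rmult: "[|con g x y; a : carrier R|] ==> con g (x ** a) (y ** a)"
proof -
 assume a: "con g x y" "a : carrier R"
 then have "x ** a \<ominus> y ** a = (x \<ominus> y) ** a"
  unfolding con_def using pr_in_carrier by (auto simp: minus_eq l_distr l_minus)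
 then show ?thesis
  using a ri_mult[OF right_ideal_mx[OF g]] ri_mult[OF right_ideal_prg] unfolding con_def by metis
qed

lemma con_lmult:
 assumes "con g x y" and d: "d : carrier R" "g ** d = d" "d ** g = d"
 shows "con g (d ** x) (d ** y)"
proof -
 have "d ** x \<ominus> d ** y = d ** (x \<ominus> y)"
  using assms unfolding con_def using pr_in_carrier by (auto simp: minus_eq r_distr r_minus)
 then show ?thesis
  using assms corner_left_mx[OF g d] pr_corner[OF d(1,2)] pr_in_carrier unfolding con_def by metis
qed

lemma con_finsum:
 assumes "finite A" "!!i. i : A ==> con g (f i) (f' i)"
 shows "con g (finsum R f A) (finsum R f' A)"
 using assms
proof (induction A rule: finite_induct)
 case empty
 then show ?case using con_refl[of \<zero>] ri_zero[OF right_ideal_prg] by simp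
next
 case (insert x A)
 have "f : insert x A \<rightarrow> carrier R" "f' : insert x A \<rightarrow> carrier R"
  using insert.prems pr_in_carrier unfolding con_def by auto
 then show ?case using insert con_add by simp
qed

lemma con_mx: "[|con g x y; y : mx g|] ==> x : mx g"
 using con_zero_iff con_trans by blast

lemma con_mx_iff: "con g x y ==> x : mx g \<longleftrightarrow> y : mx g"
 using con_mx con_sym by blast

end

section \<open>Spaces of rows\<close>

text \<open>An additive group of functions in the form of a ring record, which is what
  \<open>abelian_group\<close> expects.\<close>

definition rows :: "'a => ('i => 'a) ring" where
 "rows g = \<lparr>carrier = {zt. \<forall>i. zt i : pr g}, monoid.mult = (%_ _. undefined), monoid.one = undefined,
  ring.zero = (%_. \<zero>), ring.add = (%zt zt' i. zt i \<oplus> zt' i)\<rparr>"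

text \<open>Modulo this subgroup a row is a tuple of elements of the simple top indexed by
  \<open>N\<close>; the entries outside \<open>N\<close> are absorbed.\<close>

definition rbase :: "'a => 'i set => ('i => 'a) set" where
 "rbase g N = {zt. (\<forall>i. zt i : pr g) & (\<forall>i\<in>N. zt i : mx g)}"

definition rops :: "'a => (('i => 'a) => 'i => 'a) set" where
 "rops g = (%d zt i. d ** zt i) ` {d : carrier R. g ** d = d & d ** g = d}"

lemma rows_carrier [simp]: "zt : carrier (rows g) \<longleftrightarrow> (\<forall>i. zt i : pr g)"
 unfolding rows_def by simp

lemma rows_add [simp]: "zt \<oplus>\<^bsub>rows g\<^esub> zt' = (%i. zt i \<oplus> zt' i)"
 unfolding rows_def by simp

lemma rows_zero [simp]: "\<zero>\<^bsub>rows g\<^esub> = (%_. \<zero>)"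
 unfolding rows_def by simp

lemma rbaseD: "zt : rbase g N \<longleftrightarrow> (\<forall>i. zt i : pr g) & (\<forall>i\<in>N. zt i : mx g)"
 unfolding rbase_def by simp

lemma abelian_group_rows:
 assumes g: "local_idem g" shows "abelian_group (rows g :: ('i => 'a) ring)"
proof (rule abelian_groupI)
 note P = right_ideal_prg[OF g] and c = pr_in_carrier[OF g]
 fix x y z :: "'i => 'a"
 assume x: "x : carrier (rows g)"
 then show "\<zero>\<^bsub>rows g\<^esub> \<oplus>\<^bsub>rows g\<^esub> x = x" using c by (auto simp: fun_eq_iff)
 show "\<exists>y\<in>carrier (rows g). y \<oplus>\<^bsub>rows g\<^esub> x = \<zero>\<^bsub>rows g\<^esub>"
  using x c ri_uminus[OF P] by (intro bexI[of _ "%i. \<ominus> x i"]) (auto simp: l_neg)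
 assume y: "y : carrier (rows g)"
 then show "x \<oplus>\<^bsub>rows g\<^esub> y : carrier (rows g)" using x ri_add[OF P] by auto
 show "x \<oplus>\<^bsub>rows g\<^esub> y = y \<oplus>\<^bsub>rows g\<^esub> x" using x y c by (auto simp: fun_eq_iff intro: a_comm)
 assume "z : carrier (rows g)"
 then show "x \<oplus>\<^bsub>rows g\<^esub> y \<oplus>\<^bsub>rows g\<^esub> z = x \<oplus>\<^bsub>rows g\<^esub> (y \<oplus>\<^bsub>rows g\<^esub> z)"
  using x y c by (auto simp: fun_eq_iff intro: a_assoc)
qed (use right_ideal_prg[OF g] ri_zero in auto)

lemma rows_uminus:
 assumes g: "local_idem g" and x: "x : carrier (rows g)"
 shows "\<ominus>\<^bsub>rows g\<^esub> x = (%i. \<ominus> x i)"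
proof -
 interpret G: abelian_group "rows g" using abelian_group_rows[OF g] .
 show ?thesis
  using x ri_uminus[OF right_ideal_prg[OF g]] pr_in_carrier[OF g]
  by (intro G.minus_equality) (auto simp: l_neg)
qed

text \<open>The operators form the corner \<open>gRg\<close>, and those outside \<open>mx g\<close>
  are invertible by \<open>corner_inverse\<close>. So these spans are spans over the division ring
  that belongs to the top of \<open>gR\<close>.\<close>

lemma operator_span_rows:
 fixes N :: "'i set"
 assumes g: "local_idem g" shows "operator_span (rows g) (rbase g N) (rops g)"
proof -
 note P = right_ideal_prg[OF g] and c = pr_in_carrier[OF g] and gD = local_idemD[OF g]
 interpret G: abelian_group "rows g :: ('i => 'a) ring" using abelian_group_rows[OF g] .
 let ?D = "{d : carrier R. g ** d = d & d ** g = d}"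
 have opI: "(\<exists>om\<in>rops g. Q om) \<longleftrightarrow> (\<exists>d\<in>?D. Q (%zt i. d ** zt i))" for Q :: "(('i => 'a) => 'i => 'a) => bool"
  unfolding rops_def by blast
 show ?thesis
 proof
  show "\<zero>\<^bsub>rows g\<^esub> : rbase g N"
   using ri_zero[OF P] ri_zero[OF right_ideal_mx[OF g]] by (auto simp: rbaseD)
  show "rbase g N <= carrier (rows g)" by (auto simp: rbaseD)
  show "x \<oplus>\<^bsub>rows g\<^esub> y : rbase g N" if "x : rbase g N" "y : rbase g N" for x y
   using that ri_add[OF P] ri_add[OF right_ideal_mx[OF g]] by (auto simp: rbaseD)
  show "\<exists>om\<in>rops g. \<forall>x\<in>carrier (rows g :: ('i => 'a) ring). om x = \<zero>\<^bsub>rows g\<^esub>"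
   unfolding opI by (rule bexI[of _ \<zero>]) (use c gD(1) in auto)
  show "\<exists>om\<in>rops g. \<forall>x\<in>carrier (rows g :: ('i => 'a) ring). om x = x"
   unfolding opI by (rule bexI[of _ g]) (use gD in auto)
  show "\<exists>om\<in>rops g. \<forall>x\<in>carrier (rows g :: ('i => 'a) ring). om x = \<ominus>\<^bsub>rows g\<^esub> x"
   unfolding opI by (rule bexI[of _ "\<ominus> g"])
    (use gD in \<open>auto simp: l_minus r_minus rows_uminus[OF g]\<close>)
  fix om :: "('i => 'a) => 'i => 'a" assume "om : rops g"
  then obtain d where d: "d : ?D" "om = (%zt i. d ** zt i)" unfolding rops_def by blast
  show "om x : carrier (rows g)" if "x : carrier (rows g)" for x
   using that d pr_corner[OF g] c by auto
  show "om (x \<oplus>\<^bsub>rows g\<^esub> y) = om x \<oplus>\<^bsub>rows g\<^esub> om y"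
   if "x : carrier (rows g)" "y : carrier (rows g)" for x y
   using that d c by (auto simp: r_distr)
  show "om x : rbase g N" if "x : rbase g N" for x
   using that d pr_corner[OF g] c corner_left_mx[OF g] by (auto simp: rbaseD)
  show "(\<forall>x\<in>carrier (rows g). om x : rbase g N) |
   (\<exists>om'\<in>rops g. \<forall>x\<in>carrier (rows g). om' (om x) \<ominus>\<^bsub>rows g\<^esub> x : rbase g N)"
  proof (cases "d : mx g")
   case True
   then have "\<forall>x\<in>carrier (rows g). om x : rbase g N"
    using d pr_corner[OF g] c ri_mult[OF right_ideal_mx[OF g]] by (auto simp: rbaseD)
   then show ?thesis ..
  next
   case False
   then obtain d' where d': "d' : ?D" "d' ** d = g" using corner_inverse[OF g] d by blast
   have "om x : carrier (rows g)" "d' ** (d ** x i) = x i" if "x : carrier (rows g)" for x i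
    using that d d' c gD pr_corner[OF g] assoc_eq[OF d'(2), of "x i"] by auto
   then have "\<forall>x\<in>carrier (rows g). (%i. d' ** om x i) \<ominus>\<^bsub>rows g\<^esub> x : rbase g N"
    using d c ri_zero[OF P] ri_zero[OF right_ideal_mx[OF g]]
    by (auto simp: a_minus_def rbaseD r_neg rows_uminus[OF g])
   then show ?thesis unfolding opI using d' by blast
  qed
  fix om' :: "('i => 'a) => 'i => 'a" assume "om' : rops g"
  then obtain d' where d': "d' : ?D" "om' = (%zt i. d' ** zt i)" unfolding rops_def by blast
  show "\<exists>om''\<in>rops g. \<forall>x\<in>carrier (rows g). om'' x = om x \<oplus>\<^bsub>rows g\<^esub> om' x"
   unfolding opI by (rule bexI[of _ "d \<oplus> d'"]) (use d d' c gD in \<open>auto simp: l_distr r_distr\<close>)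
  show "\<exists>om''\<in>rops g. \<forall>x\<in>carrier (rows g). om'' x = om (om' x)"
   unfolding opI
   by (rule bexI[of _ "d ** d'"])
    (use d d' c gD in \<open>auto simp: m_assoc assoc_eq[of g d d d']\<close>)
 qed
qed

lemma rows_span_image:
 fixes L :: "('i => 'a) => 'j => 'a"
 assumes g: "local_idem g" and S: "S <= carrier (rows g)"
  and L_base: "!!zt. zt : rbase g N ==> L zt : rbase g N'"
  and L_add: "!!zt zt'. [|zt : carrier (rows g); zt' : carrier (rows g)|] ==>
   L (%i. zt i \<oplus> zt' i) = (%j. L zt j \<oplus> L zt' j)"
  and L_mult: "!!zt d. [|zt : carrier (rows g); d : carrier R|] ==> L (%i. d ** zt i) = (%j. d ** L zt j)"
  and x: "x : operator_span.ospan (rows g) (rbase g N) (rops g) S"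
 shows "L x : operator_span.ospan (rows g) (rbase g N') (rops g) (L ` S)"
proof -
 interpret E: operator_span "rows g :: ('i => 'a) ring" "rbase g N" "rops g"
  using operator_span_rows[OF g] .
 interpret E': operator_span "rows g :: ('j => 'a) ring" "rbase g N'" "rops g"
  using operator_span_rows[OF g] .
 have c: "y : carrier (rows g)" if "y : E.ospan S" for y using E.ospan_closed[OF S] that by blast
 show ?thesis using x
 proof induction
  case (ospan_base y) then show ?case using L_base E'.ospan_base by blast
 next
  case (ospan_gen y) then show ?case using E'.ospan_gen by blast
 next
  case (ospan_add y z)
  then show ?case using L_add[OF c c, of y z] E'.ospan_add[of "L y" "L ` S" "L z"] by simp
 next
  case (ospan_op om y)
  then obtain d where d: "d : carrier R" "g ** d = d" "d ** g = d" "om = (%zt i. d ** zt i)"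
   unfolding rops_def by blast
  then have "(%zt i. d ** zt i) : rops g" unfolding rops_def by blast
  then have "(%i. d ** L y i) : E'.ospan (L ` S)" using E'.ospan_op ospan_op.IH by blast
  then show ?case using L_mult[OF c d(1), of y] ospan_op.hyps d(4) by simp
 qed
qed

end

section \<open>Rings with a coaction by matrices of operators\<close>

text \<open>In the application \<open>Op\<close> is the set of operators by which \<open>H\<close> acts, \<open>u i j\<close> are
 the matrix coefficients of a basis of \<open>H\<close>, and \<open>v i j\<close> their antipodes; \<open>Ks\<close> is the
 image of the ground field. The axiom \<open>u_mult\<close> says that \<open>x \<mapsto> (u i j x)\<close> is a
 homomorphism into the ring of matrices.\<close>

locale coaction = ring R for R (structure) +
 fixes r :: nat and u v :: "nat => nat => 'a => 'a" and Op :: "('a => 'a) set" and Ks :: "'a set"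
 assumes Op_closed: "[|w : Op; x : carrier R|] ==> w x : carrier R"
  and Op_add: "[|w : Op; x : carrier R; y : carrier R|] ==> w (x \<oplus> y) = w x \<oplus> w y"
  and u_Op: "[|i < r; j < r|] ==> u i j : Op"
  and v_Op: "[|i < r; j < r|] ==> v i j : Op"
  and Op_id: "\<exists>w\<in>Op. \<forall>x\<in>carrier R. w x = x"
  and Op_comp: "[|w : Op; w' : Op|] ==> \<exists>w''\<in>Op. \<forall>x\<in>carrier R. w'' x = w (w' x)"
  and Ks_closed: "Ks <= carrier R"
  and Ks_central: "[|ka : Ks; x : carrier R|] ==> ka ** x = x ** ka"
  and Op_u: "w : Op ==> \<exists>ka. (\<forall>i<r. \<forall>j<r. ka i j : Ks) &
   (\<forall>x\<in>carrier R. w x = (\<Oplus>i\<in>{..<r}. \<Oplus>j\<in>{..<r}. u i j x ** ka i j))"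
  and Op_v: "w : Op ==> \<exists>ka. (\<forall>i<r. \<forall>j<r. ka i j : Ks) &
   (\<forall>x\<in>carrier R. w x = (\<Oplus>i\<in>{..<r}. \<Oplus>j\<in>{..<r}. v i j x ** ka i j))"
  and u_mult: "[|i < r; j < r; x : carrier R; y : carrier R|] ==>
   u i j (x ** y) = (\<Oplus>a\<in>{..<r}. u i a x ** u a j y)"
  and uv: "[|i < r; j < r; x : carrier R|] ==>
   (\<Oplus>a\<in>{..<r}. u i a (v a j x)) = (if i = j then x else \<zero>)"
  and vu: "[|i < r; j < r; x : carrier R|] ==>
   (\<Oplus>a\<in>{..<r}. v i a (u a j x)) = (if i = j then x else \<zero>)"
begin

abbreviation rsum :: "(nat => 'a) => 'a" (binder "\<Oplus>" 10) where "rsum f \<equiv> finsum R f {..<r}"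

lemma u_closed [simp]: "[|i < r; j < r; x : carrier R|] ==> u i j x : carrier R"
 using Op_closed u_Op by blast

lemma v_closed [simp]: "[|i < r; j < r; x : carrier R|] ==> v i j x : carrier R"
 using Op_closed v_Op by blast

lemma u_add: "[|i < r; j < r; x : carrier R; y : carrier R|] ==> u i j (x \<oplus> y) = u i j x \<oplus> u i j y"
 using Op_add u_Op by blast

lemma Op_finsum:
 "[|w : Op; finite A; f : A \<rightarrow> carrier R|] ==> w (finsum R f A) = (\<Oplus>i\<in>A. w (f i))"
 using Op_closed Op_add by (intro finsum_hom) auto

lemma Op_zero: "w : Op ==> w \<zero> = \<zero>"
 using Op_finsum[of w "{}" "%_. \<zero>"] by simp

lemma Op_in:
 assumes w: "w : Op" and x: "x : carrier R" and M: "M <= carrier R" "\<zero> : M"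
  "!!y z. [|y : M; z : M|] ==> y \<oplus> z : M" "!!y ka. [|y : M; ka : Ks|] ==> y ** ka : M"
  and f: "f = u | f = v" "!!i j. [|i < r; j < r|] ==> f i j x : M"
 shows "w x : M"
proof -
 obtain ka where ka: "\<forall>i<r. \<forall>j<r. ka i j : Ks"
  "\<forall>x\<in>carrier R. w x = (\<Oplus>i. \<Oplus>j. f i j x ** ka i j)" using f(1) Op_u[OF w] Op_v[OF w] by blast
 have "(\<Oplus>i. \<Oplus>j. f i j x ** ka i j) : M"
  by (intro finsum_in_closed[OF M(1-3)] M(4)) (use ka f(2) in auto)
 then show ?thesis using ka x by simp
qed

lemma Op_in_rightI:
 assumes "w : Op" "x : carrier R" and I: "right_ideal I R" and "!!i j. [|i < r; j < r|] ==> u i j x : I"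
 shows "w x : I"
 by (rule Op_in[of w x I u]) (use assms Ks_closed ri_in[OF I] ri_zero[OF I] ri_add[OF I] ri_mult[OF I] in auto)

text \<open>By \<open>u_mult\<close> alone the matrix \<open>u(1)\<close> is only idempotent.
  Inserting a factor \<open>1\<close> into the inverse relation \<open>uv\<close> forces it to be
  the unit matrix.\<close>

lemma u_one:
 assumes ij: "i < r" "j < r" shows "u i j \<one> = (if i = j then \<one> else \<zero>)"
proof -
 have "(if i = j then \<one> else \<zero>) = (\<Oplus>e. u i e (\<one> ** v e j \<one>))"
 proof -
  have "(\<Oplus>e. u i e (\<one> ** v e j \<one>)) = (\<Oplus>e. u i e (v e j \<one>))"
   using ij by (intro finsum_cong') auto
  then show ?thesis using uv[OF ij, of \<one>] by simp
 qed
 also have "... = (\<Oplus>e. \<Oplus>a. u i a \<one> ** u a e (v e j \<one>))"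
  using ij by (intro finsum_cong') (auto intro!: finsum_closed simp del: l_one intro: u_mult)
 also have "... = (\<Oplus>a. \<Oplus>e. u i a \<one> ** u a e (v e j \<one>))"
  using ij by (intro finsum_swap) auto
 also have "... = (\<Oplus>a. u i a \<one> ** (\<Oplus>e. u a e (v e j \<one>)))"
  using ij by (intro finsum_cong') (auto intro!: finsum_closed finsum_rdistr[symmetric])
 also have "... = (\<Oplus>a. if a = j then u i j \<one> else \<zero>)"
  using ij by (intro finsum_cong') (auto simp: uv)
 also have "... = u i j \<one>" using ij by (intro finsum_delta) auto
 finally show ?thesis by simp
qed

definition stable :: "'a set => bool" where
 "stable I \<longleftrightarrow> (\<forall>w\<in>Op. \<forall>x\<in>I. w x : I)"

lemma stableD: "[|stable I; w : Op; x : I|] ==> w x : I"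
 unfolding stable_def by blast

lemma stable_u: "[|stable I; i < r; j < r; x : I|] ==> u i j x : I"
 using stableD u_Op by blast

lemma stable_v: "[|stable I; i < r; j < r; x : I|] ==> v i j x : I"
 using stableD v_Op by blast

lemma stable_Int: "[|stable I; stable J|] ==> stable (I \<inter> J)"
 unfolding stable_def by blast

text \<open>The largest stable subset of \<open>{x. gRx \<subseteq> mx g}\<close>.\<close>

definition Ncore :: "'a => 'a set" where
 "Ncore g = {x : carrier R. \<forall>w\<in>Op. \<forall>q\<in>carrier R. g ** q ** w x : mx g}"

lemma Ncore_stable:
 assumes "local_idem g" shows "stable (Ncore g)"
 unfolding stable_def
proof (intro ballI)
 fix w x assume w: "w : Op" and x: "x : Ncore g"
 show "w x : Ncore g"
  unfolding Ncore_def
 proof (intro CollectI conjI ballI)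
  show "w x : carrier R" using w x Op_closed unfolding Ncore_def by blast
  fix w' q assume "w' : Op" "q : carrier R"
  then obtain w'' where "w'' : Op" "\<forall>x\<in>carrier R. w'' x = w' (w x)" using Op_comp w by blast
  then show "g ** q ** w' (w x) : mx g"
   using x `q : carrier R` unfolding Ncore_def by auto
 qed
qed

lemma Ncore_uI:
 assumes g: "local_idem g" and x: "x : carrier R"
  and u: "!!i j q. [|i < r; j < r; q : carrier R|] ==> g ** q ** u i j x : mx g"
 shows "x : Ncore g"
 unfolding Ncore_def
proof (intro CollectI conjI ballI)
 fix w q assume w: "w : Op" and q: "q : carrier R"
 note gc = local_idemD(1)[OF g] and P = right_ideal_mx[OF g]
 define I where "I = {y : carrier R. g ** q ** y : mx g}"
 have "right_ideal I R"
  unfolding I_def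
  by (rule right_idealI)
   (use gc q ri_zero[OF P] ri_add[OF P] ri_mult[OF P] in \<open>auto simp: r_distr m_assoc\<close>,
   metis gc q ri_mult[OF P] m_assoc m_closed)
 moreover have "u i j x : I" if "i < r" "j < r" for i j
  using that u q x unfolding I_def by auto
 ultimately have "w x : I" by (intro Op_in_rightI[OF w x])
 then show "g ** q ** w x : mx g" unfolding I_def by blast
qed (rule x)

lemma Ncore_ideal:
 assumes g: "local_idem g"
 shows "right_ideal (Ncore g) R" "!!q x. [|q : carrier R; x : Ncore g|] ==> q ** x : Ncore g"
proof -
 note gc = local_idemD(1)[OF g] and P = right_ideal_mx[OF g]
 have uN: "g ** q ** u i j x : mx g" if "x : Ncore g" "i < r" "j < r" "q : carrier R" for q x i j
  using that u_Op unfolding Ncore_def by blast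
 have c: "x : carrier R" if "x : Ncore g" for x using that unfolding Ncore_def by blast
 show "right_ideal (Ncore g) R"
 proof (rule right_idealI)
  show "Ncore g <= carrier R" using c by blast
  show "\<zero> : Ncore g" 
  proof -
   have "g ** q ** w \<zero> : mx g" if "w : Op" "q : carrier R" for w q
    using Op_zero[OF that(1)] that gc ri_zero[OF P] by simp
   then show ?thesis unfolding Ncore_def by blast
  qed
  fix x y assume x: "x : Ncore g"
  show "x \<oplus> y : Ncore g" if "y : Ncore g"
   using uN[OF x] uN[OF that] c[OF x] c[OF that] gc ri_add[OF P]
   by (intro Ncore_uI[OF g]) (auto simp: u_add r_distr)
  show "x ** y : Ncore g" if y: "y : carrier R"
  proof (rule Ncore_uI[OF g])
   show "x ** y : carrier R" using c x y by simp
   fix i j q assume h: "i < r" "j < r" "q : carrier R"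
   have "g ** q ** u i j (x ** y) = (\<Oplus>a. g ** q ** (u i a x ** u a j y))"
    using h gc c[OF x] y by (simp add: u_mult) (intro finsum_rdistr, auto)
   also have "... : mx g"
   proof (intro ri_finsum[OF P])
    fix a assume "a : {..<r}"
    then have "g ** q ** (u i a x ** u a j y) = (g ** q ** u i a x) ** u a j y" "u a j y : carrier R"
     using h gc c[OF x] y by (auto simp: m_assoc)
    then show "g ** q ** (u i a x ** u a j y) : mx g"
     using uN[OF x h(1) _ h(3), of a] `a : {..<r}` ri_mult[OF P] by auto
   qed auto
   finally show "g ** q ** u i j (x ** y) : mx g" .
  qed
 qed
 fix y x assume y: "y : carrier R" and x: "x : Ncore g"
 show "y ** x : Ncore g"
 proof (rule Ncore_uI[OF g])
  show "y ** x : carrier R" using c x y by simp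
  fix i j q assume h: "i < r" "j < r" "q : carrier R"
  have "g ** q ** u i j (y ** x) = (\<Oplus>a. g ** q ** (u i a y ** u a j x))"
   using h gc c[OF x] y by (simp add: u_mult) (intro finsum_rdistr, auto)
  also have "... : mx g"
  proof (intro ri_finsum[OF P])
   fix a assume "a : {..<r}"
   then have "g ** q ** (u i a y ** u a j x) = g ** (q ** u i a y) ** u a j x" "q ** u i a y : carrier R"
    using h gc c[OF x] y by (auto simp: m_assoc)
   then show "g ** q ** (u i a y ** u a j x) : mx g"
    using uN[OF x _ h(2)] `a : {..<r}` by auto
  qed auto
  finally show "g ** q ** u i j (y ** x) : mx g" .
 qed
qed

section \<open>Rows with the right action through the matrices\<close>

text \<open>This right action commutes with the corner \<open>gRg\<close> acting from the left, so
  every ring element acts linearly over the division ring.\<close>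

definition rmul :: "(nat => 'a) => 'a => nat => 'a" where
 "rmul zt q j = (if j < r then (\<Oplus>i. zt i ** u i j q) else \<zero>)"

lemma rmul_closed:
 assumes "local_idem g" "zt : carrier (rows g)" "q : carrier R"
 shows "rmul zt q : carrier (rows g)"
proof -
 note P = right_ideal_prg[OF assms(1)]
 have "(\<Oplus>i. zt i ** u i j q) : pr g" if "j < r" for j
  using that assms by (intro ri_finsum[OF P] ri_mult[OF P]) auto
 then show ?thesis unfolding rmul_def using ri_zero[OF P] by auto
qed

lemma rmul_rbase:
 assumes g: "local_idem g" and zt: "zt : rbase g {..<r}" and q: "q : carrier R"
 shows "rmul zt q : rbase g {..<r}"
proof -
 have "rmul zt q : carrier (rows g)" using rmul_closed[OF g _ q] zt by (auto simp: rbaseD)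
 moreover have "rmul zt q j : mx g" if "j < r" for j
  using that zt q unfolding rmul_def
  by (auto simp: rbaseD intro!: ri_finsum[OF right_ideal_mx[OF g]] ri_mult[OF right_ideal_mx[OF g]])
 ultimately show ?thesis by (auto simp: rbaseD)
qed

lemma rmul_rmul:
 assumes c: "!!i. zt i : carrier R" and q: "q : carrier R" "q' : carrier R"
 shows "rmul (rmul zt q) q' = rmul zt (q ** q')"
proof
 fix j
 show "rmul (rmul zt q) q' j = rmul zt (q ** q') j"
 proof (cases "j < r")
  case True
  have "rmul (rmul zt q) q' j = (\<Oplus>a. (\<Oplus>i. zt i ** u i a q) ** u a j q')"
   unfolding rmul_def using True c q by (auto intro!: finsum_cong' finsum_closed)
  also have "... = (\<Oplus>a. \<Oplus>i. zt i ** u i a q ** u a j q')"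
   using True c q by (intro finsum_cong' finsum_ldistr) (auto intro!: finsum_closed)
  also have "... = (\<Oplus>i. \<Oplus>a. zt i ** u i a q ** u a j q')"
   using True c q by (intro finsum_swap) auto
  also have "... = (\<Oplus>i. zt i ** u i j (q ** q'))"
  proof (intro finsum_cong')
   fix i assume i: "i : {..<r}"
   have "zt i ** u i j (q ** q') = (\<Oplus>a. zt i ** (u i a q ** u a j q'))"
    using True c q i by (simp add: u_mult) (intro finsum_rdistr, auto)
   then show "(\<Oplus>a. zt i ** u i a q ** u a j q') = zt i ** u i j (q ** q')"
    using True c q i by (auto simp: m_assoc intro!: finsum_cong')
  qed (use True c q in auto)
  finally show ?thesis unfolding rmul_def using True by simp
 qed (simp add: rmul_def)
qed

lemma rmul_add:
 assumes "!!i. zt i : carrier R" "!!i. zt' i : carrier R" "q : carrier R"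
 shows "rmul (%i. zt i \<oplus> zt' i) q = (%j. rmul zt q j \<oplus> rmul zt' q j)"
proof
 fix j
 have "(\<Oplus>i. (zt i \<oplus> zt' i) ** u i j q) = (\<Oplus>i. zt i ** u i j q \<oplus> zt' i ** u i j q)" if "j < r"
  using assms that by (intro finsum_cong') (auto simp: l_distr)
 also have "... = (\<Oplus>i. zt i ** u i j q) \<oplus> (\<Oplus>i. zt' i ** u i j q)" if "j < r"
  using assms that by (intro finsum_addf) auto
 finally show "rmul (%i. zt i \<oplus> zt' i) q j = rmul zt q j \<oplus> rmul zt' q j"
  unfolding rmul_def by auto
qed

lemma rmul_lmult:
 assumes "!!i. zt i : carrier R" "d : carrier R" "q : carrier R"
 shows "rmul (%i. d ** zt i) q = (%j. d ** rmul zt q j)"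
proof
 fix j
 have "(\<Oplus>i. (d ** zt i) ** u i j q) = (\<Oplus>i. d ** (zt i ** u i j q))" if "j < r"
  using assms that by (intro finsum_cong') (auto simp: m_assoc)
 also have "... = d ** (\<Oplus>i. zt i ** u i j q)" if "j < r"
  using assms that by (intro finsum_rdistr[symmetric]) auto
 finally show "rmul (%i. d ** zt i) q j = d ** rmul zt q j"
  unfolding rmul_def using assms by auto
qed

lemma rmul_zero:
 assumes "!!i. zt i : carrier R" shows "rmul zt \<zero> = (%_. \<zero>)"
proof
 fix j show "rmul zt \<zero> j = \<zero>"
  unfolding rmul_def using assms by (auto simp: Op_zero[OF u_Op] intro!: add.finprod_one_eqI)
qed

abbreviation rspn :: "'a => (nat => 'a) set => (nat => 'a) set" where
 "rspn g \<equiv> operator_span.ospan (rows g) (rbase g {..<r}) (rops g)"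

lemma rmul_span:
 assumes g: "local_idem g" and S: "S <= carrier (rows g)" and q: "q : carrier R"
  and x: "x : rspn g S"
 shows "rmul x q : rspn g ((%zt. rmul zt q) ` S)"
proof (rule rows_span_image[OF g S _ _ _ x])
 note c = pr_in_carrier[OF g]
 show "rmul zt q : rbase g {..<r}" if "zt : rbase g {..<r}" for zt
  using rmul_rbase[OF g that q] .
 show "rmul (%i. zt i \<oplus> zt' i) q = (%j. rmul zt q j \<oplus> rmul zt' q j)"
  if "zt : carrier (rows g)" "zt' : carrier (rows g)" for zt zt'
  using that c q by (intro rmul_add) auto
 show "rmul (%i. d ** zt i) q = (%j. d ** rmul zt q j)"
  if "zt : carrier (rows g)" "d : carrier R" for zt d
  using that c q by (intro rmul_lmult) auto
qed

text \<open>For an idempotent \<open>p\<close> these rows correspond to the module maps from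
  \<open>pR\<close> into the rows with the action \<open>rmul\<close>.\<close>

definition rimage :: "'a => 'a => (nat => 'a) set" where
 "rimage g p = (%zt. rmul zt p) ` carrier (rows g)"

lemma rimage_fixed:
 assumes g: "local_idem g" and p: "p : carrier R" "p ** p = p" and zt: "zt : rimage g p"
 shows "zt : carrier (rows g)" "rmul zt p = zt"
proof -
 obtain zt' where z: "zt' : carrier (rows g)" "zt = rmul zt' p" using zt unfolding rimage_def by blast
 show "zt : carrier (rows g)" using z rmul_closed[OF g _ p(1)] by blast
 show "rmul zt p = zt" using z rmul_rmul[of zt' p p] pr_in_carrier[OF g] p by auto
qed

end

lemma (in operator_span) ospan_empty: "x : ospan {} ==> x : B"
proof (induction rule: ospan.induct)
 case (ospan_op om y) then show ?case using Om_B by blast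
qed (use B_add in auto)

section \<open>Dimensions of the Peirce components of the row space\<close>

locale coaction_decomp = coaction R r u v Op Ks
 for R (structure) and r u v Op Ks +
 fixes Gm :: "'a set"
 assumes decomp: "idem_decomp \<one> Gm"
begin

lemma Gm_local: "p : Gm ==> local_idem p"
 and Gm_finite: "finite Gm"
 and Gm_orth: "[|p : Gm; p' : Gm; p ~= p'|] ==> p ** p' = \<zero>"
 and Gm_sum: "finsum R (%p. p) Gm = \<one>"
 using decomp unfolding idem_decomp_def by auto

lemma Gm_carrier: "p : Gm ==> p : carrier R" and Gm_idem: "p : Gm ==> p ** p = p"
 using local_idemD(1,3) Gm_local by auto

lemma peirce_in:
 assumes "M <= carrier R" "\<zero> : M" "!!x y. x : M ==> y : M ==> x \<oplus> y : M"
  and x: "x : carrier R" "!!p. p : Gm ==> x ** p : M"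
 shows "x : M"
proof -
 have "x = x ** finsum R (%p. p) Gm" using Gm_sum x by simp
 also have "... = (\<Oplus>p\<in>Gm. x ** p)"
  using x(1) Gm_finite Gm_carrier by (intro finsum_rdistr) auto
 also have "... : M" using finsum_in_closed[of M, OF assms(1,2,3) Gm_finite, of "%p. x ** p"] x(2) by blast
 finally show ?thesis .
qed

definition cls :: "'a => 'a set" where "cls g = {p : Gm. idem_eqv g p}"

lemma cls_finite: "finite (cls g)"
 unfolding cls_def using Gm_finite by simp

lemma cls_self: "g : Gm ==> g : cls g"
 unfolding cls_def using idem_eqv_refl Gm_local by blast

lemma card_cls_pos: "g : Gm ==> 0 < card (cls g)"
 using cls_self cls_finite card_gt_0_iff by blast

lemma cls_cong: "idem_eqv g p ==> cls g = cls p"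
 unfolding cls_def using idem_eqv_trans idem_eqv_sym by blast

definition unit_row :: "nat => 'a => nat => 'a" where
 "unit_row i x = (%j. if j = i then x else \<zero>)"

lemma unit_row_rows: "[|local_idem g; x : pr g|] ==> unit_row i x : carrier (rows g)"
 unfolding unit_row_def using ri_zero[OF right_ideal_prg] by auto

text \<open>A Peirce component \<open>x p\<close> of an element of \<open>gR\<close> lies in
  \<open>mx g\<close> unless \<open>p\<close> is isomorphic to \<open>g\<close>, and then it is a
  corner multiple of one fixed isomorphism. So \<open>card (cls g)\<close> elements span the top of
  \<open>gR\<close>, and \<open>r\<close> times as many rows suffice.\<close>

lemma rows_spanned:
 assumes gGm: "g : Gm"
 obtains J where "finite J" "J <= carrier (rows g)" "card J <= r * card (cls g)"
  "carrier (rows g) <= rspn g J"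
proof -
 note g = Gm_local[OF gGm]
 note P = right_ideal_prg[OF g] and c = pr_in_carrier[OF g] and Mx = right_ideal_mx[OF g]
 interpret E: operator_span "rows g :: (nat => 'a) ring" "rbase g {..<r}" "rops g"
  using operator_span_rows[OF g] .
 have "\<forall>p\<in>cls g. \<exists>ab. fst ab : carrier R & snd ab : carrier R & g ** fst ab = fst ab &
  snd ab ** g = snd ab & snd ab ** fst ab = p"
  unfolding cls_def idem_eqv_def by force
 from bchoice[OF this] obtain ab where ab: "!!p. p : cls g ==> fst (ab p) : carrier R"
  "!!p. p : cls g ==> snd (ab p) : carrier R" "!!p. p : cls g ==> g ** fst (ab p) = fst (ab p)"
  "!!p. p : cls g ==> snd (ab p) ** g = snd (ab p)"
  "!!p. p : cls g ==> snd (ab p) ** fst (ab p) = p" by blast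
 define J where "J = (%(i, p). unit_row i (fst (ab p))) ` ({..<r} \<times> cls g)"
 have "finite J" unfolding J_def using cls_finite by simp
 have aP: "fst (ab p) : pr g" if "p : cls g" for p using ab that local_idemD(4)[OF g] by blast
 have JC: "J <= carrier (rows g)"
  unfolding J_def using unit_row_rows[OF g aP] by auto
 have cardJ: "card J <= r * card (cls g)"
  using card_image_le[of "{..<r} \<times> cls g" "%(i, p). unit_row i (fst (ab p))"] cls_finite
  unfolding J_def by simp
 have base: "unit_row i x : rspn g J" if "x : mx g" for i x
  using that mx_pr ri_zero[OF P] ri_zero[OF Mx]
  by (intro E.ospan_base) (auto simp: rbaseD unit_row_def)
 have unit: "unit_row i x : rspn g J" if i: "i < r" and x: "x : pr g" for i x
 proof -
  define M where "M = {x : pr g. unit_row i x : rspn g J}"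
  have "x : M"
  proof (rule peirce_in)
   show "M <= carrier R" unfolding M_def using c by blast
   show "\<zero> : M" unfolding M_def using base ri_zero[OF Mx] ri_zero[OF P] by blast
   show "y \<oplus> z : M" if "y : M" "z : M" for y z
   proof -
    have "unit_row i (y \<oplus> z) = unit_row i y \<oplus>\<^bsub>rows g\<^esub> unit_row i z"
     using that c unfolding unit_row_def M_def by (auto simp: fun_eq_iff)
    then show ?thesis using that E.ospan_add ri_add[OF P] unfolding M_def by auto
   qed
   show "x : carrier R" using x c by blast
   fix p assume p: "p : Gm"
   have xp: "x ** p : pr g" using x ri_mult[OF P] Gm_carrier[OF p] by blast
   have "unit_row i (x ** p) : rspn g J"
   proof (cases "p : cls g")
    case True
    \<comment> \<open>As \<open>p = snd (ab p) ** fst (ab p)\<close>, the component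
      \<open>x p\<close> is the corner element \<open>d\<close> times the generator
      \<open>fst (ab p)\<close>.\<close>
    define d where "d = x ** snd (ab p)"
    have xc: "x : carrier R" "g ** x = x" using x local_idemD(4)[OF g] by auto
    have d: "d : carrier R" "g ** d = d" "d ** g = d" unfolding d_def
     using xc ab[OF True] local_idemD(1)[OF g] assoc_eq[OF xc(2)] by (auto simp: m_assoc)
    have "x ** p = x ** (snd (ab p) ** fst (ab p))" using ab(5)[OF True] by simp
    also have "... = d ** fst (ab p)" unfolding d_def using xc ab(1,2)[OF True] by (simp add: m_assoc)
    finally have "unit_row i (x ** p) = (%j. d ** unit_row i (fst (ab p)) j)"
     using d unfolding unit_row_def by auto
    moreover have "(%zt j. d ** zt j) : rops g" unfolding rops_def using d by blast
    moreover have "unit_row i (fst (ab p)) : rspn g J"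
     using i True by (intro E.ospan_gen) (auto simp: J_def)
    ultimately show ?thesis using E.ospan_op by metis
   next
    case False
    then have "x ** p : mx g"
     using local_idem_eqv_mx[OF g Gm_local[OF p]] x p local_idemD(4)[OF g] unfolding cls_def by blast
    then show ?thesis by (rule base)
   qed
   then show "x ** p : M" unfolding M_def using xp by blast
  qed
  then show ?thesis unfolding M_def by blast
 qed
 have "zt : rspn g J" if zt: "zt : carrier (rows g)" for zt
 proof -
  have "(%j. if j < n then zt j else \<zero>) : rspn g J" if "n <= r" for n using that
  proof (induction n)
   case 0
   then show ?case using ri_zero[OF P] ri_zero[OF Mx] by (intro E.ospan_base) (auto simp: rbaseD)
  next
   case (Suc n)
   have "(%j. if j < Suc n then zt j else \<zero>) = (%j. if j < n then zt j else \<zero>) \<oplus>\<^bsub>rows g\<^esub> unit_row n (zt n)"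
    using zt c unfolding unit_row_def by (auto simp: fun_eq_iff less_Suc_eq)
   then show ?case using E.ospan_add[OF Suc.IH unit[of n "zt n"]] Suc.prems zt by auto
  qed
  from this[of r] have "(%j. if j < r then zt j else \<zero>) \<oplus>\<^bsub>rows g\<^esub> (%j. if j < r then \<zero> else zt j) : rspn g J"
   using zt ri_zero[OF P] ri_zero[OF Mx]
   by (intro E.ospan_add[OF _ E.ospan_base]) (auto simp: rbaseD)
  also have "(%j. if j < r then zt j else \<zero>) \<oplus>\<^bsub>rows g\<^esub> (%j. if j < r then \<zero> else zt j) = zt"
   using zt c by (auto simp: fun_eq_iff)
  finally show ?thesis .
 qed
 then show ?thesis using that[of J] `finite J` JC cardJ by blast
qed

lemma rimage_subset:
 assumes "local_idem g" "p : carrier R" shows "rimage g p <= carrier (rows g)"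
 unfolding rimage_def using rmul_closed[OF assms(1) _ assms(2)] by blast

abbreviation rindep :: "'a => (nat => 'a) set => bool" where
 "rindep g \<equiv> exchange_closure.indep (carrier (rows g)) (rspn g)"

definition Bs :: "'a => 'a => (nat => 'a) set" where
 "Bs g p = (SOME B. finite B & B <= rimage g p & rindep g B & rimage g p <= rspn g B)"

lemma Bs:
 assumes "g : Gm" "p : Gm"
 shows "finite (Bs g p)" "Bs g p <= rimage g p" "rindep g (Bs g p)" "rimage g p <= rspn g (Bs g p)"
proof -
 note g = Gm_local[OF assms(1)]
 interpret E: operator_span "rows g :: (nat => 'a) ring" "rbase g {..<r}" "rops g"
  using operator_span_rows[OF g] .
 obtain J where J: "finite J" "J <= carrier (rows g)" "card J <= r * card (cls g)"
  "carrier (rows g) <= rspn g J" by (rule rows_spanned[OF assms(1)])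
 have "rimage g p <= rspn g J"
  using rimage_subset[OF g Gm_carrier[OF assms(2)]] J(4) by (rule subset_trans)
 then have "\<exists>B. finite B & B <= rimage g p & rindep g B & rimage g p <= rspn g B"
  using E.finite_basis_exists[OF J(1,2)] by blast
 then have "finite (Bs g p) & Bs g p <= rimage g p & rindep g (Bs g p) & rimage g p <= rspn g (Bs g p)"
  unfolding Bs_def by (rule someI_ex)
 then show "finite (Bs g p)" "Bs g p <= rimage g p" "rindep g (Bs g p)" "rimage g p <= rspn g (Bs g p)"
  by auto
qed

text \<open>The dimension, over the division ring at \<open>g\<close>, of the component at
  \<open>p\<close> of the row space.\<close>

definition T :: "'a => 'a => nat" where "T g p = card (Bs g p)"

text \<open>Multiplication from the right by the isomorphism \<open>a\<close> carries the component
  at \<open>p\<close> onto that at \<open>p'\<close>, so a basis becomes a spanning set.\<close>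

lemma T_le_eqv:
 assumes gGm: "g : Gm" and p: "p : Gm" "p' : Gm" and e: "idem_eqv p p'"
 shows "T g p' <= T g p"
proof -
 note g = Gm_local[OF gGm] and c = pr_in_carrier[OF g]
 interpret E: operator_span "rows g :: (nat => 'a) ring" "rbase g {..<r}" "rops g"
  using operator_span_rows[OF g] .
 obtain a b where ab: "a : carrier R" "b : carrier R" "p ** a = a" "a ** p' = a" "p' ** b = b"
  "b ** p = b" "a ** b = p" "b ** a = p'" using e unfolding idem_eqv_def by blast
 let ?B = "(%zt. rmul zt a) ` Bs g p"
 have BC: "Bs g p <= carrier (rows g)"
  using Bs(2)[OF gGm p(1)] rimage_subset[OF g Gm_carrier[OF p(1)]] by blast
 have "om : rspn g ?B" if w: "om : rimage g p'" for om
 proof -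
  have wc: "om : carrier (rows g)" "rmul om p' = om"
   using rimage_fixed[OF g Gm_carrier[OF p(2)] Gm_idem[OF p(2)] w] by auto
  have wi: "om i : carrier R" for i using wc c by auto
  have "rmul om b = rmul (rmul om b) p" using rmul_rmul[OF wi ab(2) Gm_carrier[OF p(1)]] ab by simp
  then have "rmul om b : rimage g p"
   unfolding rimage_def using rmul_closed[OF g wc(1) ab(2)] by blast
  then have "rmul om b : rspn g (Bs g p)" using Bs(4)[OF gGm p(1)] by blast
  then have "rmul (rmul om b) a : rspn g ?B" by (rule rmul_span[OF g BC ab(1)])
  then show ?thesis using rmul_rmul[OF wi ab(2,1)] ab(8) wc(2) by simp
 qed
 then have "Bs g p' <= rspn g ?B" using Bs(2)[OF gGm p(2)] by blast
 moreover have "?B <= carrier (rows g)" using BC rmul_closed[OF g _ ab(1)] by blast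
 ultimately have "card (Bs g p') <= card ?B"
  using E.indep_card_le[of ?B "Bs g p'"] Bs[OF gGm p(1)] Bs[OF gGm p(2)] by blast
 also have "... <= card (Bs g p)" using card_image_le Bs(1)[OF gGm p(1)] by blast
 finally show ?thesis unfolding T_def .
qed

lemma T_eqv: "[|g : Gm; p : Gm; p' : Gm; idem_eqv p p'|] ==> T g p' = T g p"
 using T_le_eqv idem_eqv_sym by (meson le_antisym)

lemma Bs_not_base:
 assumes "g : Gm" "p : Gm" "b : Bs g p" shows "b ~: rbase g {..<r}"
proof
 interpret E: operator_span "rows g :: (nat => 'a) ring" "rbase g {..<r}" "rops g"
  using operator_span_rows[OF Gm_local[OF assms(1)]] .
 assume "b : rbase g {..<r}"
 then have "b : rspn g (Bs g p - {b})" by (rule E.ospan_base)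
 then show False using Bs(3)[OF assms(1,2)] assms(3) unfolding E.indep_def by blast
qed

text \<open>Unit rows times \<open>p\<close> have the entries \<open>g q u i j p\<close>. All of
  these vanish in the top exactly if \<open>p\<close> lies in \<open>Ncore g\<close>.\<close>

lemma T_pos_iff:
 assumes gGm: "g : Gm" and p: "p : Gm" shows "T g p > 0 \<longleftrightarrow> p ~: Ncore g"
proof -
 note g = Gm_local[OF gGm] and c = pr_in_carrier[OF g] and Mx = right_ideal_mx[OF g]
 note pc = Gm_carrier[OF p]
 interpret E: operator_span "rows g :: (nat => 'a) ring" "rbase g {..<r}" "rops g"
  using operator_span_rows[OF g] .
 show ?thesis
 proof
  assume "T g p > 0"
  then obtain b where b: "b : Bs g p" unfolding T_def by (metis card_gt_0_iff ex_in_conv)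
  then obtain zt where z: "zt : carrier (rows g)" "b = rmul zt p"
   using Bs(2)[OF gGm p] unfolding rimage_def by blast
  show "p ~: Ncore g"
  proof
   assume N: "p : Ncore g"
   have "b j : mx g" if j: "j < r" for j
   proof -
    have "zt i ** u i j p : mx g" if "i < r" for i
    proof -
     have zi: "zt i : carrier R" "g ** zt i = zt i" using z local_idemD(4)[OF g] by auto
     have "g ** zt i ** u i j p : mx g" using N zi u_Op j that unfolding Ncore_def by blast
     then show ?thesis using zi by simp
    qed
    then show ?thesis unfolding z(2) rmul_def using j by (auto intro!: ri_finsum[OF Mx])
   qed
   then have "b : rbase g {..<r}"
    using rmul_closed[OF g z(1) pc] unfolding z(2) by (auto simp: rbaseD)
   then show False using Bs_not_base[OF gGm p b] by blast
  qed
 next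
  assume N: "p ~: Ncore g"
  show "T g p > 0"
  proof (rule ccontr)
   assume "~ T g p > 0"
   then have "Bs g p = {}" using Bs(1)[OF gGm p] unfolding T_def by simp
   then have im: "rimage g p <= rbase g {..<r}" using Bs(4)[OF gGm p] E.ospan_empty by auto
   have "g ** q ** u i j p : mx g" if "i < r" "j < r" "q : carrier R" for i j q
   proof -
    have gq: "g ** q : pr g" using that(3) unfolding pr_def by blast
    have "rmul (unit_row i (g ** q)) p : rbase g {..<r}"
     using im unit_row_rows[OF g gq] unfolding rimage_def by blast
    then have "rmul (unit_row i (g ** q)) p j : mx g" using that by (auto simp: rbaseD)
    also have "rmul (unit_row i (g ** q)) p j = (\<Oplus>k. if k = i then g ** q ** u i j p else \<zero>)"
     unfolding rmul_def unit_row_def using that pc c[OF gq]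
     by (auto intro!: finsum_cong')
    also have "... = g ** q ** u i j p" using that pc c[OF gq] by (intro finsum_delta) auto
    finally show ?thesis .
   qed
   then show False using N Ncore_uI[OF g pc] by blast
  qed
 qed
qed

text \<open>Orthogonality of the idempotents makes the components at different \<open>p\<close>
  independent, so their dimensions add up within the whole row space.\<close>

lemma T_sum_le:
 assumes gGm: "g : Gm" shows "(\<Sum>p\<in>Gm. T g p) <= r * card (cls g)"
proof -
 note g = Gm_local[OF gGm] and c = pr_in_carrier[OF g]
 interpret E: operator_span "rows g :: (nat => 'a) ring" "rbase g {..<r}" "rops g"
  using operator_span_rows[OF g] .
 obtain J where J: "finite J" "J <= carrier (rows g)" "card J <= r * card (cls g)"
  "carrier (rows g) <= rspn g J"
  by (rule rows_spanned[OF gGm])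
 have zb: "(%_. \<zero>) : rbase g {..<r}"
  using ri_zero[OF right_ideal_prg[OF g]] ri_zero[OF right_ideal_mx[OF g]] by (auto simp: rbaseD)
 have BC: "Bs g p <= carrier (rows g)" if "p : Gm" for p
  using Bs(2)[OF gGm that] rimage_subset[OF g Gm_carrier[OF that]] by blast
 have fix_: "rmul b p = b" if "p : Gm" "b : Bs g p" for p b
  using rimage_fixed(2)[OF g Gm_carrier Gm_idem] Bs(2)[OF gGm] that by blast
 have kill: "rmul b p' = (%_. \<zero>)" if "p : Gm" "b : Bs g p" "p' : Gm" "p' ~= p" for p p' b
 proof -
  have bi: "b i : carrier R" for i using BC[OF that(1)] that(2) c by auto
  have "rmul b p' = rmul (rmul b p) p'" using fix_[OF that(1,2)] by simp
  also have "... = rmul b (p ** p')" by (rule rmul_rmul[OF bi Gm_carrier[OF that(1)] Gm_carrier[OF that(3)]])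
  also have "p ** p' = \<zero>" using Gm_orth[OF that(1,3)] that(4) by auto
  finally show ?thesis using rmul_zero[OF bi] by simp
 qed
 have disj: "Bs g p \<inter> Bs g p' = {}" if "p : Gm" "p' : Gm" "p ~= p'" for p p'
 proof (rule ccontr)
  assume "Bs g p \<inter> Bs g p' ~= {}"
  then obtain b where b: "b : Bs g p" "b : Bs g p'" by blast
  then have "b = (%_. \<zero>)" using kill[OF that(1) b(1) that(2)] fix_[OF that(2) b(2)] that(3) by simp
  then show False using Bs_not_base[OF gGm that(1) b(1)] zb by blast
 qed
 define U where "U = (\<Union>p\<in>Gm. Bs g p)"
 have "card U = (\<Sum>p\<in>Gm. T g p)"
  unfolding U_def T_def using Gm_finite Bs(1)[OF gGm] disj by (intro card_UN_disjoint) auto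
 moreover have UC: "U <= carrier (rows g)" unfolding U_def using BC by blast
 have "rindep g U"
  unfolding E.indep_def
 proof (intro conjI ballI UC)
  fix b assume "b : U"
  then obtain p where p: "p : Gm" "b : Bs g p" unfolding U_def by blast
  show "b ~: rspn g (U - {b})"
  proof
   assume "b : rspn g (U - {b})"
   then have "rmul b p : rspn g ((%zt. rmul zt p) ` (U - {b}))"
    using UC Gm_carrier[OF p(1)] by (intro rmul_span[OF g]) auto
   moreover have "(%zt. rmul zt p) ` (U - {b}) <= rspn g (Bs g p - {b})"
   proof
    fix y assume "y : (%zt. rmul zt p) ` (U - {b})"
    then obtain b' p' where b': "y = rmul b' p" "b' ~= b" "p' : Gm" "b' : Bs g p'"
     unfolding U_def by blast
    show "y : rspn g (Bs g p - {b})"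
    proof (cases "p' = p")
     case True
     then show ?thesis using b' fix_ E.ospan_gen[of b' "Bs g p - {b}"] by auto
    next
     case False
     then have "y = (%_. \<zero>)" using kill[OF b'(3,4) p(1)] b'(1) by simp
     then show ?thesis using zb E.ospan_base by blast
    qed
   qed
   then have "rspn g ((%zt. rmul zt p) ` (U - {b})) <= rspn g (Bs g p - {b})"
    using BC[OF p(1)] by (intro E.cl_least) auto
   ultimately show False
    using Bs(3)[OF gGm p(1)] p fix_[OF p] unfolding E.indep_def by auto
  qed
 qed
 moreover have "finite U" unfolding U_def using Gm_finite Bs(1)[OF gGm] by blast
 ultimately have "(\<Sum>p\<in>Gm. T g p) <= card J"
  using E.indep_card_le[OF J(1,2), of U] UC J(4) by auto
 then show ?thesis using J(3) by linarith
qed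

end

text \<open>Each generator comes with an idempotent \<open>p\<close> such that
  \<open>x p = x\<close>, so \<open>Y / I\<close> is an image of a direct sum of the projective
  modules \<open>pR\<close>. Minimality refers to the deletion of a single generator.\<close>

locale minimal_generators = coaction_decomp R r u v Op Ks Gm
 for R (structure) and r u v Op Ks Gm +
 fixes I Y :: "'a set" and M :: "('a \<times> 'a) set"
 assumes rI: "right_ideal I R" and rY: "right_ideal Y R" and IY: "I <= Y"
  and sI: "stable I" and sY: "stable Y"
  and M_finite: "finite M" and M_sub: "M <= Y \<times> Gm" and M_fix: "x : M ==> fst x ** snd x = fst x"
  and gen: "Y = rspan (I \<union> fst ` M)"
  and minimal: "x : M ==> rspan (I \<union> fst ` (M - {x})) ~= Y"
begin

lemma Y_carrier: "y : Y ==> y : carrier R"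
 using ri_in[OF rY] .

lemma M_Y: "x : M ==> fst x : Y" and M_Gm: "x : M ==> snd x : Gm"
 using M_sub by auto

text \<open>\<open>functional g x xi\<close>: \<open>xi\<close> induces an \<open>R\<close>-linear map \<open>Y / I \<rightarrow> gR / mx g\<close> which
 is nonzero at the generator \<open>x\<close> and kills the other generators.\<close>

definition functional :: "'a => 'a \<times> 'a => ('a => 'a) => bool" where
 "functional g x xi \<longleftrightarrow> (\<forall>y\<in>Y. xi y : pr g) & (\<forall>y\<in>Y. \<forall>y'\<in>Y. con g (xi (y \<oplus> y')) (xi y \<oplus> xi y')) &
  (\<forall>y\<in>Y. \<forall>q\<in>carrier R. con g (xi (y ** q)) (xi y ** q)) & (\<forall>y\<in>I. xi y : mx g) &
  (\<forall>x'\<in>M. x' ~= x --> xi (fst x') : mx g) & xi (fst x) ~: mx g"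

lemma functionalD:
 assumes "functional g x xi"
 shows "!!y. y : Y ==> xi y : pr g"
  "!!y y'. [|y : Y; y' : Y|] ==> con g (xi (y \<oplus> y')) (xi y \<oplus> xi y')"
  "!!y q. [|y : Y; q : carrier R|] ==> con g (xi (y ** q)) (xi y ** q)"
  "!!y. y : I ==> xi y : mx g" "!!x'. [|x' : M; x' ~= x|] ==> xi (fst x') : mx g"
  "xi (fst x) ~: mx g"
 using assms unfolding functional_def by simp_all

text \<open>Modulo \<open>I\<close> and the other generators \<open>Y\<close> is cyclic, generated
  by \<open>m\<close> and isomorphic to \<open>pR / K\<close>. Minimality keeps \<open>p\<close> out
  of \<open>K\<close>, so \<open>K\<close> lies in \<open>mx p\<close>, and \<open>a\<close>
  identifies the top of \<open>pR\<close> with that of \<open>gR\<close>.\<close>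

lemma functional_exists:
 assumes gGm: "g : Gm" and x: "x : M" and e: "idem_eqv g (snd x)"
 shows "\<exists>xi. functional g x xi"
proof -
 define m p where "m = fst x" and "p = snd x"
 note g = Gm_local[OF gGm]
 have pGm: "p : Gm" unfolding p_def using M_Gm[OF x] .
 note p = Gm_local[OF pGm]
 have mY: "m : Y" unfolding m_def using M_Y[OF x] .
 have mp: "m ** p = m" unfolding m_def p_def using M_fix[OF x] .
 have mc: "m : carrier R" and pc: "p : carrier R" and pp: "p ** p = p"
  using Y_carrier[OF mY] local_idemD[OF p] by auto
 obtain a b where ab: "a : carrier R" "b : carrier R" "g ** a = a" "a ** p = a" "p ** b = b"
  "b ** g = b" "a ** b = g" "b ** a = p" using e unfolding idem_eqv_def p_def by blast
 let ?S = "I \<union> fst ` (M - {x})"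
 define L where "L = rspan ?S"
 have SY: "?S <= Y" using IY M_Y by blast
 have Sc: "?S <= carrier R" using SY Y_carrier by blast
 have L: "right_ideal L R" unfolding L_def using right_ideal_rspan[OF Sc] .
 have SL: "?S <= L" unfolding L_def using rspan_superset[OF Sc] .
 have LY: "L <= Y" unfolding L_def by (rule rspan_least[OF rY SY])
 have mL: "m ~: L"
 proof
  assume "m : L"
  then have "I \<union> fst ` M <= L" using SL unfolding m_def by blast
  then have "Y <= L" unfolding gen by (rule rspan_least[OF L])
  then show False using LY minimal[OF x] unfolding L_def by blast
 qed
 \<comment> \<open>\<open>q\<close> is a coordinate of \<open>y\<close> with respect to
   \<open>m\<close>; after multiplication by \<open>p\<close> it is determined up to
   \<open>K\<close>.\<close>
 define rh where "rh y q \<longleftrightarrow> q : carrier R & y \<ominus> m ** q : L" for y q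
 have rh_add: "rh (y \<oplus> y') (q \<oplus> q')" if "rh y q" "rh y' q'" "y : Y" "y' : Y" for y y' q q'
 proof -
  have "y \<oplus> y' \<ominus> m ** (q \<oplus> q') = (y \<ominus> m ** q) \<oplus> (y' \<ominus> m ** q')"
   using that Y_carrier mc unfolding rh_def by (simp add: minus_eq minus_add r_distr a_ac)
  then show ?thesis using that ri_add[OF L] unfolding rh_def by simp
 qed
 have rh_mult: "rh (y ** s) (q ** s)" if "rh y q" "y : Y" "s : carrier R" for y q s
 proof -
  have "y ** s \<ominus> m ** (q ** s) = (y \<ominus> m ** q) ** s"
   using that Y_carrier mc unfolding rh_def by (simp add: minus_eq l_distr l_minus m_assoc)
  then show ?thesis using that ri_mult[OF L] unfolding rh_def by simp
 qed
 have rh_L: "rh y \<zero>" if "y : L" for y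
  using that ri_in[OF L that] mc unfolding rh_def by (simp add: minus_eq)
 have rh_m: "rh m \<one>" unfolding rh_def using mc ri_zero[OF L] by (simp add: r_right_minus_eq[THEN iffD2])
 have rh_ex: "\<exists>q. rh y q" if "y : Y" for y
 proof -
  have "y : rspan (I \<union> fst ` M)" using that gen by blast
  then show ?thesis
  proof induction
   case rspan_zero then show ?case using rh_L ri_zero[OF L] by blast
  next
   case (rspan_mult s q)
   show ?case
   proof (cases "s = m")
    case True then show ?thesis using rh_mult[OF rh_m mY rspan_mult(2)] by blast
   next
    case False
    then have "s : L" using rspan_mult(1) SL unfolding m_def by blast
    then show ?thesis using rh_L ri_mult[OF L] rspan_mult(2) by blast
   qed
  next
   case (rspan_add y z)
   then show ?case using rh_add gen by blast
  qed
 qed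
 define K where "K = {z : pr p. m ** z : L}"
 have K: "right_ideal K R"
  unfolding K_def
 proof (rule right_idealI)
  note Pp = right_ideal_prg[OF p] and c = pr_in_carrier[OF p]
  show "{z : pr p. m ** z : L} <= carrier R" using c by blast
  show "\<zero> : {z : pr p. m ** z : L}" using ri_zero[OF Pp] ri_zero[OF L] mc by simp
  show "y \<oplus> z : {z : pr p. m ** z : L}" if "y : {z : pr p. m ** z : L}" "z : {z : pr p. m ** z : L}" for y z
   using that c ri_add[OF Pp] ri_add[OF L] mc by (auto simp: r_distr)
  show "y ** s : {z : pr p. m ** z : L}" if "y : {z : pr p. m ** z : L}" "s : carrier R" for y s
   using that c ri_mult[OF Pp] ri_mult[OF L] mc by (auto simp: m_assoc[symmetric])
 qed
 have Kmx: "K <= mx p"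
 proof (rule mx_superset[OF p K])
  show "K <= pr p" unfolding K_def by blast
  show "p ~: K" unfolding K_def using mp mL by simp
 qed
 have ag: "a ** q : pr g" if "q : carrier R" for q using pr_corner[OF g ab(1,3) that] .
 have uniq: "con g (a ** q) (a ** q')" if "rh y q" "rh y q'" "y : Y" for y q q'
 proof -
  have c: "q : carrier R" "q' : carrier R" "y : carrier R"
   using that Y_carrier unfolding rh_def by auto
  have "m ** (p ** (q \<ominus> q')) = m ** (q \<ominus> q')"
   using assoc_eq[OF mp mc pc] c by simp
  also have "... = (y \<ominus> m ** q') \<ominus> (y \<ominus> m ** q)"
   using c mc by (simp add: minus_eq minus_add r_distr r_minus a_ac r_neg1 r_neg2)
  also have "... : L" using that ri_minus[OF L] unfolding rh_def by blast
  finally have "p ** (q \<ominus> q') : K" unfolding K_def pr_def using c by blast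
  then have "a ** (p ** (q \<ominus> q')) : mx g"
   using mx_left_transfer[OF g p ab(1,3,2,6,7,8)] Kmx by blast
  also have "a ** (p ** (q \<ominus> q')) = a ** q \<ominus> a ** q'"
   using assoc_eq[OF ab(4,1) pc] c ab(1) by (simp add: minus_eq r_distr r_minus)
  finally show ?thesis unfolding con_def using ag c by blast
 qed
 \<comment> \<open>An arbitrary coordinate is chosen. By \<open>uniq\<close> the result is well
   defined in the top, so additivity and linearity hold as congruences.\<close>
 define xi where "xi y = a ** (SOME q. rh y q)" for y
 have rhS: "rh y (SOME q. rh y q)" if "y : Y" for y using rh_ex[OF that] by (rule someI_ex)
 have xi_eq: "con g (xi y) (a ** q)" if "y : Y" "rh y q" for y q
  unfolding xi_def using uniq[OF rhS that(2)] that(1) by blast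
 have SC: "(SOME q. rh y q) : carrier R" if "y : Y" for y using rhS[OF that] unfolding rh_def by blast
 have L_mx: "xi y : mx g" if "y : L" for y
  using xi_eq[OF _ rh_L[OF that]] that LY ab(1) con_zero_iff[OF g] by auto
 have "functional g x xi"
  unfolding functional_def
 proof (intro conjI ballI impI)
  show "xi y : pr g" if "y : Y" for y unfolding xi_def using ag SC[OF that] by blast
  show "con g (xi (y \<oplus> y')) (xi y \<oplus> xi y')" if "y : Y" "y' : Y" for y y'
   using xi_eq[OF ri_add[OF rY that] rh_add[OF rhS[OF that(1)] rhS[OF that(2)] that]]
    SC[OF that(1)] SC[OF that(2)] ab(1) unfolding xi_def by (simp add: r_distr)
  show "con g (xi (y ** s)) (xi y ** s)" if "y : Y" "s : carrier R" for y s
   using xi_eq[OF ri_mult[OF rY that] rh_mult[OF rhS[OF that(1)] that]]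
    SC[OF that(1)] that(2) ab(1) unfolding xi_def by (simp add: m_assoc)
  show "xi y : mx g" if "y : I" for y using L_mx that SL by blast
  show "xi (fst x') : mx g" if "x' : M" "x' ~= x" for x' using L_mx SL that by blast
  show "xi (fst x) ~: mx g"
  proof
   assume "xi (fst x) : mx g"
   then have "con g (xi m) \<zero>" unfolding m_def using con_zero_iff[OF g] by blast
   then have "con g a \<zero>" using con_trans[OF g] con_sym[OF g xi_eq[OF mY rh_m]] ab(1) by auto
   then have "a : mx g" using con_zero_iff[OF g] by blast
   moreover have "g : pr a" unfolding pr_def using ab(2,7) by blast
   ultimately show False unfolding mx_def by blast
  qed
 qed
 then show ?thesis by blast
qed

lemma functional_finsum:
 assumes g: "local_idem g" and f: "functional g x xi" and A: "finite A"
  and fY: "!!i. i : A ==> f i : Y"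
 shows "con g (xi (finsum R f A)) (\<Oplus>i\<in>A. xi (f i))"
 using A fY
proof (induction A rule: finite_induct)
 case empty
 have "xi \<zero> : mx g" using functionalD(4)[OF f ri_zero[OF rI]] .
 then show ?case using con_zero_iff[OF g] by simp
next
 case (insert i A)
 have c: "f : A \<rightarrow> carrier R" "f i : carrier R" using insert.prems Y_carrier by auto
 have xc: "xi y : carrier R" if "y : Y" for y
  using functionalD(1)[OF f that] pr_in_carrier[OF g] by blast
 have "finsum R f A : Y" using ri_finsum[OF rY] insert by blast
 then have "con g (xi (f i \<oplus> finsum R f A)) (xi (f i) \<oplus> xi (finsum R f A))"
  using functionalD(2)[OF f] insert.prems by blast
 moreover have "con g (xi (f i) \<oplus> xi (finsum R f A)) (xi (f i) \<oplus> (\<Oplus>i\<in>A. xi (f i)))"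
  using insert functionalD(1)[OF f] by (intro con_add[OF g] con_refl[OF g]) auto
 ultimately have "con g (xi (f i \<oplus> finsum R f A)) (xi (f i) \<oplus> (\<Oplus>i\<in>A. xi (f i)))"
  by (rule con_trans[OF g])
 then show ?case using insert.hyps insert.prems c xc by simp
qed

text \<open>\<open>R\<close>-linear maps from \<open>Y / I\<close> to the rows over \<open>gR / mx g\<close>.\<close>

definition row_map :: "'a => ('a => nat => 'a) => bool" where
 "row_map g et \<longleftrightarrow> (\<forall>y\<in>Y. \<forall>j<r. et y j : pr g) &
  (\<forall>y\<in>Y. \<forall>y'\<in>Y. \<forall>j<r. con g (et (y \<oplus> y') j) (et y j \<oplus> et y' j)) &
  (\<forall>y\<in>Y. \<forall>q\<in>carrier R. \<forall>j<r. con g (et (y ** q) j) (\<Oplus>l. et y l ** u l j q)) &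
  (\<forall>y\<in>I. \<forall>j<r. et y j : mx g)"

lemma row_mapD:
 assumes "row_map g et"
 shows "!!y j. [|y : Y; j < r|] ==> et y j : pr g"
  "!!y y' j. [|y : Y; y' : Y; j < r|] ==> con g (et (y \<oplus> y') j) (et y j \<oplus> et y' j)"
  "!!y q j. [|y : Y; q : carrier R; j < r|] ==> con g (et (y ** q) j) (\<Oplus>l. et y l ** u l j q)"
  "!!y j. [|y : I; j < r|] ==> et y j : mx g"
 using assms unfolding row_map_def by simp_all

text \<open>The functional is composed with the \<open>i\<close>-th row of the matrix homomorphism;
  \<open>u_mult\<close> makes the result linear for the action through matrices.\<close>

lemma row_map_functional:
 assumes g: "local_idem g" and f: "functional g x xi" and i: "i < r"
 shows "row_map g (%y j. xi (u i j y))"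
 unfolding row_map_def
proof (intro conjI ballI allI impI)
 have uY: "u i j y : Y" if "y : Y" "j < r" for y j using stable_u[OF sY i] that by blast
 show "xi (u i j y) : pr g" if "y : Y" "j < r" for y j
  using functionalD(1)[OF f uY[OF that]] .
 show "con g (xi (u i j (y \<oplus> y'))) (xi (u i j y) \<oplus> xi (u i j y'))" if "y : Y" "y' : Y" "j < r" for y y' j
  using functionalD(2)[OF f uY uY, of y j y' j] that u_add[OF i, of j y y'] Y_carrier by auto
 show "xi (u i j y) : mx g" if "y : I" "j < r" for y j
  using functionalD(4)[OF f stable_u[OF sI i]] that by blast
 show "con g (xi (u i j (y ** q))) (\<Oplus>l. xi (u i l y) ** u l j q)"
  if "y : Y" "q : carrier R" "j < r" for y q j
 proof -
  have "con g (xi (\<Oplus>l. u i l y ** u l j q)) (\<Oplus>l. xi (u i l y ** u l j q))"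
   using that by (intro functional_finsum[OF g f]) (auto intro!: ri_mult[OF rY] uY)
  moreover have "con g (\<Oplus>l. xi (u i l y ** u l j q)) (\<Oplus>l. xi (u i l y) ** u l j q)"
   using functionalD(3)[OF f] uY that by (intro con_finsum[OF g]) auto
  ultimately show ?thesis
   using con_trans[OF g] u_mult[OF i that(3)] that Y_carrier by simp
 qed
qed

lemma row_map_zero:
 assumes g: "local_idem g" shows "row_map g (%_ _. \<zero>)"
proof -
 have z: "con g \<zero> \<zero>" using con_refl[OF g] ri_zero[OF right_ideal_prg[OF g]] by blast
 have "(\<Oplus>l. \<zero> ** u l j q) = \<zero>" if "j < r" "q : carrier R" for j q
  using that by (intro add.finprod_one_eqI) auto
 then show ?thesis
  unfolding row_map_def using z ri_zero[OF right_ideal_prg[OF g]] ri_zero[OF right_ideal_mx[OF g]]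
  by auto
qed

lemma row_map_add:
 assumes g: "local_idem g" and f: "row_map g et" "row_map g et'"
 shows "row_map g (%y j. et y j \<oplus> et' y j)"
 unfolding row_map_def
proof (intro conjI ballI allI impI)
 note c = pr_in_carrier[OF g]
 have P: "et y j : pr g" "et' y j : pr g" if "y : Y" "j < r" for y j
  using row_mapD(1)[OF f(1) that] row_mapD(1)[OF f(2) that] .
 show "et y j \<oplus> et' y j : pr g" if "y : Y" "j < r" for y j
  using P[OF that] ri_add[OF right_ideal_prg[OF g]] by blast
 show "et y j \<oplus> et' y j : mx g" if "y : I" "j < r" for y j
  using ri_add[OF right_ideal_mx[OF g]] row_mapD(4)[OF f(1) that] row_mapD(4)[OF f(2) that] .
 show "con g (et (y \<oplus> y') j \<oplus> et' (y \<oplus> y') j) (et y j \<oplus> et' y j \<oplus> (et y' j \<oplus> et' y' j))"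
  if "y : Y" "y' : Y" "j < r" for y y' j
 proof -
  have "con g (et (y \<oplus> y') j \<oplus> et' (y \<oplus> y') j) ((et y j \<oplus> et y' j) \<oplus> (et' y j \<oplus> et' y' j))"
   using row_mapD(2,3)[OF f(1)] row_mapD(2,3)[OF f(2)] that by (intro con_add[OF g]) auto
  also have "(et y j \<oplus> et y' j) \<oplus> (et' y j \<oplus> et' y' j) = et y j \<oplus> et' y j \<oplus> (et y' j \<oplus> et' y' j)"
   using P that c by (simp add: a_ac)
  finally show ?thesis .
 qed
 show "con g (et (y ** q) j \<oplus> et' (y ** q) j) (\<Oplus>l. (et y l \<oplus> et' y l) ** u l j q)"
  if "y : Y" "q : carrier R" "j < r" for y q j
 proof -
  have "con g (et (y ** q) j \<oplus> et' (y ** q) j)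
   ((\<Oplus>l. et y l ** u l j q) \<oplus> (\<Oplus>l. et' y l ** u l j q))"
   using row_mapD(2,3)[OF f(1)] row_mapD(2,3)[OF f(2)] that by (intro con_add[OF g]) auto
  also have "(\<Oplus>l. et y l ** u l j q) \<oplus> (\<Oplus>l. et' y l ** u l j q) =
   (\<Oplus>l. et y l ** u l j q \<oplus> et' y l ** u l j q)"
   using P that c by (intro finsum_addf[symmetric]) auto
  also have "... = (\<Oplus>l. (et y l \<oplus> et' y l) ** u l j q)"
   using P that c by (intro finsum_cong') (auto simp: l_distr)
  finally show ?thesis .
 qed
qed

lemma row_map_lmult:
 assumes g: "local_idem g" and f: "row_map g et" and d: "d : carrier R" "g ** d = d" "d ** g = d"
 shows "row_map g (%y j. d ** et y j)"
 unfolding row_map_def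
proof (intro conjI ballI allI impI)
 note c = pr_in_carrier[OF g]
 have P: "et y j : pr g" if "y : Y" "j < r" for y j
  using row_mapD(1)[OF f that] .
 show "d ** et y j : pr g" if "y : Y" "j < r" for y j
  using P[OF that] pr_corner[OF g d(1,2)] c by blast
 show "d ** et y j : mx g" if "y : I" "j < r" for y j
  using corner_left_mx[OF g d] row_mapD(4)[OF f that] .
 show "con g (d ** et (y \<oplus> y') j) (d ** et y j \<oplus> d ** et y' j)"
  if "y : Y" "y' : Y" "j < r" for y y' j
 proof -
  have "con g (d ** et (y \<oplus> y') j) (d ** (et y j \<oplus> et y' j))"
   using row_mapD(2,3)[OF f] that by (intro con_lmult[OF g _ d]) auto
  then show ?thesis using P that c d(1) by (simp add: r_distr)
 qed
 show "con g (d ** et (y ** q) j) (\<Oplus>l. d ** et y l ** u l j q)"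
  if "y : Y" "q : carrier R" "j < r" for y q j
 proof -
  have "con g (d ** et (y ** q) j) (d ** (\<Oplus>l. et y l ** u l j q))"
   using row_mapD(2,3)[OF f] that by (intro con_lmult[OF g _ d]) auto
  also have "d ** (\<Oplus>l. et y l ** u l j q) = (\<Oplus>l. d ** (et y l ** u l j q))"
   using P that c d(1) by (intro finsum_rdistr) auto
  also have "... = (\<Oplus>l. d ** et y l ** u l j q)"
   using P that c d(1) by (intro finsum_cong') (auto simp: m_assoc)
  finally show ?thesis .
 qed
qed

lemma row_map_eqI:
 assumes g: "local_idem g" and f: "row_map g et" "row_map g et'"
  and e: "!!x j. [|x : M; j < r|] ==> con g (et (fst x) j) (et' (fst x) j)"
  and y: "y : Y" and j: "j < r"
 shows "con g (et y j) (et' y j)"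
proof -
 note tr = con_trans[OF g] and sy = con_sym[OF g]
 have I: "con g (et z j) (et' z j)" if "z : I" "j < r" for z j
 proof -
  have "con g (et z j) \<zero>" "con g (et' z j) \<zero>"
   using row_mapD(4)[OF f(1) that] row_mapD(4)[OF f(2) that] con_zero_iff[OF g] by auto
  then show ?thesis using tr sy by blast
 qed
 have "y : rspan (I \<union> fst ` M)" using y gen by blast
 then have "\<forall>j<r. con g (et y j) (et' y j)"
 proof induction
  case rspan_zero
  then show ?case using I ri_zero[OF rI] by blast
 next
  case (rspan_mult s q)
  have sY': "s : Y" using rspan_mult(1) IY M_Y by blast
  have sc: "con g (et s j) (et' s j)" if "j < r" for j using rspan_mult(1) I e that by auto
  show ?case
  proof (intro allI impI)
   fix j assume j: "j < r"
   have "con g (\<Oplus>l. et s l ** u l j q) (\<Oplus>l. et' s l ** u l j q)"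
    using sc rspan_mult(2) j by (intro con_finsum[OF g] con_rmult[OF g]) auto
   moreover have "con g (et (s ** q) j) (\<Oplus>l. et s l ** u l j q)"
    "con g (et' (s ** q) j) (\<Oplus>l. et' s l ** u l j q)"
    using row_mapD(3)[OF f(1)] row_mapD(3)[OF f(2)] sY' rspan_mult(2) j by auto
   ultimately show "con g (et (s ** q) j) (et' (s ** q) j)" using tr sy by blast
  qed
 next
  case (rspan_add y z)
  have yz: "y : Y" "z : Y" using rspan_add(1,2) gen by blast+
  show ?case
  proof (intro allI impI)
   fix j assume j: "j < r"
   have "con g (et y j \<oplus> et z j) (et' y j \<oplus> et' z j)" using rspan_add j by (intro con_add[OF g]) auto
   moreover have "con g (et (y \<oplus> z) j) (et y j \<oplus> et z j)" "con g (et' (y \<oplus> z) j) (et' y j \<oplus> et' z j)"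
    using row_mapD(2)[OF f(1)] row_mapD(2)[OF f(2)] yz j by auto
   ultimately show "con g (et (y \<oplus> z) j) (et' (y \<oplus> z) j)" using tr sy by blast
  qed
 qed
 then show ?thesis using j by blast
qed


section \<open>Counting the minimal generators of one type\<close>

definition gens :: "'a => ('a \<times> 'a) set" where "gens g = {x : M. idem_eqv g (snd x)}"

text \<open>The row map of the pair \<open>(i, x)\<close>, recorded by its values at all generators;
  these determine it by \<open>row_map_eqI\<close>.\<close>

definition zrow :: "('a \<times> 'a => 'a => 'a) => nat \<times> ('a \<times> 'a) => ('a \<times> 'a) \<times> nat => 'a" where
 "zrow Xi k = (%(x', j). if x' : M & j < r then Xi (snd k) (u (fst k) j (fst x')) else \<zero>)"

abbreviation zspn :: "'a => (('a \<times> 'a) \<times> nat => 'a) set => (('a \<times> 'a) \<times> nat => 'a) set" where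
 "zspn g \<equiv> operator_span.ospan (rows g) (rbase g (M \<times> {..<r})) (rops g)"

context
 fixes g and Xi :: "'a \<times> 'a => 'a => 'a"
 assumes gGm: "g : Gm" and Xi: "!!x. x : gens g ==> functional g x (Xi x)"
begin

lemma g_local: "local_idem g"
 using Gm_local[OF gGm] .

interpretation Z: operator_span "rows g :: (('a \<times> 'a) \<times> nat => 'a) ring" "rbase g (M \<times> {..<r})" "rops g"
 using operator_span_rows[OF g_local] .

lemma zrow_rows:
 assumes "k : {..<r} \<times> gens g" shows "zrow Xi k : carrier (rows g)"
proof -
 have "Xi (snd k) (u (fst k) j (fst x')) : pr g" if "x' : M" "j < r" for x' j
  using assms that by (intro functionalD(1)[OF Xi] stable_u[OF sY] M_Y) auto
 then show ?thesis
  unfolding zrow_def using ri_zero[OF right_ideal_prg[OF g_local]] by auto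
qed

text \<open>By \<open>uv\<close> the sum collapses to \<open>Xi x\<close> at \<open>x0\<close> if
  \<open>i = i0\<close>, and at zero otherwise. So summation against \<open>v\<close> gives
  functionals that are dual to the row maps.\<close>

lemma trace_functional:
 assumes i: "i < r" "i0 < r" and x: "x : gens g" "x0 : gens g"
 shows "(\<Oplus>j. Xi x (u i j (v j i0 (fst x0)))) : mx g \<longleftrightarrow> ~ (i = i0 & x = x0)"
proof -
 note f = Xi[OF x(1)]
 have x0: "x0 : M" "fst x0 : Y" using x(2) M_Y unfolding gens_def by auto
 have "con g (Xi x (\<Oplus>j. u i j (v j i0 (fst x0)))) (\<Oplus>j. Xi x (u i j (v j i0 (fst x0))))"
  using i x0 by (intro functional_finsum[OF g_local f] stable_u[OF sY] stable_v[OF sY]) auto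
 moreover have "(\<Oplus>j. u i j (v j i0 (fst x0))) = (if i = i0 then fst x0 else \<zero>)"
  using i x0 Y_carrier by (intro uv) auto
 ultimately have "(\<Oplus>j. Xi x (u i j (v j i0 (fst x0)))) : mx g \<longleftrightarrow>
   Xi x (if i = i0 then fst x0 else \<zero>) : mx g"
  using con_mx_iff[OF g_local] by auto
 also have "... \<longleftrightarrow> ~ (i = i0 & x = x0)"
  using functionalD(4)[OF f ri_zero[OF rI]] functionalD(5)[OF f x0(1)] functionalD(6)[OF f] by auto
 finally show ?thesis .
qed

text \<open>The vectors in the span still come from row maps, and the dual functionals with index
  outside \<open>K\<close> still vanish on them. Independence follows by evaluating one of these
  functionals.\<close>

lemma zspn_row_map:
 assumes K: "K <= {..<r} \<times> gens g" and z: "zt : zspn g (zrow Xi ` K)"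
 shows "\<exists>et. row_map g et & (\<forall>x\<in>M. \<forall>j<r. con g (zt (x, j)) (et (fst x) j)) &
  (\<forall>k\<in>{..<r} \<times> gens g - K. (\<Oplus>j. et (v j (fst k) (fst (snd k))) j) : mx g)"
 using z
proof induction
 case (ospan_base zt)
 show ?case
 proof (intro exI[of _ "%_ _. \<zero>"] conjI ballI allI impI)
  show "row_map g (%_ _. \<zero>)" using row_map_zero[OF g_local] .
  show "con g (zt (x, j)) \<zero>" if "x : M" "j < r" for x j
   using ospan_base that con_zero_iff[OF g_local] by (auto simp: rbaseD)
 qed (use ri_zero[OF right_ideal_mx[OF g_local]] in simp)
next
 case (ospan_gen zt)
 then obtain i x where k: "(i, x) : K" "zt = zrow Xi (i, x)" by auto
 have ix: "i < r" "x : gens g" using k K by auto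
 show ?case
 proof (intro exI[of _ "%y j. Xi x (u i j y)"] conjI ballI allI impI)
  show "row_map g (%y j. Xi x (u i j y))" using row_map_functional[OF g_local Xi[OF ix(2)] ix(1)] .
  show "con g (zt (x', j)) (Xi x (u i j (fst x')))" if "x' : M" "j < r" for x' j
  proof -
   have "Xi x (u i j (fst x')) : pr g"
    using that ix by (intro functionalD(1)[OF Xi] stable_u[OF sY] M_Y) auto
   then show ?thesis using that con_refl[OF g_local] unfolding k zrow_def by simp
  qed
  show "(\<Oplus>j. Xi x (u i j (v j (fst k) (fst (snd k))))) : mx g"
   if "k : {..<r} \<times> gens g - K" for k
   using that ix k by (subst trace_functional) auto
 qed
next
 case (ospan_add zt zt')
 then obtain et et' where *: "row_map g et" "row_map g et'"
  "!!x j. x : M ==> j < r ==> con g (zt (x, j)) (et (fst x) j)"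
  "!!x j. x : M ==> j < r ==> con g (zt' (x, j)) (et' (fst x) j)"
  "!!k. k : {..<r} \<times> gens g - K ==> (\<Oplus>j. et (v j (fst k) (fst (snd k))) j) : mx g"
  "!!k. k : {..<r} \<times> gens g - K ==> (\<Oplus>j. et' (v j (fst k) (fst (snd k))) j) : mx g"
  by blast
 show ?case
 proof (intro exI[of _ "%y j. et y j \<oplus> et' y j"] conjI ballI allI impI)
  show "row_map g (%y j. et y j \<oplus> et' y j)" using row_map_add[OF g_local *(1,2)] .
  show "con g ((zt \<oplus>\<^bsub>rows g\<^esub> zt') (x, j)) (et (fst x) j \<oplus> et' (fst x) j)" if "x : M" "j < r" for x j
   using con_add[OF g_local *(3)[OF that] *(4)[OF that]] by simp
  show "(\<Oplus>j. et (v j (fst k) (fst (snd k))) j \<oplus> et' (v j (fst k) (fst (snd k))) j) : mx g"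
   if k: "k : {..<r} \<times> gens g - K" for k
  proof -
   have "v j (fst k) (fst (snd k)) : Y" if "j < r" for j
    using that k by (intro stable_v[OF sY] M_Y) (auto simp: gens_def)
   then have "et (v j (fst k) (fst (snd k))) j : carrier R" "et' (v j (fst k) (fst (snd k))) j : carrier R"
    if "j < r" for j
    using that row_mapD(1)[OF *(1)] row_mapD(1)[OF *(2)] pr_in_carrier[OF g_local] by blast+
   then have "(\<Oplus>j. et (v j (fst k) (fst (snd k))) j \<oplus> et' (v j (fst k) (fst (snd k))) j) =
    (\<Oplus>j. et (v j (fst k) (fst (snd k))) j) \<oplus> (\<Oplus>j. et' (v j (fst k) (fst (snd k))) j)"
    by (intro finsum_addf) auto
   then show ?thesis using *(5,6)[OF k] ri_add[OF right_ideal_mx[OF g_local]] by simp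
  qed
 qed
next
 case (ospan_op om zt)
 then obtain et where *: "row_map g et"
  "!!x j. x : M ==> j < r ==> con g (zt (x, j)) (et (fst x) j)"
  "!!k. k : {..<r} \<times> gens g - K ==> (\<Oplus>j. et (v j (fst k) (fst (snd k))) j) : mx g"
  by blast
 obtain d where d: "d : carrier R" "g ** d = d" "d ** g = d" "om = (%zt i. d ** zt i)"
  using ospan_op(1) unfolding rops_def by blast
 show ?case
 proof (intro exI[of _ "%y j. d ** et y j"] conjI ballI allI impI)
  show "row_map g (%y j. d ** et y j)" using row_map_lmult[OF g_local *(1) d(1-3)] .
  show "con g (om zt (x, j)) (d ** et (fst x) j)" if "x : M" "j < r" for x j
   unfolding d(4) using con_lmult[OF g_local *(2)[OF that] d(1-3)] .
  show "(\<Oplus>j. d ** et (v j (fst k) (fst (snd k))) j) : mx g"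
   if k: "k : {..<r} \<times> gens g - K" for k
  proof -
   have "v j (fst k) (fst (snd k)) : Y" if "j < r" for j
    using that k by (intro stable_v[OF sY] M_Y) (auto simp: gens_def)
   then have "et (v j (fst k) (fst (snd k))) j : carrier R" if "j < r" for j
    using that row_mapD(1)[OF *(1)] pr_in_carrier[OF g_local] by blast
   then have "(\<Oplus>j. d ** et (v j (fst k) (fst (snd k))) j) =
    d ** (\<Oplus>j. et (v j (fst k) (fst (snd k))) j)"
    using d(1) by (intro finsum_rdistr[symmetric]) auto
   then show ?thesis using *(3)[OF k] corner_left_mx[OF g_local d(1-3)] by simp
  qed
 qed
qed

lemma zrow_independent:
 assumes k0: "k0 : {..<r} \<times> gens g"
 shows "zrow Xi k0 ~: zspn g (zrow Xi ` ({..<r} \<times> gens g - {k0}))"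
proof
 obtain i0 x0 where k: "k0 = (i0, x0)" "i0 < r" "x0 : gens g" using k0 by auto
 have x0: "x0 : M" "fst x0 : Y" using k(3) M_Y unfolding gens_def by auto
 assume "zrow Xi k0 : zspn g (zrow Xi ` ({..<r} \<times> gens g - {k0}))"
 from zspn_row_map[OF Diff_subset this] obtain et where et: "row_map g et"
  "\<forall>x\<in>M. \<forall>j<r. con g (zrow Xi k0 (x, j)) (et (fst x) j)"
  "\<forall>k\<in>{..<r} \<times> gens g - ({..<r} \<times> gens g - {k0}). (\<Oplus>j. et (v j (fst k) (fst (snd k))) j) : mx g"
  by (elim exE conjE)
 have "k0 : {..<r} \<times> gens g - ({..<r} \<times> gens g - {k0})" using k0 by blast
 then have *: "row_map g et" "!!x j. x : M ==> j < r ==> con g (zrow Xi k0 (x, j)) (et (fst x) j)"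
  "(\<Oplus>j. et (v j i0 (fst x0)) j) : mx g"
  using et(1,2) bspec[OF et(3), of k0] unfolding k(1) by simp_all
 have f: "row_map g (%y j. Xi x0 (u i0 j y))" using row_map_functional[OF g_local Xi[OF k(3)] k(2)] .
 have "con g (Xi x0 (u i0 j (fst x))) (et (fst x) j)" if "x : M" "j < r" for x j
  using *(2)[OF that] that unfolding k zrow_def by simp
 then have "con g (Xi x0 (u i0 j y)) (et y j)" if "y : Y" "j < r" for y j
  using row_map_eqI[OF g_local f *(1) _ that] by blast
 then have "con g (\<Oplus>j. Xi x0 (u i0 j (v j i0 (fst x0)))) (\<Oplus>j. et (v j i0 (fst x0)) j)"
  using k x0 by (intro con_finsum[OF g_local]) (auto intro!: stable_v[OF sY])
 then have "(\<Oplus>j. Xi x0 (u i0 j (v j i0 (fst x0)))) : mx g"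
  using con_mx[OF g_local] *(3) by blast
 then show False using trace_functional[OF k(2,2,3,3)] by blast
qed

lemma zrow_indep:
 "Z.indep (zrow Xi ` ({..<r} \<times> gens g))" "inj_on (zrow Xi) ({..<r} \<times> gens g)"
proof -
 have sub: "zrow Xi ` K <= carrier (rows g)" if "K <= {..<r} \<times> gens g" for K
  using zrow_rows that by blast
 show "Z.indep (zrow Xi ` ({..<r} \<times> gens g))"
  unfolding Z.indep_def
 proof (intro conjI ballI sub)
  fix zt assume "zt : zrow Xi ` ({..<r} \<times> gens g)"
  then obtain k where k: "k : {..<r} \<times> gens g" "zt = zrow Xi k" by blast
  have "zspn g (zrow Xi ` ({..<r} \<times> gens g) - {zt}) <= zspn g (zrow Xi ` ({..<r} \<times> gens g - {k}))"
   using k sub by (intro Z.cl_mono) auto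
  then show "zt ~: zspn g (zrow Xi ` ({..<r} \<times> gens g) - {zt})" using zrow_independent[OF k(1)] k(2) by blast
 qed simp
 show "inj_on (zrow Xi) ({..<r} \<times> gens g)"
 proof (rule inj_onI, rule ccontr)
  fix k k' assume *: "k : {..<r} \<times> gens g" "k' : {..<r} \<times> gens g" "zrow Xi k = zrow Xi k'" "k ~= k'"
  then have "zrow Xi k : zspn g (zrow Xi ` ({..<r} \<times> gens g - {k}))"
   by (intro Z.ospan_gen) auto
  then show False using zrow_independent[OF *(1)] by blast
 qed
qed

definition place :: "'a \<times> 'a => (nat => 'a) => ('a \<times> 'a) \<times> nat => 'a" where
 "place x b = (%(x', j). if x' = x then b j else \<zero>)"

text \<open>Bases of the components at \<open>snd x\<close>, one copy at the place of each generator
  \<open>x\<close>; they span a space that contains the values of all row maps under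
  consideration.\<close>

definition JZ :: "(('a \<times> 'a) \<times> nat => 'a) set" where
 "JZ = (\<Union>x\<in>M. place x ` Bs g (snd x))"

lemma Bs_rows: "x : M ==> Bs g (snd x) <= carrier (rows g)"
 using Bs(2)[OF gGm M_Gm] rimage_subset[OF g_local Gm_carrier[OF M_Gm]] by blast

lemma JZ_rows: "JZ <= carrier (rows g)"
 unfolding JZ_def place_def using Bs_rows ri_zero[OF right_ideal_prg[OF g_local]] by fastforce

lemma JZ_finite: "finite JZ" and JZ_card: "card JZ <= (\<Sum>x\<in>M. T g (snd x))"
proof -
 show "finite JZ" unfolding JZ_def using M_finite Bs(1)[OF gGm M_Gm] by blast
 have "card JZ <= (\<Sum>x\<in>M. card (place x ` Bs g (snd x)))"
  unfolding JZ_def using M_finite by (rule card_UN_le)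
 also have "... <= (\<Sum>x\<in>M. T g (snd x))"
  unfolding T_def using Bs(1)[OF gGm M_Gm] by (intro sum_mono card_image_le)
 finally show "card JZ <= (\<Sum>x\<in>M. T g (snd x))" .
qed

lemma place_span:
 assumes x: "x : M" and b: "b : rimage g (snd x)" shows "place x b : zspn g JZ"
proof -
 note P = right_ideal_prg[OF g_local]
 have "b : rspn g (Bs g (snd x))" using Bs(4)[OF gGm M_Gm[OF x]] b by blast
 then have "place x b : zspn g (place x ` Bs g (snd x))"
 proof (rule rows_span_image[OF g_local Bs_rows[OF x], rotated -1])
  show "place x zt : rbase g (M \<times> {..<r})" if "zt : rbase g {..<r}" for zt
   using that ri_zero[OF P] ri_zero[OF right_ideal_mx[OF g_local]]
   by (auto simp: rbaseD place_def)
  show "place x (%i. zt i \<oplus> zt' i) = (%j. place x zt j \<oplus> place x zt' j)" for zt zt'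
   by (auto simp: place_def fun_eq_iff)
  show "place x (%i. d ** zt i) = (%j. d ** place x zt j)" if "d : carrier R" for zt d
   using that by (auto simp: place_def fun_eq_iff)
 qed
 moreover have "zspn g (place x ` Bs g (snd x)) <= zspn g JZ"
  using x JZ_rows by (intro Z.cl_mono) (auto simp: JZ_def)
 ultimately show ?thesis by blast
qed

text \<open>The generator \<open>x'\<close> equals \<open>x' p'\<close> with
  \<open>p' = snd x'\<close>. So the value of a row map at \<open>x'\<close> is congruent to a row
  multiplied by \<open>p'\<close> and belongs to the component at \<open>p'\<close>.\<close>

lemma zrow_in_JZ:
 assumes k: "k : {..<r} \<times> gens g" shows "zrow Xi k : zspn g JZ"
proof -
 note P = right_ideal_prg[OF g_local] and c = pr_in_carrier[OF g_local]
 note Zc = ri_zero[OF P] ri_zero[OF right_ideal_mx[OF g_local]]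
 obtain i x where ix: "k = (i, x)" "i < r" "x : gens g" using k by auto
 note f = Xi[OF ix(3)]
 define et where "et = (%y j. Xi x (u i j y))"
 have et: "row_map g et" unfolding et_def using row_map_functional[OF g_local f ix(2)] .
 define row :: "'a \<times> 'a => nat => 'a" where "row x' = (%j. if j < r then et (fst x') j else \<zero>)" for x'
 have row: "row x' : carrier (rows g)" if "x' : M" for x'
  using row_mapD(1)[OF et M_Y[OF that]] Zc unfolding row_def by auto
 have rowp: "place x' (row x') : zspn g JZ" if x': "x' : M" for x'
 proof -
  define p where "p = snd x'"
  have p: "p : carrier R" unfolding p_def using Gm_carrier M_Gm x' by blast
  let ?b = "rmul (row x') p"
  have "con g (row x' j) (?b j)" if j: "j < r" for j
  proof -
   have "con g (et (fst x' ** p) j) (\<Oplus>l. et (fst x') l ** u l j p)"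
    using row_mapD(3)[OF et M_Y[OF x'] p j] .
   also have "fst x' ** p = fst x'" unfolding p_def using M_fix[OF x'] .
   also have "(\<Oplus>l. et (fst x') l ** u l j p) = ?b j"
    unfolding rmul_def row_def using j p row_mapD(1)[OF et M_Y[OF x']] c
    by (auto intro!: finsum_cong')
   finally show ?thesis unfolding row_def using j by simp
  qed
  then have d: "row x' j \<ominus> ?b j : mx g" if "j < r" for j using that unfolding con_def by blast
  have bC: "?b : carrier (rows g)" using rmul_closed[OF g_local row[OF x'] p] .
  have "place x' ?b : zspn g JZ"
   using row[OF x'] by (intro place_span[OF x']) (auto simp: rimage_def p_def)
  moreover have "(%(x'', j). if x'' = x' then row x' j \<ominus> ?b j else \<zero>) : zspn g JZ"
   using d Zc row[OF x'] bC ri_minus[OF P] by (intro Z.ospan_base) (auto simp: rbaseD)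
  ultimately have "place x' ?b \<oplus>\<^bsub>rows g\<^esub> (%(x'', j). if x'' = x' then row x' j \<ominus> ?b j else \<zero>) : zspn g JZ"
   by (rule Z.ospan_add)
  also have "place x' ?b \<oplus>\<^bsub>rows g\<^esub> (%(x'', j). if x'' = x' then row x' j \<ominus> ?b j else \<zero>) = place x' (row x')"
  proof -
   have "?b j \<oplus> (row x' j \<ominus> ?b j) = row x' j" for j
   proof -
    have "?b j : carrier R" "row x' j : carrier R" using bC row[OF x'] c by auto
    then show ?thesis by (simp add: minus_eq a_ac r_neg r_neg1 r_neg2)
   qed
   then show ?thesis unfolding place_def by (auto simp: fun_eq_iff)
  qed
  finally show ?thesis .
 qed
 have "(%(x', j). if x' : M' then row x' j else \<zero>) : zspn g JZ" if "finite M'" "M' <= M" for M'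
  using that
 proof (induction M' rule: finite_induct)
  case empty
  then show ?case using Zc by (intro Z.ospan_base) (auto simp: rbaseD)
 next
  case (insert y M')
  have "(%(x', j). if x' : insert y M' then row x' j else \<zero>) =
   place y (row y) \<oplus>\<^bsub>rows g\<^esub> (%(x', j). if x' : M' then row x' j else \<zero>)"
  proof -
   have "row y j : carrier R" "y' : M' ==> row y' j : carrier R" for y' j
    using row[of y] row[of y'] insert.prems c by auto
   then show ?thesis using insert.hyps unfolding place_def by (auto simp: fun_eq_iff)
  qed
  then show ?case using Z.ospan_add[OF rowp, of y] insert by auto
 qed
 from this[OF M_finite] have "(%(x', j). if x' : M then row x' j else \<zero>) : zspn g JZ" by blast
 also have "(%(x', j). if x' : M then row x' j else \<zero>) = zrow Xi k"
  unfolding zrow_def row_def et_def ix by (auto simp: fun_eq_iff)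
 finally show ?thesis .
qed

text \<open>The \<open>r * card (gens g)\<close> independent vectors \<open>zrow\<close> lie in the
  span of \<open>JZ\<close>. If the numbers agree they span it; a relation modulo \<open>I\<close>
  is killed by all row maps, hence by all vectors of this space, in particular by those concentrated
  at one generator.\<close>

lemma card_gens_le: "r * card (gens g) <= (\<Sum>x\<in>M. T g (snd x))"
 and relations_in_Ncore: "[|(\<Sum>x\<in>M. T g (snd x)) <= r * card (gens g); q : M \<rightarrow> carrier R;
  (\<Oplus>x\<in>M. fst x ** q x) : I; x : M|] ==> snd x ** q x : Ncore g"
proof -
 let ?U = "zrow Xi ` ({..<r} \<times> gens g)"
 have fg: "finite (gens g)" unfolding gens_def using M_finite by simp
 have cU: "card ?U = r * card (gens g)" using zrow_indep(2) by (simp add: card_image card_cartesian_product)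
 have fU: "finite ?U" using fg by simp
 have UJ: "?U <= zspn g JZ" using zrow_in_JZ by blast
 have le: "card ?U <= card JZ" using Z.indep_card_le[OF JZ_finite JZ_rows fU zrow_indep(1) UJ] .
 then show "r * card (gens g) <= (\<Sum>x\<in>M. T g (snd x))" using cU JZ_card by linarith
 assume "(\<Sum>x\<in>M. T g (snd x)) <= r * card (gens g)" and q: "q : M \<rightarrow> carrier R"
  and rel: "(\<Oplus>x\<in>M. fst x ** q x) : I" and x: "x : M"
 then have "card JZ <= card ?U" using cU JZ_card by linarith
 then have JU: "JZ <= zspn g ?U"
  using Z.indep_card_eq[OF JZ_finite JZ_rows fU zrow_indep(1) UJ] by blast
 note P = right_ideal_prg[OF g_local] and c = pr_in_carrier[OF g_local] and Mx = right_ideal_mx[OF g_local]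
 have qc: "q x : carrier R" if "x : M" for x using q that by auto
 have UC: "?U <= carrier (rows g)" using zrow_rows by blast
 \<comment> \<open>A vector that comes from a row map, multiplied into the relation, gives the value
   of this map at an element of \<open>I\<close>.\<close>
 have vanish: "(\<Oplus>x\<in>M. \<Oplus>j. zt (x, j) ** u j l (q x)) : mx g"
  if z: "zt : zspn g ?U" and l: "l < r" for zt l
 proof -
  obtain et where et: "row_map g et" "!!x j. x : M ==> j < r ==> con g (zt (x, j)) (et (fst x) j)"
   using zspn_row_map[OF _ z] by blast
  have "con g (\<Oplus>x\<in>M. \<Oplus>j. zt (x, j) ** u j l (q x)) (\<Oplus>x\<in>M. \<Oplus>j. et (fst x) j ** u j l (q x))"
   using et(2) qc l M_finite by (intro con_finsum[OF g_local] con_rmult[OF g_local]) auto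
  moreover have "con g (\<Oplus>x\<in>M. et (fst x ** q x) l) (\<Oplus>x\<in>M. \<Oplus>j. et (fst x) j ** u j l (q x))"
   using qc l M_finite M_Y by (intro con_finsum[OF g_local] row_mapD(3)[OF et(1)]) auto
  moreover have "con g (et (\<Oplus>x\<in>M'. fst x ** q x) l) (\<Oplus>x\<in>M'. et (fst x ** q x) l)"
   if "finite M'" "M' <= M" for M' using that
  proof (induction M' rule: finite_induct)
   case empty
   then show ?case using row_mapD(4)[OF et(1) ri_zero[OF rI] l] con_zero_iff[OF g_local] by simp
  next
   case (insert y M')
   have yY: "fst y' ** q y' : Y" if "y' : insert y M'" for y'
   proof -
    have "y' : M" using that insert.prems by blast
    then show ?thesis using M_Y qc by (intro ri_mult[OF rY])
   qed
   have sY': "(\<Oplus>x\<in>M'. fst x ** q x) : Y" using insert.hyps yY by (intro ri_finsum[OF rY]) auto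
   have "con g (et (fst y ** q y \<oplus> (\<Oplus>x\<in>M'. fst x ** q x)) l)
    (et (fst y ** q y) l \<oplus> et (\<Oplus>x\<in>M'. fst x ** q x) l)"
    using row_mapD(2)[OF et(1) yY sY' l] by blast
   moreover have "con g (et (fst y ** q y) l \<oplus> et (\<Oplus>x\<in>M'. fst x ** q x) l)
    (et (fst y ** q y) l \<oplus> (\<Oplus>x\<in>M'. et (fst x ** q x) l))"
    using insert yY l by (intro con_add[OF g_local] con_refl[OF g_local] row_mapD(1)[OF et(1)]) auto
   moreover have "(\<Oplus>x\<in>insert y M'. fst x ** q x) = fst y ** q y \<oplus> (\<Oplus>x\<in>M'. fst x ** q x)"
    using insert.hyps yY Y_carrier by (intro finsum_insert) auto
   moreover have "(\<Oplus>x\<in>insert y M'. et (fst x ** q x) l) = et (fst y ** q y) l \<oplus> (\<Oplus>x\<in>M'. et (fst x ** q x) l)"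
    using insert.hyps yY row_mapD(1)[OF et(1) _ l] c by (intro finsum_insert) auto
   ultimately show ?case by (simp only: con_trans[OF g_local])
  qed
  from this[OF M_finite] have "con g (et (\<Oplus>x\<in>M. fst x ** q x) l) (\<Oplus>x\<in>M. et (fst x ** q x) l)" by blast
  moreover have "et (\<Oplus>x\<in>M. fst x ** q x) l : mx g" using row_mapD(4)[OF et(1) rel l] .
  ultimately show ?thesis using con_mx[OF g_local] con_sym[OF g_local] by meson
 qed
 define p where "p = snd x"
 have p: "p : carrier R" unfolding p_def using Gm_carrier M_Gm x by blast
 \<comment> \<open>The vector \<open>place x b\<close> isolates the coefficient \<open>q x\<close>
   of a single generator.\<close>
 have "rmul b (q x) : rbase g {..<r}" if b: "b : Bs g p" for b
 proof -
  have bC: "b : carrier (rows g)" using Bs_rows[OF x] b unfolding p_def by blast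
  have bc: "b j : carrier R" for j using bC c by auto
  have "place x b : zspn g ?U" using JU b x unfolding JZ_def p_def by blast
  then have "(\<Oplus>x'\<in>M. \<Oplus>j. place x b (x', j) ** u j l (q x')) : mx g" if "l < r" for l
   using vanish that by blast
  moreover have "(\<Oplus>x'\<in>M. \<Oplus>j. place x b (x', j) ** u j l (q x')) = (\<Oplus>j. b j ** u j l (q x))"
   if l: "l < r" for l
  proof -
   have "(\<Oplus>x'\<in>M. \<Oplus>j. place x b (x', j) ** u j l (q x')) =
    (\<Oplus>x'\<in>M. if x' = x then (\<Oplus>j. b j ** u j l (q x)) else \<zero>)"
   proof (intro finsum_cong' refl)
    show "(%x'. if x' = x then (\<Oplus>j. b j ** u j l (q x)) else \<zero>) : M \<rightarrow> carrier R"
     using l qc[OF x] bc by (auto intro!: finsum_closed)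
    fix x' assume x': "x' : M"
    show "(\<Oplus>j. place x b (x', j) ** u j l (q x')) =
     (if x' = x then (\<Oplus>j. b j ** u j l (q x)) else \<zero>)"
    proof (cases "x' = x")
     case False
     then show ?thesis
      using l qc[OF x'] unfolding place_def by (auto intro!: add.finprod_one_eqI)
    qed (simp add: place_def)
   qed
   also have "... = (\<Oplus>j. b j ** u j l (q x))"
    using l qc[OF x] bc by (intro finsum_delta M_finite x) (auto intro!: finsum_closed)
   finally show ?thesis .
  qed
  ultimately have "rmul b (q x) l : mx g" if "l < r" for l
   using that unfolding rmul_def by simp
  then show ?thesis using rmul_closed[OF g_local bC qc[OF x]] by (auto simp: rbaseD)
 qed note Bvan = this
 have BC: "Bs g p <= carrier (rows g)" using Bs_rows[OF x] unfolding p_def .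
 have zero: "rmul (rmul zt p) (q x) : rbase g {..<r}" if "zt : carrier (rows g)" for zt
 proof -
  interpret E: operator_span "rows g :: (nat => 'a) ring" "rbase g {..<r}" "rops g"
   using operator_span_rows[OF g_local] .
  have "rmul zt p : rspn g (Bs g p)"
   using Bs(4)[OF gGm M_Gm[OF x]] that unfolding p_def rimage_def by blast
  then have "rmul (rmul zt p) (q x) : rspn g ((%zt. rmul zt (q x)) ` Bs g p)"
   by (rule rmul_span[OF g_local BC qc[OF x]])
  also have "... <= rspn g {}"
   using Bvan by (intro E.cl_least) (auto intro: E.ospan_base)
  finally show ?thesis by (rule E.ospan_empty)
 qed
 have "p ** q x : Ncore g"
 proof (rule Ncore_uI[OF g_local])
  show pq: "p ** q x : carrier R" using p qc[OF x] by simp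
  fix i j s assume h: "i < r" "j < r" "s : carrier R"
  have gs: "g ** s : pr g" using h(3) unfolding pr_def by blast
  let ?zt = "unit_row i (g ** s)"
  have ztC: "?zt : carrier (rows g)" using unit_row_rows[OF g_local gs] .
  have "rmul ?zt (p ** q x) : rbase g {..<r}"
   using zero[OF ztC] rmul_rmul[of ?zt p "q x"] ztC c p qc[OF x] by auto
  then have "rmul ?zt (p ** q x) j : mx g" using h by (auto simp: rbaseD)
  also have "rmul ?zt (p ** q x) j = (\<Oplus>k. if k = i then g ** s ** u i j (p ** q x) else \<zero>)"
   unfolding rmul_def unit_row_def using h pq c[OF gs] by (auto intro!: finsum_cong')
  also have "... = g ** s ** u i j (p ** q x)" using h pq c[OF gs] by (intro finsum_delta) auto
  finally show "g ** s ** u i j (p ** q x) : mx g" .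
 qed
 then show "snd x ** q x : Ncore g" unfolding p_def .
qed

end

end

section \<open>Types of generators with extremal ratio\<close>

context minimal_generators
begin

text \<open>\<open>T g\<close> is constant on isomorphism classes, so the contribution of a
  generator can be spread evenly over the class of its idempotent. This brings in the ratio of
  \<open>card (gens p)\<close> to \<open>card (cls p)\<close>.\<close>

lemma sum_T_eq:
 assumes gGm: "g : Gm"
 shows "(\<Sum>x\<in>M. real (T g (snd x))) = (\<Sum>p\<in>Gm. real (T g p) * real (card (gens p)) / real (card (cls p)))"
proof -
 have "real (T g (snd x)) = (\<Sum>p\<in>Gm. if idem_eqv p (snd x) then real (T g p) / real (card (cls p)) else 0)"
  if x: "x : M" for x
 proof -
  note xGm = M_Gm[OF x]
  have "(\<Sum>p\<in>Gm. if idem_eqv p (snd x) then real (T g p) / real (card (cls p)) else 0) =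
   (\<Sum>p\<in>cls (snd x). real (T g p) / real (card (cls p)))"
   unfolding cls_def using Gm_finite idem_eqv_sym
   by (intro sum.mono_neutral_cong_right) auto
  also have "... = (\<Sum>p\<in>cls (snd x). real (T g (snd x)) / real (card (cls (snd x))))"
   using T_eqv[OF gGm xGm] cls_cong unfolding cls_def by (intro sum.cong) auto
  also have "... = real (T g (snd x))" using card_cls_pos[OF xGm] by simp
  finally show ?thesis by simp
 qed
 then have "(\<Sum>x\<in>M. real (T g (snd x))) =
  (\<Sum>x\<in>M. \<Sum>p\<in>Gm. if idem_eqv p (snd x) then real (T g p) / real (card (cls p)) else 0)"
  by (rule sum.cong[OF refl])
 also have "... = (\<Sum>p\<in>Gm. \<Sum>x\<in>M. if idem_eqv p (snd x) then real (T g p) / real (card (cls p)) else 0)"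
  by (rule sum.swap)
 also have "... = (\<Sum>p\<in>Gm. real (T g p) * real (card (gens p)) / real (card (cls p)))"
 proof (rule sum.cong[OF refl])
  fix p assume "p : Gm"
  have "(\<Sum>x\<in>M. if idem_eqv p (snd x) then real (T g p) / real (card (cls p)) else 0) =
   (\<Sum>x\<in>gens p. real (T g p) / real (card (cls p)))"
   unfolding gens_def using M_finite by (intro sum.mono_neutral_cong_right) auto
  then show "(\<Sum>x\<in>M. if idem_eqv p (snd x) then real (T g p) / real (card (cls p)) else 0) =
   real (T g p) * real (card (gens p)) / real (card (cls p))" by simp
 qed
 finally show ?thesis .
qed

lemma functional_choice:
 assumes "g : Gm" shows "\<exists>Xi. \<forall>x\<in>gens g. functional g x (Xi x)"
 using functional_exists[OF assms] unfolding gens_def by (intro bchoice) blast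

text \<open>With \<open>rh p = card (gens p) / card (cls p)\<close> one has \<open>r * card (gens g)
  <= sum of T g (snd x) = sum of T g p * rh p <= rh g * sum of T g p <= r * card (gens g)\<close>,
  so equality holds throughout. Inside \<open>Ncore g\<close> the factor \<open>T g p\<close> is
  zero, which is why maximality is required only outside it.\<close>

lemma extremal_class:
 assumes gGm: "g : Gm"
  and max: "!!p. [|p : Gm; p ~: Ncore g|] ==>
   card (gens p) * card (cls g) <= card (gens g) * card (cls p)"
 shows "[|p : Gm; p ~: Ncore g|] ==> card (gens p) * card (cls g) = card (gens g) * card (cls p)"
  and "[|q : M \<rightarrow> carrier R; (\<Oplus>x\<in>M. fst x ** q x) : I; x : M|] ==> snd x ** q x : Ncore g"
proof -
 obtain Xi where Xi0: "\<forall>x\<in>gens g. functional g x (Xi x)" using functional_choice[OF gGm] by blast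
 have Xi: "functional g x (Xi x)" if "x : gens g" for x using Xi0 that by blast
 define rh where "rh p = real (card (gens p)) / real (card (cls p))" for p
 have cp: "real (card (cls p)) > 0" if "p : Gm" for p using card_cls_pos[OF that] by simp
 have iff: "rh p <= rh g \<longleftrightarrow> card (gens p) * card (cls g) <= card (gens g) * card (cls p)"
  "rh p = rh g \<longleftrightarrow> card (gens p) * card (cls g) = card (gens g) * card (cls p)" if "p : Gm" for p
 proof -
  have "rh p <= rh g \<longleftrightarrow> real (card (gens p)) * real (card (cls g)) <= real (card (gens g)) * real (card (cls p))"
   unfolding rh_def using cp[OF that] cp[OF gGm] by (simp add: field_simps)
  then show "rh p <= rh g \<longleftrightarrow> card (gens p) * card (cls g) <= card (gens g) * card (cls p)"
   unfolding of_nat_mult[symmetric] of_nat_le_iff .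
  have "rh p = rh g \<longleftrightarrow> real (card (gens p)) * real (card (cls g)) = real (card (gens g)) * real (card (cls p))"
   unfolding rh_def using cp[OF that] cp[OF gGm] by (simp add: field_simps)
  then show "rh p = rh g \<longleftrightarrow> card (gens p) * card (cls g) = card (gens g) * card (cls p)"
   unfolding of_nat_mult[symmetric] of_nat_eq_iff .
 qed
 have le: "real (T g p) * rh p <= real (T g p) * rh g" if "p : Gm" for p
 proof (cases "p : Ncore g")
  case True then show ?thesis using T_pos_iff[OF gGm that] by simp
 next
  case False then show ?thesis using max iff(1) that by (intro mult_left_mono) auto
 qed
 have "(\<Sum>x\<in>M. real (T g (snd x))) = (\<Sum>p\<in>Gm. real (T g p) * rh p)"
  unfolding sum_T_eq[OF gGm] rh_def by simp
 moreover have "(\<Sum>p\<in>Gm. real (T g p) * rh p) <= (\<Sum>p\<in>Gm. real (T g p) * rh g)"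
  using le by (intro sum_mono)
 moreover have "(\<Sum>p\<in>Gm. real (T g p) * rh g) <= real r * real (card (gens g))"
 proof -
  have "(\<Sum>p\<in>Gm. real (T g p) * rh g) = real (\<Sum>p\<in>Gm. T g p) * rh g" by (simp add: sum_distrib_right)
  also have "... <= real (r * card (cls g)) * rh g"
   using T_sum_le[OF gGm] by (intro mult_right_mono of_nat_mono) (simp_all add: rh_def)
  also have "... = real r * real (card (gens g))" unfolding rh_def using cp[OF gGm] by simp
  finally show ?thesis .
 qed
 moreover have "real r * real (card (gens g)) <= (\<Sum>x\<in>M. real (T g (snd x)))"
 proof -
  have "real (r * card (gens g)) <= real (\<Sum>x\<in>M. T g (snd x))"
   using card_gens_le[OF gGm Xi] of_nat_le_iff by blast
  then show ?thesis by simp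
 qed
 ultimately have eq: "(\<Sum>x\<in>M. real (T g (snd x))) = real r * real (card (gens g))"
  "(\<Sum>p\<in>Gm. real (T g p) * rh p) = (\<Sum>p\<in>Gm. real (T g p) * rh g)" by linarith+
 show "card (gens p) * card (cls g) = card (gens g) * card (cls p)" if p: "p : Gm" "p ~: Ncore g"
 proof -
  have "(\<Sum>p\<in>Gm. real (T g p) * rh g - real (T g p) * rh p) = 0"
   using eq(2) by (simp add: sum_subtractf)
  then have "real (T g p) * rh g - real (T g p) * rh p = 0"
   using sum_nonneg_eq_0_iff[OF Gm_finite, of "%p. real (T g p) * rh g - real (T g p) * rh p"] le p(1)
   by simp
  moreover have "T g p > 0" using T_pos_iff[OF gGm p(1)] p(2) by blast
  ultimately have "rh p = rh g" by simp
  then show ?thesis using iff(2)[OF p(1)] by blast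
 qed
 have "real (\<Sum>x\<in>M. T g (snd x)) = real (r * card (gens g))" using eq(1) by simp
 then have "(\<Sum>x\<in>M. T g (snd x)) <= r * card (gens g)" using of_nat_eq_iff by (metis order_refl)
 then show "snd x ** q x : Ncore g"
  if "q : M \<rightarrow> carrier R" "(\<Oplus>x\<in>M. fst x ** q x) : I" "x : M"
  using relations_in_Ncore[OF gGm Xi _ that] by blast
qed

lemma functional_kernel:
 assumes g: "local_idem g" and f: "functional g x xi" and S: "S <= Y"
  and k: "!!s a. [|s : S; a : carrier R|] ==> xi (s ** a) : mx g"
 shows "z : rspan S ==> xi z : mx g"
proof (induction rule: rspan.induct)
 case rspan_zero show ?case using functionalD(4)[OF f ri_zero[OF rI]] .
next
 case (rspan_mult s a) then show ?case using k by blast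
next
 case (rspan_add y z)
 have "y : Y" "z : Y" using rspan_add(1,2) rspan_least[OF rY S] by blast+
 then have "con g (xi (y \<oplus> z)) (xi y \<oplus> xi z)" using functionalD(2)[OF f] by blast
 then show ?case using con_mx[OF g] ri_add[OF right_ideal_mx[OF g]] rspan_add by blast
qed

end

context coaction_decomp
begin

lemma peirce_right_ideal:
 assumes I: "right_ideal I R" and x: "x : carrier R" "!!p. p : Gm ==> x ** p : I"
 shows "x : I"
proof (rule peirce_in[of I, OF _ _ _ x])
 show "I <= carrier R" "\<zero> : I" using right_idealD(1,2)[OF I] .
 show "y \<oplus> z : I" if "y : I" "z : I" for y z using ri_add[OF I that] .
qed

lemma one_in_right_ideal:
 assumes I: "right_ideal I R" and p: "Gm <= I" shows "\<one> : I"
 using p Gm_carrier peirce_right_ideal[OF I one_closed] by auto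

lemma minimal_gens_exist:
 assumes I: "right_ideal I R" "right_ideal Y R" "I <= Y" "stable I" "stable Y"
  and M0: "finite M0" "M0 <= Y \<times> Gm" "!!x. x : M0 ==> fst x ** snd x = fst x"
  and gen: "Y = rspan (I \<union> fst ` M0)"
 shows "\<exists>M\<subseteq>M0. minimal_generators R r u v Op Ks Gm I Y M"
proof -
 define P where "P n \<longleftrightarrow> (\<exists>M\<subseteq>M0. Y = rspan (I \<union> fst ` M) & card M = n)" for n
 have "P (card M0)" unfolding P_def using gen by blast
 then have "P (LEAST n. P n)" by (rule LeastI)
 then obtain M where M: "M <= M0" "Y = rspan (I \<union> fst ` M)" "card M = (LEAST n. P n)"
  unfolding P_def by blast
 have fM: "finite M" using M(1) M0(1) finite_subset by blast
 have "minimal_generators R r u v Op Ks Gm I Y M"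
 proof
  show "rspan (I \<union> fst ` (M - {x})) ~= Y" if "x : M" for x
  proof
   assume "rspan (I \<union> fst ` (M - {x})) = Y"
   then have "P (card (M - {x}))" unfolding P_def using M(1) by blast
   moreover have "card (M - {x}) < card M" using that fM by (rule card_Diff1_less[rotated])
   ultimately show False using not_less_Least[of "card (M - {x})" P] M(3) by simp
  qed
 qed (use I M M0 fM in auto)
 then show ?thesis using M(1) by blast
qed

lemma ratio_maximal:
 fixes k c :: "'a => nat"
 assumes "F <= Gm" "F ~= {}" "!!p. p : F ==> c p > 0"
 shows "\<exists>g\<in>F. \<forall>p\<in>F. k p * c g <= k g * c p"
proof -
 have fin: "finite F" using assms(1) Gm_finite finite_subset by blast
 define rh where "rh p = real (k p) / real (c p)" for p
 have "Max (rh ` F) : rh ` F" using fin assms(2) by (intro Max_in) auto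
 then obtain g where g: "g : F" "rh g = Max (rh ` F)" by auto
 have "k p * c g <= k g * c p" if p: "p : F" for p
 proof -
  have "rh p <= rh g" unfolding g(2) using fin p by (intro Max_ge) auto
  then have "real (k p) * real (c g) <= real (k g) * real (c p)"
   unfolding rh_def using assms(3)[OF p] assms(3)[OF g(1)] by (simp add: field_simps)
  then show ?thesis unfolding of_nat_mult[symmetric] of_nat_le_iff .
 qed
 then show ?thesis using g(1) by blast
qed

end

section \<open>Minimal stable right ideals and maximal stable ideals\<close>

context coaction
begin

lemma stable_rspan:
 assumes S: "S <= carrier R" and u: "!!s i j. [|s : S; i < r; j < r|] ==> u i j s : rspan S"
 shows "stable (rspan S)"
proof -
 note W = right_ideal_rspan[OF S]
 have "\<forall>i<r. \<forall>j<r. u i j z : rspan S" if "z : rspan S" for z using that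
 proof induction
  case rspan_zero
  then show ?case using Op_zero u_Op rspan.rspan_zero by metis
 next
  case (rspan_mult s a)
  have "u i j (s ** a) : rspan S" if "i < r" "j < r" for i j
  proof -
   have "u i j (s ** a) = (\<Oplus>e. u i e s ** u e j a)"
    using that rspan_mult S by (intro u_mult) auto
   also have "... : rspan S"
    using that rspan_mult by (intro ri_finsum[OF W] ri_mult[OF W] u) auto
   finally show ?thesis .
  qed
  then show ?case by blast
 next
  case (rspan_add y z)
  then show ?case
   using ri_add[OF W] ri_in[OF W] by (auto simp: u_add)
 qed
 then show ?thesis
  unfolding stable_def using Op_in_rightI[OF _ ri_in[OF W] W] by blast
qed

lemma stable_product:
 assumes V: "right_ideal V R" "stable V" and N: "right_ideal N R" "stable N"
 shows "stable (rspan {x ** n | x n. x : V & n : N})"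
proof (rule stable_rspan)
 let ?S = "{x ** n | x n. x : V & n : N}"
 show S: "?S <= carrier R" using ri_in[OF V(1)] ri_in[OF N(1)] by blast
 fix s i j assume "s : ?S" and ij: "i < r" "j < r"
 then obtain x n where xn: "s = x ** n" "x : V" "n : N" by blast
 have "u i j s = (\<Oplus>a. u i a x ** u a j n)"
  unfolding xn(1) using ij xn ri_in[OF V(1)] ri_in[OF N(1)] by (intro u_mult) auto
 also have "... : rspan ?S"
 proof (intro ri_finsum[OF right_ideal_rspan[OF S]])
  fix a assume "a : {..<r}"
  then have "u i a x : V" "u a j n : N"
   using ij xn stable_u[OF V(2)] stable_u[OF N(2)] by auto
  then show "u i a x ** u a j n : rspan ?S" using rspan_superset[OF S] by blast
 qed simp
 finally show "u i j s : rspan ?S" .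
qed

definition minimal_stable :: "'a set => bool" where
 "minimal_stable V \<longleftrightarrow> right_ideal V R & stable V & V ~= {\<zero>} &
  (\<forall>W. right_ideal W R & stable W & W <= V & W ~= {\<zero>} --> W = V)"

lemma minimal_stableD:
 assumes "minimal_stable V"
 shows "right_ideal V R" "stable V" "V ~= {\<zero>}"
  "!!W. [|right_ideal W R; stable W; W <= V; W ~= {\<zero>}|] ==> W = V"
 using assms unfolding minimal_stable_def by auto

lemma stable_zero: "stable {\<zero>}"
 unfolding stable_def using Op_zero by auto

lemma minimal_stable_exists:
 assumes art: "right_artinian R" and I: "right_ideal I R" "stable I" "I ~= {\<zero>}"
 obtains V where "minimal_stable V" "V <= I"
proof -
 let ?P = "%W. right_ideal W R & stable W & W <= I & W ~= {\<zero>}"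
 have "?P I" using I by blast
 then obtain V where V: "?P V" "!!W. ?P W ==> W <= V ==> W = V"
  using artinian_minimalE[OF art, of ?P I] by blast
 have "minimal_stable V"
  unfolding minimal_stable_def
 proof (intro conjI allI impI)
  fix W assume W: "right_ideal W R & stable W & W <= V & W ~= {\<zero>}"
  then have "?P W" using V(1) by blast
  then show "W = V" using V(2) W by blast
 qed (use V(1) in auto)
 then show ?thesis using that V(1) by blast
qed

definition stable_ideal :: "'a set => bool" where
 "stable_ideal N \<longleftrightarrow> right_ideal N R & (\<forall>q\<in>carrier R. \<forall>x\<in>N. q ** x : N) & stable N"

definition max_stable :: "'a set => bool" where
 "max_stable N \<longleftrightarrow> stable_ideal N & \<one> ~: N &
  (\<forall>Z. stable_ideal Z & N <= Z & \<one> ~: Z --> Z <= N)"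

lemma stable_ideal_Ncore: "local_idem g ==> stable_ideal (Ncore g)"
 unfolding stable_ideal_def using Ncore_ideal Ncore_stable by blast

lemma one_notin_Ncore:
 assumes g: "local_idem g" shows "\<one> ~: Ncore g"
proof
 assume "\<one> : Ncore g"
 moreover obtain w where "w : Op" "\<forall>x\<in>carrier R. w x = x" using Op_id by blast
 ultimately have "g ** \<one> ** \<one> : mx g" unfolding Ncore_def by force
 then show False using local_idemD(1)[OF g] pr_self[of g] unfolding mx_def by simp
qed

lemma Ncore_mult:
 assumes g: "local_idem g" and n: "n : Ncore g" and x: "x : pr g" shows "x ** n : mx g"
 using x local_idemD(4)[OF g] Op_id n by (fastforce simp: Ncore_def)

text \<open>The intersection of \<open>Z\<close> with \<open>gR\<close> is a proper submodule of
  \<open>gR\<close>, hence lies in \<open>mx g\<close>: a stable ideal without \<open>g\<close>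
  kills the top of \<open>gR\<close>.\<close>

lemma stable_ideal_mx:
 assumes g: "local_idem g" and Z: "stable_ideal Z" "g ~: Z" and z: "z : Z" and x: "x : pr g"
 shows "x ** z : mx g"
proof -
 have rZ: "right_ideal Z R" using Z(1) unfolding stable_ideal_def by blast
 have xc: "x : carrier R" using x local_idemD(4)[OF g] by auto
 have "Z \<inter> pr g <= mx g"
  using Z(2) by (intro mx_superset[OF g right_ideal_Int[OF rZ right_ideal_prg[OF g]]]) auto
 moreover have "x ** z : Z" using Z(1) xc z unfolding stable_ideal_def by blast
 moreover have "x ** z : pr g" using ri_mult[OF right_ideal_prg[OF g] x] ri_in[OF rZ z] .
 ultimately show ?thesis by blast
qed

end

section \<open>Annihilator and left identity of a minimal stable right ideal\<close>

context coaction_decomp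
begin

lemma rspan_finsum:
 assumes I: "right_ideal I R" and M: "finite M" "fst ` M <= carrier R" and z: "z : rspan (I \<union> fst ` M)"
 shows "\<exists>e\<in>I. \<exists>q. (\<forall>x\<in>M. q x : carrier R) & z = e \<oplus> (\<Oplus>x\<in>M. fst x ** q x)"
 using z
proof induction
 case rspan_zero
 have "(\<Oplus>x\<in>M. fst x ** \<zero>) = \<zero>" using M(2) by (auto intro!: add.finprod_one_eqI)
 then show ?case using ri_zero[OF I] by (intro bexI[of _ \<zero>] exI[of _ "%_. \<zero>"]) auto
next
 case (rspan_mult s a)
 have Mc: "fst x : carrier R" if "x : M" for x using M(2) that by blast
 show ?case
 proof (cases "s : I")
  case True
  have "(\<Oplus>x\<in>M. fst x ** \<zero>) = \<zero>" using Mc by (auto intro!: add.finprod_one_eqI)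
  then show ?thesis
   using ri_mult[OF I True rspan_mult(2)] ri_in[OF I]
   by (intro bexI[of _ "s ** a"] exI[of _ "%_. \<zero>"]) auto
 next
  case False
  then obtain y where y: "y : M" "s = fst y" using rspan_mult(1) by blast
  have "(\<Oplus>x\<in>M. fst x ** (if x = y then a else \<zero>)) = (\<Oplus>x\<in>M. if x = y then s ** a else \<zero>)"
   using Mc y rspan_mult(2) by (intro finsum_cong') auto
  also have "... = s ** a" using M(1) y Mc rspan_mult(2) by (intro finsum_delta) auto
  finally show ?thesis
   using ri_zero[OF I] rspan_mult(2) Mc y
   by (intro bexI[of _ \<zero>] exI[of _ "%x. if x = y then a else \<zero>"]) auto
 qed
next
 case (rspan_add y z)
 have Mc: "fst x : carrier R" if "x : M" for x using M(2) that by blast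
 obtain e q e' q' where *: "e : I" "\<forall>x\<in>M. q x : carrier R" "y = e \<oplus> (\<Oplus>x\<in>M. fst x ** q x)"
  "e' : I" "\<forall>x\<in>M. q' x : carrier R" "z = e' \<oplus> (\<Oplus>x\<in>M. fst x ** q' x)" using rspan_add.IH by blast
 have "(\<Oplus>x\<in>M. fst x ** (q x \<oplus> q' x)) = (\<Oplus>x\<in>M. fst x ** q x \<oplus> fst x ** q' x)"
  using * Mc by (intro finsum_cong') (auto simp: r_distr)
 also have "... = (\<Oplus>x\<in>M. fst x ** q x) \<oplus> (\<Oplus>x\<in>M. fst x ** q' x)"
  using * Mc by (intro finsum_addf) auto
 finally have e: "(\<Oplus>x\<in>M. fst x ** (q x \<oplus> q' x)) = (\<Oplus>x\<in>M. fst x ** q x) \<oplus> (\<Oplus>x\<in>M. fst x ** q' x)" .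
 have c: "e : carrier R" "e' : carrier R" "(\<Oplus>x\<in>M. fst x ** q x) : carrier R" "(\<Oplus>x\<in>M. fst x ** q' x) : carrier R"
  using * Mc ri_in[OF I] by (auto intro!: finsum_closed)
 have "y \<oplus> z = (e \<oplus> e') \<oplus> (\<Oplus>x\<in>M. fst x ** (q x \<oplus> q' x))"
  unfolding *(3,6) e using c by (simp add: a_ac)
 then show ?case using * ri_add[OF I] by (intro bexI[of _ "e \<oplus> e'"] exI[of _ "%x. q x \<oplus> q' x"]) auto
qed

text \<open>The ideal is \<open>Ncore g\<close> for a \<open>g\<close> of maximal ratio among the
  generators of \<open>V\<close>. For a stable ideal \<open>Z\<close> the product \<open>V Z\<close>
  is a stable right ideal inside \<open>V\<close>, hence \<open>0\<close> or \<open>V\<close>; it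
  cannot be \<open>V\<close> if \<open>Z\<close> kills a top onto which \<open>V\<close>
  maps.\<close>

lemma max_stable_of_minimal:
 assumes V: "minimal_stable V"
 shows "\<exists>N. max_stable N & (\<forall>x\<in>V. \<forall>n\<in>N. x ** n = \<zero>)"
proof -
 note VD = minimal_stableD[OF V]
 obtain x where x: "x : V" "x ~= \<zero>" using VD(1,3) ri_zero by blast
 have xc: "x : carrier R" using ri_in[OF VD(1)] x by blast
 have ux: "u i j x : V" "u i j x : carrier R" if "i < r" "j < r" for i j
  using stable_u[OF VD(2)] that x xc by auto
 \<comment> \<open>By minimality \<open>V\<close> is generated by the orbit of one nonzero element,
   that is, by the finitely many \<open>u i j x\<close>, split by the idempotents.\<close>
 define M0 where "M0 = (%((i, j), p). (u i j x ** p, p)) ` (({..<r} \<times> {..<r}) \<times> Gm)"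
 have M0: "finite M0" "M0 <= V \<times> Gm" "!!y. y : M0 ==> fst y ** snd y = fst y"
  unfolding M0_def using Gm_finite ux ri_mult[OF VD(1)] Gm_carrier Gm_idem by (auto simp: m_assoc)
 have f0: "fst ` M0 <= V" using M0(2) by auto
 have S: "{\<zero>} \<union> fst ` M0 <= V" using f0 ri_zero[OF VD(1)] by blast
 then have Sc: "{\<zero>} \<union> fst ` M0 <= carrier R" using ri_in[OF VD(1)] by blast
 let ?W = "rspan ({\<zero>} \<union> fst ` M0)"
 note W = right_ideal_rspan[OF Sc]
 have uW: "u i j x : ?W" if ij: "i < r" "j < r" for i j
 proof (rule peirce_right_ideal[OF W])
  show "u i j x : carrier R" using ux(2)[OF ij] .
  fix p assume p: "p : Gm"
  have "(u i j x ** p, p) : M0" unfolding M0_def using ij p by (intro image_eqI[of _ _ "((i, j), p)"]) auto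
  then show "u i j x ** p : ?W" using rspan_superset[OF Sc] by force
 qed
 have wW: "w x : ?W" if "w : Op" for w using Op_in_rightI[OF that xc W uW] .
 have "stable ?W"
 proof (rule stable_rspan[OF Sc])
  fix s k l assume s: "s : {\<zero>} \<union> fst ` M0" and kl: "k < r" "l < r"
  show "u k l s : ?W"
  proof (cases "s = \<zero>")
   case True then show ?thesis using Op_zero[OF u_Op[OF kl]] ri_zero[OF W] by simp
  next
   case False
   then obtain i j p where ijp: "i < r" "j < r" "p : Gm" "s = u i j x ** p"
    using s unfolding M0_def by auto
   have "u k l s = (\<Oplus>e. u k e (u i j x) ** u e l p)"
    unfolding ijp(4) using kl ijp ux Gm_carrier by (intro u_mult) auto
   also have "... : ?W"
   proof (intro ri_finsum[OF W] ri_mult[OF W])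
    fix e assume e: "e : {..<r}"
    obtain w where "w : Op" "\<forall>y\<in>carrier R. w y = u k e (u i j y)"
     using Op_comp[OF u_Op u_Op, of k e i j] kl e ijp by auto
    then show "u k e (u i j x) : ?W" using wW xc by force
    show "u e l p : carrier R" using e kl ijp Gm_carrier by auto
   qed simp
   finally show ?thesis .
  qed
 qed
 moreover have "x : ?W"
  by (metis Op_id wW xc)
 moreover have "?W <= V" using S by (rule rspan_least[OF VD(1)])
 ultimately have WV: "V = ?W" using VD(4)[OF W] x(2) by blast
 obtain M where M: "M <= M0" "minimal_generators R r u v Op Ks Gm {\<zero>} V M"
  using minimal_gens_exist[OF right_ideal_zero VD(1) _ stable_zero VD(2) M0 WV] ri_zero[OF VD(1)] by blast
 interpret G: minimal_generators R r u v Op Ks Gm "{\<zero>}" V M by (rule M(2))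
 have "M ~= {}"
 proof
  assume "M = {}"
  then have "V <= {\<zero>}" using G.gen rspan_least[OF right_ideal_zero, of "{\<zero>} \<union> fst ` M"] by simp
  then show False using x by blast
 qed
 then obtain y0 where y0: "y0 : M" by blast
 have "Gm ~= {}" using G.M_Gm[OF y0] by blast
 then obtain g where g: "g : Gm" "!!p. p : Gm ==> card (G.gens p) * card (cls g) <= card (G.gens g) * card (cls p)"
  using ratio_maximal[OF subset_refl, of "%p. card (cls p)" "%p. card (G.gens p)"] card_cls_pos by blast
 note gl = Gm_local[OF g(1)]
 have gens_fin: "finite (G.gens p)" for p unfolding G.gens_def using G.M_finite by simp
 have kg: "card (G.gens g) > 0"
 proof -
  note p0 = G.M_Gm[OF y0]
  have "y0 : G.gens (snd y0)" unfolding G.gens_def using y0 idem_eqv_refl Gm_local[OF p0] by blast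
  then have "card (G.gens (snd y0)) * card (cls g) > 0"
   using gens_fin card_cls_pos[OF g(1)] card_gt_0_iff by (metis empty_iff nat_0_less_mult_iff)
  then show ?thesis using g(2)[OF p0] by (metis gr0I mult_is_0 not_le)
 qed
 have functional_ex: "\<exists>x xi. x : M & G.functional p x xi" if p: "p : Gm" "card (G.gens p) > 0" for p
 proof -
  obtain x where "x : G.gens p" using p(2) by (metis card_gt_0_iff ex_in_conv)
  then show ?thesis using G.functional_exists[OF p(1)] unfolding G.gens_def by blast
 qed
 obtain m xi where xi: "m : M" "G.functional g m xi" using functional_ex[OF g(1) kg] by blast
 let ?N = "Ncore g"
 have prod: "rspan {a ** n | a n. a : V & n : Z} = {\<zero>}"
  if Z: "stable_ideal Z" and h: "m' : M" "G.functional p m' xi'" "local_idem p"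
   "!!n a. n : Z ==> a : pr p ==> a ** n : mx p" for Z m' p xi'
 proof (rule ccontr)
  let ?S = "{a ** n | a n. a : V & n : Z}"
  have Z': "right_ideal Z R" "stable Z" using Z unfolding stable_ideal_def by auto
  have SV: "?S <= V" using ri_mult[OF VD(1)] ri_in[OF Z'(1)] by blast
  then have Sc: "?S <= carrier R" using ri_in[OF VD(1)] by blast
  assume "rspan ?S ~= {\<zero>}"
  then have eq: "rspan ?S = V"
   using VD(4)[OF right_ideal_rspan[OF Sc] stable_product[OF VD(1,2) Z'] rspan_least[OF VD(1) SV]] by blast
  have "xi' z : mx p" if "z : rspan ?S" for z
  proof (rule G.functional_kernel[OF h(3,2) SV _ that])
   fix s b assume s: "s : ?S" and b: "b : carrier R"
   then obtain a n where an: "s = a ** n" "a : V" "n : Z" by blast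
   have nb: "n ** b : Z" using ri_mult[OF Z'(1)] an b by blast
   then have c: "n ** b : carrier R" using ri_in[OF Z'(1)] by blast
   have "s ** b = a ** (n ** b)"
    unfolding an(1) using ri_in[OF VD(1) an(2)] ri_in[OF Z'(1) an(3)] b by (simp add: m_assoc)
   then have "con p (xi' (s ** b)) (xi' a ** (n ** b))" using G.functionalD(3)[OF h(2) an(2) c] by simp
   moreover have "xi' a ** (n ** b) : mx p" using h(4)[OF nb] G.functionalD(1)[OF h(2) an(2)] by blast
   ultimately show "xi' (s ** b) : mx p" using con_mx[OF h(3)] by blast
  qed
  then have "xi' (fst m') : mx p" using eq G.M_Y[OF h(1)] by blast
  then show False using G.functionalD(6)[OF h(2)] by blast
 qed
 have annih: "a ** n = \<zero>"
  if "rspan {a ** n | a n. a : V & n : Z} = {\<zero>}" "Z <= carrier R" "a : V" "n : Z" for Z a n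
 proof -
  have "{a ** n | a n. a : V & n : Z} <= carrier R" using ri_in[OF VD(1)] that(2) by blast
  from rspan_superset[OF this] have "a ** n : rspan {a ** n | a n. a : V & n : Z}"
   using that(3,4) by blast
  then show ?thesis unfolding that(1) by simp
 qed
 have "max_stable ?N"
  unfolding max_stable_def
 proof (intro conjI allI impI)
  show "stable_ideal ?N" using stable_ideal_Ncore[OF gl] .
  show "\<one> ~: ?N" using one_notin_Ncore[OF gl] .
  fix Z assume Z: "stable_ideal Z & ?N <= Z & \<one> ~: Z"
  have Z': "right_ideal Z R" "stable Z" "!!q z. q : carrier R ==> z : Z ==> q ** z : Z"
   using Z unfolding stable_ideal_def by auto
  have "\<exists>p\<in>Gm. p ~: Z"
   using Z ccontr one_in_right_ideal Z' by fastforce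
  then obtain p where p: "p : Gm" "p ~: Z" by blast
  then have "p ~: ?N" using Z by blast
  \<comment> \<open>By extremality the idempotent \<open>p\<close> outside \<open>Z\<close> also has
    a positive ratio. So \<open>V\<close> maps onto the top of \<open>pR\<close>, which
    \<open>Z\<close> kills, and therefore \<open>V Z = 0\<close>.\<close>
  then have "card (G.gens p) * card (cls g) = card (G.gens g) * card (cls p)"
   using G.extremal_class(1)[OF g(1) g(2) p(1)] by blast
  then have "card (G.gens p) > 0" using kg card_cls_pos[OF p(1)] by (metis gr0I mult_is_0 neq0_conv)
  then obtain m' xi' where "m' : M" "G.functional p m' xi'" using functional_ex[OF p(1)] by blast
  then have z0: "rspan {a ** n | a n. a : V & n : Z} = {\<zero>}"
   using Z p Gm_local[OF p(1)] stable_ideal_mx[OF Gm_local[OF p(1)] _ p(2)] by (intro prod) auto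
  show "Z <= ?N"
  proof
   fix z assume z: "z : Z"
   have xim: "xi (fst m) : pr g" "g : pr (xi (fst m))"
    using G.functionalD(1,6)[OF xi(2)] G.M_Y[OF xi(1)] unfolding mx_def by auto
   \<comment> \<open>\<open>V Z = 0\<close> makes \<open>xi\<close> of the generator times
     \<open>Z\<close> vanish in the top of \<open>gR\<close>, and this value generates the top; so
     \<open>Z\<close> kills the whole top.\<close>
   then obtain s where s: "s : carrier R" "g = xi (fst m) ** s" unfolding pr_def by blast
   show "z : ?N"
    unfolding Ncore_def
   proof (intro CollectI conjI ballI)
    show "z : carrier R" using ri_in[OF Z'(1) z] .
    fix w q assume w: "w : Op" and q: "q : carrier R"
    have wz: "s ** (q ** w z) : Z" using Z'(3) s q stableD[OF Z'(2) w z] by blast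
    have mY: "fst m : V" using G.M_Y[OF xi(1)] .
    have "con g (xi (fst m ** (s ** (q ** w z)))) (xi (fst m) ** (s ** (q ** w z)))"
     using G.functionalD(3)[OF xi(2) mY] wz ri_in[OF Z'(1)] by blast
    moreover have "fst m ** (s ** (q ** w z)) = \<zero>"
     using annih[OF z0 _ mY wz] ri_in[OF Z'(1)] by blast
    moreover have "xi \<zero> : mx g" using G.functionalD(4)[OF xi(2)] by blast
    ultimately have "xi (fst m) ** (s ** (q ** w z)) : mx g" using con_mx_iff[OF gl] by metis
    also have "xi (fst m) ** (s ** (q ** w z)) = g ** q ** w z"
     using s q pr_in_carrier[OF gl xim(1)] Op_closed[OF w ri_in[OF Z'(1) z]]
     by (subst s(2)) (simp add: m_assoc)
    finally show "g ** q ** w z : mx g" .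
   qed
  qed
 qed
 moreover have "rspan {a ** n | a n. a : V & n : ?N} = {\<zero>}"
  using Ncore_mult[OF gl] stable_ideal_Ncore[OF gl] xi gl by (intro prod) auto
 then have "\<forall>a\<in>V. \<forall>n\<in>?N. a ** n = \<zero>"
  using annih[of ?N] unfolding Ncore_def by blast
 ultimately show ?thesis by blast
qed

text \<open>The maximal ideal \<open>N\<close> with \<open>V N = 0\<close> meets \<open>V\<close> in
  zero, since otherwise \<open>V\<close> would lie in \<open>N\<close> and have zero products.
  Minimal generators of \<open>R / V\<close> give \<open>1 = e + sum\<close>. Multiplied by
  \<open>y\<close> in \<open>V\<close>, the sum becomes an element of \<open>V\<close>, so by
  extremality its terms lie in \<open>N\<close>; hence it vanishes and
  \<open>y = e y\<close>.\<close>

lemma minimal_stable_left_identity: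
 assumes V: "minimal_stable V" and sq: "\<exists>x\<in>V. \<exists>y\<in>V. x ** y ~= \<zero>"
 shows "\<exists>e\<in>V. \<forall>y\<in>V. e ** y = y"
proof -
 note VD = minimal_stableD[OF V]
 obtain N where N: "max_stable N" "\<forall>x\<in>V. \<forall>n\<in>N. x ** n = \<zero>" using max_stable_of_minimal[OF V] by blast
 have N': "right_ideal N R" "stable N" "!!q x. q : carrier R ==> x : N ==> q ** x : N" "\<one> ~: N"
  "!!Z. stable_ideal Z ==> N <= Z ==> \<one> ~: Z ==> Z <= N"
  using N(1) unfolding max_stable_def stable_ideal_def by auto
 have VN: "V \<inter> N = {\<zero>}"
  using VD(4)[OF right_ideal_Int[OF VD(1) N'(1)] stable_Int[OF VD(2) N'(2)]] sq N(2) by auto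
 define M0 where "M0 = (%p. (p, p)) ` Gm"
 have M0: "finite M0" "M0 <= carrier R \<times> Gm" "!!y. y : M0 ==> fst y ** snd y = fst y"
  unfolding M0_def using Gm_finite Gm_carrier Gm_idem by auto
 have Sc: "V \<union> fst ` M0 <= carrier R" using ri_in[OF VD(1)] M0(2) by auto
 have "carrier R = rspan (V \<union> fst ` M0)"
 proof
  note W = right_ideal_rspan[OF Sc]
  have pW: "p : rspan (V \<union> fst ` M0)" if "p : Gm" for p
   using rspan_superset[OF Sc] that unfolding M0_def by force
  have "\<one> : rspan (V \<union> fst ` M0)"
   using pW by (intro one_in_right_ideal[OF W] subsetI)
  then have "\<one> ** a : rspan (V \<union> fst ` M0)" if "a : carrier R" for a using ri_mult[OF W] that by blast
  then show "carrier R <= rspan (V \<union> fst ` M0)" by auto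
 qed (use rspan_closed[OF Sc] in blast)
 moreover have "stable (carrier R)" unfolding stable_def using Op_closed by blast
 ultimately obtain M where M: "M <= M0" "minimal_generators R r u v Op Ks Gm V (carrier R) M"
  using minimal_gens_exist[OF VD(1) right_ideal_carrier right_idealD(1)[OF VD(1)] VD(2) _ M0] by blast
 interpret G: minimal_generators R r u v Op Ks Gm V "carrier R" M by (rule M(2))
 have "{p : Gm. p ~: N} ~= {}"
  using N'(4) one_in_right_ideal N' by blast
 then obtain g where g: "g : Gm" "g ~: N"
  "!!p. p : Gm ==> p ~: N ==> card (G.gens p) * card (cls g) <= card (G.gens g) * card (cls p)"
  using ratio_maximal[of "{p : Gm. p ~: N}" "%p. card (cls p)" "%p. card (G.gens p)"] card_cls_pos by blast
 note gl = Gm_local[OF g(1)]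
 have sN: "stable_ideal N" using N(1) unfolding max_stable_def by blast
 have "N <= Ncore g"
 proof
  fix n assume n: "n : N"
  have "g ** q ** w n : mx g" if "w : Op" "q : carrier R" for w q
  proof (rule stable_ideal_mx[OF gl sN g(2) stableD[OF N'(2) that(1) n]])
   show "g ** q : pr g" using that(2) unfolding pr_def by blast
  qed
  then show "n : Ncore g" unfolding Ncore_def using ri_in[OF N'(1) n] by blast
 qed
 \<comment> \<open>The ratio was maximized over the idempotents outside \<open>N\<close>. Maximality
   of \<open>N\<close> shows that these are the ones outside \<open>Ncore g\<close>, as
   \<open>extremal_class\<close> requires.\<close>
 then have Ng: "Ncore g = N"
  using N'(5)[OF stable_ideal_Ncore[OF gl]] one_notin_Ncore[OF gl] by blast
 have rel: "snd x ** q x : N" if "q : M \<rightarrow> carrier R" "(\<Oplus>x\<in>M. fst x ** q x) : V" "x : M" for q x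
  using G.extremal_class(2)[OF g(1) _ that] g(3) unfolding Ng by blast
 have "\<one> : rspan (V \<union> fst ` M)" using G.gen by blast
 moreover have Mc: "fst ` M <= carrier R" using M(1) M0(2) by auto
 ultimately obtain e q where e: "e : V" "\<forall>x\<in>M. q x : carrier R" "\<one> = e \<oplus> (\<Oplus>x\<in>M. fst x ** q x)"
  using rspan_finsum[OF VD(1) G.M_finite] by blast
 have ec: "e : carrier R" using ri_in[OF VD(1) e(1)] .
 have "e ** y = y" if y: "y : V" for y
 proof -
  have yc: "y : carrier R" using ri_in[OF VD(1) y] .
  have sc: "(\<Oplus>x\<in>M. fst x ** q x) : carrier R" using e(2) Mc by (intro finsum_closed) auto
  have "(\<Oplus>x\<in>M. fst x ** q x) ** y = (\<Oplus>x\<in>M. fst x ** q x ** y)"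
   using e(2) Mc yc G.M_finite by (intro finsum_ldistr) auto
  also have "... = (\<Oplus>x\<in>M. fst x ** (q x ** y))"
   using e(2) Mc yc by (intro finsum_cong') (auto simp: m_assoc subset_iff)
  finally have s1: "(\<Oplus>x\<in>M. fst x ** q x) ** y = (\<Oplus>x\<in>M. fst x ** (q x ** y))" .
  have "y = \<one> ** y" using yc by simp
  also have "... = e ** y \<oplus> (\<Oplus>x\<in>M. fst x ** (q x ** y))"
   unfolding s1[symmetric] using e(3) ec sc yc l_distr by metis
  finally have y1: "y = e ** y \<oplus> (\<Oplus>x\<in>M. fst x ** (q x ** y))" .
  have c: "(\<Oplus>x\<in>M. fst x ** (q x ** y)) : carrier R" using e(2) Mc yc by (intro finsum_closed) auto
  have "(\<Oplus>x\<in>M. fst x ** (q x ** y)) = (e ** y \<oplus> (\<Oplus>x\<in>M. fst x ** (q x ** y))) \<ominus> e ** y"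
   using c ec yc by (simp add: minus_eq a_ac r_neg r_neg1 r_neg2)
  also have "... = y \<ominus> e ** y" using y1 by simp
  also have "... : V" using ri_minus[OF VD(1) y ri_mult[OF VD(1) e(1) yc]] .
  finally have sV: "(\<Oplus>x\<in>M. fst x ** (q x ** y)) : V" .
  have "(\<Oplus>x\<in>M. fst x ** (q x ** y)) : N"
  proof (intro ri_finsum[OF N'(1)] G.M_finite)
   fix x assume x: "x : M"
   have "snd x ** (q x ** y) : N" using e(2) yc by (intro rel[OF _ sV x]) auto
   moreover have "fst x = snd x" using x M(1) unfolding M0_def by auto
   ultimately show "fst x ** (q x ** y) : N" by simp
  qed
  then have "(\<Oplus>x\<in>M. fst x ** (q x ** y)) = \<zero>" using sV VN by blast
  then show ?thesis using y1 ec yc by simp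
 qed
 then show ?thesis using e(1) by blast
qed

end

section \<open>Invariants and integrals\<close>

context coaction
begin

text \<open>The counit of \<open>u i j\<close> is the Kronecker delta, so this is invariance tested
  on a spanning set of operators.\<close>

definition invs :: "'a set" where
 "invs = {x : carrier R. \<forall>i<r. \<forall>j<r. u i j x = (if i = j then x else \<zero>)}"

lemma invs_carrier: "x : invs ==> x : carrier R"
 unfolding invs_def by blast

lemma invs_u: "[|x : invs; i < r; j < r|] ==> u i j x = (if i = j then x else \<zero>)"
 unfolding invs_def by blast

lemma invs_zero: "\<zero> : invs"
 unfolding invs_def using Op_zero[OF u_Op] by auto

lemma invs_one: "\<one> : invs"
 unfolding invs_def using u_one by auto

lemma invs_add: "[|x : invs; y : invs|] ==> x \<oplus> y : invs"
 unfolding invs_def by (auto simp: u_add)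

lemma u_inv_mult:
 assumes "x : invs" "y : carrier R" "i < r" "j < r" shows "u i j (x ** y) = x ** u i j y"
proof -
 have xc: "x : carrier R" using invs_carrier assms(1) .
 have "u i j (x ** y) = (\<Oplus>a. u i a x ** u a j y)" using assms xc by (intro u_mult) auto
 also have "... = (\<Oplus>a. if a = i then x ** u i j y else \<zero>)"
  using assms xc by (intro finsum_cong') (auto simp: invs_u)
 also have "... = x ** u i j y" using assms xc by (intro finsum_delta) auto
 finally show ?thesis .
qed

lemma u_mult_inv:
 assumes "x : invs" "y : carrier R" "i < r" "j < r" shows "u i j (y ** x) = u i j y ** x"
proof -
 have xc: "x : carrier R" using invs_carrier assms(1) .
 have "u i j (y ** x) = (\<Oplus>a. u i a y ** u a j x)" using assms xc by (intro u_mult) auto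
 also have "... = (\<Oplus>a. if a = j then u i j y ** x else \<zero>)"
  using assms xc by (intro finsum_cong') (auto simp: invs_u)
 also have "... = u i j y ** x" using assms xc by (intro finsum_delta) auto
 finally show ?thesis .
qed

lemma Op_inv_mult:
 assumes w: "w : Op" and x: "x : invs" and y: "y : carrier R"
 shows "w (x ** y) = x ** w y" "w (y ** x) = w y ** x"
proof -
 have xc: "x : carrier R" using invs_carrier x .
 obtain ka where ka: "\<forall>i<r. \<forall>j<r. ka i j : Ks"
  "\<forall>x\<in>carrier R. w x = (\<Oplus>i. \<Oplus>j. u i j x ** ka i j)" using Op_u[OF w] by blast
 have kac: "ka i j : carrier R" if "i < r" "j < r" for i j using ka(1) Ks_closed that by blast
 have "w (x ** y) = (\<Oplus>i. \<Oplus>j. x ** (u i j y ** ka i j))"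
  using ka(2) x xc y kac by (auto simp: u_inv_mult m_assoc intro!: finsum_cong' finsum_closed)
 also have "... = (\<Oplus>i. x ** (\<Oplus>j. u i j y ** ka i j))"
  using xc y kac by (intro finsum_cong') (auto intro!: finsum_closed finsum_rdistr[symmetric])
 also have "... = x ** (\<Oplus>i. \<Oplus>j. u i j y ** ka i j)"
  using xc y kac by (intro finsum_rdistr[symmetric]) (auto intro!: finsum_closed)
 finally show "w (x ** y) = x ** w y" using ka(2) y by simp
 have "w (y ** x) = (\<Oplus>i. \<Oplus>j. (u i j y ** ka i j) ** x)"
 proof -
  have "u i j (y ** x) ** ka i j = (u i j y ** ka i j) ** x" if "i < r" "j < r" for i j
   using that ka(1) Ks_central[of "ka i j" x] xc y kac[OF that] u_mult_inv[OF x y that]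
   by (simp add: m_assoc)
  then show ?thesis using ka(2) xc y kac by (auto intro!: finsum_cong' finsum_closed)
 qed
 also have "... = (\<Oplus>i. (\<Oplus>j. u i j y ** ka i j) ** x)"
  using xc y kac by (intro finsum_cong') (auto intro!: finsum_closed finsum_ldistr[symmetric])
 also have "... = (\<Oplus>i. \<Oplus>j. u i j y ** ka i j) ** x"
  using xc y kac by (intro finsum_ldistr[symmetric]) (auto intro!: finsum_closed)
 finally show "w (y ** x) = w y ** x" using ka(2) y by simp
qed

lemma invs_mult:
 assumes x: "x : invs" and y: "y : invs" shows "x ** y : invs"
 unfolding invs_def
 using invs_carrier x y u_inv_mult invs_u invs_carrier[OF x] by simp

lemma invs_uminus:
 assumes "x : invs" shows "\<ominus> x : invs"
proof -
 have m1: "\<ominus> \<one> : invs"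
 proof -
  have "u i j (\<ominus> \<one>) = \<ominus> (u i j \<one>)" if "i < r" "j < r" for i j
  proof -
   have "u i j (\<ominus> \<one>) \<oplus> u i j \<one> = u i j (\<ominus> \<one> \<oplus> \<one>)" using that by (simp add: u_add)
   also have "... = \<zero>" using Op_zero[OF u_Op[OF that]] by (simp add: l_neg)
   finally show ?thesis using that by (intro minus_equality[symmetric]) auto
  qed
  then show ?thesis unfolding invs_def by (auto simp: u_one)
 qed
 have "\<ominus> x = \<ominus> \<one> ** x" using invs_carrier[OF assms] by (simp add: l_minus)
 then show ?thesis using invs_mult[OF m1 assms] by simp
qed

lemma invs_minus: "[|x : invs; y : invs|] ==> x \<ominus> y : invs"
 unfolding minus_eq using invs_add invs_uminus by blast

text \<open>In Sweedler notation: (h a) b is the sum of h1 (a (S(h2) b)).\<close>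

lemma u_move:
 assumes ij: "i < r" "j < r" and a: "a : carrier R" and b: "b : carrier R"
 shows "u i j a ** b = (\<Oplus>e. u i e (a ** v e j b))"
proof -
 have "(\<Oplus>e. u i e (a ** v e j b)) = (\<Oplus>e. \<Oplus>k. u i k a ** u k e (v e j b))"
  using ij a b by (intro finsum_cong' u_mult) (auto intro!: finsum_closed)
 also have "... = (\<Oplus>k. \<Oplus>e. u i k a ** u k e (v e j b))"
  using ij a b by (intro finsum_swap) auto
 also have "... = (\<Oplus>k. u i k a ** (\<Oplus>e. u k e (v e j b)))"
  using ij a b by (intro finsum_cong' finsum_rdistr[symmetric]) (auto intro!: finsum_closed)
 also have "... = (\<Oplus>k. if k = j then u i j a ** b else \<zero>)"
  using ij a b by (intro finsum_cong') (auto simp: uv)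
 also have "... = u i j a ** b" using ij a b by (intro finsum_delta) auto
 finally show ?thesis by simp
qed

end

locale coaction_integral = coaction R r u v Op Ks
 for R (structure) and r u v Op Ks +
 fixes t :: "'a => 'a"
 assumes t_Op: "t : Op"
  and u_t: "[|i < r; j < r; x : carrier R|] ==> u i j (t x) = (if i = j then t x else \<zero>)"
  and t_u: "[|i < r; j < r; x : carrier R|] ==> t (u i j x) = (if i = j then t x else \<zero>)"
  and t_one: "t \<one> = \<one>"
begin

lemma t_inv: "x : carrier R ==> t x : invs"
 unfolding invs_def using u_t Op_closed[OF t_Op] by blast

lemma t_id: "x : invs ==> t x = x"
 using Op_inv_mult(1)[OF t_Op, of x \<one>] t_one invs_carrier by auto

text \<open>By \<open>u_move\<close> the product of \<open>u i j f\<close> and \<open>y\<close> is a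
  sum of \<open>u i e (f (v e j y))\<close>, and \<open>f\<close> is the identity on the stable
  \<open>I\<close>. So \<open>u i j f\<close> acts on \<open>I\<close> like \<open>u i j 1\<close>,
  and \<open>t f\<close> acts like \<open>t 1 = 1\<close>.\<close>

lemma t_left_identity:
 assumes I: "right_ideal I R" "stable I" and f: "f : I" "!!y. y : I ==> f ** y = y" and y: "y : I"
 shows "t f ** y = y"
proof -
 have fc: "f : carrier R" and yc: "y : carrier R" using ri_in[OF I(1)] f y by auto
 obtain ka where ka: "\<forall>i<r. \<forall>j<r. ka i j : Ks"
  "\<forall>x\<in>carrier R. t x = (\<Oplus>i. \<Oplus>j. u i j x ** ka i j)" using Op_u[OF t_Op] by blast
 have kac: "ka i j : carrier R" if "i < r" "j < r" for i j using ka(1) Ks_closed that by blast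
 have tm: "u i j f ** ka i j ** y = y ** (u i j \<one> ** ka i j)" if ij: "i < r" "j < r" for i j
 proof -
  have yk: "y ** ka i j : I" using ri_mult[OF I(1) y kac[OF ij]] .
  have "u i j f ** ka i j ** y = u i j f ** (y ** ka i j)"
   using ij fc yc kac Ks_central[of "ka i j" y] ka(1) by (simp add: m_assoc)
  also have "... = (\<Oplus>e. u i e (f ** v e j (y ** ka i j)))"
   using u_move[OF ij fc] yc kac[OF ij] by simp
  also have "... = (\<Oplus>e. u i e (v e j (y ** ka i j)))"
   using ij yc kac[OF ij] f(2) stable_v[OF I(2) _ ij(2) yk] by (intro finsum_cong') auto
  also have "... = (if i = j then y ** ka i j else \<zero>)" using uv[OF ij] yc kac[OF ij] by simp
  also have "... = y ** (u i j \<one> ** ka i j)" using ij yc kac[OF ij] u_one by (cases "i = j") auto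
  finally show ?thesis .
 qed
 have "t f ** y = (\<Oplus>i. \<Oplus>j. u i j f ** ka i j) ** y" using ka(2) fc by simp
 also have "... = (\<Oplus>i. (\<Oplus>j. u i j f ** ka i j) ** y)"
  using fc yc kac by (intro finsum_ldistr) (auto intro!: finsum_closed)
 also have "... = (\<Oplus>i. \<Oplus>j. u i j f ** ka i j ** y)"
  using fc yc kac by (intro finsum_cong' finsum_ldistr) (auto intro!: finsum_closed)
 also have "... = (\<Oplus>i. \<Oplus>j. y ** (u i j \<one> ** ka i j))"
  using yc kac by (intro finsum_cong' tm) (auto intro!: finsum_closed)
 also have "... = (\<Oplus>i. y ** (\<Oplus>j. u i j \<one> ** ka i j))"
  using yc kac by (intro finsum_cong' finsum_rdistr[symmetric]) (auto intro!: finsum_closed)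
 also have "... = y ** (\<Oplus>i. \<Oplus>j. u i j \<one> ** ka i j)"
  using yc kac by (intro finsum_rdistr[symmetric]) (auto intro!: finsum_closed)
 also have "... = y ** t \<one>" using ka(2) by simp
 finally show ?thesis using t_one yc by simp
qed

text \<open>In a minimal counterexample \<open>J\<close> an invariant \<open>e\<close> splits off
  from a minimal stable \<open>V\<close>, and the smaller stable set \<open>W\<close> of elements
  killed by \<open>e\<close> has an invariant left identity \<open>e'\<close>. Then
  \<open>e + e' (1 - e)\<close> serves for \<open>J\<close>, because \<open>y - e y\<close> lies in
  \<open>W\<close>.\<close>

theorem stable_right_ideal_left_identity:
 assumes art: "right_artinian R"
  and sq: "!!V. [|right_ideal V R; stable V; V ~= {\<zero>}|] ==> \<exists>x\<in>V. \<exists>y\<in>V. x ** y ~= \<zero>"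
  and I: "right_ideal I R" "stable I"
 shows "\<exists>e\<in>I. e : invs & (\<forall>y\<in>I. e ** y = y)"
proof (rule ccontr)
 assume neg: "~ ?thesis"
 let ?P = "%I. right_ideal I R & stable I & ~ (\<exists>e\<in>I. e : invs & (\<forall>y\<in>I. e ** y = y))"
 have "?P I" using neg I by blast
 then obtain J where J: "?P J" "!!W. ?P W ==> W <= J ==> W = J"
  using artinian_minimalE[OF art, of ?P I] by blast
 then have rJ: "right_ideal J R" and sJ: "stable J" by auto
 have "J ~= {\<zero>}"
  using invs_zero J(1) by auto
 then obtain V where V: "minimal_stable V" "V <= J" using minimal_stable_exists[OF art rJ sJ] by blast
 note VD = minimal_stableD[OF V(1)]
 obtain Gm where "idem_decomp \<one> Gm" using idem_decomp_exists[OF art, of \<one>] by auto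
 then interpret D: coaction_decomp R r u v Op Ks Gm by unfold_locales
 obtain f where f: "f : V" "\<forall>y\<in>V. f ** y = y"
  using D.minimal_stable_left_identity[OF V(1) sq[OF VD(1-3)]] by blast
 define e where "e = t f"
 have e: "e : V" "e : invs" "!!y. y : V ==> e ** y = y"
  unfolding e_def using stableD[OF VD(2) t_Op f(1)] t_inv[OF ri_in[OF VD(1) f(1)]]
   t_left_identity[OF VD(1,2) f(1)] f(2) by auto
 have ec: "e : carrier R" "e : J" "e ** e = e" using e invs_carrier V(2) by auto
 have "e ~= \<zero>"
  using e(3) ri_in[OF VD(1)] VD(3) e(1) by auto
 define W where "W = {y : J. e ** y = \<zero>}"
 have W: "right_ideal W R"
  unfolding W_def
  by (rule right_idealI)
   (use ec ri_in[OF rJ] ri_zero[OF rJ] ri_add[OF rJ] ri_mult[OF rJ] in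
    \<open>auto simp: r_distr m_assoc[symmetric]\<close>)
 have "stable W"
  unfolding stable_def W_def
 proof (intro ballI CollectI conjI)
  fix w y assume w: "w : Op" and y: "y : {y : J. e ** y = \<zero>}"
  show "w y : J" using stableD[OF sJ w] y by blast
  have "y : carrier R" using y ri_in[OF rJ] by blast
  then have "e ** w y = w (e ** y)" by (rule Op_inv_mult(1)[OF w e(2), symmetric])
  then show "e ** w y = \<zero>" using y Op_zero[OF w] by simp
 qed
 moreover have "W <= J" unfolding W_def by blast
 moreover have "W ~= J"
 proof
  assume "W = J"
  then have "e : W" using ec(2) by blast
  then show False unfolding W_def using ec(3) `e ~= \<zero>` by simp
 qed
 ultimately obtain e' where e': "e' : W" "e' : invs" "\<forall>y\<in>W. e' ** y = y" using J(2)[of W] W by blast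
 have e'c: "e' : carrier R" "e' : J" using e' invs_carrier unfolding W_def by auto
 define e'' where "e'' = e \<oplus> (e' \<ominus> e' ** e)"
 have "e'' : J" "e'' : invs"
  unfolding e''_def using ec e'c e e' ri_add[OF rJ] ri_minus[OF rJ] ri_mult[OF rJ] invs_add invs_minus invs_mult
  by auto
 moreover have "e'' ** y = y" if y: "y : J" for y
 proof -
  have yc: "y : carrier R" using ri_in[OF rJ y] .
  have z: "y \<ominus> e ** y : W"
   unfolding W_def using ri_minus[OF rJ y ri_mult[OF rJ ec(2) yc]] ec yc
   by (simp add: minus_eq r_distr r_minus m_assoc[symmetric] r_neg)
  have "e'' ** y = e ** y \<oplus> e' ** (y \<ominus> e ** y)"
   unfolding e''_def using ec e'c yc by (simp add: minus_eq l_distr r_distr l_minus r_minus m_assoc)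
  also have "... = e ** y \<oplus> (y \<ominus> e ** y)" using e'(3) z by simp
  also have "... = y" using ec yc by (simp add: minus_eq a_ac r_neg r_neg1 r_neg2)
  finally show ?thesis .
 qed
 ultimately show False using J(1) by blast
qed

end

section \<open>Right orders in right artinian rings\<close>

context ring begin

text \<open>The right ideals generated by the powers of \<open>x\<close> become stationary, and
  cancelling a power of \<open>x\<close> gives a right inverse.\<close>

lemma injective_unit:
 assumes art: "right_artinian R" and x: "x : carrier R" and inj: "!!q. [|q : carrier R; x ** q = \<zero>|] ==> q = \<zero>"
 shows "x : Units R"
proof -
 have inj_pow: "q = \<zero>" if "q : carrier R" "x [^] n ** q = \<zero>" for q and n :: nat
  using that
 proof (induction n arbitrary: q)
  case (Suc n)
  then have "x [^] n ** (x ** q) = \<zero>" using x by (simp add: m_assoc)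
  then have "x ** q = \<zero>" using Suc x by blast
  then show ?case using inj Suc by blast
 qed (use x in simp)
 obtain I where I: "\<exists>n :: nat. I = pr (x [^] n)" "!!J. (\<exists>n :: nat. J = pr (x [^] n)) ==> J <= I ==> J = I"
  using artinian_minimalE[OF art, of "%I. \<exists>n :: nat. I = pr (x [^] n)" "pr (x [^] (0::nat))"]
   right_ideal_pr nat_pow_closed[OF x] by metis
 then obtain n :: nat where n: "I = pr (x [^] n)" by blast
 have "x [^] Suc n : pr (x [^] n)" unfolding pr_def using x by simp
 then have "pr (x [^] Suc n) <= I"
  unfolding n using pr_least right_ideal_pr nat_pow_closed[OF x] by blast
 then have "pr (x [^] Suc n) = I" using I(2) by blast
 then have "x [^] n : pr (x [^] Suc n)" using pr_self[OF nat_pow_closed[OF x]] n by simp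
 then obtain y where y: "y : carrier R" "x [^] n = x [^] Suc n ** y" unfolding pr_def by blast
 have "x [^] n ** (\<one> \<ominus> x ** y) = x [^] n \<ominus> x [^] Suc n ** y"
  using x y(1) by (simp add: minus_eq r_distr r_minus m_assoc)
 also have "... = \<zero>" using y(2) nat_pow_closed[OF x, of n] by (metis r_right_minus_eq)
 finally have "\<one> \<ominus> x ** y = \<zero>" using inj_pow x y(1) by simp
 then have xy: "x ** y = \<one>" using x y(1) by simp
 have "x ** (y ** x \<ominus> \<one>) = (x ** y) ** x \<ominus> x"
  using x y(1) by (simp add: minus_eq r_distr r_minus m_assoc)
 also have "... = \<zero>" unfolding xy using x by simp
 finally have "y ** x \<ominus> \<one> = \<zero>" using inj x y(1) by simp
 then have "y ** x = \<one>" using x y(1) by simp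
 then show ?thesis unfolding Units_def using x y(1) xy by blast
qed

text \<open>In a finite power of an artinian module, an intersection of kernels is already the intersection
 of finitely many of them.\<close>

lemma finitely_many_functionals:
 assumes art: "right_artinian R" and N: "finite N"
  and c: "!!p k. p : P ==> k : N ==> c p k : carrier R"
 shows "\<exists>F\<subseteq>P. finite F & (\<forall>z\<in>N \<rightarrow> carrier R. (\<forall>p\<in>F. (\<Oplus>k\<in>N. c p k ** z k) = \<zero>) -->
  (\<forall>p\<in>P. (\<Oplus>k\<in>N. c p k ** z k) = \<zero>))"
 using N c
proof (induction N rule: finite_induct)
 case empty
 show ?case by (intro exI[of _ "{}"]) simp
next
 case (insert k0 N)
 let ?\<Phi> = "%p z. \<Oplus>k\<in>insert k0 N. c p k ** z k"
 define K where "K F = {z : insert k0 N \<rightarrow> carrier R. \<forall>p\<in>F. ?\<Phi> p z = \<zero>}" for F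
 define I where "I F = (%z. z k0) ` K F" for F
 have expand: "?\<Phi> p z = c p k0 ** z k0 \<oplus> (\<Oplus>k\<in>N. c p k ** z k)"
  if "p : P" "z : insert k0 N \<rightarrow> carrier R" for p z
  using that insert.hyps insert.prems by (intro finsum_insert) (auto simp: Pi_iff)
 have \<Phi>_add: "?\<Phi> p (%k. z k \<oplus> z' k) = ?\<Phi> p z \<oplus> ?\<Phi> p z'"
  if "p : P" "z : insert k0 N \<rightarrow> carrier R" "z' : insert k0 N \<rightarrow> carrier R" for p z z'
 proof -
  have "?\<Phi> p (%k. z k \<oplus> z' k) = (\<Oplus>k\<in>insert k0 N. c p k ** z k \<oplus> c p k ** z' k)"
   using that insert.prems by (intro finsum_cong') (auto simp: r_distr Pi_iff)
  also have "... = ?\<Phi> p z \<oplus> ?\<Phi> p z'"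
   using that insert.prems by (intro finsum_addf) (auto simp: Pi_iff)
  finally show ?thesis .
 qed
 have \<Phi>_mult: "?\<Phi> p (%k. z k ** a) = ?\<Phi> p z ** a"
  if "p : P" "z : insert k0 N \<rightarrow> carrier R" "a : carrier R" for p z a
 proof -
  have "?\<Phi> p (%k. z k ** a) = (\<Oplus>k\<in>insert k0 N. c p k ** z k ** a)"
   using that insert.prems by (intro finsum_cong') (auto simp: m_assoc Pi_iff)
  also have "... = ?\<Phi> p z ** a"
   using that insert.prems insert.hyps by (intro finsum_ldistr[symmetric]) (auto simp: Pi_iff)
  finally show ?thesis .
 qed
 have \<Phi>c: "?\<Phi> p z : carrier R" if "p : P" "z : insert k0 N \<rightarrow> carrier R" for p z
  using that insert.prems by (intro finsum_closed) (auto simp: Pi_iff)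
 have K_add: "(%k. z k \<oplus> z' k) : K F" if "z : K F" "z' : K F" "F <= P" for z z' F
  using that \<Phi>_add unfolding K_def by (auto simp: Pi_iff subset_iff)
 have K_mult: "(%k. z k ** a) : K F" if "z : K F" "a : carrier R" "F <= P" for z a F
  using that \<Phi>_mult unfolding K_def by (auto simp: Pi_iff subset_iff)
 have rI: "right_ideal (I F) R" if F: "F <= P" for F
  unfolding I_def
 proof (rule right_idealI)
  show "(%z. z k0) ` K F <= carrier R" unfolding K_def by auto
  have "?\<Phi> p (%_. \<zero>) = \<zero>" if "p : F" for p
   using that F insert.prems by (intro add.finprod_one_eqI) auto
  then have "(%_. \<zero>) : K F" unfolding K_def by auto
  then show "\<zero> : (%z. z k0) ` K F" by (rule rev_image_eqI) simp
  fix x y assume "x : (%z. z k0) ` K F"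
  then obtain z where z: "z : K F" "x = z k0" by blast
  show "x ** a : (%z. z k0) ` K F" if "a : carrier R" for a
   using K_mult[OF z(1) that F] by (rule rev_image_eqI) (simp add: z)
  assume "y : (%z. z k0) ` K F"
  then obtain z' where z': "z' : K F" "y = z' k0" by blast
  show "x \<oplus> y : (%z. z k0) ` K F"
   using K_add[OF z(1) z'(1) F] by (rule rev_image_eqI) (simp add: z z')
 qed
 obtain F1 where F1: "F1 <= P" "finite F1"
  "\<forall>z\<in>N \<rightarrow> carrier R. (\<forall>p\<in>F1. (\<Oplus>k\<in>N. c p k ** z k) = \<zero>) --> (\<forall>p\<in>P. (\<Oplus>k\<in>N. c p k ** z k) = \<zero>)"
 proof -
  have "\<exists>F\<subseteq>P. finite F & (\<forall>z\<in>N \<rightarrow> carrier R. (\<forall>p\<in>F. (\<Oplus>k\<in>N. c p k ** z k) = \<zero>) -->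
   (\<forall>p\<in>P. (\<Oplus>k\<in>N. c p k ** z k) = \<zero>))"
   by (rule insert.IH) (use insert.prems in auto)
  then show ?thesis using that by blast
 qed
 let ?Q = "%J. \<exists>F\<subseteq>P. finite F & J = I F"
 have Q0: "?Q (I {})" by blast
 have "right_ideal J R" if "?Q J" for J using that rI by blast
 from artinian_minimalE[OF art, of ?Q, OF Q0 this]
 obtain J where J: "?Q J" "!!J'. ?Q J' ==> J' <= J ==> J' = J" by blast
 then obtain F0 where F0: "F0 <= P" "finite F0" "J = I F0" by blast
 have "?\<Phi> p z = \<zero>"
  if z: "z : insert k0 N \<rightarrow> carrier R" "\<forall>p\<in>F0 \<union> F1. ?\<Phi> p z = \<zero>" and p: "p : P" for z p
 proof -
  let ?F = "insert p (F0 \<union> F1)"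
  have F: "?F <= P" "finite ?F" using F0 F1 p by auto
  have "I ?F <= I F0" unfolding I_def K_def by blast
  then have "I ?F = I F0" using J(2) F F0(3) by blast
  moreover have "z k0 : I F0" unfolding I_def K_def using z by blast
  \<comment> \<open>Minimality of \<open>I F0\<close> yields a \<open>z'\<close> with the same
    coordinate at \<open>k0\<close> that is killed by the additional functional too. The difference
    \<open>z - z'\<close> vanishes at \<open>k0\<close>, so \<open>F1\<close> decides about
    it.\<close>
  ultimately obtain z' where z': "z' : K ?F" "z' k0 = z k0" unfolding I_def by force
  have z'c: "z' : insert k0 N \<rightarrow> carrier R" "(%k. \<ominus> z' k) : insert k0 N \<rightarrow> carrier R"
   using z'(1) unfolding K_def by auto
  define y where "y = (%k. z k \<ominus> z' k)"
  have yc: "y : insert k0 N \<rightarrow> carrier R" unfolding y_def using z z'c by auto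
  have zy: "?\<Phi> q z = ?\<Phi> q y \<oplus> ?\<Phi> q z'" if "q : P" for q
  proof -
   have "?\<Phi> q z = ?\<Phi> q (%k. y k \<oplus> z' k)"
    using that z z'c insert.prems unfolding y_def
    by (intro finsum_cong') (auto simp: Pi_iff minus_eq a_assoc l_neg)
   then show ?thesis using \<Phi>_add[OF that yc z'c(1)] by simp
  qed
  have y0: "?\<Phi> q y = (\<Oplus>k\<in>N. c q k ** y k)" if "q : P" for q
  proof -
   have "y k0 = \<zero>" unfolding y_def using z'(2) z(1) by auto
   then show ?thesis
    using expand[OF that yc] that insert.prems yc by (auto simp: Pi_iff intro!: l_zero finsum_closed)
  qed
  have "?\<Phi> q y = \<zero>" if "q : F1" for q
   using zy[of q] z(2) z'(1) \<Phi>c[OF _ yc, of q] that F1(1) unfolding K_def by auto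
  then have "\<forall>q\<in>F1. (\<Oplus>k\<in>N. c q k ** y k) = \<zero>"
   using y0[symmetric] F1(1) by (simp add: subset_iff)
  then have "(\<Oplus>k\<in>N. c p k ** y k) = \<zero>" using F1(3) yc p by auto
  then have "?\<Phi> p y = \<zero>" using y0 p by simp
  moreover have "?\<Phi> p z' = \<zero>" using z'(1) unfolding K_def by blast
  ultimately show ?thesis using zy[OF p] by simp
 qed
 then show ?case using F0 F1 by (intro exI[of _ "F0 \<union> F1"]) auto
qed

end

lemma (in abelian_group) finsum_cartesian:
 assumes A: "finite A" and B: "finite B" and f: "!!i j. i : A ==> j : B ==> f (i, j) : carrier G"
 shows "finsum G f (A \<times> B) = (\<Oplus>i\<in>A. \<Oplus>j\<in>B. f (i, j))"
 using A f
proof (induction A rule: finite_induct)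
 case empty then show ?case by simp
next
 case (insert x A)
 have e: "insert x A \<times> B = Pair x ` B \<union> A \<times> B" by auto
 have "finsum G f (insert x A \<times> B) = finsum G f (Pair x ` B) \<oplus> finsum G f (A \<times> B)"
  unfolding e using insert B by (intro finsum_Un_disjoint) auto
 also have "finsum G f (Pair x ` B) = (\<Oplus>j\<in>B. f (x, j))"
  using insert by (intro finsum_reindex) (auto intro: inj_onI)
 also have "finsum G f (A \<times> B) = (\<Oplus>i\<in>A. \<Oplus>j\<in>B. f (i, j))" using insert by auto
 also have "(\<Oplus>j\<in>B. f (x, j)) \<oplus> ... = (\<Oplus>i\<in>insert x A. \<Oplus>j\<in>B. f (i, j))"
  using insert by (intro finsum_insert[symmetric]) (auto intro!: finsum_closed)
 finally show ?case .
qed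

text \<open>\<open>A\<close> is a subset of the artinian ring, so elements and fractions share a
  carrier. \<open>A_semiprime\<close> expresses \<open>H\<close>-semiprimeness elementwise, through
  stable ideals with zero square.\<close>

locale right_order = coaction_integral R r u v Op Ks t
 for R (structure) and r u v Op Ks t +
 fixes A :: "'a set"
 assumes A_closed: "A <= carrier R" and A_one: "\<one> : A"
  and A_add: "[|x : A; y : A|] ==> x \<oplus> y : A"
  and A_uminus: "x : A ==> \<ominus> x : A"
  and A_mult: "[|x : A; y : A|] ==> x ** y : A"
  and A_Op: "[|w : Op; x : A|] ==> w x : A"
  and Ks_A: "Ks <= A"
  and artinian: "right_artinian R"
  and fractions: "q : carrier R ==> \<exists>s\<in>A \<inter> Units R. q ** s : A"
  and A_semiprime: "[|N <= A; \<zero> : N; !!x y. x : N ==> y : N ==> x \<oplus> y : N;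
   !!a x. a : A ==> x : N ==> a ** x : N; !!a x. a : A ==> x : N ==> x ** a : N; stable N;
   !!x y. x : N ==> y : N ==> x ** y = \<zero>|] ==> N <= {\<zero>}"
begin

abbreviation Reg :: "'a set" where "Reg \<equiv> A \<inter> Units R"

lemma A_in [simp]: "x : A ==> x : carrier R"
 using A_closed by blast

lemma A_zero: "\<zero> : A"
 using A_add[OF A_one A_uminus[OF A_one]] by (simp add: r_neg)

lemma Reg_mult: "[|s : Reg; s' : Reg|] ==> s ** s' : Reg"
 using A_mult by auto

lemma Reg_one: "\<one> : Reg"
 using A_one by auto

lemma Reg_cancel:
 assumes "s : Reg" "q : carrier R" "s ** q = \<zero>" shows "q = \<zero>"
 using assms by (metis IntD2 Units_closed Units_l_cancel r_null zero_closed)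

lemma Reg_cancel_right:
 assumes s: "s : Reg" and q: "q : carrier R" "q ** s = \<zero>" shows "q = \<zero>"
proof -
 have i: "inv s : carrier R" "s : carrier R" using s by auto
 have "q = q ** (s ** inv s)" using s q by simp
 also have "... = q ** s ** inv s" using i q(1) by (simp only: m_assoc)
 finally show ?thesis unfolding q(2) using i by simp
qed

lemma common_denominator:
 assumes "finite F" "F <= carrier R" shows "\<exists>s\<in>Reg. \<forall>q\<in>F. q ** s : A"
 using assms
proof (induction F rule: finite_induct)
 case empty then show ?case using Reg_one by blast
next
 case (insert q F)
 then obtain s where s: "s : Reg" "\<forall>q\<in>F. q ** s : A" by auto
 have qc: "q : carrier R" "s : carrier R" using insert.prems s by auto
 obtain s' where s': "s' : Reg" "(q ** s) ** s' : A" using fractions[of "q ** s"] qc by auto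
 have "q' ** (s ** s') : A" if "q' : insert q F" for q'
 proof -
  have e: "q' ** (s ** s') = (q' ** s) ** s'"
   using that insert.prems qc s' by (auto simp: m_assoc)
  show ?thesis
  proof (cases "q' = q")
   case False then show ?thesis unfolding e using that s s' A_mult by auto
  qed (use e s' in simp)
 qed
 then show ?case using Reg_mult[OF s(1) s'(1)] by blast
qed

text \<open>The right Ore condition with a numerator from the whole quotient ring, obtained by
  clearing the denominator of \<open>inv s ** q\<close>.\<close>

lemma Reg_move:
 assumes s: "s : Reg" and q: "q : carrier R"
 shows "\<exists>d\<in>Reg. \<exists>b\<in>A. q ** d = s ** b"
proof -
 have i: "inv s : carrier R" "s : carrier R" "s ** inv s = \<one>" using s by auto
 obtain d where d: "d : Reg" "(inv s ** q) ** d : A" using fractions[of "inv s ** q"] i q by auto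
 have "s ** ((inv s ** q) ** d) = q ** d"
  using i q d by (simp add: m_assoc assoc_eq[OF i(3)])
 then show ?thesis using d by metis
qed

definition Arid :: "'a set => bool" where
 "Arid M \<longleftrightarrow> M <= A & \<zero> : M & (\<forall>x\<in>M. \<forall>y\<in>M. x \<oplus> y : M) & (\<forall>x\<in>M. \<forall>a\<in>A. x ** a : M)"

lemma AridI:
 assumes "M <= A" "\<zero> : M" "!!x y. x : M ==> y : M ==> x \<oplus> y : M" "!!x a. x : M ==> a : A ==> x ** a : M"
 shows "Arid M"
 using assms unfolding Arid_def by blast

lemma AridD:
 assumes "Arid M"
 shows "M <= A" "\<zero> : M" "!!x y. x : M ==> y : M ==> x \<oplus> y : M" "!!x a. x : M ==> a : A ==> x ** a : M"
 using assms unfolding Arid_def by auto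

lemma Arid_in: "Arid M ==> x : M ==> x : A"
 using AridD(1) by blast

lemma Arid_Int: "[|Arid M; Arid M'|] ==> Arid (M \<inter> M')"
 unfolding Arid_def by blast

lemma Arid_trace: "right_ideal V R ==> Arid (V \<inter> A)"
 using right_idealD(2,3,4) A_zero A_add A_mult by (intro AridI) auto

lemma Arid_finsum: "[|Arid M; finite F; !!x. x : F ==> f x : M|] ==> finsum R f F : M"
 using finsum_in_closed[of M F f] AridD A_closed by blast

lemma stable_A: "stable A"
 unfolding stable_def using A_Op by blast

lemma Op_in_Arid:
 assumes "w : Op" "x : carrier R" "Arid M"
  and "(!!i j. [|i < r; j < r|] ==> f i j x : M)" "f = u | f = v"
 shows "w x : M"
 by (rule Op_in[of w x M f]) (use assms Ks_A A_closed AridD[of M] in auto)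

lemmas Op_in_AridI = Op_in_Arid[where f = u, OF _ _ _ _ disjI1[OF refl]]
 and Op_in_AridI_v = Op_in_Arid[where f = v, OF _ _ _ _ disjI2[OF refl]]

text \<open>The companion of \<open>u_move\<close>: a (S(h) b) is the sum of S(h1) ((h2 a)
  b).\<close>

lemma v_move:
 assumes ij: "i < r" "j < r" and a: "a : carrier R" and b: "b : carrier R"
 shows "a ** v i j b = (\<Oplus>e. v i e (u e j a ** b))"
proof -
 have "(\<Oplus>e. v i e (u e j a ** b)) = (\<Oplus>e. v i e (\<Oplus>k. u e k (a ** v k j b)))"
  using ij a b by (intro finsum_cong') (auto simp: u_move intro!: v_closed finsum_closed)
 also have "... = (\<Oplus>e. \<Oplus>k. v i e (u e k (a ** v k j b)))"
  using ij a b by (intro finsum_cong') (auto intro!: Op_finsum[OF v_Op] finsum_closed)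
 also have "... = (\<Oplus>k. \<Oplus>e. v i e (u e k (a ** v k j b)))"
  using ij a b by (intro finsum_swap) auto
 also have "... = (\<Oplus>k. if k = i then a ** v i j b else \<zero>)"
  using ij a b by (intro finsum_cong') (auto simp: vu)
 also have "... = a ** v i j b" using ij a b by (intro finsum_delta) auto
 finally show ?thesis by simp
qed

text \<open>The purpose is a regular element whose whole orbit lies in \<open>sA\<close>. By
  \<open>v_move\<close>, \<open>inv s ** v d j c\<close> is the sum of
  \<open>v d e (u e j (inv s) ** c)\<close>, so any common denominator \<open>c\<close> of the
  finitely many \<open>u e j (inv s)\<close> will do, as the \<open>v d j\<close> span the
  operators.\<close>

lemma Reg_stable_multiple:
 assumes s: "s : Reg" shows "\<exists>c\<in>Reg. \<forall>w\<in>Op. \<exists>b\<in>A. w c = s ** b"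
proof -
 have i: "inv s : carrier R" "s : carrier R" "s ** inv s = \<one>" using s by auto
 let ?F = "(%(e, j). u e j (inv s)) ` ({..<r} \<times> {..<r})"
 have "?F <= carrier R" using i by auto
 then obtain c where c: "c : Reg" "\<forall>q\<in>?F. q ** c : A" using common_denominator[of ?F] by auto
 have cc: "c : carrier R" using c by auto
 define M where "M = {x : A. inv s ** x : A}"
 have M: "Arid M"
  unfolding M_def
  by (rule AridI) (use i A_zero A_add A_mult in \<open>auto simp: r_distr m_assoc[symmetric]\<close>)
 have vM: "v d j c : M" if dj: "d < r" "j < r" for d j
 proof -
  have "inv s ** v d j c = (\<Oplus>e. v d e (u e j (inv s) ** c))"
   using v_move[OF dj i(1) cc] .
  also have "... : A"
  proof (intro finsum_in_closed[of A] A_closed A_zero A_add)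
   fix e assume e: "e : {..<r}"
   then have "u e j (inv s) ** c : A" using c(2) dj by force
   then show "v d e (u e j (inv s) ** c) : A" using A_Op v_Op dj e by blast
  qed auto
  finally show ?thesis unfolding M_def using A_Op v_Op dj c(1) by blast
 qed
 have "\<exists>b\<in>A. w c = s ** b" if w: "w : Op" for w
 proof -
  have "w c : M" using Op_in_AridI_v[OF w cc M vM] .
  moreover have "s ** (inv s ** w c) = w c"
   using assoc_eq[OF i(3,2,1)] Op_closed[OF w cc] by simp
  ultimately show ?thesis unfolding M_def by force
 qed
 then show ?thesis using c(1) by blast
qed

text \<open>For a right ideal \<open>M\<close> of \<open>A\<close> this is its extension to the
  quotient ring: by the Ore condition a sum of fractions with numerators in \<open>M\<close> is a
  single one.\<close>

definition loc :: "'a set => 'a set" where "loc M = {x : carrier R. \<exists>s\<in>Reg. x ** s : M}"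

lemma loc_superset: "Arid M ==> M <= loc M"
 unfolding loc_def using Reg_one Arid_in by force

lemma right_ideal_loc:
 assumes M: "Arid M" shows "right_ideal (loc M) R"
proof (rule right_idealI)
 note MD = AridD[OF M]
 show "loc M <= carrier R" unfolding loc_def by blast
 show "\<zero> : loc M" using loc_superset[OF M] MD(2) by blast
 fix x assume "x : loc M"
 then obtain s where x: "x : carrier R" "s : Reg" "x ** s : M" unfolding loc_def by blast
 have sc: "s : carrier R" using x by auto
 show "x ** a : loc M" if a: "a : carrier R" for a
 proof -
  obtain d b where d: "d : Reg" "b : A" "a ** d = s ** b" using Reg_move[OF x(2) a] by blast
  have "x ** a ** d = x ** (s ** b)" using x a d by (simp add: m_assoc)
  also have "... = x ** s ** b" using x sc d by (simp add: m_assoc)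
  also have "... : M" using MD(4) x d by blast
  finally show ?thesis unfolding loc_def using d x a by blast
 qed
 fix y assume "y : loc M"
 then obtain s' where y: "y : carrier R" "s' : Reg" "y ** s' : M" unfolding loc_def by blast
 have s'c: "s' : carrier R" using y by auto
 obtain d b where d: "d : Reg" "b : A" "s' ** d = s ** b" using Reg_move[OF x(2) s'c] by blast
 have dc: "d : carrier R" "b : carrier R" using d by auto
 have "(x \<oplus> y) ** (s' ** d) = x ** (s' ** d) \<oplus> y ** (s' ** d)"
  using x y s'c dc by (simp add: l_distr)
 also have "x ** (s' ** d) = x ** s ** b" unfolding d(3) using x sc dc by (simp add: m_assoc)
 also have "y ** (s' ** d) = y ** s' ** d" using y s'c dc by (simp add: m_assoc)
 also have "x ** s ** b \<oplus> y ** s' ** d : M" using MD(3,4) x y d by blast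
 finally show "x \<oplus> y : loc M" unfolding loc_def using Reg_mult[OF y(2) d(1)] x y by blast
qed

lemma stable_loc:
 assumes M: "Arid M" "stable M" shows "stable (loc M)"
 unfolding stable_def
proof (intro ballI)
 note P = right_ideal_loc[OF M(1)]
 fix w x assume w: "w : Op" and x: "x : loc M"
 then obtain s where s: "s : Reg" "x ** s : M" "x : carrier R" unfolding loc_def by blast
 have i: "inv s : carrier R" "s : carrier R" "s ** inv s = \<one>" using s by auto
 have xs: "x = (x ** s) ** inv s" using i s by (simp add: m_assoc)
 show "w x : loc M"
 proof (rule Op_in_rightI[OF w s(3) P])
  fix k l assume kl: "k < r" "l < r"
  have "u k l x = (\<Oplus>a. u k a (x ** s) ** u a l (inv s))"
   using u_mult[OF kl, of "x ** s" "inv s"] xs i s by simp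
  also have "... : loc M"
  proof (intro ri_finsum[OF P] ri_mult[OF P])
   fix a assume a: "a : {..<r}"
   then show "u k a (x ** s) : loc M" using stable_u[OF M(2)] kl s(2) loc_superset[OF M(1)] by blast
   show "u a l (inv s) : carrier R" using a kl i by simp
  qed simp
  finally show "u k l x : loc M" .
 qed
qed

lemma stable_trace: "stable V ==> stable (V \<inter> A)"
 using stable_Int stable_A by blast

lemma trace_nonzero:
 assumes V: "right_ideal V R" and x: "x : V" "x ~= \<zero>"
 shows "\<exists>y\<in>V \<inter> A. y ~= \<zero>"
proof -
 have xc: "x : carrier R" using ri_in[OF V x(1)] .
 obtain s where s: "s : Reg" "x ** s : A" using fractions[OF xc] by blast
 have "x ** s : V" using ri_mult[OF V x(1)] s by auto
 moreover have "x ** s ~= \<zero>" using Reg_cancel_right[OF s(1) xc] x(2) by blast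
 ultimately show ?thesis using s(2) by blast
qed

lemma loc_one_iff: "\<one> : loc M \<longleftrightarrow> M \<inter> Reg ~= {}"
 unfolding loc_def by force

text \<open>A stable right ideal \<open>V\<close> with square zero meets \<open>A\<close> in a subset of
 \<open>L \<inter> l(L)\<close>, where \<open>L\<close> is the right annihilator of \<open>V\<close> in \<open>A\<close>, a two-sided
 ideal.\<close>

lemma stable_square_nonzero:
 assumes V: "right_ideal V R" "stable V" "V ~= {\<zero>}"
 shows "\<exists>x\<in>V. \<exists>y\<in>V. x ** y ~= \<zero>"
proof (rule ccontr)
 assume "~ ?thesis"
 then have z: "x ** y = \<zero>" if "x : V" "y : V" for x y using that by blast
 have Vc: "x : carrier R" if "x : V" for x using ri_in[OF V(1) that] .
 define L where "L = {y : A. \<forall>x\<in>V. x ** y = \<zero>}"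
 define N where "N = {y : L. \<forall>x\<in>L. y ** x = \<zero>}"
 have LA: "y : A" "y : carrier R" if "y : L" for y using that unfolding L_def by auto
 have L0: "x ** y = \<zero>" if "x : V" "y : L" for x y using that unfolding L_def by blast
 have L_zero: "\<zero> : L" unfolding L_def using A_zero Vc by auto
 have L_add: "x \<oplus> y : L" if "x : L" "y : L" for x y
  using that Vc A_add unfolding L_def by (auto simp: r_distr)
 have Lr: "y ** a : L" if y: "y : L" and a: "a : A" for y a
 proof -
  have "x ** (y ** a) = \<zero>" if "x : V" for x
   using assoc_eq[OF L0[OF that y] Vc[OF that] LA(2)[OF y], of a] a by simp
  then show ?thesis unfolding L_def using A_mult LA(1)[OF y] a by blast
 qed
 have Ll: "a ** y : L" if y: "y : L" and a: "a : A" for y a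
 proof -
  have "x ** (a ** y) = \<zero>" if "x : V" for x
   using L0[OF ri_mult[OF V(1) that A_in[OF a]] y] Vc[OF that] LA(2)[OF y] a by (simp add: m_assoc)
  then show ?thesis unfolding L_def using A_mult LA(1)[OF y] a by blast
 qed
 have AL: "Arid L" using LA(1) L_zero L_add Lr by (intro AridI) auto
 have sL: "stable L"
  unfolding stable_def
 proof (intro ballI)
  fix w y assume w: "w : Op" and y: "y : L"
  show "w y : L"
  proof (rule Op_in_AridI_v[OF w LA(2)[OF y] AL])
   fix i j assume ij: "i < r" "j < r"
   have "x ** v i j y = \<zero>" if x: "x : V" for x
   proof -
    have "x ** v i j y = (\<Oplus>e. v i e (u e j x ** y))"
     using v_move[OF ij Vc[OF x] LA(2)[OF y]] .
    also have "... = (\<Oplus>e. \<zero>)"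
     using L0[OF stable_u[OF V(2) _ ij(2) x] y] ij Op_zero[OF v_Op] by (intro finsum_cong') auto
    finally show ?thesis by simp
   qed
   then show "v i j y : L" unfolding L_def using A_Op[OF v_Op[OF ij]] LA(1)[OF y] by blast
  qed
 qed
 have NL: "y : L" if "y : N" for y using that unfolding N_def by blast
 have N0: "y ** x = \<zero>" if "y : N" "x : L" for x y using that unfolding N_def by blast
 have Nr: "y ** a : N" if y: "y : N" and a: "a : A" for y a
 proof -
  have "y ** a ** x = \<zero>" if "x : L" for x
   using N0[OF y Ll[OF that a]] LA(2)[OF NL[OF y]] LA(2)[OF that] a by (simp add: m_assoc)
  then show ?thesis unfolding N_def using Lr[OF NL[OF y] a] by blast
 qed
 have Nl: "a ** y : N" if y: "y : N" and a: "a : A" for y a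
 proof -
  have "a ** y ** x = \<zero>" if "x : L" for x
   using N0[OF y that] LA(2)[OF NL[OF y]] LA(2)[OF that] a by (simp add: m_assoc)
  then show ?thesis unfolding N_def using Ll[OF NL[OF y] a] by blast
 qed
 have N_add: "x \<oplus> y : N" if "x : N" "y : N" for x y
  using that L_add LA(2) unfolding N_def by (auto simp: l_distr)
 have N_zero: "\<zero> : N" unfolding N_def using L_zero LA(2) by auto
 have AN: "Arid N" using LA(1)[OF NL] N_zero N_add Nr by (intro AridI) auto
 have sN: "stable N"
  unfolding stable_def
 proof (intro ballI)
  fix w y assume w: "w : Op" and y: "y : N"
  note yc = LA(2)[OF NL[OF y]]
  show "w y : N"
  proof (rule Op_in_AridI[OF w yc AN])
   fix i j assume ij: "i < r" "j < r"
   have "u i j y ** x = \<zero>" if x: "x : L" for x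
   proof -
    have "u i j y ** x = (\<Oplus>e. u i e (y ** v e j x))"
     using u_move[OF ij yc LA(2)[OF x]] .
    also have "... = (\<Oplus>e. \<zero>)"
     using N0[OF y stable_v[OF sL _ ij(2) x]] ij Op_zero[OF u_Op] by (intro finsum_cong') auto
    finally show ?thesis by simp
   qed
   then show "u i j y : N" unfolding N_def using stable_u[OF sL ij NL[OF y]] by blast
  qed
 qed
 have "N <= {\<zero>}"
 proof (rule A_semiprime)
  show "N <= A" using LA(1)[OF NL] by blast
  show "x ** y = \<zero>" if "x : N" "y : N" for x y using N0[OF that(1) NL[OF that(2)]] .
 qed (use N_zero N_add Nl Nr sN in auto)
 moreover have "V \<inter> A <= N" unfolding N_def L_def using z by auto
 moreover obtain x where "x : V" "x ~= \<zero>" using V(1,3) ri_zero by blast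
 then obtain y where "y : V \<inter> A" "y ~= \<zero>" using trace_nonzero[OF V(1)] by blast
 ultimately show False by blast
qed

lemma left_identity:
 assumes "right_ideal I R" "stable I" shows "\<exists>e\<in>I. e : invs & (\<forall>y\<in>I. e ** y = y)"
 by (rule stable_right_ideal_left_identity[OF artinian stable_square_nonzero assms])

text \<open>The trace form: an element killed from the left by \<open>t(sA)\<close> vanishes, because \<open>t(px)\<close> is
 a combination of the \<open>u a j x\<close> with coefficients depending on \<open>p\<close>, and finitely many \<open>p\<close>
 suffice to detect the vanishing of all these combinations.\<close>

lemma trace_faithful:
 assumes s: "s : Reg" and x: "x : carrier R" and z: "!!a. a : A ==> t (s ** a) ** x = \<zero>"
 shows "x = \<zero>"
proof -
 obtain ka where ka: "\<forall>i<r. \<forall>j<r. ka i j : Ks"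
  "\<forall>x\<in>carrier R. t x = (\<Oplus>i. \<Oplus>j. u i j x ** ka i j)" using Op_u[OF t_Op] by blast
 have kac: "ka i j : carrier R" if "i < r" "j < r" for i j using ka(1) Ks_closed that by blast
 define N where "N = ({..<r} \<times> {..<r}) \<times> {..<r}"
 have fN: "finite N" unfolding N_def by simp
 define c :: "'a => (nat \<times> nat) \<times> nat => 'a" where "c p k = u (fst (fst k)) (snd k) p" for p k
 have cc: "c p k : carrier R" if "p : carrier R" "k : N" for p k
  using that unfolding c_def N_def by auto
 from finitely_many_functionals[OF artinian fN, of "carrier R" c, OF cc]
 obtain F where F: "F <= carrier R" "finite F"
  "\<forall>z\<in>N \<rightarrow> carrier R. (\<forall>p\<in>F. (\<Oplus>k\<in>N. c p k ** z k) = \<zero>) --> (\<forall>p\<in>carrier R. (\<Oplus>k\<in>N. c p k ** z k) = \<zero>)"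
  by blast
 have i: "inv s : carrier R" "s : carrier R" "s ** inv s = \<one>" using s by auto
 have "(%p. inv s ** p) ` F <= carrier R" using i F(1) by auto
 then obtain d where d: "d : Reg" "!!p. p : F ==> inv s ** p ** d : A"
  using common_denominator[of "(%p. inv s ** p) ` F"] F(2) by auto
 have dc: "d : carrier R" using d by auto
 \<comment> \<open>\<open>u_mult\<close> splits \<open>u i j (p ** d)\<close>; the factors of
   \<open>t (p ** d) ** x\<close> that do not involve \<open>p\<close> are collected here.\<close>
 define z :: "(nat \<times> nat) \<times> nat => 'a" where "z k = u (snd k) (snd (fst k)) d ** ka (fst (fst k)) (snd (fst k)) ** x" for k
 have zc: "z : N \<rightarrow> carrier R" unfolding z_def N_def using dc kac x by auto
 have \<Phi>: "(\<Oplus>k\<in>N. c p k ** z k) = t (p ** d) ** x" if p: "p : carrier R" for p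
 proof -
  have "t (p ** d) ** x = (\<Oplus>i. \<Oplus>j. u i j (p ** d) ** ka i j) ** x" using ka(2) p dc by simp
  also have "... = (\<Oplus>i. (\<Oplus>j. u i j (p ** d) ** ka i j) ** x)"
   using p dc kac x by (intro finsum_ldistr) (auto intro!: finsum_closed)
  also have "... = (\<Oplus>i. \<Oplus>j. u i j (p ** d) ** ka i j ** x)"
   using p dc kac x by (intro finsum_cong' finsum_ldistr) (auto intro!: finsum_closed)
  also have "... = (\<Oplus>i. \<Oplus>j. \<Oplus>a. c p ((i, j), a) ** z ((i, j), a))"
  proof (intro finsum_cong' refl)
   fix i j assume ij: "i : {..<r}" "j : {..<r}"
   have "u i j (p ** d) ** ka i j ** x = (\<Oplus>a. u i a p ** u a j d) ** (ka i j ** x)"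
    using ij p dc kac x by (simp add: u_mult m_assoc)
   also have "... = (\<Oplus>a. u i a p ** u a j d ** (ka i j ** x))"
    using ij p dc kac x by (intro finsum_ldistr) auto
   also have "... = (\<Oplus>a. c p ((i, j), a) ** z ((i, j), a))"
    using ij p dc kac x unfolding c_def z_def by (intro finsum_cong') (auto simp: m_assoc)
   finally show "u i j (p ** d) ** ka i j ** x = (\<Oplus>a. c p ((i, j), a) ** z ((i, j), a))" .
  qed (use p dc kac x in \<open>auto simp: c_def z_def intro!: finsum_closed\<close>)
  also have "... = (\<Oplus>ij\<in>{..<r} \<times> {..<r}. \<Oplus>a. c p (ij, a) ** z (ij, a))"
   using p cc zc
   by (intro finsum_cartesian[symmetric, of _ _ "%ij. \<Oplus>a. c p (ij, a) ** z (ij, a)"])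
    (auto simp: N_def Pi_iff intro!: finsum_closed)
  also have "... = (\<Oplus>k\<in>N. c p k ** z k)"
   unfolding N_def using p cc zc
   by (intro finsum_cartesian[symmetric, of _ _ "%k. c p k ** z k"]) (auto simp: N_def Pi_iff)
  finally show ?thesis by simp
 qed
 have "t (p ** d) ** x = \<zero>" if p: "p : F" for p
 proof -
  have pc: "p : carrier R" using p F by blast
  have "p ** d = s ** (inv s ** p ** d)" using i pc dc by (simp add: m_assoc assoc_eq[OF i(3)])
  then show ?thesis using z d(2)[OF p] by simp
 qed
 then have "\<forall>p\<in>F. (\<Oplus>k\<in>N. c p k ** z k) = \<zero>" using \<Phi> F(1) by auto
 then have all: "\<forall>p\<in>carrier R. (\<Oplus>k\<in>N. c p k ** z k) = \<zero>" using F(3) zc by auto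
 \<comment> \<open>The combination vanishes also at \<open>p = inv d\<close>, where it equals
   \<open>t 1 ** x = x\<close>.\<close>
 have dinv: "inv d : carrier R" using d(1) by auto
 have "t (inv d ** d) ** x = \<zero>" using all dinv \<Phi>[OF dinv] by auto
 then show ?thesis using d(1) t_one x by simp
qed

end

section \<open>Invariant regular elements\<close>

context right_order begin

text \<open>If \<open>1 - e\<close> were nonzero, clearing its denominator would give a nonzero
  element of \<open>A\<close> killed by \<open>e\<close>.\<close>

lemma complement_zero:
 assumes e: "e : carrier R" "e ** e = e" and z: "!!y. y : A ==> e ** y = \<zero> ==> y = \<zero>"
 shows "e = \<one>"
proof -
 obtain s where s: "s : Reg" "(\<one> \<ominus> e) ** s : A" using fractions[of "\<one> \<ominus> e"] e by auto
 have sc: "s : carrier R" using s by auto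
 have "e ** (\<one> \<ominus> e) = \<zero>" using e by (simp add: minus_eq r_distr r_minus r_neg)
 then have "e ** ((\<one> \<ominus> e) ** s) = \<zero>" using assoc_eq[of e "\<one> \<ominus> e" \<zero> s] e sc by simp
 then have "(\<one> \<ominus> e) ** s = \<zero>" using z s(2) by blast
 then have "\<one> \<ominus> e = \<zero>" using Reg_cancel_right[OF s(1)] e by auto
 then show ?thesis using e by simp
qed

text \<open>The left ideal \<open>L0 = {l. t(lA)M = 0}\<close> is a stable right ideal of \<open>A\<close> with zero right
 complement, so it contains a regular element.\<close>

lemma integrals_square_zero:
 assumes M: "Arid M" "stable M" and tt: "!!m m'. [|m : M; m' : M|] ==> t m ** t m' = \<zero>"
 shows "M <= {\<zero>}"
proof -
 have MA: "m : A" "m : carrier R" if "m : M" for m using Arid_in[OF M(1) that] by auto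
 have tc: "t x : carrier R" if "x : carrier R" for x using Op_closed[OF t_Op that] .
 define L0 where "L0 = {l : A. \<forall>a\<in>A. \<forall>m\<in>M. t (l ** a) ** m = \<zero>}"
 have L0A: "l : A" "l : carrier R" if "l : L0" for l using that unfolding L0_def by auto
 have L00: "t (l ** a) ** m = \<zero>" if "l : L0" "a : A" "m : M" for l a m
  using that unfolding L0_def by blast
 have AL0: "Arid L0"
 proof (rule AridI)
  show "\<zero> : L0" unfolding L0_def using A_zero MA Op_zero[OF t_Op] by auto
  show "x \<oplus> y : L0" if "x : L0" "y : L0" for x y
   using that A_add MA Op_add[OF t_Op] tc unfolding L0_def by (auto simp: l_distr)
  show "x ** a : L0" if x: "x : L0" and a: "a : A" for x a
  proof -
   have "t (x ** a ** b) ** m = \<zero>" if b: "b : A" and m: "m : M" for b m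
    using L00[OF x A_mult[OF a b] m] L0A[OF x] a b by (simp add: m_assoc)
   then show ?thesis unfolding L0_def using A_mult[OF L0A(1)[OF x] a] by blast
  qed
 qed (use L0A in auto)
 have sL0: "stable L0"
  unfolding stable_def
 proof (intro ballI)
  fix w l assume w: "w : Op" and l: "l : L0"
  show "w l : L0"
  proof (rule Op_in_AridI[OF w L0A(2)[OF l] AL0])
   fix i j assume ij: "i < r" "j < r"
   \<comment> \<open>\<open>t\<close> absorbs the operators \<open>u i e\<close>, so
     \<open>u_move\<close> shifts the operator from \<open>l\<close> to \<open>a\<close>:
     \<open>t (u i j l ** a) = t (l ** v i j a)\<close>.\<close>
   have "t (u i j l ** a) ** m = \<zero>" if a: "a : A" and m: "m : M" for a m
   proof -
    have c: "l : carrier R" "a : carrier R" using L0A[OF l] a by auto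
    have "t (u i j l ** a) = t (\<Oplus>e. u i e (l ** v e j a))" using u_move[OF ij c] by simp
    also have "... = (\<Oplus>e. t (u i e (l ** v e j a)))" using ij c by (intro Op_finsum[OF t_Op]) auto
    also have "... = (\<Oplus>e. if e = i then t (l ** v i j a) else \<zero>)"
     using ij c tc by (intro finsum_cong') (auto simp: t_u)
    also have "... = t (l ** v i j a)" using ij c tc by (intro finsum_delta) auto
    finally show ?thesis using L00[OF l A_Op[OF v_Op[OF ij] a] m] by simp
   qed
   then show "u i j l : L0" unfolding L0_def using A_Op[OF u_Op[OF ij]] L0A(1)[OF l] by blast
  qed
 qed
 obtain f where f: "f : loc L0" "f : invs" "\<forall>y\<in>loc L0. f ** y = y"
  using left_identity[OF right_ideal_loc[OF AL0] stable_loc[OF AL0 sL0]] by blast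
 have fc: "f : carrier R" using invs_carrier f(2) .
 \<comment> \<open>The complement of \<open>L0\<close>, which meets it only in zero. Three kinds of
   elements of \<open>L\<close> are shown to lie in \<open>L0\<close> and hence to vanish: first
   \<open>t l ** t m ** m'\<close>, then \<open>t l ** m\<close>, and finally \<open>l\<close>
   itself.\<close>
 define L where "L = {y : A. f ** y = \<zero>}"
 have LA: "l : A" "l : carrier R" if "l : L" for l using that unfolding L_def by auto
 have Lr: "y ** a : L" if y: "y : L" and a: "a : A" for y a
 proof -
  have "f ** y = \<zero>" using y unfolding L_def by blast
  from assoc_eq[OF this fc LA(2)[OF y], of a] show ?thesis
   unfolding L_def using a A_mult[OF LA(1)[OF y] a] by simp
 qed
 have LL0: "y = \<zero>" if "y : L" "y : L0" for y
  using that f(3) loc_superset[OF AL0] unfolding L_def by auto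
 have tL: "t l : L" if l: "l : L" for l
  using Op_inv_mult(1)[OF t_Op f(2) LA(2)[OF l]] l Op_zero[OF t_Op] A_Op[OF t_Op LA(1)[OF l]] by (simp add: L_def)
 have tM: "t m : M" if "m : M" for m using stableD[OF M(2) t_Op that] .
 have step1: "t l ** t m ** m' = \<zero>" if l: "l : L" and m: "m : M" and m': "m' : M" for l m m'
 proof (rule LL0)
  note c = LA(2)[OF l] MA(2)[OF m] MA(2)[OF m'] tc[OF LA(2)[OF l]] tc[OF MA(2)[OF m]]
  show "t l ** t m ** m' : L" by (rule Lr[OF Lr[OF tL[OF l] MA(1)[OF tM[OF m]]] MA(1)[OF m']])
  then have inA: "t l ** t m ** m' : A" using LA by blast
  have "t (t l ** t m ** m' ** a) ** m'' = \<zero>" if a: "a : A" and m'': "m'' : M" for a m''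
  proof -
   note ma = AridD(4)[OF M(1) m' a]
   have i: "t l ** t m : invs" using invs_mult t_inv c by blast
   have "t (t l ** t m ** m' ** a) = t (t l ** t m ** (m' ** a))" using c a by (simp add: m_assoc)
   also have "... = t l ** t m ** t (m' ** a)" using Op_inv_mult(1)[OF t_Op i MA(2)[OF ma]] .
   also have "... = t l ** (t m ** t (m' ** a))" using c tc[OF MA(2)[OF ma]] by (simp add: m_assoc)
   finally show ?thesis using tt[OF m ma] c MA(2)[OF m''] by simp
  qed
  then show "t l ** t m ** m' : L0" unfolding L0_def using inA by blast
 qed
 have step2: "t l ** m = \<zero>" if l: "l : L" and m: "m : M" for l m
 proof (rule LL0)
  note c = LA(2)[OF l] MA(2)[OF m] tc[OF LA(2)[OF l]]
  show tlm: "t l ** m : L" by (rule Lr[OF tL[OF l] MA(1)[OF m]])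
  have "t (t l ** m ** a) ** m'' = \<zero>" if a: "a : A" and m'': "m'' : M" for a m''
  proof -
   note ma = AridD(4)[OF M(1) m a]
   have "t (t l ** m ** a) = t (t l ** (m ** a))" using c a by (simp add: m_assoc)
   also have "... = t l ** t (m ** a)" using Op_inv_mult(1)[OF t_Op t_inv[OF c(1)] MA(2)[OF ma]] .
   finally show ?thesis using step1[OF l ma m''] by simp
  qed
  then show "t l ** m : L0" unfolding L0_def using LA(1)[OF tlm] by blast
 qed
 have "l = \<zero>" if l: "l : L" for l
  using LA(1)[OF l] step2[OF Lr[OF l]] LL0[OF l] by (auto simp: L0_def)
 then have z: "y = \<zero>" if "y : A" "f ** y = \<zero>" for y using that unfolding L_def by blast
 have "f ** f = f" using f(1,3) by blast
 then have "f = \<one>" using z by (rule complement_zero[OF fc])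
 then obtain s where s: "s : Reg" "s : L0" using f(1) loc_one_iff by auto
 have "m = \<zero>" if m: "m : M" for m
  using trace_faithful[OF s(1) MA(2)[OF m]] L00[OF s(2) _ m] by blast
 then show ?thesis by blast
qed

abbreviation RegI :: "'a set" where "RegI \<equiv> Reg \<inter> invs"

lemma right_ideal_annihilator:
 assumes S: "S <= carrier R" shows "right_ideal {q : carrier R. \<forall>s\<in>S. s ** q = \<zero>} R"
proof (rule right_idealI)
 show "x ** a : {q : carrier R. \<forall>s\<in>S. s ** q = \<zero>}"
  if x: "x : {q : carrier R. \<forall>s\<in>S. s ** q = \<zero>}" and a: "a : carrier R" for x a
 proof -
  have "s ** (x ** a) = \<zero>" if "s : S" for s
   using assoc_eq[of s x \<zero> a] x a that S by auto
  then show ?thesis using x a by simp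
 qed
qed (use S in \<open>auto simp: r_distr subset_iff\<close>)

lemma stable_annihilator:
 assumes "S <= invs" shows "stable {q : carrier R. \<forall>s\<in>S. s ** q = \<zero>}"
 using assms Op_inv_mult(1)[symmetric] Op_zero Op_closed unfolding stable_def by fastforce

text \<open>Choose \<open>x\<close> with \<open>r(x)\<close> minimal among the invariants \<open>x \<in> L\<close> such that
 \<open>xQ \<inter> r(x) = 0\<close>; a nonzero \<open>r(x)\<close> could be decreased by adding an invariant from
 \<open>r(x) \<inter> L\<close>.\<close>

lemma stable_contains_invariant_regular:
 assumes L: "Arid L" "stable L" "L \<inter> Reg ~= {}"
 shows "L \<inter> RegI ~= {}"
proof -
 obtain s where s: "s : L" "s : Reg" using L(3) by blast
 define rt where "rt x = {q : carrier R. \<forall>s\<in>{x}. s ** q = \<zero>}" for x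
 have rtD: "q : rt x \<longleftrightarrow> q : carrier R & x ** q = \<zero>" for q x unfolding rt_def by auto
 have rrt: "right_ideal (rt x) R" "stable (rt x)" if "x : invs" for x
  unfolding rt_def using right_ideal_annihilator[of "{x}"] stable_annihilator[of "{x}"] that invs_carrier by auto
 define P where "P x \<longleftrightarrow> x : L \<inter> invs & (\<forall>q\<in>carrier R. x ** (x ** q) = \<zero> --> x ** q = \<zero>)" for x
 have P0: "P \<zero>" unfolding P_def using AridD(2)[OF L(1)] invs_zero by simp
 have Pi: "x : invs" "x : L" if "P x" for x using that unfolding P_def by auto
 have "\<exists>x. P x & J = rt x ==> right_ideal J R" for J using rrt(1) Pi by blast
 from artinian_minimalE[OF artinian, of "%J. \<exists>x. P x & J = rt x", OF _ this] P0
 obtain x where x: "P x" "!!y. P y ==> rt y <= rt x ==> rt y = rt x" by metis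
 have xc: "x : carrier R" using Pi[OF x(1)] invs_carrier by blast
 have "rt x = {\<zero>}"
 proof (rule ccontr)
  assume ne: "rt x ~= {\<zero>}"
  obtain V where V: "minimal_stable V" "V <= rt x"
   using minimal_stable_exists[OF artinian rrt[OF Pi(1)[OF x(1)]] ne] .
  note VD = minimal_stableD[OF V(1)]
  define M where "M = (V \<inter> A) \<inter> L"
  have M: "Arid M" "stable M" unfolding M_def
   using Arid_Int[OF Arid_trace[OF VD(1)] L(1)] stable_Int[OF stable_trace[OF VD(2)] L(2)] by auto
  obtain y where y: "y : V" "y ~= \<zero>" using VD(1,3) ri_zero by blast
  have yc: "y : carrier R" using ri_in[OF VD(1) y(1)] .
  \<comment> \<open>The regular element \<open>s\<close> of \<open>L\<close> pulls a nonzero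
    multiple of \<open>y\<close> into \<open>L\<close>. So \<open>M\<close> is nonzero, and the
    integrals of its elements cannot all multiply to zero.\<close>
  obtain d b where d: "d : Reg" "b : A" "y ** d = s ** b" using Reg_move[OF s(2) yc] by blast
  have "y ** d : M" unfolding M_def
   using ri_mult[OF VD(1) y(1), of d] AridD(4)[OF L(1) s(1) d(2)] Arid_in[OF L(1)] d(1) unfolding d(3)[symmetric] by blast
  moreover have "y ** d ~= \<zero>" using Reg_cancel_right[OF d(1) yc] y(2) by blast
  ultimately obtain m m' where m: "m : M" "m' : M" "t m ** t m' ~= \<zero>"
   using integrals_square_zero[OF M] by blast
  have MV: "z : V" "z : L" "z : carrier R" if "z : M" for z using that unfolding M_def by auto
  define z where "z = t m"
  define z' where "z' = t m'"
  have z: "z : V" "z : L" "z : carrier R" "z : invs" "z' : V" "z' : carrier R" "z ** z' ~= \<zero>"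
   unfolding z_def z'_def
   using MV[OF stableD[OF M(2) t_Op m(1)]] MV[OF stableD[OF M(2) t_Op m(2)]] m(3)
    t_inv[OF MV(3)[OF m(1)]] by auto
  \<comment> \<open>This stable right ideal inside \<open>V\<close> misses \<open>z'\<close>, so
    minimality of \<open>V\<close> makes it zero.\<close>
  have W: "rt z \<inter> V = {\<zero>}"
   using VD(4) right_ideal_Int[OF rrt(1)[OF z(4)] VD(1)] stable_Int[OF rrt(2)[OF z(4)] VD(2)] z(5) z(7) rtD[of z' z] by auto
  have xV: "x ** q = \<zero>" if "q : V" for q using rtD[of q x] subsetD[OF V(2) that] by blast
  have Vc: "q : carrier R" if "q : V" for q using ri_in[OF VD(1) that] .
  have zV: "z ** q : V" if "q : carrier R" for q using ri_mult[OF VD(1) z(1) that] .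
  have e: "(x \<oplus> z) ** q = x ** q \<oplus> z ** q" if "q : carrier R" for q
   using that xc z(3) by (simp add: l_distr)
  \<comment> \<open>\<open>z ** q\<close> lies in \<open>V\<close>, which \<open>x\<close> kills. If
    \<open>x ** q\<close> is its negative, then \<open>x ** q\<close> lies both in \<open>xQ\<close>
    and in \<open>r(x)\<close>, and \<open>P x\<close> makes it zero.\<close>
  have key: "x ** q = \<zero> & z ** q = \<zero>" if q: "q : carrier R" and xz: "(x \<oplus> z) ** q = \<zero>" for q
   using xz q xc z(3) ri_uminus[OF VD(1) zV[OF q]] xV x(1) minus_equality by (auto simp: e[OF q] P_def)
  have "P (x \<oplus> z)"
   unfolding P_def
  proof (intro conjI ballI impI)
   show "x \<oplus> z : L \<inter> invs" using AridD(3)[OF L(1)] invs_add Pi[OF x(1)] z by blast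
   fix q assume q: "q : carrier R" and 0: "(x \<oplus> z) ** ((x \<oplus> z) ** q) = \<zero>"
   have c: "(x \<oplus> z) ** q : carrier R" using q xc z(3) by simp
   have "x ** ((x \<oplus> z) ** q) = x ** (x ** q)"
    unfolding e[OF q] using xV[OF zV[OF q]] q xc z(3) by (simp add: r_distr)
   then have "x ** (x ** q) = \<zero>" using key[OF c 0] by simp
   then have xq: "x ** q = \<zero>" using x(1) q unfolding P_def by blast
   then have eq: "(x \<oplus> z) ** q = z ** q" using e[OF q] q z(3) by simp
   then have "z ** (z ** q) = \<zero>" using key[OF c 0] by simp
   then have "z ** q : rt z \<inter> V" using zV[OF q] Vc[OF zV[OF q]] rtD[of "z ** q" z] by simp
   then have "z ** q = \<zero>" unfolding W by simp
   then show "(x \<oplus> z) ** q = \<zero>" using eq by (rule trans[rotated])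
  qed
  moreover have "rt (x \<oplus> z) <= rt x"
   using rtD key rtD[of q x] by auto
  ultimately have "rt (x \<oplus> z) = rt x" by (rule x(2))
  moreover have "z' : rt x" using V(2) z(5) by blast
  ultimately have "z' : rt (x \<oplus> z)" by simp
  then show False using key[OF z(6)] z(7) rtD[of z' "x \<oplus> z"] by blast
 qed
 then have z: "q = \<zero>" if "q : carrier R" "x ** q = \<zero>" for q using rtD[of q x] that by simp
 have "x : Units R" by (rule injective_unit[OF artinian xc z])
 then show ?thesis using Pi[OF x(1)] Arid_in[OF L(1)] by blast
qed

section \<open>Largest stable right ideals and essentiality\<close>

definition core :: "'a set => 'a set" where "core I = {x : I. \<forall>w\<in>Op. w x : I}"

lemma core_subset: "core I <= I"
 unfolding core_def by blast

lemma Arid_core: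
 assumes I: "Arid I" shows "Arid (core I)"
proof (rule AridI)
 note D = AridD[OF I]
 have c: "x : carrier R" if "x : core I" for x
  using that Arid_in[OF I] unfolding core_def by auto
 show "core I <= A" using D(1) unfolding core_def by blast
 have "w \<zero> : I" if w: "w : Op" for w unfolding Op_zero[OF w] by (rule D(2))
 then show "\<zero> : core I" unfolding core_def using D(2) by blast
 show "x \<oplus> y : core I" if "x : core I" "y : core I" for x y
 proof -
  have "w (x \<oplus> y) : I" if w: "w : Op" for w
   unfolding Op_add[OF w c[OF `x : core I`] c[OF `y : core I`]]
   using D(3) w `x : core I` `y : core I` unfolding core_def by blast
  then show ?thesis using D(3) that unfolding core_def by blast
 qed
 show "x ** a : core I" if x: "x : core I" and a: "a : A" for x a
 proof -
  have "w (x ** a) : I" if w: "w : Op" for w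
  proof (rule Op_in_AridI[OF w _ I])
   show "x ** a : carrier R" using c[OF x] a by simp
   fix i j assume ij: "i < r" "j < r"
   have "u i j (x ** a) = (\<Oplus>e. u i e x ** u e j a)" using u_mult[OF ij c[OF x]] a by simp
   also have "... : I"
    by (intro Arid_finsum[OF I] D(4)) (use x a ij u_Op A_Op in \<open>auto simp: core_def\<close>)
   finally show "u i j (x ** a) : I" .
  qed
  then show ?thesis using D(4) x a unfolding core_def by blast
 qed
qed

lemma stable_core:
 assumes I: "Arid I" shows "stable (core I)"
 unfolding stable_def
proof (intro ballI)
 fix w x assume w: "w : Op" and x: "x : core I"
 have xc: "x : carrier R" using x Arid_in[OF I] unfolding core_def by auto
 have "w' (w x) : I" if w': "w' : Op" for w'
  using Op_comp[OF w' w] x xc by (auto simp: core_def)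
 then show "w x : core I" using w x unfolding core_def by blast
qed

lemma core_regular:
 assumes I: "Arid I" "I \<inter> Reg ~= {}" shows "core I \<inter> Reg ~= {}"
proof -
 obtain s where s: "s : I" "s : Reg" using I(2) by blast
 obtain c where c: "c : Reg" "\<forall>w\<in>Op. \<exists>b\<in>A. w c = s ** b" using Reg_stable_multiple[OF s(2)] by blast
 have wc: "w c : I" if "w : Op" for w using c(2) that AridD(4)[OF I(1) s(1)] by fastforce
 obtain w where "w : Op" "w c = c" using Op_id c(1) A_in by blast
 then have "c : core I" unfolding core_def using wc by force
 then show ?thesis using c(1) by blast
qed

lemma contains_invariant_regular:
 assumes I: "Arid I" "I \<inter> Reg ~= {}" shows "I \<inter> RegI ~= {}"
 using stable_contains_invariant_regular[OF Arid_core[OF I(1)] stable_core[OF I(1)] core_regular[OF I]]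
  core_subset by blast

text \<open>Let \<open>e\<close> be the invariant left identity of the extension of an essential
  core. The right annihilator of \<open>e\<close> in \<open>A\<close> meets the core in zero, so it
  is zero; then \<open>e = 1\<close>, and the core contains a regular element. The converse is the
  Ore condition for a regular element of the core.\<close>

lemma core_essential_iff:
 assumes I: "Arid I"
 shows "(\<forall>J. Arid J & J ~= {\<zero>} --> core I \<inter> J ~= {\<zero>}) \<longleftrightarrow> I \<inter> Reg ~= {}"
proof
 note C = Arid_core[OF I] and sC = stable_core[OF I]
 assume ess: "\<forall>J. Arid J & J ~= {\<zero>} --> core I \<inter> J ~= {\<zero>}"
 obtain e where e: "e : loc (core I)" "e : invs" "\<forall>y\<in>loc (core I). e ** y = y"
  using left_identity[OF right_ideal_loc[OF C] stable_loc[OF C sC]] by blast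
 have ec: "e : carrier R" using invs_carrier e(2) .
 define J where "J = {q : carrier R. \<forall>s\<in>{e}. s ** q = \<zero>} \<inter> A"
 have J: "Arid J" unfolding J_def using ec by (intro Arid_trace right_ideal_annihilator) auto
 have JD: "y : J \<longleftrightarrow> y : A & e ** y = \<zero>" for y unfolding J_def by auto
 have "y = \<zero>" if y: "y : core I" "y : J" for y
  using e(3) loc_superset[OF C] y(1) JD[of y] y(2) by auto
 then have "core I \<inter> J = {\<zero>}" using AridD(2)[OF C] AridD(2)[OF J] by blast
 then have "J = {\<zero>}" using ess J by blast
 then have z: "y = \<zero>" if "y : A" "e ** y = \<zero>" for y using that JD[of y] by simp
 have "e ** e = e" using e(1,3) by blast
 then have "e = \<one>" using z by (rule complement_zero[OF ec])
 then have "core I \<inter> Reg ~= {}" using e(1) loc_one_iff by simp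
 then show "I \<inter> Reg ~= {}" using core_subset by blast
next
 assume "I \<inter> Reg ~= {}"
 then obtain c where c: "c : core I" "c : Reg" using core_regular[OF I] by blast
 show "\<forall>J. Arid J & J ~= {\<zero>} --> core I \<inter> J ~= {\<zero>}"
 proof (intro allI impI, elim conjE)
  fix J assume J: "Arid J" and ne: "J ~= {\<zero>}"
  obtain y where y: "y : J" "y ~= \<zero>" using ne AridD(2)[OF J] by blast
  have yc: "y : carrier R" using Arid_in[OF J y(1)] by simp
  obtain d b where d: "d : Reg" "b : A" "y ** d = c ** b" using Reg_move[OF c(2) yc] by blast
  have "y ** d : J" using AridD(4)[OF J y(1)] d(1) by blast
  moreover have "y ** d : core I" unfolding d(3) using AridD(4)[OF Arid_core[OF I] c(1) d(2)] .
  moreover have "y ** d ~= \<zero>" using Reg_cancel_right[OF d(1) yc] y(2) by blast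
  ultimately show "core I \<inter> J ~= {\<zero>}" by blast
 qed
qed

section \<open>Invariant denominators and annihilators of invariants\<close>

lemma invariant_common_denominator:
 assumes "finite F" "F <= carrier R" shows "\<exists>s\<in>RegI. \<forall>q\<in>F. q ** s : A"
proof -
 define I where "I = {a : A. \<forall>q\<in>F. q ** a : A}"
 have "Arid I"
 proof (rule AridI)
  show "x ** a : I" if x: "x : I" and a: "a : A" for x a
   using that x a assms(2) A_mult by (fastforce simp: m_assoc subset_iff I_def)
 qed (use assms A_zero A_add in \<open>auto simp: I_def r_distr subset_iff\<close>)
 moreover have "I \<inter> Reg ~= {}" unfolding I_def using common_denominator[OF assms] by blast
 ultimately show ?thesis using contains_invariant_regular unfolding I_def by blast
qed

lemma invariant_denominator:
 assumes "q : carrier R" shows "\<exists>s\<in>RegI. q ** s : A"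
 using invariant_common_denominator[of "{q}"] assms by auto

lemma inv_invs:
 assumes s: "s : RegI" shows "inv s : invs"
proof -
 have i: "inv s : carrier R" "s : carrier R" "s ** inv s = \<one>" using s by auto
 have "u i j (inv s) = (if i = j then inv s else \<zero>)" if ij: "i < r" "j < r" for i j
 proof -
  have "s ** u i j (inv s) = u i j \<one>" using u_inv_mult[OF _ i(1) ij, of s] s i(3) by simp
  also have "... = s ** (if i = j then inv s else \<zero>)" using u_one[OF ij] i by simp
  finally have e: "s ** u i j (inv s) = s ** (if i = j then inv s else \<zero>)" .
  have c: "u i j (inv s) : carrier R" "(if i = j then inv s else \<zero>) : carrier R" using i ij by auto
  show ?thesis using Units_l_cancel[OF _ c] e s by blast
 qed
 then show ?thesis unfolding invs_def using i by blast
qed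

lemma annihilator_left_identity:
 assumes S: "S <= invs"
 obtains e where "e : invs" "\<forall>s\<in>S. s ** e = \<zero>"
  "!!q. [|q : carrier R; \<forall>s\<in>S. s ** q = \<zero>|] ==> e ** q = q"
proof -
 have Sc: "S <= carrier R" using S invs_carrier by blast
 show ?thesis using left_identity[OF right_ideal_annihilator[OF Sc] stable_annihilator[OF S]] that by blast
qed

text \<open>The annihilator of \<open>x\<close> in the quotient ring has an invariant left identity
  \<open>e\<close>. Some multiple \<open>e ** s\<close> by an invariant regular \<open>s\<close>
  lies in \<open>A\<close>, so testing against the invariants of \<open>A\<close> already gives
  \<open>e = 0\<close>.\<close>

lemma invariant_regular:
 assumes x: "x : invs" "x : A" and inj: "!!y. [|y : A; y : invs; x ** y = \<zero>|] ==> y = \<zero>"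
 shows "x : RegI"
proof -
 have xc: "x : carrier R" using x by simp
 obtain e where e: "e : invs" "\<forall>s\<in>{x}. s ** e = \<zero>"
  "!!q. [|q : carrier R; \<forall>s\<in>{x}. s ** q = \<zero>|] ==> e ** q = q"
  using annihilator_left_identity[of "{x}"] x(1) by auto
 have ec: "e : carrier R" using invs_carrier e(1) .
 obtain s where s: "s : RegI" "e ** s : A" using invariant_denominator[OF ec] by blast
 have "x ** (e ** s) = \<zero>" using assoc_eq[of x e \<zero> s] e(2) xc ec s(1) by auto
 then have "e ** s = \<zero>" using inj s e(1) invs_mult by blast
 then have "e = \<zero>" using Reg_cancel_right[of s e] ec s(1) by blast
 then have "q = \<zero>" if "q : carrier R" "x ** q = \<zero>" for q using e(3)[of q] that by auto
 then have "x : Units R" by (rule injective_unit[OF artinian xc])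
 then show ?thesis using x by blast
qed

text \<open>\<open>xA\<close> is stable since \<open>x\<close> is invariant, and
  \<open>t (x a) t (x b) = x (t a) x (t b) = 0\<close>, so \<open>integrals_square_zero\<close>
  applies.\<close>

lemma invariant_semiprime:
 assumes x: "x : invs" "x : A" and z: "!!y. [|y : A; y : invs|] ==> x ** y ** x = \<zero>"
 shows "x = \<zero>"
proof -
 have xc: "x : carrier R" using x by simp
 define M where "M = (%a. x ** a) ` A"
 have "Arid M"
 proof (rule AridI)
  show "M <= A" unfolding M_def using x(2) A_mult by blast
  show "\<zero> : M" unfolding M_def using A_zero xc by force
  fix y a assume y: "y : M"
  then obtain b where b: "b : A" "y = x ** b" unfolding M_def by blast
  show "y ** a : M" if "a : A"
   unfolding M_def using b that xc A_mult by (intro image_eqI[of _ _ "b ** a"]) (auto simp: m_assoc)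
  assume "a : M"
  then obtain c where c: "c : A" "a = x ** c" unfolding M_def by blast
  show "y \<oplus> a : M"
   unfolding M_def using b c xc A_add by (intro image_eqI[of _ _ "b \<oplus> c"]) (auto simp: r_distr)
 qed
 moreover have "stable M"
  unfolding stable_def
 proof (intro ballI)
  fix w y assume w: "w : Op" and "y : M"
  then obtain a where a: "a : A" "y = x ** a" unfolding M_def by blast
  then have "w y = x ** w a" using Op_inv_mult(1)[OF w x(1)] by simp
  then show "w y : M" unfolding M_def using A_Op[OF w a(1)] by blast
 qed
 moreover have "t m ** t m' = \<zero>" if m: "m : M" "m' : M" for m m'
 proof -
  obtain a b where ab: "a : A" "m = x ** a" "b : A" "m' = x ** b" using m unfolding M_def by blast
  have c: "t a : carrier R" "t b : carrier R" using ab Op_closed[OF t_Op] by auto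
  have "t m ** t m' = x ** t a ** x ** t b"
   using ab Op_inv_mult(1)[OF t_Op x(1)] c xc by (simp add: m_assoc)
  then show ?thesis using z[OF A_Op[OF t_Op ab(1)] t_inv] ab(1) c by simp
 qed
 ultimately have "M <= {\<zero>}" by (rule integrals_square_zero)
 then show ?thesis using A_one xc unfolding M_def by force
qed

lemma invariant_ore:
 assumes a: "a : A" and s: "s : RegI"
 shows "\<exists>b\<in>A. \<exists>s'\<in>RegI. a ** s' = s ** b"
proof -
 have i: "inv s : carrier R" "s : carrier R" "s ** inv s = \<one>" using s by auto
 obtain s' where s': "s' : RegI" "inv s ** a ** s' : A" using invariant_denominator[of "inv s ** a"] i a by auto
 have c: "s' : carrier R" "a : carrier R" using s' a by auto
 have "a ** s' = s ** (inv s ** a ** s')"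
  using i c by (simp add: m_assoc assoc_eq[OF i(3)])
 then show ?thesis using s' by blast
qed

text \<open>With \<open>e\<close>, \<open>e'\<close> left identities of the annihilators of \<open>S n\<close> and of a later \<open>S m\<close>,
 the element \<open>e + e' - ee'\<close> is a left identity of the latter, and
 \<open>1 - (e + e' - ee') = (1 - e)(1 - e')\<close>.\<close>

lemma invariant_annihilator_acc:
 fixes S :: "nat => 'a set"
 defines "an \<equiv> %n. {y : A \<inter> invs. \<forall>s\<in>S n. s ** y = \<zero>}"
 assumes S: "!!n. S n <= A \<inter> invs" and asc: "!!n. an n <= an (Suc n)"
 shows "\<exists>N. \<forall>n\<ge>N. an n = an N"
proof -
 have mono: "an m <= an n" if "m <= n" for m n using lift_Suc_mono_le[of an, OF asc that] .
 have Sc: "s : carrier R" "s : invs" if "s : S n" for s n using subsetD[OF S that] by auto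
 define lid where "lid n e \<longleftrightarrow> e : invs & (\<forall>s\<in>S n. s ** e = \<zero>) &
  (\<forall>q\<in>carrier R. (\<forall>s\<in>S n. s ** q = \<zero>) --> e ** q = q)" for n e
 have ex: "\<exists>e. lid n e" for n
  using annihilator_left_identity[of "S n"] S unfolding lid_def by (metis Int_subset_iff)
 \<comment> \<open>A multiple \<open>e ** d\<close> by an invariant regular \<open>d\<close> belongs
   to \<open>an n\<close>, hence to \<open>an m\<close>; cancelling \<open>d\<close> shows that
   \<open>S m\<close> kills \<open>e\<close> as well.\<close>
 have up: "s ** e = \<zero>" if le: "n <= m" and e: "lid n e" and s: "s : S m" for n m e s
 proof -
  have ec: "e : carrier R" "e : invs" using e invs_carrier unfolding lid_def by auto
  obtain d where d: "d : RegI" "e ** d : A" using invariant_denominator[OF ec(1)] by blast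
  have dc: "d : carrier R" "d : invs" using d by auto
  have "s' ** (e ** d) = \<zero>" if "s' : S n" for s'
   using assoc_eq[of s' e \<zero> d] e that Sc[OF that] ec dc unfolding lid_def by auto
  then have "e ** d : an n" unfolding an_def using d(2) invs_mult[OF ec(2) dc(2)] by blast
  then have "s ** (e ** d) = \<zero>" using mono[OF le] s unfolding an_def by blast
  then have "s ** e ** d = \<zero>" using Sc[OF s] ec dc by (simp add: m_assoc)
  then show ?thesis using Reg_cancel_right[of d "s ** e"] d Sc[OF s] ec by blast
 qed
 \<comment> \<open>The annihilators ascend, so the descending chain condition is used for the
   complements \<open>pr (1 - e)\<close>.\<close>
 have "\<exists>n e. lid n e & J = pr (\<one> \<ominus> e) ==> right_ideal J R" for J
  using right_ideal_pr invs_carrier unfolding lid_def by (metis minus_closed one_closed)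
 from artinian_minimalE[OF artinian, of "%J. \<exists>n e. lid n e & J = pr (\<one> \<ominus> e)", OF _ this] ex
 obtain N e where e: "lid N e" "!!n e'. lid n e' ==> pr (\<one> \<ominus> e') <= pr (\<one> \<ominus> e) ==> pr (\<one> \<ominus> e') = pr (\<one> \<ominus> e)"
  by metis
 have ec: "e : carrier R" "e : invs" using e(1) invs_carrier unfolding lid_def by auto
 have "an n = an N" if n: "N <= n" for n
 proof (rule antisym[OF _ mono[OF n]])
  obtain e' where e': "lid n e'" using ex by blast
  have e'c: "e' : carrier R" "e' : invs" using e' invs_carrier unfolding lid_def by auto
  define g where "g = e \<oplus> (e' \<ominus> e ** e')"
  have gc: "g : carrier R" unfolding g_def using ec e'c by simp
  have se: "s ** e = \<zero>" if "s : S n" for s using up[OF n e(1) that] .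
  have gl: "g ** y = y" if y: "y : carrier R" "\<forall>s\<in>S n. s ** y = \<zero>" for y
   using e' y ec(1) e'c(1) y(1) by (simp add: l_distr minus_eq l_minus m_assoc a_lcomm r_neg lid_def g_def)
  have "s ** g = \<zero>" if s: "s : S n" for s
   using e' s assoc_eq[OF se[OF s]] Sc[OF s] ec e'c se[OF s] by (simp add: r_distr minus_eq r_minus lid_def g_def)
  moreover have "g : invs"
   unfolding g_def by (intro invs_add invs_minus invs_mult ec(2) e'c(2))
  ultimately have lg: "lid n g" unfolding lid_def using gl by blast
  have "\<one> \<ominus> g = (\<one> \<ominus> e) ** (\<one> \<ominus> e')"
   unfolding g_def using ec(1) e'c(1)
   by (simp add: minus_eq l_distr r_distr l_minus r_minus minus_add a_ac)
  then have "\<one> \<ominus> g : pr (\<one> \<ominus> e)" unfolding pr_def using ec e'c by auto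
  then have "pr (\<one> \<ominus> g) <= pr (\<one> \<ominus> e)" using pr_least right_ideal_pr ec by simp
  then have "pr (\<one> \<ominus> g) = pr (\<one> \<ominus> e)" using e(2)[OF lg] by blast
  then have "\<one> \<ominus> e : pr (\<one> \<ominus> g)" using pr_self[of "\<one> \<ominus> e"] ec by auto
  then obtain a where a: "a : carrier R" "\<one> \<ominus> e = (\<one> \<ominus> g) ** a" unfolding pr_def by blast
  have "g ** g = g" using gl gc lg unfolding lid_def by blast
  then have "g ** (\<one> \<ominus> g) = \<zero>" using gc by (simp add: minus_eq r_distr r_minus r_neg)
  then have "g ** (\<one> \<ominus> e) = \<zero>" unfolding a(2) using assoc_eq[of g "\<one> \<ominus> g" \<zero> a] gc a(1) by simp
  then have ge: "g \<ominus> g ** e = \<zero>" using gc ec by (simp add: minus_eq r_distr r_minus)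
  then have ge: "g = g ** e" using gc ec by simp
  show "an n <= an N"
  proof
   fix y assume y: "y : an n"
   have yc: "y : carrier R" "\<forall>s\<in>S n. s ** y = \<zero>" using y unfolding an_def by auto
   have "s ** (e ** y) = \<zero>" if "s : S n" for s
    using assoc_eq[OF se[OF that]] Sc[OF that] ec yc by simp
   then have "e ** y = g ** (e ** y)" using gl[of "e ** y"] ec yc(1) by simp
   also have "... = g ** y" using assoc_eq[OF ge[symmetric] gc ec(1) yc(1)] by simp
   also have "... = y" using gl yc by blast
   finally have ey: "e ** y = y" .
   have "s ** y = \<zero>" if "s : S N" for s
    using assoc_eq[of s e \<zero> y] e(1) that Sc[OF that] ec yc ey unfolding lid_def by auto
   then show "y : an N" using y unfolding an_def by blast
  qed
 qed
 then show ?thesis by blast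
qed

text \<open>Nonzero elements \<open>x i\<close> of the right ideals \<open>f i\<close> yield a relation
 \<open>x N = \<Sum>\<^sub>i\<^sub>>\<^sub>N x i q i\<close> over the artinian ring; applying \<open>t\<close> and clearing denominators turns
 it into a relation with invariant coefficients from \<open>A\<close>.\<close>

lemma no_infinite_independent_invariants:
 fixes f :: "nat => 'a set"
 assumes f: "!!n. f n <= A \<inter> invs" and fm: "!!n x y. [|x : f n; y : A \<inter> invs|] ==> x ** y : f n"
  and ind: "!!N x. [|!!i. i < N ==> x i : f i; (\<Oplus>i\<in>{..<N}. x i) = \<zero>|] ==> \<forall>i<N. x i = \<zero>"
 shows "\<exists>n. f n <= {\<zero>}"
proof (rule ccontr)
 assume "~ ?thesis"
 then have "\<forall>n. \<exists>y. y : f n & y ~= \<zero>" by blast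
 then obtain x :: "nat => 'a" where x: "!!n. x n : f n" "!!n. x n ~= \<zero>" by metis
 have xc: "x n : carrier R" "x n : invs" for n using subsetD[OF f x(1)] by auto
 \<comment> \<open>A finite combination of the \<open>x i\<close> with \<open>i >= n\<close> is
   coded by a coefficient sequence that vanishes below \<open>n\<close> and has constant partial
   sums from \<open>m0\<close> on.\<close>
 let ?rep = "%n z q m0. (\<forall>i. q i : carrier R) & (\<forall>i<n. q i = \<zero>) & (\<forall>m\<ge>m0. (\<Oplus>i\<in>{..<m}. x i ** q i) = z)"
 have rep_add: "?rep n (y \<oplus> z) (%i. q i \<oplus> q' i) (max m m')"
  if "?rep n y q m" "?rep n z q' m'" for n y z q q' and m m' :: nat
 proof (intro conjI allI impI)
  fix k assume k: "max m m' <= k"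
  have "(\<Oplus>i\<in>{..<k}. x i ** (q i \<oplus> q' i)) = (\<Oplus>i\<in>{..<k}. x i ** q i \<oplus> x i ** q' i)"
   using that xc by (intro finsum_cong') (auto simp: r_distr)
  also have "... = (\<Oplus>i\<in>{..<k}. x i ** q i) \<oplus> (\<Oplus>i\<in>{..<k}. x i ** q' i)"
   using that xc by (intro finsum_addf) auto
  also have "... = y \<oplus> z" using that k by simp
  finally show "(\<Oplus>i\<in>{..<k}. x i ** (q i \<oplus> q' i)) = y \<oplus> z" .
 qed (use that in auto)
 have rep_mult: "?rep n (x j ** a) (%i. if i = j then a else \<zero>) (Suc j)"
  if "n <= j" "a : carrier R" for n j a
 proof (intro conjI allI impI)
  fix k assume k: "Suc j <= k"
  have "(\<Oplus>i\<in>{..<k}. x i ** (if i = j then a else \<zero>)) = (\<Oplus>i\<in>{..<k}. if i = j then x j ** a else \<zero>)"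
   using that xc by (intro finsum_cong') auto
  also have "... = x j ** a" using that xc k by (intro finsum_delta) auto
  finally show "(\<Oplus>i\<in>{..<k}. x i ** (if i = j then a else \<zero>)) = x j ** a" .
 qed (use that in auto)
 have rep: "\<exists>q m. ?rep n z q m" if "z : rspan (x ` {n..})" for z n
  using that
 proof induction
  case rspan_zero
  have "(\<Oplus>i\<in>{..<k}. x i ** \<zero>) = \<zero>" for k :: nat using xc by (intro add.finprod_one_eqI) auto
  then show ?case by (intro exI[of _ "%_. \<zero>"] exI[of _ 0]) auto
 next
  case (rspan_mult s a)
  obtain j where j: "n <= j" "s = x j" using rspan_mult(1) by auto
  show ?case unfolding j(2) by (intro exI) (rule rep_mult[OF j(1) rspan_mult(2)])
 next
  case (rspan_add y z)
  then obtain q m q' m' where "?rep n y q m" "?rep n z q' m'" by blast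
  from rep_add[OF this] show ?case by (intro exI)
 qed
 have xS: "x ` {n..} <= carrier R" for n using xc by auto
 have "right_ideal J R" if "\<exists>n. J = rspan (x ` {n..})" for J using that right_ideal_rspan[OF xS] by blast
 from artinian_minimalE[OF artinian, of "%J. \<exists>n. J = rspan (x ` {n..})", OF _ this]
 obtain J where J: "\<exists>n. J = rspan (x ` {n..})" "!!J'. \<exists>n. J' = rspan (x ` {n..}) ==> J' <= J ==> J' = J" by blast
 then obtain N where N: "J = rspan (x ` {N..})" by blast
 have "x ` {Suc N..} <= x ` {N..}" by auto
 then have "rspan (x ` {Suc N..}) <= J" unfolding N by (rule rspan_mono) (rule xS)
 then have "rspan (x ` {Suc N..}) = rspan (x ` {N..})" using J(2) unfolding N by blast
 moreover have "x N : rspan (x ` {N..})" using rspan_superset[OF xS] by auto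
 ultimately have "x N : rspan (x ` {Suc N..})" by simp
 from rep[OF this] obtain q m where q: "?rep (Suc N) (x N) q m" by blast
 \<comment> \<open>The relation is normalized to have the coefficient \<open>-1\<close> at
   \<open>N\<close>. This is fixed by \<open>t\<close>, so the relation stays nontrivial when
   \<open>t\<close> is applied.\<close>
 define p where "p i = q i \<oplus> (if i = N then \<ominus> \<one> else \<zero>)" for i
 have pc: "p i : carrier R" for i using q unfolding p_def by auto
 define k where "k = max m (Suc N)"
 have Nk: "N < k" unfolding k_def by simp
 have "x N \<oplus> x N ** \<ominus> \<one> = (\<Oplus>i\<in>{..<k}. x i ** p i)"
 proof -
  have "?rep N (x N) q m" using q by auto
  moreover have "?rep N (x N ** \<ominus> \<one>) (%i. if i = N then \<ominus> \<one> else \<zero>) (Suc N)"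
   by (rule rep_mult) auto
  ultimately have "\<forall>n\<ge>k. (\<Oplus>i\<in>{..<n}. x i ** p i) = x N \<oplus> x N ** \<ominus> \<one>"
   unfolding p_def k_def by (rule rep_add[THEN conjunct2, THEN conjunct2])
  then show ?thesis by simp
 qed
 then have p0: "(\<Oplus>i\<in>{..<k}. x i ** p i) = \<zero>" using xc(1)[of N] by (simp add: r_minus r_neg)
 have tc: "t (p i) : carrier R" "t (p i) : invs" for i using t_inv[OF pc] invs_carrier by auto
 have tN: "t (p N) = \<ominus> \<one>" using q t_id[OF invs_uminus[OF invs_one]] unfolding p_def by simp
 obtain d where d: "d : RegI" "\<forall>y\<in>(%i. t (p i)) ` {..<k}. y ** d : A"
  using invariant_common_denominator[of "(%i. t (p i)) ` {..<k}"] tc by auto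
 have dc: "d : carrier R" "d : invs" using d by auto
 have "\<forall>i<k. x i ** (t (p i) ** d) = \<zero>"
 proof (rule ind)
  fix i assume "i < k"
  then have "t (p i) ** d : A \<inter> invs" using d(2) invs_mult[OF tc(2) dc(2)] by blast
  then show "x i ** (t (p i) ** d) : f i" by (rule fm[OF x(1)])
 next
  have "(\<Oplus>i\<in>{..<k}. x i ** (t (p i) ** d)) = (\<Oplus>i\<in>{..<k}. t (x i ** p i) ** d)"
   using xc tc dc pc Op_inv_mult(1)[OF t_Op xc(2) pc] by (intro finsum_cong') (auto simp: m_assoc)
  also have "... = (\<Oplus>i\<in>{..<k}. t (x i ** p i)) ** d"
   using xc pc dc Op_closed[OF t_Op] by (intro finsum_ldistr[symmetric]) auto
  also have "(\<Oplus>i\<in>{..<k}. t (x i ** p i)) = t (\<Oplus>i\<in>{..<k}. x i ** p i)"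
   using xc pc by (intro Op_finsum[OF t_Op, symmetric]) auto
  also have "... = \<zero>" unfolding p0 by (rule Op_zero[OF t_Op])
  finally show "(\<Oplus>i\<in>{..<k}. x i ** (t (p i) ** d)) = \<zero>" using dc by simp
 qed
 then have "x N ** (\<ominus> \<one> ** d) = \<zero>" using Nk tN by auto
 then have "x N ** d = \<zero>" using xc(1)[of N] dc(1) by (simp add: l_minus r_minus)
 then have "x N = \<zero>" using Reg_cancel_right[of d "x N"] d(1) xc(1) by blast
 then show False using x(2) by blast
qed

end

section \<open>Tensor products\<close>

definition balanced ::
  "('k, 'm) ring_scheme => ('k, 'a, 'n) module_scheme => ('k, 'b, 'p) module_scheme \<Rightarrow>
  ('g, 'q) monoid_scheme => ('a => 'b => 'g) => bool" where
 "balanced K V W G f \<longleftrightarrow> comm_group G & (\<forall>x\<in>carrier V. \<forall>y\<in>carrier W. f x y : carrier G) &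
  (\<forall>x\<in>carrier V. \<forall>x'\<in>carrier V. \<forall>y\<in>carrier W. f (x \<oplus>\<^bsub>V\<^esub> x') y = f x y **\<^bsub>G\<^esub> f x' y) &
  (\<forall>x\<in>carrier V. \<forall>y\<in>carrier W. \<forall>y'\<in>carrier W. f x (y \<oplus>\<^bsub>W\<^esub> y') = f x y **\<^bsub>G\<^esub> f x y') &
  (\<forall>c\<in>carrier K. \<forall>x\<in>carrier V. \<forall>y\<in>carrier W. f (c \<odot>\<^bsub>V\<^esub> x) y = f x (c \<odot>\<^bsub>W\<^esub> y))"

lemma balancedI:
 assumes "comm_group G" "!!x y. [|x : carrier V; y : carrier W|] ==> f x y : carrier G"
  and "!!x x' y. [|x : carrier V; x' : carrier V; y : carrier W|] ==> f (x \<oplus>\<^bsub>V\<^esub> x') y = f x y **\<^bsub>G\<^esub> f x' y"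
  and "!!x y y'. [|x : carrier V; y : carrier W; y' : carrier W|] ==> f x (y \<oplus>\<^bsub>W\<^esub> y') = f x y **\<^bsub>G\<^esub> f x y'"
  and "!!c x y. [|c : carrier K; x : carrier V; y : carrier W|] ==> f (c \<odot>\<^bsub>V\<^esub> x) y = f x (c \<odot>\<^bsub>W\<^esub> y)"
 shows "balanced K V W G f"
 using assms unfolding balanced_def by blast

lemma balancedD:
 assumes "balanced K V W G f"
 shows "comm_group G" "!!x y. [|x : carrier V; y : carrier W|] ==> f x y : carrier G"
  "!!x x' y. [|x : carrier V; x' : carrier V; y : carrier W|] ==> f (x \<oplus>\<^bsub>V\<^esub> x') y = f x y **\<^bsub>G\<^esub> f x' y"
  "!!x y y'. [|x : carrier V; y : carrier W; y' : carrier W|] ==> f x (y \<oplus>\<^bsub>W\<^esub> y') = f x y **\<^bsub>G\<^esub> f x y'"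
  "!!c x y. [|c : carrier K; x : carrier V; y : carrier W|] ==> f (c \<odot>\<^bsub>V\<^esub> x) y = f x (c \<odot>\<^bsub>W\<^esub> y)"
 using assms unfolding balanced_def by auto

lemma hom_finprod:
 assumes h: "h : hom G G'" and G: "comm_group G" and G': "comm_group G'"
  and A: "finite A" and f: "!!i. i : A ==> f i : carrier G"
 shows "h (finprod G f A) = finprod G' (%i. h (f i)) A"
proof -
 interpret G: comm_group G by fact
 interpret G': comm_group G' by fact
 interpret group_hom G G' h using h by unfold_locales
 show ?thesis using A f by (induction A rule: finite_induct) (auto simp: Pi_iff)
qed

lemma hom_finprod_hom:
 assumes G: "comm_group G" and T: "group T" and A: "finite A" and g: "!!i. i : A ==> g i : hom T G"
 shows "(%t. finprod G (%i. g i t) A) : hom T G"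
proof -
 interpret G: comm_group G by fact
 have c: "g i t : carrier G" if "i : A" "t : carrier T" for i t using g[OF that(1)] that(2) by (auto simp: hom_def)
 show ?thesis
 proof (rule homI)
  fix s t assume st: "s : carrier T" "t : carrier T"
  have "finprod G (%i. g i (s **\<^bsub>T\<^esub> t)) A = finprod G (%i. g i s **\<^bsub>G\<^esub> g i t) A"
   using g st c by (intro G.finprod_cong') (auto simp: hom_mult)
  also have "... = finprod G (%i. g i s) A **\<^bsub>G\<^esub> finprod G (%i. g i t) A"
   using st c by (intro G.finprod_multf) auto
  finally show "finprod G (%i. g i (s **\<^bsub>T\<^esub> t)) A = finprod G (%i. g i s) A **\<^bsub>G\<^esub> finprod G (%i. g i t) A" .
 qed (use c in auto)
qed

locale tensor_pair =
 fixes K :: "('k, 'm) ring_scheme" and V :: "('k, 'a, 'n) module_scheme" and W :: "('k, 'b, 'p) module_scheme"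
 assumes V_add: "[|x : carrier V; x' : carrier V|] ==> x \<oplus>\<^bsub>V\<^esub> x' : carrier V"
  and V_smult: "[|c : carrier K; x : carrier V|] ==> c \<odot>\<^bsub>V\<^esub> x : carrier V"
  and W_add: "[|y : carrier W; y' : carrier W|] ==> y \<oplus>\<^bsub>W\<^esub> y' : carrier W"
  and W_smult: "[|c : carrier K; y : carrier W|] ==> c \<odot>\<^bsub>W\<^esub> y : carrier W"
begin

abbreviation "F \<equiv> free_Abelian_group (carrier V \<times> carrier W)"
abbreviation "N \<equiv> tensor_null K V W"
abbreviation "T \<equiv> tensor_group K V W"
abbreviation "pt \<equiv> pure_tensor K V W"

lemma relations_carrier: "tensor_relations K V W <= carrier F"
 using V_add V_smult W_add W_smult keys_diff
 unfolding tensor_relations_def carrier_free_Abelian_group_iff by (fastforce dest: subsetD[OF keys_diff])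

lemma subgroup_null: "subgroup N F"
 unfolding tensor_null_def
 using group.generate_is_subgroup[OF group_free_Abelian_group relations_carrier] .

lemma comm_group_tensor: "comm_group T"
 unfolding tensor_group_def using comm_group.abelian_FactGroup[OF abelian_free_Abelian_group subgroup_null] .

lemma normal_null: "N \<lhd> F"
 using comm_group.subgroup_imp_normal[OF abelian_free_Abelian_group] subgroup_null by blast

lemma coset_hom: "(%p. N #>\<^bsub>F\<^esub> p) : hom F T"
 unfolding tensor_group_def using normal.r_coset_hom_Mod[OF normal_null] .

lemma pure_closed: "[|x : carrier V; y : carrier W|] ==> pt x y : carrier T"
 unfolding pure_tensor_def using hom_in_carrier[OF coset_hom] by (metis frag_of_in_free_Abelian_group mem_Sigma_iff)

lemma tensor_carrierE:
 assumes "s : carrier T"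
 obtains p where "p : carrier F" "s = N #>\<^bsub>F\<^esub> p"
 using assms unfolding tensor_group_def carrier_FactGroup by blast

text \<open>Pure tensors are the images of the free generators.\<close>

lemma tensor_hom_ext:
 assumes G: "group G" and g: "g : hom T G" "h : hom T G" and s: "s : carrier T"
  and eq: "!!x y. [|x : carrier V; y : carrier W|] ==> g (pt x y) = h (pt x y)"
 shows "g s = h s"
proof -
 obtain p where p: "p : carrier F" "s = N #>\<^bsub>F\<^esub> p" using tensor_carrierE[OF s] .
 have hm: "group_hom F G (%p. g (N #>\<^bsub>F\<^esub> p))" "group_hom F G (%p. h (N #>\<^bsub>F\<^esub> p))"
  using g G coset_hom hom_compose[OF coset_hom] unfolding group_hom_def group_hom_axioms_def
  by (auto simp: o_def)
 have "g (N #>\<^bsub>F\<^esub> p) = h (N #>\<^bsub>F\<^esub> p)"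
 proof (rule free_Abelian_group_induct)
  show "Poly_Mapping.keys p <= carrier V \<times> carrier W" using p(1) by simp
  show "g (N #>\<^bsub>F\<^esub> 0) = h (N #>\<^bsub>F\<^esub> 0)"
   using group_hom.hom_one[OF hm(1)] group_hom.hom_one[OF hm(2)] by simp
  fix p q assume k: "Poly_Mapping.keys p <= carrier V \<times> carrier W" "Poly_Mapping.keys q <= carrier V \<times> carrier W"
   and eq: "g (N #>\<^bsub>F\<^esub> p) = h (N #>\<^bsub>F\<^esub> p)" "g (N #>\<^bsub>F\<^esub> q) = h (N #>\<^bsub>F\<^esub> q)"
  have k': "p : carrier F" "q : carrier F" "inv\<^bsub>F\<^esub> q : carrier F"
   using k by (simp_all add: group.inv_closed)
  have e: "p - q = p **\<^bsub>F\<^esub> inv\<^bsub>F\<^esub> q" using k by simp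
  show "g (N #>\<^bsub>F\<^esub> (p - q)) = h (N #>\<^bsub>F\<^esub> (p - q))"
   unfolding e group_hom.hom_mult[OF hm(1) k'(1,3)] group_hom.hom_mult[OF hm(2) k'(1,3)]
    group_hom.hom_inv[OF hm(1) k'(2)] group_hom.hom_inv[OF hm(2) k'(2)] eq ..
 next
  fix a assume "a : carrier V \<times> carrier W"
  then show "g (N #>\<^bsub>F\<^esub> frag_of a) = h (N #>\<^bsub>F\<^esub> frag_of a)"
   using eq unfolding pure_tensor_def by auto
 qed
 then show ?thesis using p by simp
qed

lemma balanced_pure: "balanced K V W T pt"
proof -
 interpret n: normal N F by (rule normal_null)
 have rel: "N #>\<^bsub>F\<^esub> p = N #>\<^bsub>F\<^esub> q" if "p - q : tensor_relations K V W" "p : carrier F" "q : carrier F" for p q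
 proof -
  have "p - q : N" unfolding tensor_null_def using that(1) by (rule generate.incl)
  then have "p : N #>\<^bsub>F\<^esub> q" unfolding r_coset_def by (auto intro!: bexI[of _ "p - q"])
  then show ?thesis using n.repr_independence[OF _ that(3) subgroup_null] by simp
 qed
 have fo: "frag_of (x, y) : carrier F" if "x : carrier V" "y : carrier W" for x y using that by simp
 have add: "N #>\<^bsub>F\<^esub> p = (N #>\<^bsub>F\<^esub> q) **\<^bsub>T\<^esub> (N #>\<^bsub>F\<^esub> q')"
  if "p - q - q' : tensor_relations K V W" "p : carrier F" "q : carrier F" "q' : carrier F" for p q q'
  using rel[of p "q + q'"] that hom_mult[OF coset_hom that(3,4)]
  by (metis diff_diff_eq group.subgroup_self group_free_Abelian_group mult_free_Abelian_group subgroup_def)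
 show ?thesis
  by (rule balancedI[OF comm_group_tensor pure_closed], assumption+; unfold pure_tensor_def)
   (intro add rel fo V_add V_smult W_add W_smult; (simp add: tensor_relations_def; blast)?; assumption)+
qed

definition frag_lift :: "('g, 'q) monoid_scheme => ('a => 'b => 'g) => ('a \<times> 'b \<Rightarrow>\<^sub>0 int) => 'g" where
 "frag_lift G f p = finprod G (%(x, y). f x y [^]\<^bsub>G\<^esub> Poly_Mapping.lookup p (x, y)) (Poly_Mapping.keys p)"

lemma frag_lift_hom:
 assumes f: "balanced K V W G f" shows "frag_lift G f : hom F G"
proof -
 note fD = balancedD[OF f]
 interpret G: comm_group G by (rule fD(1))
 let ?g = "%(p :: 'a \<times> 'b \<Rightarrow>\<^sub>0 int) (x, y). f x y [^]\<^bsub>G\<^esub> Poly_Mapping.lookup p (x, y)"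
 have gc: "?g p k : carrier G" if "k : carrier V \<times> carrier W" for p k using that fD(2) by (auto intro: G.int_pow_closed)
 have ext: "frag_lift G f p = finprod G (?g p) S"
  if "Poly_Mapping.keys p <= S" "finite S" "S <= carrier V \<times> carrier W" for p S
  unfolding frag_lift_def using that gc
  by (intro G.finprod_mono_neutral_cong_left) (auto simp: in_keys_iff intro!: G.int_pow_closed fD(2))
 show ?thesis
 proof (rule homI)
  fix p q assume pq: "p : carrier F" "q : carrier F"
  let ?S = "Poly_Mapping.keys p \<union> Poly_Mapping.keys q"
  have S: "finite ?S" "?S <= carrier V \<times> carrier W" using pq by auto
  have "frag_lift G f (p **\<^bsub>F\<^esub> q) = finprod G (?g (p + q)) ?S"
   using ext[of "p + q" ?S] S keys_add[of p q] by simp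
  also have "... = finprod G (%k. ?g p k **\<^bsub>G\<^esub> ?g q k) ?S"
   using S fD(2) by (intro G.finprod_cong') (auto simp: Poly_Mapping.lookup_add G.int_pow_mult)
  also have "... = finprod G (?g p) ?S **\<^bsub>G\<^esub> finprod G (?g q) ?S"
   using S gc by (intro G.finprod_multf) blast+
  also have "... = frag_lift G f p **\<^bsub>G\<^esub> frag_lift G f q" using ext[of p ?S] ext[of q ?S] S by auto
  finally show "frag_lift G f (p **\<^bsub>F\<^esub> q) = frag_lift G f p **\<^bsub>G\<^esub> frag_lift G f q" .
 next
  show "frag_lift G f p : carrier G" if "p : carrier F" for p
   unfolding frag_lift_def using that gc by (intro G.finprod_closed) auto
 qed
qed

lemma frag_lift_frag_of:
 assumes f: "balanced K V W G f" and x: "x : carrier V" "y : carrier W"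
 shows "frag_lift G f (frag_of (x, y)) = f x y"
proof -
 interpret G: comm_group G by (rule balancedD(1)[OF f])
 show ?thesis unfolding frag_lift_def using balancedD(2)[OF f x] by simp
qed

text \<open>The representative chosen by \<open>SOME\<close> differs from \<open>p\<close> by an
  element of \<open>N\<close>. As \<open>f\<close> is balanced, \<open>frag_lift\<close> is trivial
  on the relations that generate \<open>N\<close>.\<close>

lemma lift_coset:
 assumes f: "balanced K V W G f" and p: "p : carrier F"
 shows "tensor_lift G f (N #>\<^bsub>F\<^esub> p) = frag_lift G f p"
proof -
 note fD = balancedD[OF f]
 interpret h: group_hom F G "frag_lift G f"
  using frag_lift_hom[OF f] group_free_Abelian_group fD(1)
  unfolding group_hom_def group_hom_axioms_def comm_group_def by blast
 have of: "frag_of (x, y) : carrier F" if "x : carrier V" "y : carrier W" for x y using that by simp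
 have diff: "frag_lift G f (a - b) = frag_lift G f a **\<^bsub>G\<^esub> inv\<^bsub>G\<^esub> frag_lift G f b & a - b : carrier F"
  if "a : carrier F" "b : carrier F" for a b
 proof -
  have e: "a - b = a **\<^bsub>F\<^esub> inv\<^bsub>F\<^esub> b" using that by simp
  show ?thesis unfolding e using that
   by (simp del: inv_free_Abelian_group mult_free_Abelian_group carrier_free_Abelian_group_iff)
 qed
 have rel: "frag_lift G f q = \<one>\<^bsub>G\<^esub>" if "q : tensor_relations K V W" for q
 proof -
  have z: "frag_lift G f (a - b - c) = \<one>\<^bsub>G\<^esub>"
   if "a : carrier F" "b : carrier F" "c : carrier F" "frag_lift G f a = frag_lift G f b **\<^bsub>G\<^esub> frag_lift G f c" for a b c
  proof -
   have h: "frag_lift G f b : carrier G" "frag_lift G f c : carrier G" using that(2,3) by auto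
   have "frag_lift G f b **\<^bsub>G\<^esub> frag_lift G f c = frag_lift G f c **\<^bsub>G\<^esub> frag_lift G f b"
    using comm_groupE(4)[OF fD(1) h] .
   then show ?thesis using diff[of a b] diff[of "a - b" c] that h by (simp add: h.H.m_assoc)
  qed
  have z': "frag_lift G f (a - b) = \<one>\<^bsub>G\<^esub>"
   if "a : carrier F" "b : carrier F" "frag_lift G f a = frag_lift G f b" for a b
   using diff[OF that(1,2)] that h.hom_closed[OF that(2)] by simp
  show ?thesis
   using that unfolding tensor_relations_def
   by (elim UnE CollectE exE conjE; simp only:; intro z z' of V_add V_smult W_add W_smult)
    (simp_all add: frag_lift_frag_of[OF f] V_add V_smult W_add W_smult fD(3-5))
 qed
 have null: "n : carrier F & frag_lift G f n = \<one>\<^bsub>G\<^esub>" if "n : N" for n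
  using that unfolding tensor_null_def
 proof induction
  case one then show ?case using h.hom_one by simp
 next
  case (incl q)
  then show ?case using rel relations_carrier by blast
 next
  case (inv q)
  then have "q : carrier F" "frag_lift G f q = \<one>\<^bsub>G\<^esub>" using rel relations_carrier by blast+
  then show ?case using h.hom_inv[of q] h.G.inv_closed[of q] by (metis h.H.inv_one)
 next
  case (eng p q)
  then show ?case using h.hom_mult[of p q] h.G.m_closed[of p q] by (metis h.H.l_one h.H.one_closed)
 qed
 have "p : N #>\<^bsub>F\<^esub> p"
  using normal_null p by (meson group.rcos_self normal_def subgroup_null)
 then have "(SOME q. q : N #>\<^bsub>F\<^esub> p) : N #>\<^bsub>F\<^esub> p" by (rule someI[of "%q. q : N #>\<^bsub>F\<^esub> p"])
 then obtain n where n: "n : N" "(SOME q. q : N #>\<^bsub>F\<^esub> p) = n **\<^bsub>F\<^esub> p" unfolding r_coset_def by blast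
 have "frag_lift G f (n **\<^bsub>F\<^esub> p) = frag_lift G f p"
  using h.hom_mult[of n p] null[OF n(1)] p h.hom_closed[OF p] h.H.l_one by metis
 then show ?thesis
  unfolding tensor_lift_def Let_def n(2) by (simp only: frag_lift_def)
qed

lemma lift_hom:
 assumes f: "balanced K V W G f"
 shows "tensor_lift G f : hom T G"
proof (rule homI)
 fix s u assume "s : carrier T" "u : carrier T"
 then obtain p q where p: "p : carrier F" "s = N #>\<^bsub>F\<^esub> p" "q : carrier F" "u = N #>\<^bsub>F\<^esub> q"
  by (metis tensor_carrierE)
 show "tensor_lift G f s : carrier G"
  using hom_in_carrier[OF frag_lift_hom[OF f] p(1)] lift_coset[OF f p(1)] p(2) by simp
 have pq: "p **\<^bsub>F\<^esub> q : carrier F" using p group.is_monoid[OF group_free_Abelian_group] monoid.m_closed by metis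
 show "tensor_lift G f (s **\<^bsub>T\<^esub> u) = tensor_lift G f s **\<^bsub>G\<^esub> tensor_lift G f u"
  using hom_mult[OF coset_hom p(1,3)] hom_mult[OF frag_lift_hom[OF f] p(1,3)] p
   lift_coset[OF f p(1)] lift_coset[OF f p(3)] lift_coset[OF f pq] by metis
qed

lemma lift_pure:
 assumes f: "balanced K V W G f" and x: "x : carrier V" "y : carrier W"
 shows "tensor_lift G f (pt x y) = f x y"
 unfolding pure_tensor_def using lift_coset[OF f, of "frag_of (x, y)"] frag_lift_frag_of[OF f x] x by simp

lemma lift_closed: "[|balanced K V W G f; s : carrier T|] ==> tensor_lift G f s : carrier G"
 using lift_hom hom_in_carrier by metis

lemma lift_unique:
 assumes f: "balanced K V W G f" and g: "g : hom T G" and s: "s : carrier T"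
  and eq: "!!x y. [|x : carrier V; y : carrier W|] ==> g (pt x y) = f x y"
 shows "tensor_lift G f s = g s"
 using tensor_hom_ext[OF comm_group.axioms(2)[OF balancedD(1)[OF f]] lift_hom[OF f] g s] lift_pure[OF f] eq by simp

end

section \<open>Finite-dimensional algebras\<close>

definition linear_functional :: "('k, 'm) ring_scheme => ('k, 'a, 'n) module_scheme => ('a => 'k) => bool" where
 "linear_functional K V f \<longleftrightarrow> (\<forall>x\<in>carrier V. f x : carrier K) &
  (\<forall>x\<in>carrier V. \<forall>y\<in>carrier V. f (x \<oplus>\<^bsub>V\<^esub> y) = f x \<oplus>\<^bsub>K\<^esub> f y) &
  (\<forall>c\<in>carrier K. \<forall>x\<in>carrier V. f (c \<odot>\<^bsub>V\<^esub> x) = c **\<^bsub>K\<^esub> f x)"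

lemma linear_functionalD:
 assumes "linear_functional K V f"
 shows "x : carrier V ==> f x : carrier K"
  "[|x : carrier V; y : carrier V|] ==> f (x \<oplus>\<^bsub>V\<^esub> y) = f x \<oplus>\<^bsub>K\<^esub> f y"
  "[|c : carrier K; x : carrier V|] ==> f (c \<odot>\<^bsub>V\<^esub> x) = c **\<^bsub>K\<^esub> f x"
 using assms unfolding linear_functional_def by auto

lemma linear_mapsD:
 assumes "f : linear_maps K V W"
 shows "x : carrier V ==> f x : carrier W"
  "[|x : carrier V; y : carrier V|] ==> f (x \<oplus>\<^bsub>V\<^esub> y) = f x \<oplus>\<^bsub>W\<^esub> f y"
  "[|c : carrier K; x : carrier V|] ==> f (c \<odot>\<^bsub>V\<^esub> x) = c \<odot>\<^bsub>W\<^esub> f x"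
 using assms unfolding linear_maps_def by auto

locale algebra_over_field_str = algebra_over_field K A for K :: "('k, 'm) ring_scheme" and A :: "('k, 'a, 'n) module_scheme" (structure)
begin

text \<open>Linear algebra over the field is the case of scalar operators and a trivial base, so the
  exchange argument is available for \<open>H\<close> too.\<close>

lemma operator_span_scalars: "operator_span A {\<zero>} ((%c x. c \<odot> x) ` carrier K)"
proof (intro operator_span.intro[OF A.is_abelian_group] operator_span_axioms.intro)
 let ?Om = "(%c x. c \<odot> x) ` carrier K"
 show "\<exists>om\<in>?Om. \<forall>x\<in>carrier A. om x = \<zero>" by (rule bexI[of _ "%x. \<zero>\<^bsub>K\<^esub> \<odot> x"]) auto
 show "\<exists>om\<in>?Om. \<forall>x\<in>carrier A. om x = x" by (rule bexI[of _ "%x. \<one>\<^bsub>K\<^esub> \<odot> x"]) auto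
 show "\<exists>om\<in>?Om. \<forall>x\<in>carrier A. om x = \<ominus> x"
  by (rule bexI[of _ "%x. (\<ominus>\<^bsub>K\<^esub> \<one>\<^bsub>K\<^esub>) \<odot> x"]) (auto simp: smult_l_minus)
 show "\<exists>om''\<in>?Om. \<forall>x\<in>carrier A. om'' x = om x \<oplus> om' x" if om: "om : ?Om" "om' : ?Om" for om om'
 proof -
  obtain c d where c: "c : carrier K" "d : carrier K" "om = (%x. c \<odot> x)" "om' = (%x. d \<odot> x)" using om by auto
  then show ?thesis by (intro bexI[of _ "%x. (c \<oplus>\<^bsub>K\<^esub> d) \<odot> x"]) (auto simp: smult_l_distr)
 qed
 show "\<exists>om''\<in>?Om. \<forall>x\<in>carrier A. om'' x = om (om' x)" if om: "om : ?Om" "om' : ?Om" for om om'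
 proof -
  obtain c d where c: "c : carrier K" "d : carrier K" "om = (%x. c \<odot> x)" "om' = (%x. d \<odot> x)" using om by auto
  then show ?thesis by (intro bexI[of _ "%x. (c **\<^bsub>K\<^esub> d) \<odot> x"]) (auto simp: smult_assoc1)
 qed
 show "(\<forall>x\<in>carrier A. om x : {\<zero>}) | (\<exists>om'\<in>?Om. \<forall>x\<in>carrier A. om' (om x) \<ominus> x : {\<zero>})" if om: "om : ?Om" for om
 proof -
  obtain c where c: "c : carrier K" "om = (%x. c \<odot> x)" using om by auto
  show ?thesis
  proof (cases "c = \<zero>\<^bsub>K\<^esub>")
   case False
   then have i: "inv\<^bsub>K\<^esub> c : carrier K" "inv\<^bsub>K\<^esub> c **\<^bsub>K\<^esub> c = \<one>\<^bsub>K\<^esub>" using c K.field_Units by auto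
   have "inv\<^bsub>K\<^esub> c \<odot> (c \<odot> x) \<ominus> x : {\<zero>}" if "x : carrier A" for x
    using that c i smult_assoc1[of "inv\<^bsub>K\<^esub> c" c x] by simp
   then show ?thesis unfolding c(2) using i(1) by blast
  qed (use c in simp)
 qed
qed (auto simp: smult_r_distr)

interpretation S: operator_span A "{\<zero>}" "(%c x. c \<odot> x) ` carrier K"
 by (rule operator_span_scalars)

lemma ospan_induct [consumes 1, case_names 1 2 3 4]:
 assumes "x : S.ospan B" "P \<zero>" "!!b. b : B ==> P b"
  "!!x y. [|x : S.ospan B; y : S.ospan B; P x; P y|] ==> P (x \<oplus> y)"
  "!!c x. [|c : carrier K; x : S.ospan B; P x|] ==> P (c \<odot> x)"
 shows "P x"
 using assms(1) by induction (use assms(2-5) in auto)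

lemma ospan_smult: "[|c : carrier K; x : S.ospan B|] ==> c \<odot> x : S.ospan B"
 by (rule S.ospan_op) auto

lemma finite_dimensional_indep:
 assumes "finite_dimensional K A"
 obtains B where "finite B" "S.indep B" "carrier A <= S.ospan B"
proof -
 obtain J where J: "finite J" "J <= carrier A"
  "\<forall>v\<in>carrier A. \<exists>c\<in>J \<rightarrow> carrier K. v = (\<Oplus>b\<in>J. c b \<odot> b)"
  using assms unfolding finite_dimensional_def by blast
 have "carrier A <= S.ospan J"
 proof
  fix v assume "v : carrier A"
  then obtain c where c: "c : J \<rightarrow> carrier K" "v = (\<Oplus>b\<in>J. c b \<odot> b)" using J(3) by blast
  have "(\<Oplus>b\<in>J. c b \<odot> b) : S.ospan J"
  proof (rule A.finsum_in_closed)
   show "S.ospan J <= carrier A" using S.ospan_closed J(2) .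
   show "c b \<odot> b : S.ospan J" if "b : J" for b
    using that c(1) by (intro ospan_smult) (auto intro: S.ospan_gen)
  qed (auto intro: J S.ospan_base S.ospan_add)
  then show "v : S.ospan J" using c(2) by simp
 qed
 from S.finite_basis_exists[OF J(1,2) this] show ?thesis using that by blast
qed

text \<open>The dual function \<open>\<phi> i\<close> gives the coefficient of \<open>b i\<close>
  modulo the span \<open>U i\<close> of the other basis elements; independence makes it
  unique.\<close>

lemma finite_dimensional_basis:
 assumes "finite_dimensional K A"
 obtains r b \<phi> where "\<forall>i<(r::nat). b i : carrier A" "\<forall>i<r. linear_functional K A (\<phi> i)"
  "\<forall>i<r. \<forall>j<r. \<phi> i (b j) = (if i = j then \<one>\<^bsub>K\<^esub> else \<zero>\<^bsub>K\<^esub>)"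
  "\<forall>x\<in>carrier A. x = (\<Oplus>i\<in>{..<r}. \<phi> i x \<odot> b i)"
proof -
 obtain B where B: "finite B" "S.indep B" "carrier A <= S.ospan B" using finite_dimensional_indep[OF assms] .
 have Bc: "B <= carrier A" using B(2) unfolding S.indep_def by blast
 define r where "r = card B"
 obtain b where b: "bij_betw b {..<r} B" unfolding r_def using ex_bij_betw_nat_finite[OF B(1)] atLeast0LessThan by metis
 have bB: "b i : B" if "i < r" for i using b that unfolding bij_betw_def by auto
 have bc: "b i : carrier A" if "i < r" for i using bB[OF that] Bc by blast
 define U where "U i = S.ospan (B - {b i})" for i
 have Uc: "U i <= carrier A" for i unfolding U_def by (rule S.ospan_closed) (use Bc in blast)
 have U_add: "x \<oplus> y : U i" if "x : U i" "y : U i" for x y i using that S.ospan_add unfolding U_def by blast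
 have U_smult: "c \<odot> x : U i" if "x : U i" "c : carrier K" for x c i
  using that ospan_smult unfolding U_def by blast
 define R where "R i x c \<longleftrightarrow> c : carrier K & (\<exists>s\<in>U i. x = c \<odot> b i \<oplus> s)" for i x c
 have ex: "\<exists>c. R i x c" if i: "i < r" and x: "x : carrier A" for i x
 proof -
  have "insert (b i) (B - {b i}) = B" using bB[OF i] by blast
  then have "x : S.ospan (insert (b i) (B - {b i}))" using B(3) x by auto
  from S.ospan_insertE[OF _ bc[OF i] this] Bc
  obtain om s where "om : (%c x. c \<odot> x) ` carrier K" "s : U i" "x = om (b i) \<oplus> s"
   unfolding U_def by blast
  then show ?thesis unfolding R_def by blast
 qed
 have uniq: "c = d" if i: "i < r" and R: "R i x c" "R i x d" for i x c d
 proof (rule ccontr)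
  assume ne: "c ~= d"
  obtain s s' where s: "c : carrier K" "s : U i" "x = c \<odot> b i \<oplus> s" "d : carrier K" "s' : U i" "x = d \<odot> b i \<oplus> s'"
   using R unfolding R_def by blast
  have sc: "s : carrier A" "s' : carrier A" using s Uc by auto
  let ?e = "c \<ominus>\<^bsub>K\<^esub> d"
  have e: "?e : carrier K" "?e ~= \<zero>\<^bsub>K\<^esub>" using s ne by auto
  have "?e \<odot> b i = (c \<odot> b i \<oplus> s) \<ominus> s \<ominus> d \<odot> b i"
   using s(1,4) sc bc[OF i] by (simp add: K.minus_eq M.minus_eq smult_l_distr smult_l_minus M.a_assoc M.r_neg)
  also have "... = s' \<ominus> s"
   using s(1,4) sc bc[OF i] unfolding s(3)[symmetric] unfolding s(6)
   by (simp add: M.minus_eq M.a_ac M.r_neg M.r_neg2)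
  also have "... : U i"
  proof -
   have "\<ominus> s : U i" using U_smult[OF s(2), of "\<ominus>\<^bsub>K\<^esub> \<one>\<^bsub>K\<^esub>"] smult_l_minus[of "\<one>\<^bsub>K\<^esub>" s] sc by simp
   then show ?thesis unfolding M.minus_eq by (rule U_add[OF s(5)])
  qed
  finally have eb: "?e \<odot> b i : U i" .
  have "?e : Units K" using e K.field_Units by blast
  then have i': "inv\<^bsub>K\<^esub> ?e : carrier K" "inv\<^bsub>K\<^esub> ?e **\<^bsub>K\<^esub> ?e = \<one>\<^bsub>K\<^esub>" by simp_all
  have "inv\<^bsub>K\<^esub> ?e \<odot> (?e \<odot> b i) = b i"
   using smult_assoc1[OF i'(1) e(1) bc[OF i]] bc[OF i] unfolding i'(2) by simp
  moreover have "inv\<^bsub>K\<^esub> ?e \<odot> (?e \<odot> b i) : U i" by (rule U_smult[OF eb i'(1)])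
  ultimately show False using B(2) bB[OF i] unfolding S.indep_def U_def by auto
 qed
 define \<phi> where "\<phi> i x = (THE c. R i x c)" for i x
 have \<phi>I: "\<phi> i x = c" if "i < r" "R i x c" for i x c
  unfolding \<phi>_def using uniq[OF that(1)] that(2) by (intro the_equality) blast+
 have \<phi>R: "R i x (\<phi> i x)" if "i < r" "x : carrier A" for i x using ex[OF that] \<phi>I[OF that(1)] by metis
 have lin: "linear_functional K A (\<phi> i)" if i: "i < r" for i
  unfolding linear_functional_def
 proof (intro conjI ballI)
  fix x assume x: "x : carrier A"
  obtain s where s: "\<phi> i x : carrier K" "s : U i" "x = \<phi> i x \<odot> b i \<oplus> s" using \<phi>R[OF i x] unfolding R_def by blast
  have sc: "s : carrier A" using s Uc by auto
  show "\<phi> i x : carrier K" by (rule s(1))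
  show "\<phi> i (c \<odot> x) = c **\<^bsub>K\<^esub> \<phi> i x" if c: "c : carrier K" for c
  proof (rule \<phi>I[OF i])
   have "c \<odot> x = c \<odot> (\<phi> i x \<odot> b i \<oplus> s)" by (rule arg_cong[OF s(3)])
   also have "... = (c **\<^bsub>K\<^esub> \<phi> i x) \<odot> b i \<oplus> c \<odot> s"
    using c s(1) sc bc[OF i] by (simp add: smult_r_distr smult_assoc1)
   finally show "R i (c \<odot> x) (c **\<^bsub>K\<^esub> \<phi> i x)" unfolding R_def using U_smult[OF s(2) c] c s(1) by blast
  qed
  fix y assume y: "y : carrier A"
  obtain s' where s': "\<phi> i y : carrier K" "s' : U i" "y = \<phi> i y \<odot> b i \<oplus> s'" using \<phi>R[OF i y] unfolding R_def by blast
  have s'c: "s' : carrier A" using s' Uc by auto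
  show "\<phi> i (x \<oplus> y) = \<phi> i x \<oplus>\<^bsub>K\<^esub> \<phi> i y"
  proof (rule \<phi>I[OF i])
   have "x \<oplus> y = (\<phi> i x \<odot> b i \<oplus> s) \<oplus> (\<phi> i y \<odot> b i \<oplus> s')" by (rule arg_cong2[OF s(3) s'(3)])
   also have "... = (\<phi> i x \<oplus>\<^bsub>K\<^esub> \<phi> i y) \<odot> b i \<oplus> (s \<oplus> s')"
    using s(1) s'(1) sc s'c bc[OF i] by (simp add: smult_l_distr M.a_ac)
   finally show "R i (x \<oplus> y) (\<phi> i x \<oplus>\<^bsub>K\<^esub> \<phi> i y)" unfolding R_def using U_add[OF s(2) s'(2)] s(1) s'(1) by blast
  qed
 qed
 have delta: "\<phi> i (b j) = (if i = j then \<one>\<^bsub>K\<^esub> else \<zero>\<^bsub>K\<^esub>)" if ij: "i < r" "j < r" for i j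
 proof (rule \<phi>I[OF ij(1)])
  show "R i (b j) (if i = j then \<one>\<^bsub>K\<^esub> else \<zero>\<^bsub>K\<^esub>)"
  proof (cases "i = j")
   case True
   have "\<zero> : U i" unfolding U_def by (rule S.ospan_base) simp
   then show ?thesis unfolding R_def using True bc[OF ij(1)] by (auto intro!: bexI[of _ "\<zero>"])
  next
   case False
   then have "b j ~= b i" using b ij unfolding bij_betw_def inj_on_def by auto
   then have "b j : U i" unfolding U_def using bB[OF ij(2)] by (auto intro: S.ospan_gen)
   then show ?thesis unfolding R_def using False bc ij by (auto intro!: bexI[of _ "b j"])
  qed
 qed
 note \<phi> = linear_functionalD[OF lin]
 have rep: "x = (\<Oplus>i\<in>{..<r}. \<phi> i x \<odot> b i)" if "x : carrier A" for x
 proof -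
  have "x : S.ospan B" using B(3) that by blast
  then show ?thesis
  proof (induction rule: ospan_induct)
   case 1
   have "\<phi> i \<zero> = \<zero>\<^bsub>K\<^esub>" if "i < r" for i using \<phi>(3)[OF that, of "\<zero>\<^bsub>K\<^esub>" "\<zero>"] \<phi>(1)[OF that] by simp
   then have "(\<Oplus>i\<in>{..<r}. \<phi> i \<zero> \<odot> b i) = \<zero>" using bc by (intro M.add.finprod_one_eqI) auto
   then show ?case by simp
  next
   case (2 z)
   then obtain j where j: "j < r" "z = b j" using b unfolding bij_betw_def by auto
   have "(\<Oplus>i\<in>{..<r}. \<phi> i (b j) \<odot> b i) = (\<Oplus>i\<in>{..<r}. if i = j then b j else \<zero>)"
    using j bc by (intro M.finsum_cong') (auto simp: delta)
   also have "... = b j" using j bc by (intro M.finsum_delta) auto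
   finally show ?case using j by simp
  next
   case (3 x y)
   then have c: "x : carrier A" "y : carrier A" using S.ospan_closed[OF Bc] by auto
   have "(\<Oplus>i\<in>{..<r}. \<phi> i (x \<oplus> y) \<odot> b i) = (\<Oplus>i\<in>{..<r}. \<phi> i x \<odot> b i \<oplus> \<phi> i y \<odot> b i)"
    using c bc \<phi>(1,2) by (intro M.finsum_cong') (auto simp: smult_l_distr)
   also have "... = (\<Oplus>i\<in>{..<r}. \<phi> i x \<odot> b i) \<oplus> (\<Oplus>i\<in>{..<r}. \<phi> i y \<odot> b i)"
    using c bc \<phi>(1) by (intro M.finsum_addf) auto
   finally show ?case using 3 by simp
  next
   case (4 c x)
   then have x: "x : carrier A" using S.ospan_closed[OF Bc] by auto
   have "(\<Oplus>i\<in>{..<r}. \<phi> i (c \<odot> x) \<odot> b i) = (\<Oplus>i\<in>{..<r}. c \<odot> (\<phi> i x \<odot> b i))"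
    using 4(1) x bc \<phi>(1,3) by (intro M.finsum_cong') (auto simp: smult_assoc1)
   also have "... = c \<odot> (\<Oplus>i\<in>{..<r}. \<phi> i x \<odot> b i)"
    using 4(1) x bc \<phi>(1) by (intro finsum_smult_ldistr[symmetric]) auto
   finally show ?case using 4(3) by simp
  qed
 qed
 show ?thesis using that[of r b \<phi>] bc lin delta rep by blast
qed

text \<open>The image of a finite basis is independent and has the same cardinality, so it
  spans.\<close>

lemma injective_linear_surj:
 assumes fd: "finite_dimensional K A" and f: "f : linear_maps K A A"
  and inj: "!!x. [|x : carrier A; f x = \<zero>|] ==> x = \<zero>"
 shows "f ` carrier A = carrier A"
proof
 note fD = linear_mapsD[OF f]
 show "f ` carrier A <= carrier A" using fD(1) by blast
 obtain B where B: "finite B" "S.indep B" "carrier A <= S.ospan B" using finite_dimensional_indep[OF fd] .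
 have Bc: "B <= carrier A" using B(2) unfolding S.indep_def by blast
 have f0: "f \<zero> = \<zero>" using fD(3)[of "\<zero>\<^bsub>K\<^esub>" "\<zero>"] fD(1)[of "\<zero>"] by simp
 have inj_on: "inj_on f (carrier A)"
 proof (rule inj_onI)
  fix x y assume xy: "x : carrier A" "y : carrier A" "f x = f y"
  have m: "\<ominus> y = (\<ominus>\<^bsub>K\<^esub> \<one>\<^bsub>K\<^esub>) \<odot> y" using xy by (simp add: smult_l_minus)
  have "f (\<ominus> y) = (\<ominus>\<^bsub>K\<^esub> \<one>\<^bsub>K\<^esub>) \<odot> f y" unfolding m by (rule fD(3)) (use xy in auto)
  then have "f (x \<ominus> y) = f x \<oplus> \<ominus> f y"
   unfolding M.minus_eq using xy fD(1,2) by (simp add: smult_l_minus)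
  then have "x \<ominus> y = \<zero>" using inj xy fD(1) by (simp add: M.r_neg)
  then show "x = y" using xy by simp
 qed
 have img: "S.ospan (f ` C) <= f ` S.ospan C" if C: "C <= carrier A" for C
 proof
  fix x assume "x : S.ospan (f ` C)"
  then show "x : f ` S.ospan C"
  proof (induction rule: ospan_induct)
   case 1
   then show ?case using f0 S.ospan_base[of "\<zero>" C] by force
  next
   case (2 b)
   then show ?case by (auto intro: S.ospan_gen)
  next
   case (3 x y)
   then obtain x' y' where "x' : S.ospan C" "x = f x'" "y' : S.ospan C" "y = f y'" by blast
   moreover from this have "x' : carrier A" "y' : carrier A" using S.ospan_closed[OF C] by auto
   ultimately show ?case using fD(2) S.ospan_add by (metis imageI)
  next
   case (4 c x)
   then obtain x' where "x' : S.ospan C" "x = f x'" by blast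
   moreover from this have "x' : carrier A" using S.ospan_closed[OF C] by auto
   ultimately show ?case using fD(3) ospan_smult 4(1) by (metis imageI)
  qed
 qed
 have "S.indep (f ` B)"
  unfolding S.indep_def
 proof (intro conjI ballI)
  show "f ` B <= carrier A" using Bc fD(1) by blast
  fix x assume "x : f ` B"
  then obtain b where b: "b : B" "x = f b" by blast
  have e: "f ` B - {x} = f ` (B - {b})" using b Bc inj_on unfolding inj_on_def by blast
  show "x ~: S.ospan (f ` B - {x})"
  proof
   assume "x : S.ospan (f ` B - {x})"
   then obtain y where y: "y : S.ospan (B - {b})" "f b = f y" using img[of "B - {b}"] Bc b unfolding e by blast
   then have "b = y" using inj_on b Bc S.ospan_closed[of "B - {b}"] unfolding inj_on_def by blast
   then show False using y(1) B(2) b(1) unfolding S.indep_def by blast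
  qed
 qed
 moreover have "f ` B <= S.ospan B" using B(3) Bc fD(1) by blast
 moreover have "card B <= card (f ` B)" using card_image[OF inj_on_subset[OF inj_on Bc]] by simp
 ultimately have "B <= S.ospan (f ` B)" using S.indep_card_eq[OF B(1) Bc] B(1) by blast
 then have "S.ospan B <= S.ospan (f ` B)" using S.cl_least Bc fD(1) by blast
 then show "carrier A <= f ` carrier A" using B(3) img[OF Bc] S.ospan_closed[OF Bc] by blast
qed

end

lemmas (in algebra_over_field) finite_dimensional_basis =
 algebra_over_field_str.finite_dimensional_basis[OF algebra_over_field_str.intro[OF algebra_over_field_axioms]]
 and injective_linear_surj = algebra_over_field_str.injective_linear_surj[OF algebra_over_field_str.intro[OF algebra_over_field_axioms]]

section \<open>Matrix coefficients of a finite-dimensional Hopf algebra\<close>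

lemma balanced_hom_left:
 "[|balanced K V W G f; y : carrier W|] ==> (%x. f x y) : hom (add_monoid V) G"
 by (rule homI) (auto dest: balancedD)

lemma balanced_hom_right:
 "[|balanced K V W G f; x : carrier V|] ==> (%y. f x y) : hom (add_monoid W) G"
 by (rule homI) (auto dest: balancedD)

lemma hom_mult_pointwise:
 assumes G: "comm_group G" and g: "g : hom T G" "h : hom T G" and T: "group T"
 shows "(%t. g t **\<^bsub>G\<^esub> h t) : hom T G"
proof -
 interpret G: comm_group G by fact
 have c: "g t : carrier G" "h t : carrier G" if "t : carrier T" for t using that g by (auto simp: hom_def)
 show ?thesis by (rule homI) (use g c in \<open>auto simp: hom_mult G.m_ac\<close>)
qed

lemma balanced_cong:
 assumes f: "balanced K V W G f" and V: "tensor_pair K V W"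
  and eq: "!!x y. [|x : carrier V; y : carrier W|] ==> g x y = f x y"
 shows "balanced K V W G g"
 by (rule balancedI) (simp_all add: eq balancedD[OF f] tensor_pair.V_add[OF V] tensor_pair.V_smult[OF V]
  tensor_pair.W_add[OF V] tensor_pair.W_smult[OF V])

context tensor_pair begin

lemma lift_cong:
 assumes f: "balanced K V W G f" and s: "s : carrier T"
  and eq: "!!x y. [|x : carrier V; y : carrier W|] ==> g x y = f x y"
 shows "tensor_lift G g s = tensor_lift G f s"
proof (rule lift_unique[OF _ lift_hom[OF f] s])
 show "balanced K V W G g" by (rule balanced_cong[OF f tensor_pair_axioms eq])
qed (simp add: lift_pure[OF f] eq)

lemma lift_mult:
 assumes f: "balanced K V W G f" and g: "balanced K V W G g" "balanced K V W G h" and s: "s : carrier T"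
  and eq: "!!x y. [|x : carrier V; y : carrier W|] ==> f x y = g x y **\<^bsub>G\<^esub> h x y"
 shows "tensor_lift G f s = tensor_lift G g s **\<^bsub>G\<^esub> tensor_lift G h s"
 by (rule lift_unique[OF f hom_mult_pointwise[OF balancedD(1)[OF f] lift_hom[OF g(1)] lift_hom[OF g(2)]
   comm_group.axioms(2)[OF comm_group_tensor]] s])
  (simp add: lift_pure[OF g(1)] lift_pure[OF g(2)] eq)

lemma lift_hom_image:
 assumes f: "balanced K V W G f" and h: "h : hom G G'" and G': "comm_group G'" and s: "s : carrier T"
 shows "h (tensor_lift G f s) = tensor_lift G' (%x y. h (f x y)) s"
proof -
 have "balanced K V W G' (%x y. h (f x y))"
  using h balancedD[OF f] by (intro balancedI G') (auto simp: hom_mult hom_in_carrier)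
 from lift_unique[OF this hom_compose[OF lift_hom[OF f] h] s] show ?thesis by (simp add: lift_pure[OF f])
qed

end

lemma tensor_pair_module:
 assumes "module K V" "module K W" shows "tensor_pair K V W"
 using assms[THEN module.smult_closed] assms[THEN module.axioms(2), THEN abelian_groupE(1)]
 by unfold_locales auto

locale hopf_basis = hopf_algebra K H
 for K :: "('k, 'm) ring_scheme" and H :: "('k, 'h, 'n) hopf_scheme" (structure) +
 fixes r :: nat and b :: "nat => 'h" and \<phi> :: "nat => 'h => 'k"
 assumes b_closed [simp]: "i < r ==> b i : carrier H"
  and \<phi>_lin: "i < r ==> linear_functional K H (\<phi> i)"
  and \<phi>_b: "[|i < r; j < r|] ==> \<phi> i (b j) = (if i = j then \<one>\<^bsub>K\<^esub> else \<zero>\<^bsub>K\<^esub>)"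
  and expand: "x : carrier H ==> x = (\<Oplus>i\<in>{..<r}. \<phi> i x \<odot> b i)"
begin

abbreviation "TA \<equiv> tensor_algebra K H H"
abbreviation "D \<equiv> comult H"
abbreviation "\<epsilon> \<equiv> counit H"
abbreviation "S \<equiv> antipode H"

lemmas \<phi>_closed [simp] = linear_functionalD(1)[OF \<phi>_lin]
 and \<phi>_add = linear_functionalD(2)[OF \<phi>_lin] and \<phi>_smult = linear_functionalD(3)[OF \<phi>_lin]

sublocale HH: tensor_pair K H H
 by (rule tensor_pair_module) (rule H.module_axioms)+

lemma TA_simps [simp]: "carrier TA = carrier HH.T" "ring.add TA = monoid.mult HH.T"
 "c \<odot>\<^bsub>TA\<^esub> s = tensor_lift HH.T (%x y. HH.pt (c \<odot> x) y) s" "ring.zero TA = \<one>\<^bsub>HH.T\<^esub>"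
 unfolding tensor_algebra_def by simp_all

text \<open>A separate name keeps scalar multiples from being rewritten into lifts.\<close>

definition sm :: "'k => ('h \<times> 'h \<Rightarrow>\<^sub>0 int) set => ('h \<times> 'h \<Rightarrow>\<^sub>0 int) set" where "sm c s = c \<odot>\<^bsub>TA\<^esub> s"

lemmas ptD = balancedD[OF HH.balanced_pure]

lemma group_T: "group HH.T" "comm_group HH.T"
 using HH.comm_group_tensor comm_group.axioms(2) by blast+

lemma balanced_sm: "c : carrier K ==> balanced K H H HH.T (%x y. HH.pt (c \<odot> x) y)"
 by (rule balancedI[OF group_T(2)])
  (auto simp: ptD H.smult_r_distr H.smult_closed intro: trans[OF arg_cong[where f = "%z. HH.pt z _"] ptD(5)]
   simp flip: ptD(5) H.smult_assoc1 simp: H.K.m_comm)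

lemma sm_hom: "c : carrier K ==> sm c : hom HH.T HH.T"
 using HH.lift_hom[OF balanced_sm] unfolding sm_def by simp

lemma sm_closed: "[|c : carrier K; s : carrier HH.T|] ==> sm c s : carrier HH.T"
 using sm_hom hom_in_carrier by metis

lemma sm_pure: "[|c : carrier K; x : carrier H; y : carrier H|] ==> sm c (HH.pt x y) = HH.pt (c \<odot> x) y"
 using HH.lift_pure[OF balanced_sm] unfolding sm_def by simp

lemma sm_add:
 assumes c: "c : carrier K" "d : carrier K" and s: "s : carrier HH.T"
 shows "sm (c \<oplus>\<^bsub>K\<^esub> d) s = sm c s **\<^bsub>HH.T\<^esub> sm d s"
 using HH.tensor_hom_ext[OF group_T(1) sm_hom[OF H.K.a_closed[OF c]]
  hom_mult_pointwise[OF group_T(2) sm_hom[OF c(1)] sm_hom[OF c(2)] group_T(1)] s] c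
 by (simp add: sm_pure H.smult_l_distr ptD)

lemma sm_assoc:
 assumes c: "c : carrier K" "d : carrier K" and s: "s : carrier HH.T"
 shows "sm (c **\<^bsub>K\<^esub> d) s = sm d (sm c s)"
 using HH.tensor_hom_ext[OF group_T(1) sm_hom[OF H.K.m_closed[OF c]] hom_compose[OF sm_hom[OF c(1)] sm_hom[OF c(2)]] s] c
 by (simp add: sm_pure H.smult_closed H.K.m_comm[of c d] H.smult_assoc1)

lemma sm_one: "s : carrier HH.T ==> sm \<one>\<^bsub>K\<^esub> s = s"
 using HH.tensor_hom_ext[OF group_T(1) sm_hom[OF H.K.one_closed] iso_imp_homomorphism[OF iso_set_refl[of HH.T]]]
 by (simp add: sm_pure)

lemma sm_zero: "s : carrier HH.T ==> sm \<zero>\<^bsub>K\<^esub> s = \<one>\<^bsub>HH.T\<^esub>"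
proof -
 assume s: "s : carrier HH.T"
 interpret T: comm_group HH.T by (rule group_T)
 have "sm \<zero>\<^bsub>K\<^esub> s **\<^bsub>HH.T\<^esub> sm \<zero>\<^bsub>K\<^esub> s = sm \<zero>\<^bsub>K\<^esub> s" using sm_add[OF H.K.zero_closed H.K.zero_closed s] by simp
 then show ?thesis using sm_closed[OF H.K.zero_closed s] by simp
qed

sublocale HT: tensor_pair K H TA
 by unfold_locales (use sm_closed[unfolded sm_def] group_T in \<open>auto simp: monoid.m_closed group.is_monoid\<close>)
sublocale TH: tensor_pair K TA H
 by unfold_locales (use sm_closed[unfolded sm_def] group_T in \<open>auto simp: monoid.m_closed group.is_monoid\<close>)

lemma D_closed [simp]: "h : carrier H ==> D h : carrier HH.T"
 and D_add: "[|h : carrier H; h' : carrier H|] ==> D (h \<oplus> h') = D h **\<^bsub>HH.T\<^esub> D h'"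
 and D_smult: "[|c : carrier K; h : carrier H|] ==> D (c \<odot> h) = sm c (D h)"
 and D_mult: "[|h : carrier H; h' : carrier H|] ==> D (h ** h') = D h **\<^bsub>TA\<^esub> D h'"
 using comult_hom unfolding algebra_homs_def linear_maps_def ring_hom_def sm_def by auto

definition cf :: "nat => ('h \<times> 'h \<Rightarrow>\<^sub>0 int) set => 'h" where
 "cf a = tensor_lift (add_monoid H) (%x y. \<phi> a x \<odot> y)"

lemma balanced_cf: "a < r ==> balanced K H H (add_monoid H) (%x y. \<phi> a x \<odot> y)"
 by (rule balancedI[OF H.M.a_comm_group])
  (auto simp: \<phi>_add \<phi>_smult H.smult_l_distr H.smult_r_distr H.K.m_comm simp flip: H.smult_assoc1)

lemma cf_closed [simp]: "[|a < r; s : carrier HH.T|] ==> cf a s : carrier H"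
 unfolding cf_def using HH.lift_closed[OF balanced_cf] by simp

lemma tensor_expand:
 assumes s: "s : carrier HH.T"
 shows "s = finprod HH.T (%a. HH.pt (b a) (cf a s)) {..<r}"
proof -
 have g: "(%s. HH.pt (b a) (cf a s)) : hom HH.T HH.T" if "a < r" for a
  using hom_compose[OF HH.lift_hom[OF balanced_cf[OF that]] balanced_hom_right[OF HH.balanced_pure b_closed[OF that]]]
  unfolding cf_def o_def .
 have eq: "HH.pt x y = finprod HH.T (%a. HH.pt (b a) (cf a (HH.pt x y))) {..<r}"
  if x: "x : carrier H" and y: "y : carrier H" for x y
 proof -
  have "HH.pt x y = HH.pt (\<Oplus>i\<in>{..<r}. \<phi> i x \<odot> b i) y" using expand[OF x] by simp
  also have "... = finprod HH.T (%i. HH.pt (\<phi> i x \<odot> b i) y) {..<r}"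
   unfolding finsum_def using x
   by (intro hom_finprod[OF balanced_hom_left[OF HH.balanced_pure y] H.M.a_comm_group group_T(2)]) auto
  also have "... = finprod HH.T (%a. HH.pt (b a) (cf a (HH.pt x y))) {..<r}"
   using x y by (intro comm_monoid.finprod_cong'[OF comm_group.axioms(1)[OF group_T(2)]])
    (auto simp: cf_def HH.lift_pure[OF balanced_cf] ptD intro!: HH.pure_closed)
  finally show ?thesis .
 qed
 show ?thesis
  using HH.tensor_hom_ext[OF group_T(1) iso_imp_homomorphism[OF iso_set_refl[of HH.T]]
   hom_finprod_hom[OF group_T(2) group_T(1) finite_lessThan g] s] eq by simp
qed

lemma lift_expand:
 assumes f: "balanced K H H G f" and s: "s : carrier HH.T"
 shows "tensor_lift G f s = finprod G (%a. f (b a) (cf a s)) {..<r}"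
proof -
 note G = balancedD(1)[OF f]
 have "tensor_lift G f s = tensor_lift G f (finprod HH.T (%a. HH.pt (b a) (cf a s)) {..<r})"
  using tensor_expand[OF s] by simp
 also have "... = finprod G (%a. tensor_lift G f (HH.pt (b a) (cf a s))) {..<r}"
  using s by (intro hom_finprod[OF HH.lift_hom[OF f] group_T(2) G]) (auto intro!: HH.pure_closed)
 also have "... = finprod G (%a. f (b a) (cf a s)) {..<r}"
  using s balancedD(2)[OF f]
  by (intro comm_monoid.finprod_cong'[OF comm_group.axioms(1)[OF G]]) (auto simp: HH.lift_pure[OF f])
 finally show ?thesis .
qed

text \<open>The coefficients in \<open>D (b i) = sum of b c (x) u c i\<close>, that is, the matrix
  coefficients of \<open>H\<close> as a comodule over itself.\<close>

definition u :: "nat => nat => 'h" where "u c i = cf c (D (b i))"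

lemma u_closed [simp]: "[|c < r; i < r|] ==> u c i : carrier H"
 unfolding u_def by simp

lemma finprod_delta:
 assumes "comm_group G" "i < r" "x : carrier G"
 shows "finprod G (%a. if a = i then x else \<one>\<^bsub>G\<^esub>) {..<r} = x"
 using comm_monoid.finprod_singleton[OF comm_group.axioms(1)[OF assms(1)], of i "{..<r}" "%_. x"] assms
 by (simp add: eq_commute)

lemma balanced_HT: "a < r ==> balanced K H TA HH.T (%x s. sm (\<phi> a x) s)"
 by (rule balancedI[OF group_T(2)])
  (auto simp: \<phi>_add \<phi>_smult sm_add sm_closed hom_mult[OF sm_hom] sm_assoc simp flip: sm_def simp del: TA_simps(3))

lemma balanced_inner:
 assumes z: "z : carrier H" shows "balanced K H H HT.T (%x y. HT.pt x (HH.pt y z))"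
proof (rule balancedI[OF HT.comm_group_tensor])
 note D' = balancedD[OF HT.balanced_pure]
 show "HT.pt (c \<odot> x) (HH.pt y z) = HT.pt x (HH.pt (c \<odot> y) z)"
  if "c : carrier K" "x : carrier H" "y : carrier H" for c x y
  using D'(5)[OF that(1,2), of "HH.pt y z"] sm_pure[OF that(1,3) z] HH.pure_closed[OF that(3) z]
  by (simp add: sm_def)
qed (use z HH.pure_closed balancedD[OF HT.balanced_pure] ptD in auto)

lemma balanced_outer:
 "balanced K TA H HT.T (%s z. tensor_lift HT.T (%x y. HT.pt x (HH.pt y z)) s)"
proof (rule balancedI[OF HT.comm_group_tensor])
 note D' = balancedD[OF HT.balanced_pure]
 let ?f = "%z. tensor_lift HT.T (%x y. HT.pt x (HH.pt y z))"
 fix s z assume s: "s : carrier TA" and z: "z : carrier H"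
 have s': "s : carrier HH.T" using s by simp
 show "?f z s : carrier HT.T" using HH.lift_closed[OF balanced_inner[OF z] s'] .
 show "?f z (s \<oplus>\<^bsub>TA\<^esub> s') = ?f z s **\<^bsub>HT.T\<^esub> ?f z s'" if "s' : carrier TA" for s'
  using hom_mult[OF HH.lift_hom[OF balanced_inner[OF z]] s'] that by simp
 show "?f (z \<oplus> z') s = ?f z s **\<^bsub>HT.T\<^esub> ?f z' s" if z': "z' : carrier H" for z'
 proof (rule HH.lift_mult[OF balanced_inner balanced_inner[OF z] balanced_inner[OF z'] s'])
  show "HT.pt x (HH.pt y (z \<oplus> z')) = HT.pt x (HH.pt y z) **\<^bsub>HT.T\<^esub> HT.pt x (HH.pt y z')"
   if "x : carrier H" "y : carrier H" for x y
   using D'(4)[OF that(1), of "HH.pt y z" "HH.pt y z'"] HH.pure_closed that z z' by (simp add: ptD)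
 qed (use z z' in simp)
 show "?f z (c \<odot>\<^bsub>TA\<^esub> s) = ?f (c \<odot> z) s" if c: "c : carrier K" for c
 proof -
  have cz: "c \<odot> z : carrier H" using c z by simp
  have "?f (c \<odot> z) s = ?f z (sm c s)"
  proof (rule HH.lift_unique[OF balanced_inner[OF cz] _ s'])
   show "(%s. ?f z (sm c s)) : hom HH.T HT.T"
    using hom_compose[OF sm_hom[OF c] HH.lift_hom[OF balanced_inner[OF z]]] unfolding o_def .
   show "?f z (sm c (HH.pt x y)) = HT.pt x (HH.pt y (c \<odot> z))" if "x : carrier H" "y : carrier H" for x y
    using that c z balancedD(5)[OF balanced_inner[OF z] c that]
    by (simp add: sm_pure HH.lift_pure[OF balanced_inner[OF z]] ptD(5))
  qed
  then show ?thesis unfolding sm_def by simp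
 qed
qed

lemma lift_D_b:
 assumes f: "balanced K H H G f" and i: "i < r"
 shows "tensor_lift G f (D (b i)) = finprod G (%a. f (b a) (u a i)) {..<r}"
 using lift_expand[OF f D_closed[OF b_closed[OF i]]] unfolding u_def .

text \<open>Both sides of coassociativity at \<open>b i\<close> are expanded in the basis of the
  first factor, and \<open>L\<close> extracts the coefficient of \<open>b c\<close>. So
  \<open>u\<close> comultiplies like matrix units of a matrix coalgebra.\<close>

lemma D_u:
 assumes c: "c < r" "i < r"
 shows "D (u c i) = finprod HH.T (%a. HH.pt (u c a) (u a i)) {..<r}"
proof -
 define L where "L = tensor_lift HH.T (%x s. sm (\<phi> c x) s)"
 have L: "L : hom HT.T HH.T" "!!x s. [|x : carrier H; s : carrier HH.T|] ==> L (HT.pt x s) = sm (\<phi> c x) s"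
  unfolding L_def using HT.lift_hom[OF balanced_HT[OF c(1)]] HT.lift_pure[OF balanced_HT[OF c(1)]] by auto
 interpret T: comm_group HH.T by (rule group_T)
 interpret T3: comm_group HT.T by (rule HT.comm_group_tensor)
 have ptc: "HT.pt x (HH.pt y z) : carrier HT.T" if "x : carrier H" "y : carrier H" "z : carrier H" for x y z
  using HT.pure_closed[OF that(1)] HH.pure_closed[OF that(2,3)] by simp
 have \<delta>: "sm (\<phi> c (b d)) s = (if d = c then s else \<one>\<^bsub>HH.T\<^esub>)" if "d < r" "s : carrier HH.T" for d s
  using that c \<phi>_b sm_one sm_zero by auto
 let ?rhs = "tensor_map K H TA id D (D (b i))"
 let ?lhs = "tensor_assoc K H H H (tensor_map K TA H D id (D (b i)))"
 have bl: "balanced K H H TH.T (%x y. TH.pt (D x) y)"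
  using balancedD[OF TH.balanced_pure] D_add D_smult TH.comm_group_tensor
  by (intro balancedI) (auto simp: sm_def)
 have br: "balanced K H H HT.T (%x y. HT.pt x (D y))"
  using balancedD[OF HT.balanced_pure] D_add D_smult HT.comm_group_tensor
  by (intro balancedI) (auto simp: sm_def)
 have "?rhs = finprod HT.T (%a. HT.pt (b a) (D (u a i))) {..<r}"
  using lift_D_b[OF br c(2)] unfolding tensor_map_def id_apply .
 then have "L ?rhs = finprod HH.T (%a. L (HT.pt (b a) (D (u a i)))) {..<r}"
  using c by (simp only:) (intro hom_finprod[OF L(1) HT.comm_group_tensor group_T(2)], auto intro!: HT.pure_closed)
 also have "... = finprod HH.T (%a. if a = c then D (u c i) else \<one>\<^bsub>HH.T\<^esub>) {..<r}"
  using c by (intro T.finprod_cong') (auto simp: L(2) \<delta>)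
 also have "... = D (u c i)" using c by (intro finprod_delta group_T) auto
 finally have rhs: "L ?rhs = D (u c i)" .
 have "?lhs = tensor_lift HT.T (%s z. tensor_lift HT.T (%x y. HT.pt x (HH.pt y z)) s)
   (finprod TH.T (%a. TH.pt (D (b a)) (u a i)) {..<r})"
  using lift_D_b[OF bl c(2)] unfolding tensor_map_def tensor_assoc_def id_apply by simp
 also have "... = finprod HT.T (%a. tensor_lift HT.T (%s z. tensor_lift HT.T (%x y. HT.pt x (HH.pt y z)) s)
   (TH.pt (D (b a)) (u a i))) {..<r}"
  using c by (intro hom_finprod[OF TH.lift_hom[OF balanced_outer] TH.comm_group_tensor HT.comm_group_tensor])
   (auto intro!: TH.pure_closed)
 also have "... = finprod HT.T (%a. tensor_lift HT.T (%x y. HT.pt x (HH.pt y (u a i))) (D (b a))) {..<r}"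
  using c by (intro T3.finprod_cong')
   (auto simp: TH.lift_pure[OF balanced_outer] intro!: HH.lift_closed[OF balanced_inner])
 also have "... = finprod HT.T (%a. finprod HT.T (%d. HT.pt (b d) (HH.pt (u d a) (u a i))) {..<r}) {..<r}"
  using c by (intro T3.finprod_cong' T3.finprod_closed) (auto simp: lift_D_b[OF balanced_inner] intro!: ptc T3.finprod_closed)
 finally have "L ?lhs = finprod HH.T (%a. L (finprod HT.T (%d. HT.pt (b d) (HH.pt (u d a) (u a i))) {..<r})) {..<r}"
  using c by (simp only:) (intro hom_finprod[OF L(1) HT.comm_group_tensor group_T(2)], auto intro!: ptc T3.finprod_closed)
 also have "... = finprod HH.T (%a. finprod HH.T (%d. if d = c then HH.pt (u c a) (u a i) else \<one>\<^bsub>HH.T\<^esub>) {..<r}) {..<r}"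
 proof (intro T.finprod_cong')
  fix a assume a: "a : {..<r}"
  have "L (finprod HT.T (%d. HT.pt (b d) (HH.pt (u d a) (u a i))) {..<r}) =
    finprod HH.T (%d. L (HT.pt (b d) (HH.pt (u d a) (u a i)))) {..<r}"
   using c a by (intro hom_finprod[OF L(1) HT.comm_group_tensor group_T(2)]) (auto intro!: ptc)
  also have "... = finprod HH.T (%d. if d = c then HH.pt (u c a) (u a i) else \<one>\<^bsub>HH.T\<^esub>) {..<r}"
  proof (intro T.finprod_cong')
   fix d assume d: "d : {..<r}"
   have "HH.pt (u d a) (u a i) : carrier HH.T" using c a d by (intro HH.pure_closed) auto
   then show "L (HT.pt (b d) (HH.pt (u d a) (u a i))) = (if d = c then HH.pt (u c a) (u a i) else \<one>\<^bsub>HH.T\<^esub>)"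
    using L(2)[OF b_closed] \<delta> d by auto
  qed (use c a in \<open>auto intro!: HH.pure_closed\<close>)
  finally show "L (finprod HT.T (%d. HT.pt (b d) (HH.pt (u d a) (u a i))) {..<r}) = ..." .
 qed (use c in \<open>auto intro!: HH.pure_closed T.finprod_closed\<close>)
 also have "... = finprod HH.T (%a. HH.pt (u c a) (u a i)) {..<r}"
  using c by (intro T.finprod_cong' finprod_delta group_T) (auto intro!: HH.pure_closed)
 finally show ?thesis using rhs coassoc[OF b_closed[OF c(2)]] by simp
qed

lemma lift_D_u:
 assumes f: "balanced K H H G f" and i: "c < r" "i < r"
 shows "tensor_lift G f (D (u c i)) = finprod G (%a. f (u c a) (u a i)) {..<r}"
proof -
 note G = balancedD(1)[OF f]
 show ?thesis
  unfolding D_u[OF i] using i balancedD(2)[OF f]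
  by (subst hom_finprod[OF HH.lift_hom[OF f] group_T(2) G])
   (auto intro!: HH.pure_closed comm_monoid.finprod_cong'[OF comm_group.axioms(1)[OF G]] simp: HH.lift_pure[OF f])
qed

lemma \<epsilon>_closed [simp]: "h : carrier H ==> \<epsilon> h : carrier K"
 and \<epsilon>_add: "[|h : carrier H; h' : carrier H|] ==> \<epsilon> (h \<oplus> h') = \<epsilon> h \<oplus>\<^bsub>K\<^esub> \<epsilon> h'"
 and \<epsilon>_mult: "[|h : carrier H; h' : carrier H|] ==> \<epsilon> (h ** h') = \<epsilon> h **\<^bsub>K\<^esub> \<epsilon> h'"
 and \<epsilon>_one: "\<epsilon> \<one> = \<one>\<^bsub>K\<^esub>"
 using counit_hom unfolding ring_hom_def by auto

lemma \<epsilon>_u: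
 assumes ai: "a < r" "i < r" shows "\<epsilon> (u a i) = (if a = i then \<one>\<^bsub>K\<^esub> else \<zero>\<^bsub>K\<^esub>)"
proof -
 have f: "balanced K H H (add_monoid H) (%x y. \<epsilon> y \<odot> x)"
  by (rule balancedI[OF H.M.a_comm_group])
   (auto simp: \<epsilon>_add counit_smult H.smult_l_distr H.smult_r_distr H.K.m_comm simp flip: H.smult_assoc1)
 have "b i = (\<Oplus>a\<in>{..<r}. \<epsilon> (u a i) \<odot> b a)"
  using counit_right[OF b_closed[OF ai(2)]] lift_D_b[OF f ai(2)] unfolding finsum_def by simp
 then have "\<phi> a (b i) = \<phi> a (\<Oplus>d\<in>{..<r}. \<epsilon> (u d i) \<odot> b d)" by simp
 also have "... = finprod (add_monoid K) (%d. \<phi> a (\<epsilon> (u d i) \<odot> b d)) {..<r}"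
  unfolding finsum_def using ai
  by (intro hom_finprod[OF homI H.M.a_comm_group H.K.a_comm_group]) (auto simp: \<phi>_add)
 also have "... = finprod (add_monoid K) (%d. if d = a then \<epsilon> (u a i) else \<one>\<^bsub>add_monoid K\<^esub>) {..<r}"
  using ai by (intro comm_monoid.finprod_cong'[OF comm_group.axioms(1)[OF H.K.a_comm_group]])
   (auto simp: \<phi>_smult \<phi>_b)
 also have "... = \<epsilon> (u a i)" using finprod_delta[OF H.K.a_comm_group ai(1), of "\<epsilon> (u a i)"] ai by simp
 finally show ?thesis using \<phi>_b[OF ai] by simp
qed

text \<open>The counit applied to the first factor of \<open>D (b i)\<close> shows that the
  coefficients span \<open>H\<close>, so linear statements need to be checked only on them.\<close>

lemma b_u: "i < r ==> b i = (\<Oplus>a\<in>{..<r}. \<epsilon> (b a) \<odot> u a i)"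
proof -
 assume i: "i < r"
 have f: "balanced K H H (add_monoid H) (%x y. \<epsilon> x \<odot> y)"
  by (rule balancedI[OF H.M.a_comm_group])
   (auto simp: \<epsilon>_add counit_smult H.smult_l_distr H.smult_r_distr H.K.m_comm simp flip: H.smult_assoc1)
 show ?thesis using counit_left[OF b_closed[OF i]] lift_D_b[OF f i] unfolding finsum_def by simp
qed

lemma S_closed [simp]: "h : carrier H ==> S h : carrier H"
 and S_add: "[|h : carrier H; h' : carrier H|] ==> S (h \<oplus> h') = S h \<oplus> S h'"
 and S_smult: "[|c : carrier K; h : carrier H|] ==> S (c \<odot> h) = c \<odot> S h"
 using linear_mapsD[OF antipode_linear] by auto

lemma balanced_S:
 "balanced K H H (add_monoid H) (%x y. S x ** y)" "balanced K H H (add_monoid H) (%x y. x ** S y)"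
 by (rule balancedI[OF H.M.a_comm_group]; auto simp: S_add S_smult H.A.l_distr H.A.r_distr H.smult_mult_left H.smult_mult_right)+

text \<open>The counit of the coefficients is the unit matrix, so the antipode axioms say that the
  matrix of antipodes is inverse to \<open>u\<close>.\<close>

lemma u_antipode:
 assumes "c < r" "i < r"
 shows "(\<Oplus>a\<in>{..<r}. S (u c a) ** u a i) = (if c = i then \<one> else \<zero>)"
  "(\<Oplus>a\<in>{..<r}. u c a ** S (u a i)) = (if c = i then \<one> else \<zero>)"
 using antipode_left[OF u_closed[OF assms]] antipode_right[OF u_closed[OF assms]]
  lift_D_u[OF balanced_S(1) assms] lift_D_u[OF balanced_S(2) assms] \<epsilon>_u[OF assms]
 unfolding finsum_def by auto

end

lemma (in ring) left_idealI:
 assumes "I <= carrier R" "\<zero> : I" "!!x y. x : I ==> y : I ==> x \<oplus> y : I"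
  and "!!x a. x : I ==> a : carrier R ==> a ** x : I"
 shows "left_ideal I R"
proof -
 have "\<ominus> x : I" if "x : I" for x
  using assms(4)[OF that, of "\<ominus> \<one>"] subsetD[OF assms(1) that] by (simp add: l_minus)
 then have "subgroup I (add_monoid R)"
  using assms by (unfold_locales) (auto simp: a_inv_def[symmetric])
 then show ?thesis
  using assms(4) unfolding left_ideal_def additive_subgroup_def by blast
qed

lemma (in ring) left_idealD:
 assumes "left_ideal I R"
 shows "I <= carrier R" "!!x y. x : I ==> y : I ==> x \<ominus> y : I"
  "!!x a. x : I ==> a : carrier R ==> a ** x : I"
proof -
 interpret additive_subgroup I R using assms unfolding left_ideal_def by blast
 show "I <= carrier R" using a_subset by auto
 show "!!x y. x : I ==> y : I ==> x \<ominus> y : I" unfolding minus_eq using a_closed a_inv_closed by blast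
 show "!!x a. x : I ==> a : carrier R ==> a ** x : I" using assms unfolding left_ideal_def by blast
qed

lemma (in algebra_over_field) left_ideal_smult:
 assumes I: "left_ideal I A" and x: "x : I" and c: "c : carrier K"
 shows "c \<odot>\<^bsub>A\<^esub> x : I"
proof -
 have xc: "x : carrier A" using A.left_idealD(1)[OF I] x by blast
 have "c \<odot>\<^bsub>A\<^esub> x = (c \<odot>\<^bsub>A\<^esub> \<one>\<^bsub>A\<^esub>) **\<^bsub>A\<^esub> x" using smult_mult_left[OF c _ xc, of "\<one>\<^bsub>A\<^esub>"] xc by simp
 then show ?thesis using A.left_idealD(3)[OF I x, of "c \<odot>\<^bsub>A\<^esub> \<one>\<^bsub>A\<^esub>"] c by simp
qed

section \<open>Integrals and the antipode\<close>

context hopf_basis begin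

lemma \<epsilon>_zero: "\<epsilon> \<zero> = \<zero>\<^bsub>K\<^esub>"
 using counit_smult[of "\<zero>\<^bsub>K\<^esub>" "\<zero>"] by simp

lemma \<epsilon>_smult: "[|c : carrier K; h : carrier H|] ==> \<epsilon> (c \<odot> h) = c **\<^bsub>K\<^esub> \<epsilon> h"
 by (rule counit_smult)

lemma \<epsilon>_minus: "[|x : carrier H; y : carrier H|] ==> \<epsilon> (x \<ominus> y) = \<epsilon> x \<ominus>\<^bsub>K\<^esub> \<epsilon> y"
proof -
 assume xy: "x : carrier H" "y : carrier H"
 have e: "x \<ominus> y = x \<oplus> (\<ominus>\<^bsub>K\<^esub> \<one>\<^bsub>K\<^esub>) \<odot> y" using xy by (simp add: H.M.minus_eq H.smult_l_minus)
 show ?thesis unfolding e using xy by (simp add: \<epsilon>_add \<epsilon>_smult H.K.minus_eq H.K.l_minus)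
qed

text \<open>A complement of the kernel of the counit consists of left integrals. If \<open>t\<close> is one with
 counit \<open>1\<close>, then \<open>x = th - \<epsilon>(h)t\<close> is a left integral with \<open>xx = 0\<close>, so that the left ideal
 \<open>Kx\<close> has a complement only if \<open>x = 0\<close>.\<close>

lemma integral_exists:
 assumes ss: "semisimple_ring H"
 obtains t where "t : carrier H" "\<epsilon> t = \<one>\<^bsub>K\<^esub>"
  "\<forall>h\<in>carrier H. h ** t = \<epsilon> h \<odot> t & t ** h = \<epsilon> h \<odot> t"
proof -
 have compl: "\<exists>J. left_ideal J H & I \<inter> J = {\<zero>} & I <+> J = carrier H" if "left_ideal I H" for I
  using ss that unfolding semisimple_ring_def by blast
 define I where "I = {h : carrier H. \<epsilon> h = \<zero>\<^bsub>K\<^esub>}"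
 have I: "left_ideal I H"
  unfolding I_def by (rule H.A.left_idealI) (auto simp: \<epsilon>_zero \<epsilon>_add \<epsilon>_mult)
 obtain J where J: "left_ideal J H" "I \<inter> J = {\<zero>}" "I <+> J = carrier H" using compl[OF I] by blast
 note JD = H.A.left_idealD[OF J(1)]
 have "\<one> : I <+> J" using J(3) by simp
 then obtain k t where k: "k : I" "t : J" "\<one> = k \<oplus> t" unfolding set_add_def' by blast
 have tc: "t : carrier H" and kc: "k : carrier H" using JD(1) k I_def by auto
 have "\<epsilon> \<one> = \<epsilon> t" using k(1,3) kc tc by (simp add: \<epsilon>_add I_def)
 then have \<epsilon>t: "\<epsilon> t = \<one>\<^bsub>K\<^esub>" by (simp add: \<epsilon>_one)
 have lt: "h ** t = \<epsilon> h \<odot> t" if h: "h : carrier H" for h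
 proof -
  have "h ** t \<ominus> \<epsilon> h \<odot> t : J"
   using JD(2) JD(3)[OF k(2) h] H.left_ideal_smult[OF J(1) k(2)] h by simp
  moreover have "h ** t \<ominus> \<epsilon> h \<odot> t : I"
   unfolding I_def using h tc by (simp add: \<epsilon>_minus \<epsilon>_mult \<epsilon>_smult \<epsilon>t)
  ultimately have "h ** t \<ominus> \<epsilon> h \<odot> t = \<zero>" using J(2) by blast
  then show ?thesis using h tc by simp
 qed
 have rt: "t ** h = \<epsilon> h \<odot> t" if h: "h : carrier H" for h
 proof -
  define x where "x = t ** h \<ominus> \<epsilon> h \<odot> t"
  have xc: "x : carrier H" unfolding x_def using h tc by simp
  have lx: "g ** x = \<epsilon> g \<odot> x" if g: "g : carrier H" for g
  proof -
   have "g ** x = (g ** t) ** h \<ominus> \<epsilon> h \<odot> (g ** t)"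
    unfolding x_def using g h tc by (simp add: H.M.minus_eq H.A.r_distr H.A.r_minus H.A.m_assoc H.smult_mult_right)
   also have "... = \<epsilon> g \<odot> x"
    unfolding lt[OF g] x_def using g h tc
    by (simp add: H.M.minus_eq H.smult_r_distr H.smult_r_minus H.smult_mult_left H.K.m_comm flip: H.smult_assoc1)
   finally show ?thesis .
  qed
  have "\<epsilon> x = \<zero>\<^bsub>K\<^esub>" unfolding x_def using h tc by (simp add: \<epsilon>_minus \<epsilon>_mult \<epsilon>_smult \<epsilon>t)
  then have xx: "x ** x = \<zero>" using lx[OF xc] xc by simp
  define Kx where "Kx = (%c. c \<odot> x) ` carrier K"
  have "left_ideal Kx H"
  proof (rule H.A.left_idealI)
   show "Kx <= carrier H" unfolding Kx_def using xc by auto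
   show "\<zero> : Kx" unfolding Kx_def using xc by (intro image_eqI[of _ _ "\<zero>\<^bsub>K\<^esub>"]) auto
   fix y assume "y : Kx"
   then obtain c where c: "c : carrier K" "y = c \<odot> x" unfolding Kx_def by blast
   show "y \<oplus> z : Kx" if z: "z : Kx" for z
   proof -
    obtain d where d: "d : carrier K" "z = d \<odot> x" using z unfolding Kx_def by blast
    show ?thesis
     unfolding Kx_def using c d xc by (intro image_eqI[of _ _ "c \<oplus>\<^bsub>K\<^esub> d"]) (auto simp: H.smult_l_distr)
   qed
   show "a ** y : Kx" if a: "a : carrier H" for a
    unfolding Kx_def using c xc a lx[OF a]
    by (intro image_eqI[of _ _ "c **\<^bsub>K\<^esub> \<epsilon> a"]) (auto simp: H.smult_mult_right H.smult_assoc1)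
  qed
  from compl[OF this] obtain J' where J': "left_ideal J' H" "Kx \<inter> J' = {\<zero>}" "Kx <+> J' = carrier H"
   by blast
  have "\<one> : Kx <+> J'" using J'(3) by simp
  then obtain c j where j: "c : carrier K" "j : J'" "\<one> = c \<odot> x \<oplus> j" unfolding set_add_def' Kx_def by blast
  have jc: "j : carrier H" using H.A.left_idealD(1)[OF J'(1)] j by blast
  have "x = x ** (c \<odot> x \<oplus> j)" unfolding j(3)[symmetric] using xc by simp
  also have "... = x ** j" using xc jc j(1) xx by (simp add: H.A.r_distr H.smult_mult_right)
  finally have "x = x ** j" .
  then have "x : J'" using H.A.left_idealD(3)[OF J'(1) j(2) xc] by simp
  moreover have "x : Kx" unfolding Kx_def using xc by (intro image_eqI[of _ _ "\<one>\<^bsub>K\<^esub>"]) auto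
  ultimately have "x = \<zero>" using J'(2) by blast
  then show ?thesis unfolding x_def using h tc by simp
 qed
 show ?thesis using that[OF tc \<epsilon>t] lt rt by blast
qed

lemma u_induct:
 assumes h: "h : carrier H" and P0: "P \<zero>" and Pu: "!!i j. [|i < r; j < r|] ==> P (u i j)"
  and Padd: "!!x y. [|x : carrier H; y : carrier H; P x; P y|] ==> P (x \<oplus> y)"
  and Psmult: "!!c x. [|c : carrier K; x : carrier H; P x|] ==> P (c \<odot> x)"
 shows "P h"
proof -
 define C where "C = {x : carrier H. P x}"
 have C: "finsum H f {..<r} : C" if "!!i. i < r ==> f i : C" for f
  by (rule H.A.finsum_in_closed) (use that P0 Padd in \<open>auto simp: C_def\<close>)
 have bC: "b i : C" if "i < r" for i
  unfolding b_u[OF that] using that Pu Psmult by (intro C) (auto simp: C_def)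
 have "(\<Oplus>i\<in>{..<r}. \<phi> i h \<odot> b i) : C"
  using h bC Psmult by (intro C) (auto simp: C_def)
 then show ?thesis using expand[OF h] unfolding C_def by simp
qed

section \<open>Surjectivity of the antipode\<close>

lemma balanced_mult:
 assumes x: "x : carrier H" "y : carrier H"
 shows "balanced K H H HH.T (%x' y'. HH.pt (x ** x') (y ** y'))"
 by (rule balancedI[OF group_T(2)])
  (use x in \<open>auto simp: H.A.r_distr ptD H.smult_mult_right intro!: HH.pure_closed\<close>)

lemma balanced_mult_outer:
 assumes s: "s : carrier HH.T"
 shows "balanced K H H HH.T (%x y. tensor_lift HH.T (%x' y'. HH.pt (x ** x') (y ** y')) s)"
proof (rule balancedI[OF group_T(2)])
 note bm = balanced_mult
 fix x y assume x: "x : carrier H" and y: "y : carrier H"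
 let ?f = "%x y. tensor_lift HH.T (%x' y'. HH.pt (x ** x') (y ** y')) s"
 show "?f x y : carrier HH.T" using HH.lift_closed[OF bm[OF x y] s] .
 show "?f (x \<oplus> x') y = ?f x y **\<^bsub>HH.T\<^esub> ?f x' y" if "x' : carrier H" for x'
  using that x y by (intro HH.lift_mult[OF bm bm bm s]) (auto simp: H.A.l_distr ptD)
 show "?f x (y \<oplus> y') = ?f x y **\<^bsub>HH.T\<^esub> ?f x y'" if "y' : carrier H" for y'
  using that x y by (intro HH.lift_mult[OF bm bm bm s]) (auto simp: H.A.l_distr ptD)
 show "?f (c \<odot> x) y = ?f x (c \<odot> y)" if "c : carrier K" for c
  using that x y by (intro HH.lift_cong[OF bm s]) (auto simp: H.smult_mult_left ptD(5))
qed

text \<open>In Sweedler notation the sum of ps(x s1) (y s2).\<close>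

definition Bf :: "('h => 'k) => 'h => 'h => ('h \<times> 'h \<Rightarrow>\<^sub>0 int) set => 'h" where
 "Bf ps x y = tensor_lift (add_monoid H) (%x' y'. ps (x ** x') \<odot> (y ** y'))"

context
 fixes ps assumes ps: "linear_functional K H ps"
begin

lemmas psD = linear_functionalD[OF ps]

lemma balanced_Bf:
 assumes x: "x : carrier H" "y : carrier H"
 shows "balanced K H H (add_monoid H) (%x' y'. ps (x ** x') \<odot> (y ** y'))"
 by (rule balancedI[OF H.M.a_comm_group])
  (use x in \<open>auto simp: psD H.A.r_distr H.smult_mult_right H.smult_l_distr H.smult_r_distr H.K.m_comm
   simp flip: H.smult_assoc1\<close>)

lemma Bf_closed: "[|x : carrier H; y : carrier H; s : carrier HH.T|] ==> Bf ps x y s : carrier H"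
 unfolding Bf_def using HH.lift_closed[OF balanced_Bf] by simp

lemma Bf_add:
 "[|x : carrier H; x' : carrier H; y : carrier H; s : carrier HH.T|] ==>
  Bf ps (x \<oplus> x') y s = Bf ps x y s \<oplus> Bf ps x' y s"
 unfolding Bf_def
 using HH.lift_mult[OF balanced_Bf balanced_Bf balanced_Bf, of "x \<oplus> x'" y x y x' y s]
 by (simp add: psD H.A.l_distr H.smult_l_distr)

lemma Bf_smult:
 assumes c: "c : carrier K" and x: "x : carrier H" "y : carrier H" and s: "s : carrier HH.T"
 shows "Bf ps (c \<odot> x) y s = c \<odot> Bf ps x y s"
proof -
 have "(%z. c \<odot> z) : hom (add_monoid H) (add_monoid H)" by (rule homI) (use c in \<open>auto simp: H.smult_r_distr\<close>)
 from HH.lift_hom_image[OF balanced_Bf[OF x] this H.M.a_comm_group s]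
 have "c \<odot> Bf ps x y s = tensor_lift (add_monoid H) (%x' y'. c \<odot> (ps (x ** x') \<odot> (y ** y'))) s"
  unfolding Bf_def .
 also have "... = Bf ps (c \<odot> x) y s"
  unfolding Bf_def using c x by (intro HH.lift_cong balanced_Bf s) (auto simp: psD H.smult_mult_left H.smult_assoc1)
 finally show ?thesis by simp
qed

lemma Bf_zero: "[|y : carrier H; s : carrier HH.T|] ==> Bf ps \<zero> y s = \<zero>"
 using Bf_smult[of "\<zero>\<^bsub>K\<^esub>" "\<zero>" y s] Bf_closed[of "\<zero>" y s] by simp

lemma Bf_mult:
 assumes x: "x : carrier H" "y : carrier H" "z : carrier H" and s: "s : carrier HH.T"
 shows "z ** Bf ps x y s = Bf ps x (z ** y) s"
proof -
 have "(%w. z ** w) : hom (add_monoid H) (add_monoid H)" by (rule homI) (use x in \<open>auto simp: H.A.r_distr\<close>)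
 from HH.lift_hom_image[OF balanced_Bf[OF x(1,2)] this H.M.a_comm_group s]
 have "z ** Bf ps x y s = tensor_lift (add_monoid H) (%x' y'. z ** (ps (x ** x') \<odot> (y ** y'))) s"
  unfolding Bf_def .
 also have "... = Bf ps x (z ** y) s"
  unfolding Bf_def using x by (intro HH.lift_cong balanced_Bf s) (auto simp: psD H.smult_mult_right H.A.m_assoc)
 finally show ?thesis by simp
qed

lemma Bf_D_u:
 assumes c: "c < r" "i < r" and x: "x : carrier H" "y : carrier H" and s: "s : carrier HH.T"
 shows "Bf ps x y (D (u c i) **\<^bsub>TA\<^esub> s) = (\<Oplus>e\<in>{..<r}. Bf ps (x ** u c e) (y ** u e i) s)"
proof -
 have h: "Bf ps x y : hom HH.T (add_monoid H)" unfolding Bf_def by (rule HH.lift_hom[OF balanced_Bf[OF x]])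
 have "D (u c i) **\<^bsub>TA\<^esub> s = finprod HH.T (%e. tensor_lift HH.T (%x' y'. HH.pt (u c e ** x') (u e i ** y')) s) {..<r}"
  using lift_D_u[OF balanced_mult_outer[OF s] c] by (simp add: tensor_algebra_def)
 then have "Bf ps x y (D (u c i) **\<^bsub>TA\<^esub> s) =
   (\<Oplus>e\<in>{..<r}. Bf ps x y (tensor_lift HH.T (%x' y'. HH.pt (u c e ** x') (u e i ** y')) s))"
  unfolding finsum_def using c s
  by (simp only:) (intro hom_finprod[OF h group_T(2) H.M.a_comm_group], auto intro!: HH.lift_closed balanced_mult)
 also have "... = (\<Oplus>e\<in>{..<r}. Bf ps (x ** u c e) (y ** u e i) s)"
 proof (intro H.M.finsum_cong')
  fix e assume e: "e : {..<r}"
  have ue: "u c e : carrier H" "u e i : carrier H" using c e by auto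
  have "Bf ps x y (tensor_lift HH.T (%x' y'. HH.pt (u c e ** x') (u e i ** y')) s) =
    tensor_lift (add_monoid H) (%x' y'. Bf ps x y (HH.pt (u c e ** x') (u e i ** y'))) s"
   by (rule HH.lift_hom_image[OF balanced_mult[OF ue] h H.M.a_comm_group s])
  also have "... = Bf ps (x ** u c e) (y ** u e i) s"
   unfolding Bf_def using x ue
   by (intro HH.lift_cong balanced_Bf s) (auto simp: HH.lift_pure[OF balanced_Bf] H.A.m_assoc)
  finally show "Bf ps x y (tensor_lift HH.T (%x' y'. HH.pt (u c e ** x') (u e i ** y')) s) = ..." .
 qed (use x c s Bf_closed in auto)
 finally show ?thesis .
qed

text \<open>In Sweedler notation, ps(t1) (h t2) and ps(S(h) t1) t2 have the same sum: insert S(h1)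
  h2 into the first factor and use that a product with the integral only produces the
  counit.\<close>

lemma Bf_integral:
 assumes t: "t : carrier H" "!!h. h : carrier H ==> h ** t = \<epsilon> h \<odot> t" and h: "h : carrier H"
 shows "h ** Bf ps \<one> \<one> (D t) = Bf ps (S h) \<one> (D t)"
proof (rule u_induct[OF h])
 let ?b = "%x y. Bf ps x y (D t)"
 have bc: "?b x y : carrier H" if "x : carrier H" "y : carrier H" for x y using Bf_closed that t(1) by simp
 have S0: "S \<zero> = \<zero>" using S_smult[of "\<zero>\<^bsub>K\<^esub>" "\<zero>"] by simp
 have b0: "?b \<zero> y = \<zero>" if "y : carrier H" for y using Bf_zero[OF that D_closed[OF t(1)]] .
 show "\<zero> ** ?b \<one> \<one> = ?b (S \<zero>) \<one>" using bc b0 by (simp add: S0)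
 show "(x \<oplus> y) ** ?b \<one> \<one> = ?b (S (x \<oplus> y)) \<one>"
  if "x : carrier H" "y : carrier H" "x ** ?b \<one> \<one> = ?b (S x) \<one>" "y ** ?b \<one> \<one> = ?b (S y) \<one>" for x y
  using that bc t(1) by (simp add: H.A.l_distr S_add Bf_add)
 show "(c \<odot> x) ** ?b \<one> \<one> = ?b (S (c \<odot> x)) \<one>"
  if "c : carrier K" "x : carrier H" "x ** ?b \<one> \<one> = ?b (S x) \<one>" for c x
  using that bc t(1) by (simp add: H.smult_mult_left S_smult Bf_smult)
 fix i j assume ij: "i < r" "j < r"
 have Dt: "Bf ps (S (u i a)) \<one> (D (u a j) **\<^bsub>TA\<^esub> D t) = (if a = j then ?b (S (u i j)) \<one> else \<zero>)" if a: "a < r" for a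
 proof -
  have Su: "S (u i a) : carrier H" using ij a by simp
  interpret gh: group_hom HH.T "add_monoid H" "Bf ps (S (u i a)) \<one>"
   using HH.lift_hom[OF balanced_Bf[OF Su H.A.one_closed]] group_T H.M.a_comm_group
   unfolding Bf_def group_hom_def group_hom_axioms_def comm_group_def by simp
  have "D (u a j) **\<^bsub>TA\<^esub> D t = sm (\<epsilon> (u a j)) (D t)"
   using D_mult[OF u_closed[OF a ij(2)] t(1)] t(2)[of "u a j"] D_smult[OF _ t(1)] a ij t(1) by simp
  then show ?thesis
   using gh.hom_one t(1) \<epsilon>_u[OF a ij(2)] by (simp add: sm_one sm_zero)
 qed
 have "?b (S (u i j)) \<one> = (\<Oplus>a\<in>{..<r}. if a = j then ?b (S (u i j)) \<one> else \<zero>)"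
  using ij bc by (intro H.M.finsum_delta[symmetric]) auto
 also have "... = (\<Oplus>a\<in>{..<r}. \<Oplus>e\<in>{..<r}. ?b (S (u i a) ** u a e) (u e j))"
 proof (intro H.M.finsum_cong')
  fix a assume "a : {..<r}"
  then have a: "a < r" by simp
  have "(if a = j then ?b (S (u i j)) \<one> else \<zero>) =
    (\<Oplus>e\<in>{..<r}. ?b (S (u i a) ** u a e) (\<one> ** u e j))"
   using Dt[OF a] Bf_D_u[OF a ij(2) S_closed[OF u_closed[OF ij(1) a]] H.A.one_closed D_closed[OF t(1)]] by simp
  also have "... = (\<Oplus>e\<in>{..<r}. ?b (S (u i a) ** u a e) (u e j))"
   using a ij bc by (intro H.M.finsum_cong') auto
  finally show "(if a = j then ?b (S (u i j)) \<one> else \<zero>) = ..." .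
 qed (use ij bc in \<open>auto intro!: H.M.finsum_closed\<close>)
 also have "... = (\<Oplus>e\<in>{..<r}. \<Oplus>a\<in>{..<r}. ?b (S (u i a) ** u a e) (u e j))"
  using ij bc by (intro H.M.finsum_swap) auto
 also have "... = (\<Oplus>e\<in>{..<r}. if e = i then ?b \<one> (u i j) else \<zero>)"
 proof (intro H.M.finsum_cong')
  fix e assume e: "e : {..<r}"
  have uc: "u e j : carrier H" using e ij by simp
  have "(\<Oplus>a\<in>{..<r}. ?b (S (u i a) ** u a e) (u e j)) = ?b (\<Oplus>a\<in>{..<r}. S (u i a) ** u a e) (u e j)"
   using e ij bc uc t(1) by (intro H.M.finsum_hom[symmetric, of "%x. ?b x (u e j)"]) (auto simp: Bf_add)
  then show "(\<Oplus>a\<in>{..<r}. ?b (S (u i a) ** u a e) (u e j)) = (if e = i then ?b \<one> (u i j) else \<zero>)"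
   using u_antipode(1)[of i e] e ij b0[OF uc] by auto
 qed (use ij bc in auto)
 also have "... = ?b \<one> (u i j)" using ij bc by (intro H.M.finsum_delta) auto
 also have "... = u i j ** ?b \<one> \<one>" using Bf_mult[of "\<one>" "\<one>" "u i j" "D t"] ij t(1) by simp
 finally show "u i j ** ?b \<one> \<one> = ?b (S (u i j)) \<one>" by simp
qed

end

text \<open>The antipode axiom at \<open>t\<close> writes \<open>1\<close> as a sum of elements
  \<open>Bf (ps c) 1 1 (D t)\<close>, and by \<open>Bf_integral\<close> left multiplication by
  \<open>h\<close> turns each of them into an expression in \<open>S h\<close>. So \<open>S\<close>
  is injective, and by finite dimension surjective.\<close>

lemma antipode_surj:
 assumes fd: "finite_dimensional K H" and t: "t : carrier H" "\<epsilon> t = \<one>\<^bsub>K\<^esub>" "!!h. h : carrier H ==> h ** t = \<epsilon> h \<odot> t"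
 shows "S ` carrier H = carrier H"
proof (rule H.injective_linear_surj[OF fd antipode_linear])
 fix h assume h: "h : carrier H" and Sh: "S h = \<zero>"
 define \<chi> where "\<chi> c x = \<phi> c (S x)" for c x
 define ps where "ps c x = \<chi> c (S (b c) ** x)" for c x
 have \<chi>: "linear_functional K H (\<chi> c)" if "c < r" for c
  unfolding linear_functional_def \<chi>_def using that by (auto simp: S_add S_smult \<phi>_add \<phi>_smult)
 have ps: "linear_functional K H (ps c)" if "c < r" for c
  unfolding linear_functional_def ps_def using that linear_functionalD[OF \<chi>[OF that]]
  by (auto simp: H.A.r_distr H.smult_mult_right)
 have Bc: "Bf (ps c) \<one> \<one> (D t) : carrier H" if "c < r" for c using Bf_closed[OF ps[OF that]] t(1) by simp
 have one: "\<one> = (\<Oplus>c\<in>{..<r}. Bf (ps c) \<one> \<one> (D t))"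
 proof -
  define g where "g c s = Bf (\<chi> c) \<one> (b c) s" for c s
  have g: "g c : hom HH.T (add_monoid H)" if "c < r" for c
   unfolding g_def Bf_def using HH.lift_hom[OF balanced_Bf[OF \<chi>[OF that] H.A.one_closed b_closed[OF that]]] by simp
  have "S x ** y = finprod (add_monoid H) (%c. g c (HH.pt x y)) {..<r}" if x: "x : carrier H" "y : carrier H" for x y
  proof -
   have "S x ** y = (\<Oplus>c\<in>{..<r}. \<chi> c x \<odot> b c) ** y" using expand[of "S x"] x unfolding \<chi>_def by simp
   also have "... = (\<Oplus>c\<in>{..<r}. (\<chi> c x \<odot> b c) ** y)"
    using x linear_functionalD(1)[OF \<chi>] by (intro H.A.finsum_ldistr) auto
   also have "... = (\<Oplus>c\<in>{..<r}. g c (HH.pt x y))"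
    using x linear_functionalD(1)[OF \<chi>]
    by (intro H.M.finsum_cong') (auto simp: g_def Bf_def HH.lift_pure[OF balanced_Bf[OF \<chi>]] H.smult_mult_left)
   finally show ?thesis unfolding finsum_def .
  qed
  then have "tensor_lift (add_monoid H) (%x y. S x ** y) (D t) = finprod (add_monoid H) (%c. g c (D t)) {..<r}"
   using hom_finprod_hom[OF H.M.a_comm_group group_T(1) finite_lessThan, of r g] g t(1)
   by (intro HH.lift_unique[OF balanced_S(1)]) auto
  then have "\<one> = (\<Oplus>c\<in>{..<r}. g c (D t))" using antipode_left[OF t(1)] t(2) unfolding finsum_def by simp
  also have "... = (\<Oplus>c\<in>{..<r}. Bf (ps c) \<one> \<one> (D t))"
  proof (intro H.M.finsum_cong')
   fix c assume "c : {..<r}"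
   then have c: "c < r" by simp
   have "g c (D t) = b c ** Bf (\<chi> c) \<one> \<one> (D t)"
    using Bf_mult[OF \<chi>[OF c], of "\<one>" "\<one>" "b c"] c t(1) unfolding g_def by simp
   also have "... = Bf (\<chi> c) (S (b c)) \<one> (D t)" using Bf_integral[OF \<chi>[OF c] t(1,3) b_closed[OF c]] .
   also have "... = Bf (ps c) \<one> \<one> (D t)"
    unfolding Bf_def using c t(1) by (intro HH.lift_cong balanced_Bf[OF ps[OF c]]) (auto simp: ps_def)
   finally show "g c (D t) = Bf (ps c) \<one> \<one> (D t)" .
  qed (use Bc in auto)
  finally show ?thesis .
 qed
 have "h = h ** (\<Oplus>c\<in>{..<r}. Bf (ps c) \<one> \<one> (D t))" unfolding one[symmetric] using h by simp
 also have "... = (\<Oplus>c\<in>{..<r}. h ** Bf (ps c) \<one> \<one> (D t))" using h Bc by (intro H.A.finsum_rdistr) auto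
 also have "... = \<zero>"
 proof (intro H.M.add.finprod_one_eqI)
  fix c assume "c : {..<r}"
  then have c: "c < r" by simp
  show "h ** Bf (ps c) \<one> \<one> (D t) = \<zero>"
   using Bf_integral[OF ps[OF c] t(1,3) h] Bf_zero[OF ps[OF c] H.A.one_closed D_closed[OF t(1)]] Sh by simp
 qed
 finally show "h = \<zero>" .
qed

end

section \<open>Semisimple Hopf algebras acting on a ring\<close>

locale semisimple_hopf_action = hopf_basis K H r b \<phi> + hopf_module_algebra K H Q act
 for K :: "('k, 'm) ring_scheme" and H :: "('k, 'h, 'n) hopf_scheme" and r b \<phi>
  and Q :: "('k, 'q, 'p) module_scheme" (structure) and act :: "'h => 'q => 'q" +
 fixes t :: 'h
 assumes fd: "finite_dimensional K H" and t_closed: "t : carrier H" and \<epsilon>_t: "\<epsilon> t = \<one>\<^bsub>K\<^esub>"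
  and left_integral: "h : carrier H ==> h **\<^bsub>H\<^esub> t = \<epsilon> h \<odot>\<^bsub>H\<^esub> t"
  and right_integral: "h : carrier H ==> t **\<^bsub>H\<^esub> h = \<epsilon> h \<odot>\<^bsub>H\<^esub> t"
begin

sublocale QQ: tensor_pair K Q Q
 by (rule tensor_pair_module) (rule A.module_axioms)+

lemma act_closed [simp]: "[|h : carrier H; x : carrier Q|] ==> act h x : carrier Q"
 and act_add: "[|h : carrier H; x : carrier Q; y : carrier Q|] ==> act h (x \<oplus> y) = act h x \<oplus> act h y"
 and act_smult: "[|h : carrier H; c : carrier K; x : carrier Q|] ==> act h (c \<odot> x) = c \<odot> act h x"
 using linear_mapsD[OF act_linear] by auto

lemma act_add_left: "[|h : carrier H; g : carrier H; x : carrier Q|] ==> act (h \<oplus>\<^bsub>H\<^esub> g) x = act h x \<oplus> act g x"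
 and act_smult_left: "[|h : carrier H; c : carrier K; x : carrier Q|] ==> act (c \<odot>\<^bsub>H\<^esub> h) x = c \<odot> act h x"
 using linear_mapsD[OF act_linear_left] by auto

lemma act_finsum_left:
 "[|finite I; !!i. i : I ==> f i : carrier H; x : carrier Q|] ==>
  act (finsum H f I) x = (\<Oplus>i\<in>I. act (f i) x)"
 unfolding finsum_def
 by (rule hom_finprod[OF homI H.M.a_comm_group A.M.a_comm_group]) (auto simp: act_add_left)

lemma act_zero_left: "x : carrier Q ==> act \<zero>\<^bsub>H\<^esub> x = \<zero>"
 using act_smult_left[of "\<zero>\<^bsub>H\<^esub>" "\<zero>\<^bsub>K\<^esub>" x] by simp

text \<open>Since \<open>D (u i j)\<close> is a sum of pure tensors of coefficients, the module
  algebra axiom becomes matrix multiplication.\<close>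

lemma act_u_mult:
 assumes ij: "i < r" "j < r" and x: "x : carrier Q" "y : carrier Q"
 shows "act (u i j) (x ** y) = (\<Oplus>a\<in>{..<r}. act (u i a) x ** act (u a j) y)"
proof -
 note D' = balancedD[OF QQ.balanced_pure]
 have mul: "balanced K Q Q (add_monoid Q) (%x y. x ** y)"
  by (rule balancedI[OF A.M.a_comm_group])
   (auto simp: A.A.l_distr A.A.r_distr A.smult_mult_left A.smult_mult_right)
 have ba: "balanced K Q Q QQ.T (%x y. QQ.pt (act g x) (act h y))" if "g : carrier H" "h : carrier H" for g h
  by (rule balancedI[OF QQ.comm_group_tensor])
   (use that in \<open>auto simp: act_add act_smult D' intro!: QQ.pure_closed\<close>)
 have bh: "balanced K H H QQ.T (%g h. QQ.pt (act g x) (act h y))"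
  by (rule balancedI[OF QQ.comm_group_tensor])
   (use x in \<open>auto simp: act_add_left act_smult_left D' intro!: QQ.pure_closed\<close>)
 have bm: "balanced K H H (add_monoid Q) (%g h. act g x ** act h y)"
  by (rule balancedI[OF A.M.a_comm_group])
   (use x in \<open>auto simp: act_add_left act_smult_left A.A.l_distr A.A.r_distr A.smult_mult_left A.smult_mult_right\<close>)
 have Du: "D (u i j) : carrier HH.T" using ij by simp
 have "act (u i j) (x ** y) =
   tensor_lift (add_monoid Q) (%a b. a ** b)
    (tensor_lift QQ.T (%g h. tensor_map K Q Q (act g) (act h) (QQ.pt x y)) (D (u i j)))"
  using act_mult[of "u i j" "QQ.pt x y"] ij x QQ.pure_closed[OF x]
  by (simp add: QQ.lift_pure[OF mul] tensor_algebra_def)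
 also have "tensor_lift QQ.T (%g h. tensor_map K Q Q (act g) (act h) (QQ.pt x y)) (D (u i j)) =
   tensor_lift QQ.T (%g h. QQ.pt (act g x) (act h y)) (D (u i j))"
  by (rule HH.lift_cong[OF bh Du]) (simp add: tensor_map_def QQ.lift_pure[OF ba x])
 also have "tensor_lift (add_monoid Q) (%a b. a ** b) ... =
   tensor_lift (add_monoid Q) (%g h. tensor_lift (add_monoid Q) (%a b. a ** b) (QQ.pt (act g x) (act h y))) (D (u i j))"
  by (rule HH.lift_hom_image[OF bh QQ.lift_hom[OF mul] A.M.a_comm_group Du])
 also have "... = tensor_lift (add_monoid Q) (%g h. act g x ** act h y) (D (u i j))"
  by (rule HH.lift_cong[OF bm Du]) (simp add: QQ.lift_pure[OF mul] x)
 also have "... = (\<Oplus>a\<in>{..<r}. act (u i a) x ** act (u a j) y)"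
  unfolding finsum_def by (rule lift_D_u[OF bm ij])
 finally show ?thesis .
qed

abbreviation "Ks \<equiv> (%c. c \<odot> \<one>) ` carrier K"

lemma act_combination:
 assumes f: "!!i j. [|i < r; j < r|] ==> f i j : carrier H" and c: "!!i j. [|i < r; j < r|] ==> c i j : carrier K"
  and x: "x : carrier Q"
 shows "act (\<Oplus>\<^bsub>H\<^esub>i\<in>{..<r}. \<Oplus>\<^bsub>H\<^esub>j\<in>{..<r}. c i j \<odot>\<^bsub>H\<^esub> f i j) x =
  (\<Oplus>i\<in>{..<r}. \<Oplus>j\<in>{..<r}. act (f i j) x ** (c i j \<odot> \<one>))"
proof -
 have "act (\<Oplus>\<^bsub>H\<^esub>i\<in>{..<r}. \<Oplus>\<^bsub>H\<^esub>j\<in>{..<r}. c i j \<odot>\<^bsub>H\<^esub> f i j) x =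
   (\<Oplus>i\<in>{..<r}. act (\<Oplus>\<^bsub>H\<^esub>j\<in>{..<r}. c i j \<odot>\<^bsub>H\<^esub> f i j) x)"
  using f c x by (intro act_finsum_left) (auto intro!: H.M.finsum_closed)
 also have "... = (\<Oplus>i\<in>{..<r}. \<Oplus>j\<in>{..<r}. act (c i j \<odot>\<^bsub>H\<^esub> f i j) x)"
  using f c x by (intro A.M.finsum_cong' act_finsum_left) (auto intro!: A.M.finsum_closed)
 also have "... = (\<Oplus>i\<in>{..<r}. \<Oplus>j\<in>{..<r}. act (f i j) x ** (c i j \<odot> \<one>))"
  using f c x by (intro A.M.finsum_cong')
   (auto simp: act_smult_left A.smult_mult_right intro!: A.M.finsum_closed)
 finally show ?thesis .
qed

lemma u_span:
 assumes h: "h : carrier H"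
 obtains c where "\<forall>i<r. \<forall>j<r. c i j : carrier K"
  "h = (\<Oplus>\<^bsub>H\<^esub>i\<in>{..<r}. \<Oplus>\<^bsub>H\<^esub>j\<in>{..<r}. c i j \<odot>\<^bsub>H\<^esub> u i j)"
proof (rule that[of "%i j. \<phi> j h **\<^bsub>K\<^esub> \<epsilon> (b i)"])
 show "\<forall>i<r. \<forall>j<r. \<phi> j h **\<^bsub>K\<^esub> \<epsilon> (b i) : carrier K" using h by simp
 have "h = (\<Oplus>\<^bsub>H\<^esub>j\<in>{..<r}. \<phi> j h \<odot>\<^bsub>H\<^esub> b j)" using expand[OF h] .
 also have "... = (\<Oplus>\<^bsub>H\<^esub>j\<in>{..<r}. \<Oplus>\<^bsub>H\<^esub>i\<in>{..<r}. (\<phi> j h **\<^bsub>K\<^esub> \<epsilon> (b i)) \<odot>\<^bsub>H\<^esub> u i j)"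
 proof (intro H.M.finsum_cong')
  fix j assume "j : {..<r}"
  then have j: "j < r" by simp
  have "\<phi> j h \<odot>\<^bsub>H\<^esub> b j = \<phi> j h \<odot>\<^bsub>H\<^esub> (\<Oplus>\<^bsub>H\<^esub>i\<in>{..<r}. \<epsilon> (b i) \<odot>\<^bsub>H\<^esub> u i j)" by (rule arg_cong[OF b_u[OF j]])
  also have "... = (\<Oplus>\<^bsub>H\<^esub>i\<in>{..<r}. \<phi> j h \<odot>\<^bsub>H\<^esub> (\<epsilon> (b i) \<odot>\<^bsub>H\<^esub> u i j))"
   using j h by (intro H.finsum_smult_ldistr) auto
  also have "... = (\<Oplus>\<^bsub>H\<^esub>i\<in>{..<r}. (\<phi> j h **\<^bsub>K\<^esub> \<epsilon> (b i)) \<odot>\<^bsub>H\<^esub> u i j)"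
   using j h by (intro H.M.finsum_cong') (auto simp: H.smult_assoc1)
  finally show "\<phi> j h \<odot>\<^bsub>H\<^esub> b j = ..." .
 qed (use h in \<open>auto intro!: H.M.finsum_closed\<close>)
 also have "... = (\<Oplus>\<^bsub>H\<^esub>i\<in>{..<r}. \<Oplus>\<^bsub>H\<^esub>j\<in>{..<r}. (\<phi> j h **\<^bsub>K\<^esub> \<epsilon> (b i)) \<odot>\<^bsub>H\<^esub> u i j)"
  using h by (intro H.M.finsum_swap) auto
 finally show "h = ..." .
qed

lemma act_antipode:
 assumes ij: "i < r" "j < r" and x: "x : carrier Q"
  and f: "!!a. a < r ==> f a : carrier H" "!!a. a < r ==> g a : carrier H"
  and s: "(\<Oplus>\<^bsub>H\<^esub>a\<in>{..<r}. f a **\<^bsub>H\<^esub> g a) = (if i = j then \<one>\<^bsub>H\<^esub> else \<zero>\<^bsub>H\<^esub>)"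
 shows "(\<Oplus>a\<in>{..<r}. act (f a) (act (g a) x)) = (if i = j then x else \<zero>)"
proof -
 have "(\<Oplus>a\<in>{..<r}. act (f a) (act (g a) x)) = (\<Oplus>a\<in>{..<r}. act (f a **\<^bsub>H\<^esub> g a) x)"
  using f x by (intro A.M.finsum_cong') (auto simp: act_assoc)
 also have "... = act (\<Oplus>\<^bsub>H\<^esub>a\<in>{..<r}. f a **\<^bsub>H\<^esub> g a) x" using f x by (intro act_finsum_left[symmetric]) auto
 finally show ?thesis unfolding s using x by (simp add: act_one act_zero_left)
qed

sublocale co: coaction Q r "%i j. act (u i j)" "%i j. act (S (u i j))" "act ` carrier H" Ks
proof unfold_locales
 show "\<exists>w''\<in>act ` carrier H. \<forall>x\<in>carrier Q. w'' x = w (w' x)"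
  if w: "w : act ` carrier H" "w' : act ` carrier H" for w w'
 proof -
  obtain g h where "g : carrier H" "h : carrier H" "w = act g" "w' = act h" using w by blast
  then show ?thesis by (intro bexI[of _ "act (g **\<^bsub>H\<^esub> h)"]) (auto simp: act_assoc)
 qed
 show "\<exists>ka. (\<forall>i<r. \<forall>j<r. ka i j : Ks) &
   (\<forall>x\<in>carrier Q. w x = (\<Oplus>i\<in>{..<r}. \<Oplus>j\<in>{..<r}. act (u i j) x ** ka i j))"
  if w: "w : act ` carrier H" for w
 proof -
  obtain h where h: "h : carrier H" "w = act h" using w by blast
  obtain c where c: "\<forall>i<r. \<forall>j<r. c i j : carrier K"
   "h = (\<Oplus>\<^bsub>H\<^esub>i\<in>{..<r}. \<Oplus>\<^bsub>H\<^esub>j\<in>{..<r}. c i j \<odot>\<^bsub>H\<^esub> u i j)" using u_span[OF h(1)] .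
  have e: "act h x = (\<Oplus>i\<in>{..<r}. \<Oplus>j\<in>{..<r}. act (u i j) x ** (c i j \<odot> \<one>))" if "x : carrier Q" for x
   unfolding c(2) by (rule act_combination[of u c, OF _ _ that]) (use c(1) in simp_all)
  have k: "\<forall>i<r. \<forall>j<r. c i j \<odot> \<one> : Ks" by (intro allI impI imageI) (rule c(1)[rule_format])
  show ?thesis
   unfolding h(2) by (rule exI[of _ "%i j. c i j \<odot> \<one>"], rule conjI[OF k], rule ballI, rule e)
 qed
 show "\<exists>ka. (\<forall>i<r. \<forall>j<r. ka i j : Ks) &
   (\<forall>x\<in>carrier Q. w x = (\<Oplus>i\<in>{..<r}. \<Oplus>j\<in>{..<r}. act (S (u i j)) x ** ka i j))"
  if w: "w : act ` carrier H" for w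
 proof -
  obtain g where g: "g : carrier H" "w = act g" using w by blast
  \<comment> \<open>Surjectivity of the antipode makes every operator a combination of antipodes of
    coefficients.\<close>
  then have "g : S ` carrier H" using antipode_surj[OF fd t_closed \<epsilon>_t left_integral] by simp
  then obtain h where h: "h : carrier H" "w = act (S h)" using g(2) by blast
  obtain c where c: "\<forall>i<r. \<forall>j<r. c i j : carrier K"
   "h = (\<Oplus>\<^bsub>H\<^esub>i\<in>{..<r}. \<Oplus>\<^bsub>H\<^esub>j\<in>{..<r}. c i j \<odot>\<^bsub>H\<^esub> u i j)" using u_span[OF h(1)] .
  have Sf: "S (finsum H f I) = (\<Oplus>\<^bsub>H\<^esub>i\<in>I. S (f i))" if "finite I" "!!i. i : I ==> f i : carrier H" for f and I :: "nat set"
   using that by (intro H.M.finsum_hom) (auto simp: S_add)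
  have "S h = (\<Oplus>\<^bsub>H\<^esub>i\<in>{..<r}. S (\<Oplus>\<^bsub>H\<^esub>j\<in>{..<r}. c i j \<odot>\<^bsub>H\<^esub> u i j))"
   unfolding c(2) using c(1) by (intro Sf) (auto intro!: H.M.finsum_closed)
  also have "... = (\<Oplus>\<^bsub>H\<^esub>i\<in>{..<r}. \<Oplus>\<^bsub>H\<^esub>j\<in>{..<r}. S (c i j \<odot>\<^bsub>H\<^esub> u i j))"
   using c(1) by (intro H.M.finsum_cong' Sf) (auto intro!: H.M.finsum_closed)
  also have "... = (\<Oplus>\<^bsub>H\<^esub>i\<in>{..<r}. \<Oplus>\<^bsub>H\<^esub>j\<in>{..<r}. c i j \<odot>\<^bsub>H\<^esub> S (u i j))"
   using c(1) by (intro H.M.finsum_cong') (auto simp: S_smult intro!: H.M.finsum_closed)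
  finally have Sh: "S h = (\<Oplus>\<^bsub>H\<^esub>i\<in>{..<r}. \<Oplus>\<^bsub>H\<^esub>j\<in>{..<r}. c i j \<odot>\<^bsub>H\<^esub> S (u i j))" .
  have e: "act (S h) x = (\<Oplus>i\<in>{..<r}. \<Oplus>j\<in>{..<r}. act (S (u i j)) x ** (c i j \<odot> \<one>))" if "x : carrier Q" for x
   unfolding Sh by (rule act_combination[of "%i j. S (u i j)" c, OF _ _ that]) (use c(1) in simp_all)
  have k: "\<forall>i<r. \<forall>j<r. c i j \<odot> \<one> : Ks" by (intro allI impI imageI) (rule c(1)[rule_format])
  show ?thesis
   unfolding h(2) by (rule exI[of _ "%i j. c i j \<odot> \<one>"], rule conjI[OF k], rule ballI, rule e)
 qed
 show "\<exists>w\<in>act ` carrier H. \<forall>x\<in>carrier Q. w x = x" by (rule bexI[of _ "act \<one>\<^bsub>H\<^esub>"]) (auto simp: act_one)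
 show "(\<Oplus>a\<in>{..<r}. act (u i a) (act (S (u a j)) x)) = (if i = j then x else \<zero>)"
  "(\<Oplus>a\<in>{..<r}. act (S (u i a)) (act (u a j) x)) = (if i = j then x else \<zero>)"
  if ij: "i < r" "j < r" "x : carrier Q" for i j x
  using act_antipode[OF ij _ _ u_antipode(1)[OF ij(1,2)]] act_antipode[OF ij _ _ u_antipode(2)[OF ij(1,2)]] ij
  by auto
qed (use t_closed in \<open>auto simp: act_add A.smult_mult_left A.smult_mult_right act_u_mult\<close>)

text \<open>On matrix coefficients this is \<open>co.u_one\<close>, and the coefficients span
  \<open>H\<close>.\<close>

lemma act_one_right: "h : carrier H ==> act h \<one> = \<epsilon> h \<odot> \<one>"
 by (erule u_induct)
  (auto simp: co.u_one act_zero_left \<epsilon>_zero \<epsilon>_u act_add_left \<epsilon>_add A.smult_l_distr act_smult_left \<epsilon>_smult A.smult_assoc1)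

sublocale co: coaction_integral Q r "%i j. act (u i j)" "%i j. act (S (u i j))" "act ` carrier H" Ks "act t"
proof unfold_locales
 show "act (u i j) (act t x) = (if i = j then act t x else \<zero>)"
  "act t (act (u i j) x) = (if i = j then act t x else \<zero>)" if ij: "i < r" "j < r" "x : carrier Q" for i j x
  using act_assoc[OF u_closed[OF ij(1,2)] t_closed ij(3)] act_assoc[OF t_closed u_closed[OF ij(1,2)] ij(3)]
   left_integral[OF u_closed[OF ij(1,2)]] right_integral[OF u_closed[OF ij(1,2)]] \<epsilon>_u[OF ij(1,2)] ij(3) t_closed
  by (auto simp: act_smult_left)
 show "act t \<one> = \<one>" using act_one_right[OF t_closed] \<epsilon>_t by simp
qed (use t_closed in blast)

lemma invs_iff: "x : co.invs \<longleftrightarrow> x : carrier Q & (\<forall>h\<in>carrier H. act h x = \<epsilon> h \<odot> x)"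
proof (intro iffI conjI ballI)
 assume x: "x : co.invs"
 then show xc: "x : carrier Q" by (rule co.invs_carrier)
 fix h assume "h : carrier H"
 then show "act h x = \<epsilon> h \<odot> x"
  by (rule u_induct)
   (use xc co.invs_u[OF x] in \<open>auto simp: act_zero_left \<epsilon>_zero \<epsilon>_u act_add_left \<epsilon>_add A.smult_l_distr act_smult_left \<epsilon>_smult A.smult_assoc1\<close>)
next
 assume "x : carrier Q & (\<forall>h\<in>carrier H. act h x = \<epsilon> h \<odot> x)"
 then show "x : co.invs" unfolding co.invs_def by (auto simp: \<epsilon>_u)
qed

lemma stable_iff: "co.stable I \<longleftrightarrow> H_stable H act I"
 unfolding co.stable_def H_stable_def by auto

end

section \<open>Uniqueness of right localizations\<close>

lemma right_localizationD:
 assumes "right_localization R S l L"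
 shows "ring R" "ring L" "l : ring_hom R L" "!!s. s : S ==> l s : Units L"
  "!!q. q : carrier L ==> \<exists>a\<in>carrier R. \<exists>s\<in>S. q = l a **\<^bsub>L\<^esub> inv\<^bsub>L\<^esub> (l s)"
  "!!a. a : carrier R ==> l a = \<zero>\<^bsub>L\<^esub> \<longleftrightarrow> (\<exists>s\<in>S. a **\<^bsub>R\<^esub> s = \<zero>\<^bsub>R\<^esub>)"
 using assms unfolding right_localization_def by auto

lemma (in ring) fraction_iff:
 assumes "s : Units R" "x : carrier R" "q : carrier R" shows "q = x ** inv s \<longleftrightarrow> q ** s = x"
 using assms Units_closed[OF assms(1)] by (auto simp: m_assoc)

lemma (in ring) fraction_mult: "[|s : Units R; x : carrier R|] ==> x ** inv s ** s = x"
 using fraction_iff[of s x "x ** inv s"] by simp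

lemma (in ring) Units_cancel_right:
 assumes "s : Units R" "x : carrier R" "y : carrier R" "x ** s = y ** s" shows "x = y"
 using fraction_iff[OF assms(1), of "y ** s" x] fraction_iff[OF assms(1), of "y ** s" y] assms Units_closed[OF assms(1)]
 by simp

locale two_right_localizations =
 fixes R :: "('a, 'm) ring_scheme" (structure) and S :: "'a set" and l :: "'a => 'b" and L :: "('b, 'n) ring_scheme"
  and l' :: "'a => 'c" and L' :: "('c, 'p) ring_scheme"
 assumes loc: "right_localization R S l L" and loc': "right_localization R S l' L'"
  and S_closed: "S <= carrier R"
begin

sublocale R: ring R using right_localizationD(1)[OF loc] .
sublocale L: ring L using right_localizationD(2)[OF loc] .
sublocale L': ring L' using right_localizationD(2)[OF loc'] .
sublocale h: ring_hom_ring R L l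
 using right_localizationD(3)[OF loc] by (intro ring_hom_ringI2 R.ring_axioms L.ring_axioms)
sublocale h': ring_hom_ring R L' l'
 using right_localizationD(3)[OF loc'] by (intro ring_hom_ringI2 R.ring_axioms L'.ring_axioms)

text \<open>\<open>S\<close> is not assumed to be closed under products, but the elements inverted
  by both maps are; they serve as common denominators.\<close>

definition good :: "'a => bool" where "good w \<longleftrightarrow> w : carrier R & l w : Units L & l' w : Units L'"

lemma good_S: "s : S ==> good s"
 unfolding good_def using right_localizationD(4)[OF loc] right_localizationD(4)[OF loc'] S_closed by blast

lemma good_mult: "[|good w; good w'|] ==> good (w ** w')"
 unfolding good_def by simp

lemma goodD: "good w ==> w : carrier R" "good w ==> l w : Units L" "good w ==> l' w : Units L'"
 unfolding good_def by auto

lemma equal_image: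
 assumes "a : carrier R" "b : carrier R" "l a = l b"
 shows "\<exists>s\<in>S. a ** s = b ** s"
proof -
 have "l (a \<ominus> b) = \<zero>\<^bsub>L\<^esub>" using assms by (simp add: R.minus_eq L.r_neg)
 then obtain s where s: "s : S" "(a \<ominus> b) ** s = \<zero>"
  using right_localizationD(6)[OF loc, of "a \<ominus> b"] assms by auto
 have sc: "s : carrier R" using s S_closed by blast
 have "a ** s \<ominus> b ** s = \<zero>" using s(2) assms sc by (simp add: R.minus_eq R.l_distr R.l_minus)
 then show ?thesis using s(1) assms sc by auto
qed

text \<open>The Ore condition is read off from \<open>L\<close>: the inverse of \<open>l w\<close>
  times \<open>l y\<close> is a fraction, and after clearing denominators \<open>equal_image\<close>
  lifts the equation to \<open>R\<close> at the cost of one more factor from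
  \<open>S\<close>.\<close>

lemma good_move:
 assumes w: "good w" and y: "y : carrier R"
 obtains d c where "good d" "c : carrier R" "y ** d = w ** c"
proof -
 have lw: "l w : Units L" "w : carrier R" using goodD w by auto
 obtain c s where c: "c : carrier R" "s : S" "inv\<^bsub>L\<^esub> (l w) **\<^bsub>L\<^esub> l y = l c **\<^bsub>L\<^esub> inv\<^bsub>L\<^esub> (l s)"
  using right_localizationD(5)[OF loc, of "inv\<^bsub>L\<^esub> (l w) **\<^bsub>L\<^esub> l y"] lw y by auto
 have s: "l s : Units L" "s : carrier R" using good_S[OF c(2)] goodD by auto
 have "inv\<^bsub>L\<^esub> (l w) **\<^bsub>L\<^esub> l y **\<^bsub>L\<^esub> l s = l c" using c(3) s lw y c(1) L.fraction_iff[OF s(1)] by simp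
 then have "l w **\<^bsub>L\<^esub> (inv\<^bsub>L\<^esub> (l w) **\<^bsub>L\<^esub> l y **\<^bsub>L\<^esub> l s) = l (w ** c)" using lw c(1) by simp
 then have "l (y ** s) = l (w ** c)"
  using lw s y by (simp add: L.m_assoc L.assoc_eq[OF L.Units_r_inv])
 from equal_image[OF _ _ this] obtain e where e: "e : S" "y ** s ** e = w ** c ** e"
  using y s lw c(1) by auto
 have ec: "e : carrier R" using e S_closed by blast
 show ?thesis
  using that[OF good_mult[OF good_S[OF c(2)] good_S[OF e(1)]], of "c ** e"] e(2) ec y s lw c(1)
  by (simp add: R.m_assoc)
qed

text \<open>The graph of the isomorphism: fractions with a common numerator and a common
  denominator. Single-valuedness is left to \<open>rel_functional\<close>.\<close>

definition rel :: "'b => 'c => bool" where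
 "rel q q' \<longleftrightarrow> q : carrier L & q' : carrier L' &
  (\<exists>w a. good w & a : carrier R & q **\<^bsub>L\<^esub> l w = l a & q' **\<^bsub>L'\<^esub> l' w = l' a)"

lemma relI:
 "[|q : carrier L; q' : carrier L'; good w; a : carrier R; q **\<^bsub>L\<^esub> l w = l a; q' **\<^bsub>L'\<^esub> l' w = l' a|] ==> rel q q'"
 unfolding rel_def by blast

lemma rel_hom: "a : carrier R ==> rel (l a) (l' a)"
 by (rule relI[of _ _ "\<one>" a]) (simp_all add: good_def)

lemma rel_total:
 assumes q: "q : carrier L" shows "\<exists>q'. rel q q'"
proof -
 obtain a s where a: "a : carrier R" "s : S" "q = l a **\<^bsub>L\<^esub> inv\<^bsub>L\<^esub> (l s)"
  using right_localizationD(5)[OF loc q] by blast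
 note g = good_S[OF a(2)] goodD[OF good_S[OF a(2)]]
 have "rel q (l' a **\<^bsub>L'\<^esub> inv\<^bsub>L'\<^esub> (l' s))"
  using a g L.fraction_mult[OF g(3), of "l a"] L'.fraction_mult[OF g(4), of "l' a"] q
  by (intro relI[of _ _ s a]) auto
 then show ?thesis by blast
qed

lemma rel_scale:
 assumes "q : carrier L" "a : carrier R" "w : carrier R" "c : carrier R" "q **\<^bsub>L\<^esub> l w = l a"
 shows "q **\<^bsub>L\<^esub> l (w ** c) = l (a ** c)"
 using assms L.assoc_eq[OF assms(5), of "l c"] by simp

lemma rel_scale':
 assumes "q : carrier L'" "a : carrier R" "w : carrier R" "c : carrier R" "q **\<^bsub>L'\<^esub> l' w = l' a"
 shows "q **\<^bsub>L'\<^esub> l' (w ** c) = l' (a ** c)"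
 using assms L'.assoc_eq[OF assms(5), of "l' c"] by simp

lemma rel_common:
 assumes "rel p p'" "rel q q'"
 obtains w a b where "good w" "a : carrier R" "b : carrier R" "p **\<^bsub>L\<^esub> l w = l a" "p' **\<^bsub>L'\<^esub> l' w = l' a"
  "q **\<^bsub>L\<^esub> l w = l b" "q' **\<^bsub>L'\<^esub> l' w = l' b"
proof -
 obtain w a where 1: "good w" "a : carrier R" "p **\<^bsub>L\<^esub> l w = l a" "p' **\<^bsub>L'\<^esub> l' w = l' a"
  using assms(1) unfolding rel_def by blast
 obtain v b where 2: "good v" "b : carrier R" "q **\<^bsub>L\<^esub> l v = l b" "q' **\<^bsub>L'\<^esub> l' v = l' b"
  using assms(2) unfolding rel_def by blast
 have c: "p : carrier L" "q : carrier L" "p' : carrier L'" "q' : carrier L'" using assms unfolding rel_def by auto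
 obtain d e where d: "good d" "e : carrier R" "v ** d = w ** e"
  using good_move[OF 1(1) goodD(1)[OF 2(1)]] .
 show ?thesis
 proof (rule that[OF good_mult[OF 2(1) d(1)]])
  show "p **\<^bsub>L\<^esub> l (v ** d) = l (a ** e)" "p' **\<^bsub>L'\<^esub> l' (v ** d) = l' (a ** e)"
   unfolding d(3) by (rule rel_scale[OF c(1) 1(2) goodD(1)[OF 1(1)] d(2) 1(3)])
    (rule rel_scale'[OF c(3) 1(2) goodD(1)[OF 1(1)] d(2) 1(4)])
  show "q **\<^bsub>L\<^esub> l (v ** d) = l (b ** d)" "q' **\<^bsub>L'\<^esub> l' (v ** d) = l' (b ** d)"
   by (rule rel_scale[OF c(2) 2(2) goodD(1)[OF 2(1)] goodD(1)[OF d(1)] 2(3)])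
    (rule rel_scale'[OF c(4) 2(2) goodD(1)[OF 2(1)] goodD(1)[OF d(1)] 2(4)])
 qed (use 1 2 d goodD in auto)
qed

lemma rel_functional:
 assumes "rel q p'" "rel q q'" shows "p' = q'"
proof -
 obtain w a b where w: "good w" "a : carrier R" "b : carrier R" "q **\<^bsub>L\<^esub> l w = l a" "p' **\<^bsub>L'\<^esub> l' w = l' a"
  "q **\<^bsub>L\<^esub> l w = l b" "q' **\<^bsub>L'\<^esub> l' w = l' b" using rel_common[OF assms] .
 obtain s where s: "s : S" "a ** s = b ** s" using equal_image[OF w(2,3)] w(4,6) by auto
 have sc: "s : carrier R" using s S_closed by blast
 have c: "p' : carrier L'" "q' : carrier L'" using assms unfolding rel_def by auto
 have "p' **\<^bsub>L'\<^esub> l' (w ** s) = q' **\<^bsub>L'\<^esub> l' (w ** s)"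
  using rel_scale'[OF c(1) w(2) goodD(1)[OF w(1)] sc w(5)] rel_scale'[OF c(2) w(3) goodD(1)[OF w(1)] sc w(7)] s(2)
  by simp
 then show ?thesis using L'.Units_cancel_right[OF goodD(3)[OF good_mult[OF w(1) good_S[OF s(1)]]]] c by blast
qed

lemma rel_add:
 assumes "rel p p'" "rel q q'" shows "rel (p \<oplus>\<^bsub>L\<^esub> q) (p' \<oplus>\<^bsub>L'\<^esub> q')"
proof -
 have c: "p : carrier L" "q : carrier L" "p' : carrier L'" "q' : carrier L'" using assms unfolding rel_def by auto
 obtain w a b where w: "good w" "a : carrier R" "b : carrier R" "p **\<^bsub>L\<^esub> l w = l a" "p' **\<^bsub>L'\<^esub> l' w = l' a"
  "q **\<^bsub>L\<^esub> l w = l b" "q' **\<^bsub>L'\<^esub> l' w = l' b" using rel_common[OF assms] .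
 show ?thesis
  by (rule relI[of _ _ w "a \<oplus> b"]) (use c w goodD(1)[OF w(1)] in \<open>auto simp: L.l_distr L'.l_distr\<close>)
qed

lemma rel_mult:
 assumes "rel p p'" "rel q q'" shows "rel (p **\<^bsub>L\<^esub> q) (p' **\<^bsub>L'\<^esub> q')"
proof -
 obtain w a where 1: "good w" "a : carrier R" "p **\<^bsub>L\<^esub> l w = l a" "p' **\<^bsub>L'\<^esub> l' w = l' a"
  using assms(1) unfolding rel_def by blast
 obtain v b where 2: "good v" "b : carrier R" "q **\<^bsub>L\<^esub> l v = l b" "q' **\<^bsub>L'\<^esub> l' v = l' b"
  using assms(2) unfolding rel_def by blast
 have c: "p : carrier L" "q : carrier L" "p' : carrier L'" "q' : carrier L'" using assms unfolding rel_def by auto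
 obtain d e where d: "good d" "e : carrier R" "b ** d = w ** e" using good_move[OF 1(1) 2(2)] .
 have g: "w : carrier R" "v : carrier R" "d : carrier R" using goodD 1 2 d by auto
 have "p **\<^bsub>L\<^esub> q **\<^bsub>L\<^esub> l (v ** d) = l (a ** e)"
  using rel_scale[OF c(2) 2(2) g(2,3) 2(3)] rel_scale[OF c(1) 1(2) g(1) d(2) 1(3)] c g unfolding d(3)
  by (simp add: L.m_assoc del: h.hom_mult)
 moreover have "p' **\<^bsub>L'\<^esub> q' **\<^bsub>L'\<^esub> l' (v ** d) = l' (a ** e)"
  using rel_scale'[OF c(4) 2(2) g(2,3) 2(4)] rel_scale'[OF c(3) 1(2) g(1) d(2) 1(4)] c g unfolding d(3)
  by (simp add: L'.m_assoc del: h'.hom_mult)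
 ultimately show ?thesis
  using c good_mult[OF 2(1) d(1)] 1(2) d(2) by (intro relI[of _ _ "v ** d" "a ** e"]) auto
qed

end

theorem right_localization_unique:
 assumes L: "right_localization R S l L" and L': "right_localization R S l' L'" and S: "S <= carrier R"
 shows "\<exists>\<phi>\<in>ring_iso L L'. \<forall>a\<in>carrier R. \<phi> (l a) = l' a"
proof -
 interpret F: two_right_localizations R S l L l' L' by unfold_locales fact+
 interpret B: two_right_localizations R S l' L' l L by unfold_locales fact+
 \<comment> \<open>The graph is symmetric, so injectivity and surjectivity are single-valuedness and
   totality in the other direction.\<close>
 have sym: "B.rel q' q \<longleftrightarrow> F.rel q q'" for q q'
  unfolding F.rel_def B.rel_def F.good_def B.good_def by blast
 define \<phi> where "\<phi> q = (SOME q'. F.rel q q')" for q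
 have rel: "F.rel q (\<phi> q)" if "q : carrier L" for q
  unfolding \<phi>_def using F.rel_total[OF that] by (rule someI_ex)
 have \<phi>I: "\<phi> q = q'" if "F.rel q q'" for q q'
  using F.rel_functional[OF rel that] that unfolding F.rel_def by blast
 have c: "\<phi> q : carrier L'" if "q : carrier L" for q using rel[OF that] unfolding F.rel_def by blast
 have "\<phi> : ring_hom L L'"
  by (intro ring_hom_memI c \<phi>I F.rel_add F.rel_mult rel)
   (use F.rel_hom[OF F.R.one_closed] in auto)
 moreover have "inj_on \<phi> (carrier L)"
  by (intro inj_onI) (metis rel sym B.rel_functional)
 moreover have "q' : \<phi> ` carrier L" if "q' : carrier L'" for q'
  using B.rel_total[OF that] \<phi>I sym unfolding F.rel_def by blast
 ultimately show ?thesis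
  unfolding ring_iso_def bij_betw_def using c \<phi>I[OF F.rel_hom] by blast
qed

text \<open>If \<open>I^(m+1) = 0\<close> with \<open>m >= 1\<close>, then \<open>x y x = 0\<close>
  for all \<open>x\<close> in \<open>I^m\<close>, so \<open>I^m = 0\<close> already.\<close>

lemma (in ring) semiprime_elementwise:
 assumes e: "!!x. [|x : carrier R; !!y. y : carrier R ==> x ** y ** x = \<zero>|] ==> x = \<zero>"
 shows "semiprime_ring R"
 unfolding semiprime_ring_def
proof (intro conjI allI impI ring_axioms)
 fix I assume "nilpotent_ideal I R"
 then obtain n where I: "ideal I R" and n: "ideal_pow R I n = {\<zero>}" unfolding nilpotent_ideal_def by blast
 have id: "ideal (ideal_pow R I m) R" for m by (induction m) (auto intro: oneideal ideal_prod_is_ideal I)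
 have one: "x : ideal_pow R I 1" if "x : I" for x
  using ideal_prod.prod[of \<one> "carrier R" x I R] that ideal.Icarr[OF I that] by simp
 have sub: "ideal_pow R I (Suc m) <= I" for m
  using ideal_prod_inter[OF id[of m] I] unfolding ideal_pow.simps by blast
 have z: "\<zero> : I" by (rule additive_subgroup.zero_closed[OF ideal.axioms(1)[OF I]])
 from n show "I = {\<zero>}"
 proof (induction n)
  case 0
  then have "carrier R = {\<zero>}" unfolding ideal_pow.simps .
  moreover have "I <= carrier R" using ideal.Icarr[OF I] by blast
  ultimately show ?case using z by blast
 next
  case (Suc m)
  show ?case
  proof (cases m)
   case 0
   have "I <= ideal_pow R I 1" using one by blast
   then show ?thesis using Suc.prems z unfolding 0 One_nat_def by blast
  next
   case (Suc k)
   have "x = \<zero>" if x: "x : ideal_pow R I m" for x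
   proof (rule e)
    show "x : carrier R" using ideal.Icarr[OF id x] .
    fix y assume "y : carrier R"
    then have "x ** y : ideal_pow R I m" using ideal.I_r_closed[OF id x] by simp
    moreover have "x : I" using x sub[of k] unfolding Suc by blast
    ultimately have "x ** y ** x : ideal_pow R I (Suc m)" by (simp add: ideal_prod.prod)
    then show "x ** y ** x = \<zero>" using Suc.prems by simp
   qed
   then have "ideal_pow R I m = {\<zero>}" using additive_subgroup.zero_closed[OF ideal.axioms(1)[OF id]] by blast
   then show ?thesis by (rule Suc.IH)
  qed
 qed
qed

section \<open>Orders in artinian module algebras\<close>

locale hopf_order = semisimple_hopf_action K H r b \<phi> Q actQ t + AA: hopf_module_algebra K H A act
 for K :: "'k ring" and H :: "('k, 'h) hopf" and r b \<phi> and Q :: "('k, 'q) module" (structure) and actQ t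
  and A :: "('k, 'a) module" and act +
 fixes \<iota> :: "'a => 'q"
 assumes semiprime: "H_semiprime H A act" and quotient: "classical_right_quotient_ring A \<iota> Q"
  and art: "right_artinian Q" and \<iota>_linear: "\<iota> : algebra_homs K A Q"
  and \<iota>_act: "[|h : carrier H; a : carrier A|] ==> \<iota> (act h a) = actQ h (\<iota> a)"
begin

sublocale h: ring_hom_ring A Q \<iota>
 using quotient unfolding classical_right_quotient_ring_def by (intro ring_hom_ringI2) auto

lemma inj: "inj_on \<iota> (carrier A)"
 and regular_units: "s : regular_elements A ==> \<iota> s : Units Q"
 and fraction: "q : carrier Q ==> \<exists>a\<in>carrier A. \<exists>s\<in>regular_elements A. q = \<iota> a ** inv (\<iota> s)"
 using quotient unfolding classical_right_quotient_ring_def by auto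

lemma \<iota>_eq: "[|x : carrier A; y : carrier A|] ==> \<iota> x = \<iota> y \<longleftrightarrow> x = y"
 using inj unfolding inj_on_def by blast

lemma \<iota>_zero: "x : carrier A ==> \<iota> x = \<zero> \<longleftrightarrow> x = \<zero>\<^bsub>A\<^esub>"
 using \<iota>_eq[of x "\<zero>\<^bsub>A\<^esub>"] by simp

lemma \<iota>_smult: "[|c : carrier K; x : carrier A|] ==> \<iota> (c \<odot>\<^bsub>A\<^esub> x) = c \<odot> \<iota> x"
 using \<iota>_linear unfolding algebra_homs_def linear_maps_def by auto

lemma act_A: "[|h : carrier H; a : carrier A|] ==> act h a : carrier A"
 using linear_mapsD(1)[OF AA.act_linear] by blast

lemma regular_carrier: "s : regular_elements A ==> s : carrier A"
 unfolding regular_elements_def by blast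

lemma ideal_preimage:
 assumes N: "N <= \<iota> ` carrier A" "\<zero> : N" "!!x y. x : N ==> y : N ==> x \<oplus> y : N"
  and l: "!!a x. a : \<iota> ` carrier A ==> x : N ==> a ** x : N"
  and r: "!!a x. a : \<iota> ` carrier A ==> x : N ==> x ** a : N"
 shows "ideal {a : carrier A. \<iota> a : N} A"
proof (rule idealI[OF AA.A.A.ring_axioms])
 have u: "\<ominus>\<^bsub>A\<^esub> a = (\<ominus>\<^bsub>A\<^esub> \<one>\<^bsub>A\<^esub>) **\<^bsub>A\<^esub> a" if "a : carrier A" for a using that by (simp add: AA.A.A.l_minus)
 have "\<iota> (\<ominus>\<^bsub>A\<^esub> a) : N" if "a : carrier A" "\<iota> a : N" for a
  using l[OF imageI that(2), of "\<ominus>\<^bsub>A\<^esub> \<one>\<^bsub>A\<^esub>"] that(1) unfolding u[OF that(1)] by (simp del: h.hom_a_inv)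
 then show "subgroup {a : carrier A. \<iota> a : N} (add_monoid A)"
  using N by (intro AA.A.M.add.subgroupI) (auto simp: a_inv_def[symmetric])
qed (use l r in auto)

sublocale ro: right_order Q r "%i j. actQ (u i j)" "%i j. actQ (S (u i j))" "actQ ` carrier H" Ks "actQ t" "\<iota> ` carrier A"
proof unfold_locales
 show "\<exists>s\<in>\<iota> ` carrier A \<inter> Units Q. q ** s : \<iota> ` carrier A" if q: "q : carrier Q" for q
 proof -
  obtain a s where a: "a : carrier A" "s : regular_elements A" "q = \<iota> a ** inv (\<iota> s)"
   using fraction[OF q] by blast
  have "q ** \<iota> s = \<iota> a"
   unfolding a(3) using A.A.fraction_mult[OF regular_units[OF a(2)]] a(1) by simp
  then show ?thesis using a regular_units regular_carrier by (intro bexI[of _ "\<iota> s"]) auto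
 qed
 show "\<ominus> x : \<iota> ` carrier A" if "x : \<iota> ` carrier A" for x
  using that by (auto simp flip: h.hom_a_inv)
 show "N <= {\<zero>}"
  if N: "N <= \<iota> ` carrier A" "\<zero> : N" "!!x y. x : N ==> y : N ==> x \<oplus> y : N"
   "!!a x. a : \<iota> ` carrier A ==> x : N ==> a ** x : N" "!!a x. a : \<iota> ` carrier A ==> x : N ==> x ** a : N"
   and st: "co.stable N" and sq: "!!x y. x : N ==> y : N ==> x ** y = \<zero>" for N
 proof -
  \<comment> \<open>The preimage is a stable ideal whose second power is zero, so
    \<open>H_semiprime\<close> applies to it.\<close>
  define I where "I = {a : carrier A. \<iota> a : N}"
  have I: "ideal I A" unfolding I_def by (rule ideal_preimage[OF N])
  have I1: "ideal_pow A I 1 <= I" using AA.A.A.ideal_prod_inter[OF AA.A.A.oneideal I] by simp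
  have "x = \<zero>\<^bsub>A\<^esub>" if "x : ideal_prod A (ideal_pow A I 1) I" for x
   using that
  proof induction
   case (prod i j)
   then have "i : I" "j : I" using I1 by auto
   then show ?case using sq \<iota>_zero[of "i **\<^bsub>A\<^esub> j"] unfolding I_def by simp
  qed simp
  moreover have p2: "ideal_pow A I 2 = ideal_prod A (ideal_pow A I 1) I" by (simp add: numeral_2_eq_2)
  moreover have "ideal (ideal_pow A I 2) A"
   unfolding p2 by (simp, intro AA.A.A.ideal_prod_is_ideal AA.A.A.oneideal I)
  then have "\<zero>\<^bsub>A\<^esub> : ideal_pow A I 2" by (rule additive_subgroup.zero_closed[OF ideal.axioms(1)])
  ultimately have "ideal_pow A I 2 = {\<zero>\<^bsub>A\<^esub>}" by blast
  moreover have "H_stable H act I"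
   unfolding H_stable_def I_def using st[unfolded stable_iff H_stable_def] act_A \<iota>_act by auto
  ultimately have "I = {\<zero>\<^bsub>A\<^esub>}" using semiprime I unfolding H_semiprime_def nilpotent_ideal_def by blast
  then show ?thesis using N(1) unfolding I_def by force
 qed
 show "Ks <= \<iota> ` carrier A"
 proof
  fix x assume "x : Ks"
  then obtain c where c: "c : carrier K" "x = c \<odot> \<one>" by blast
  then show "x : \<iota> ` carrier A" using \<iota>_smult[OF c(1) AA.A.A.one_closed] by (intro image_eqI[of _ _ "c \<odot>\<^bsub>A\<^esub> \<one>\<^bsub>A\<^esub>"]) auto
 qed
 show "w x : \<iota> ` carrier A" if w: "w : actQ ` carrier H" and x: "x : \<iota> ` carrier A" for w x
 proof -
  obtain h a where h: "h : carrier H" "w = actQ h" and a: "a : carrier A" "x = \<iota> a" using w x by blast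
  have "w x = \<iota> (act h a)" using \<iota>_act[OF h(1) a(1)] h(2) a(2) by simp
  then show ?thesis using act_A[OF h(1) a(1)] by blast
 qed
qed (use art in \<open>auto simp flip: h.hom_mult h.hom_add h.hom_one\<close>)

lemma regular_iff: "s : regular_elements A \<longleftrightarrow> s : carrier A & \<iota> s : ro.Reg"
proof
 assume s: "s : carrier A & \<iota> s : ro.Reg"
 then have Rs: "\<iota> s : ro.Reg" "s : carrier A" by auto
 show "s : regular_elements A"
  unfolding regular_elements_def
 proof (intro CollectI conjI ballI impI Rs(2))
  fix a assume a: "a : carrier A"
  show "a = \<zero>\<^bsub>A\<^esub>" if "s **\<^bsub>A\<^esub> a = \<zero>\<^bsub>A\<^esub>"
   using ro.Reg_cancel[OF Rs(1), of "\<iota> a"] h.hom_mult[OF Rs(2) a] that a \<iota>_zero[OF a] by simp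
  show "a = \<zero>\<^bsub>A\<^esub>" if "a **\<^bsub>A\<^esub> s = \<zero>\<^bsub>A\<^esub>"
   using ro.Reg_cancel_right[OF Rs(1), of "\<iota> a"] h.hom_mult[OF a Rs(2)] that a \<iota>_zero[OF a] by simp
 qed
qed (use regular_carrier regular_units in auto)

lemma Reg_image: "ro.Reg = \<iota> ` regular_elements A"
 using regular_iff by auto

lemma Arid_image:
 assumes "right_ideal I A" shows "ro.Arid (\<iota> ` I)"
proof -
 note D' = AA.A.A.right_idealD[OF assms]
 have c: "x : carrier A" if "x : I" for x using D'(1) that by blast
 show ?thesis
 proof (rule ro.AridI)
  show "\<iota> ` I <= \<iota> ` carrier A" using D'(1) by blast
  show "\<zero> : \<iota> ` I" using D'(2) by (rule rev_image_eqI) simp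
  show "x \<oplus> y : \<iota> ` I" if "x : \<iota> ` I" "y : \<iota> ` I" for x y
   using that D'(3) c by (auto simp flip: h.hom_add)
  show "x ** a : \<iota> ` I" if "x : \<iota> ` I" "a : \<iota> ` carrier A" for x a
   using that D'(4) c by (auto simp flip: h.hom_mult)
 qed
qed

lemma right_ideal_preimage:
 assumes M: "ro.Arid M" shows "right_ideal {a : carrier A. \<iota> a : M} A"
 using ro.AridD[OF M] by (intro AA.A.A.right_idealI) auto

lemma image_preimage: "M <= \<iota> ` carrier A ==> \<iota> ` {a : carrier A. \<iota> a : M} = M"
 by auto

lemma core_image:
 assumes "right_ideal I A" shows "ro.core (\<iota> ` I) = \<iota> ` {x : I. \<forall>h\<in>carrier H. act h x : I}"
proof -
 have c: "x : carrier A" if "x : I" for x using AA.A.A.right_idealD(1)[OF assms] that by blast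
 have "actQ h (\<iota> x) : \<iota> ` I \<longleftrightarrow> act h x : I" if "x : I" "h : carrier H" for x h
  using inj_on_image_mem_iff[OF inj act_A[OF that(2) c[OF that(1)]] AA.A.A.right_idealD(1)[OF assms]]
   \<iota>_act[OF that(2) c[OF that(1)]] by simp
 then show ?thesis unfolding ro.core_def by auto
qed

text \<open>The elements whose orbit stays in \<open>I\<close> form a stable right ideal, so the
  greatest one exists and \<open>GREATEST\<close> finds it.\<close>

lemma H_core_eq:
 assumes I: "right_ideal I A" shows "H_core H A act I = {x : I. \<forall>h\<in>carrier H. act h x : I}" (is "_ = ?C")
proof -
 have c: "x : carrier A" if "x : I" for x using AA.A.A.right_idealD(1)[OF I] that by blast
 have "?C = {a : carrier A. \<iota> a : ro.core (\<iota> ` I)}"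
  unfolding core_image[OF I] using c \<iota>_eq by auto
 then have "right_ideal ?C A" using right_ideal_preimage[OF ro.Arid_core[OF Arid_image[OF I]]] by simp
 moreover have "H_stable H act ?C"
  unfolding H_stable_def using c AA.act_assoc[symmetric] AA.A.A.ring_axioms by auto
 ultimately show ?thesis unfolding H_core_def by (intro Greatest_equality) (auto simp: H_stable_def)
qed

lemma essential_iff:
 assumes I: "right_ideal I A"
 shows "essential_right_ideal (H_core H A act I) A \<longleftrightarrow> I \<inter> regular_elements A ~= {}"
proof -
 let ?C = "H_core H A act I"
 have Ic: "I <= carrier A" using AA.A.A.right_idealD(1)[OF I] .
 have C: "\<iota> ` ?C = ro.core (\<iota> ` I)" unfolding H_core_eq[OF I] core_image[OF I] ..
 have Cc: "?C <= carrier A" unfolding H_core_eq[OF I] using Ic by blast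
 have "?C = {a : carrier A. \<iota> a : ro.core (\<iota> ` I)}" unfolding C[symmetric] using Cc \<iota>_eq by auto
 then have rC: "right_ideal ?C A" using right_ideal_preimage[OF ro.Arid_core[OF Arid_image[OF I]]] by simp
 have zero: "J = {\<zero>\<^bsub>A\<^esub>} \<longleftrightarrow> \<iota> ` J = {\<zero>}" if "J <= carrier A" for J
  using inj_on_image_eq_iff[OF inj that, of "{\<zero>\<^bsub>A\<^esub>}"] by simp
 have int: "?C \<inter> J = {\<zero>\<^bsub>A\<^esub>} \<longleftrightarrow> ro.core (\<iota> ` I) \<inter> \<iota> ` J = {\<zero>}" if "J <= carrier A" for J
  using zero[of "?C \<inter> J"] inj_on_image_Int[OF inj Cc that] that C by auto
 have "essential_right_ideal ?C A \<longleftrightarrow> (\<forall>J. ro.Arid J & J ~= {\<zero>} --> ro.core (\<iota> ` I) \<inter> J ~= {\<zero>})"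
 proof
  assume e: "essential_right_ideal ?C A"
  show "\<forall>J. ro.Arid J & J ~= {\<zero>} --> ro.core (\<iota> ` I) \<inter> J ~= {\<zero>}"
  proof (intro allI impI, elim conjE)
   fix J assume J: "ro.Arid J" "J ~= {\<zero>}"
   let ?J = "{a : carrier A. \<iota> a : J}"
   have i: "\<iota> ` ?J = J" using image_preimage ro.AridD(1)[OF J(1)] by blast
   have Jc: "?J <= carrier A" by blast
   have "?J ~= {\<zero>\<^bsub>A\<^esub>}" using zero[OF Jc] J(2) unfolding i by blast
   then have "?C \<inter> ?J ~= {\<zero>\<^bsub>A\<^esub>}"
    using e right_ideal_preimage[OF J(1)] unfolding essential_right_ideal_def by blast
   then show "ro.core (\<iota> ` I) \<inter> J ~= {\<zero>}" using int[OF Jc] unfolding i by blast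
  qed
 next
  assume e: "\<forall>J. ro.Arid J & J ~= {\<zero>} --> ro.core (\<iota> ` I) \<inter> J ~= {\<zero>}"
  show "essential_right_ideal ?C A"
   unfolding essential_right_ideal_def
  proof (intro conjI allI impI rC, elim conjE)
   fix J assume J: "right_ideal J A" "J ~= {\<zero>\<^bsub>A\<^esub>}"
   note Jc = AA.A.A.right_idealD(1)[OF J(1)]
   have "ro.core (\<iota> ` I) \<inter> \<iota> ` J ~= {\<zero>}" using e Arid_image[OF J(1)] zero[OF Jc] J(2) by blast
   then show "?C \<inter> J ~= {\<zero>\<^bsub>A\<^esub>}" using int[OF Jc] by blast
  qed
 qed
 also have "... \<longleftrightarrow> \<iota> ` I \<inter> ro.Reg ~= {}" by (rule ro.core_essential_iff[OF Arid_image[OF I]])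
 also have "... \<longleftrightarrow> I \<inter> regular_elements A ~= {}"
  unfolding Reg_image using inj_on_image_Int[OF inj Ic, of "regular_elements A"] regular_carrier by auto
 finally show ?thesis .
qed

end

section \<open>The invariant subalgebra and its quotient ring\<close>

context hopf_order begin

abbreviation "B \<equiv> invariant_subalgebra H A act"

lemma B_simps [simp]:
 "carrier B = {a : carrier A. \<forall>h\<in>carrier H. act h a = \<epsilon> h \<odot>\<^bsub>A\<^esub> a}" "x **\<^bsub>B\<^esub> y = x **\<^bsub>A\<^esub> y" "x \<oplus>\<^bsub>B\<^esub> y = x \<oplus>\<^bsub>A\<^esub> y"
 "\<one>\<^bsub>B\<^esub> = \<one>\<^bsub>A\<^esub>" "\<zero>\<^bsub>B\<^esub> = \<zero>\<^bsub>A\<^esub>"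
 unfolding invariant_subalgebra_def by auto

lemma B_iff: "a : carrier B \<longleftrightarrow> a : carrier A & \<iota> a : co.invs"
proof (cases "a : carrier A")
 case True
 have "act h a = \<epsilon> h \<odot>\<^bsub>A\<^esub> a \<longleftrightarrow> actQ h (\<iota> a) = \<epsilon> h \<odot> \<iota> a" if h: "h : carrier H" for h
  using \<iota>_eq[OF act_A[OF h True], of "\<epsilon> h \<odot>\<^bsub>A\<^esub> a"] \<iota>_act[OF h True] \<iota>_smult[of "\<epsilon> h" a] h True by simp
 then show ?thesis using True invs_iff by simp
qed simp

lemma B_carrier: "a : carrier B ==> a : carrier A"
 by simp

lemma B_invs: "a : carrier B ==> \<iota> a : co.invs"
 using B_iff by blast

lemma BI: "[|a : carrier A; \<iota> a : co.invs|] ==> a : carrier B"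
 using B_iff by blast

lemma invs_B: "[|y : \<iota> ` carrier A; y : co.invs|] ==> \<exists>a\<in>carrier B. y = \<iota> a"
 using BI by blast

declare B_simps(1) [simp del]

lemma ring_B: "ring B"
proof -
 have "subring (carrier B) A"
  by (rule AA.A.A.subringI)
   (use B_carrier B_invs co.invs_add co.invs_mult co.invs_uminus co.invs_one in \<open>auto intro!: BI\<close>)
 then show ?thesis
  using AA.A.A.subring_is_ring[of "carrier B"] unfolding invariant_subalgebra_def by simp
qed

text \<open>Regularity in the invariants is tested only against invariants;
  \<open>ro.invariant_regular\<close> improves it to invertibility in \<open>Q\<close>.\<close>

lemma \<Sigma>_iff: "s : regular_elements B \<longleftrightarrow> s : carrier A & \<iota> s : ro.RegI"
proof
 assume s: "s : regular_elements B"
 then have sB: "s : carrier B" unfolding regular_elements_def by blast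
 have "\<iota> s : ro.RegI"
 proof (rule ro.invariant_regular[OF B_invs[OF sB]])
  show "\<iota> s : \<iota> ` carrier A" using B_carrier[OF sB] by blast
  fix y assume y: "y : \<iota> ` carrier A" "y : co.invs" and 0: "\<iota> s ** y = \<zero>"
  obtain a where a: "a : carrier B" "y = \<iota> a" using invs_B[OF y] by blast
  have "\<iota> (s **\<^bsub>A\<^esub> a) = \<zero>" using 0 a B_carrier[OF a(1)] B_carrier[OF sB] by simp
  then have "s **\<^bsub>B\<^esub> a = \<zero>\<^bsub>B\<^esub>" using \<iota>_zero[of "s **\<^bsub>A\<^esub> a"] B_carrier[OF a(1)] B_carrier[OF sB] by simp
  then have "a = \<zero>\<^bsub>B\<^esub>" using s a(1) unfolding regular_elements_def by blast
  then show "y = \<zero>" using a(2) by simp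
 qed
 then show "s : carrier A & \<iota> s : ro.RegI" using B_carrier[OF sB] by blast
next
 assume s: "s : carrier A & \<iota> s : ro.RegI"
 then have r: "s : regular_elements A" and "s : carrier B" using regular_iff BI by blast+
 then show "s : regular_elements B" using B_carrier unfolding regular_elements_def B_simps(2,5) by blast
qed

lemma \<Sigma>D:
 assumes "s : regular_elements B"
 shows "s : carrier A" "s : carrier B" "s : regular_elements A" "\<iota> s : ro.RegI" "\<iota> s : Units Q"
 using assms \<Sigma>_iff regular_iff BI by auto

lemma RegI_\<Sigma>: "x : ro.RegI ==> \<exists>s\<in>regular_elements B. x = \<iota> s"
 using \<Sigma>_iff by blast

lemma semiprime_B: "semiprime_ring B"
proof (rule ring.semiprime_elementwise[OF ring_B])
 fix x assume x: "x : carrier B" and z: "!!y. y : carrier B ==> x **\<^bsub>B\<^esub> y **\<^bsub>B\<^esub> x = \<zero>\<^bsub>B\<^esub>"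
 note xA = B_carrier[OF x]
 have "\<iota> x = \<zero>"
 proof (rule ro.invariant_semiprime[OF B_invs[OF x] imageI[OF xA]])
  fix y assume "y : \<iota> ` carrier A" "y : co.invs"
  then obtain a where a: "a : carrier B" "y = \<iota> a" using invs_B by blast
  have "\<iota> (x **\<^bsub>A\<^esub> a **\<^bsub>A\<^esub> x) = \<zero>" using z[OF a(1)] by simp
  then show "\<iota> x ** y ** \<iota> x = \<zero>" using xA a(2) B_carrier[OF a(1)] by simp
 qed
 then show "x = \<zero>\<^bsub>B\<^esub>" using \<iota>_zero[OF xA] by simp
qed

lemma goldie_B: "right_goldie B"
 unfolding right_goldie_def
proof (intro conjI allI impI notI ring_B)
 interpret B: ring B by (rule ring_B)
 assume "\<exists>I :: nat => 'a set. independent_right_ideals B I & (\<forall>n. I n ~= {\<zero>\<^bsub>B\<^esub>})"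
 then obtain I :: "nat => 'a set" where ind: "independent_right_ideals B I" "\<forall>n. I n ~= {\<zero>\<^bsub>B\<^esub>}" by blast
 have I: "right_ideal (I n) B" "I n ~= {\<zero>\<^bsub>B\<^esub>}" for n using ind unfolding independent_right_ideals_def by auto
 have I3: "\<forall>i<N. x i = \<zero>\<^bsub>B\<^esub>" if "\<forall>i<N. x i : I i" "(\<Oplus>\<^bsub>B\<^esub>i\<in>{..<N}. x i) = \<zero>\<^bsub>B\<^esub>" for N x
  using ind(1) that unfolding independent_right_ideals_def by blast
 note ID = B.right_idealD[OF I(1)]
 have IB: "x : carrier B" if "x : I n" for x n using ID(1) that by blast
 have "\<exists>n. \<iota> ` I n <= {\<zero>}"
 proof (rule ro.no_infinite_independent_invariants)
  show "\<iota> ` I n <= \<iota> ` carrier A \<inter> co.invs" for n using IB B_carrier B_invs by blast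
  show "x ** y : \<iota> ` I n" if x: "x : \<iota> ` I n" and y: "y : \<iota> ` carrier A \<inter> co.invs" for n x y
  proof -
   obtain a c where a: "a : I n" "x = \<iota> a" "c : carrier B" "y = \<iota> c" using x y invs_B by blast
   have "x ** y = \<iota> (a **\<^bsub>B\<^esub> c)" using a B_carrier IB by simp
   then show ?thesis using ID(4)[OF a(1,3)] by blast
  qed
  fix N x assume x: "!!i. i < N ==> x i : \<iota> ` I i" and s: "(\<Oplus>i\<in>{..<N}. x i) = \<zero>"
  define y where "y i = (SOME a. a : I i & x i = \<iota> a)" for i
  have y: "y i : I i" "x i = \<iota> (y i)" if "i < N" for i
  proof -
   have "\<exists>a. a : I i & x i = \<iota> a" using x[OF that] by blast
   then have "y i : I i & x i = \<iota> (y i)" unfolding y_def by (rule someI_ex)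
   then show "y i : I i" "x i = \<iota> (y i)" by auto
  qed
  have yA: "y i : carrier A" if "i < N" for i using B_carrier[OF IB[OF y(1)[OF that]]] .
  have c: "finsum B y {..<N} : carrier B" using y IB by (intro B.finsum_closed) auto
  have "\<iota> (finsum B y {..<N}) = (\<Oplus>i\<in>{..<N}. \<iota> (y i))"
   unfolding finsum_def using y IB B_carrier
   by (intro hom_finprod[OF homI B.a_comm_group A.M.a_comm_group]) auto
  also have "... = \<zero>" unfolding s[symmetric] using y(2) yA by (intro A.M.finsum_cong') auto
  finally have "finsum B y {..<N} = \<zero>\<^bsub>B\<^esub>" using \<iota>_zero[OF B_carrier[OF c]] by simp
  then have "\<forall>i<N. y i = \<zero>\<^bsub>B\<^esub>" using I3 y(1) by blast
  then show "\<forall>i<N. x i = \<zero>" using y(2) by simp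
 qed
 then obtain n where n: "\<iota> ` I n <= {\<zero>}" by blast
 have "x = \<zero>\<^bsub>B\<^esub>" if "x : I n" for x using n that \<iota>_zero[OF B_carrier[OF IB[OF that]]] by auto
 then show False using I(2)[of n] ID(2)[of n] by blast
next
 interpret B: ring B by (rule ring_B)
 fix S :: "nat => 'a set"
 assume S: "\<forall>n. S n <= carrier B & right_annihilator B (S n) <= right_annihilator B (S (Suc n))"
 then have SB: "s : carrier B" if "s : S n" for s n using that by blast
 have an: "{y : \<iota> ` carrier A \<inter> co.invs. \<forall>s\<in>\<iota> ` S n. s ** y = \<zero>} = \<iota> ` right_annihilator B (S n)" for n
 proof -
  have e: "\<iota> s ** \<iota> a = \<zero> \<longleftrightarrow> s **\<^bsub>B\<^esub> a = \<zero>\<^bsub>B\<^esub>" if "s : S n" "a : carrier B" for s a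
   using \<iota>_zero[of "s **\<^bsub>A\<^esub> a"] B_carrier[OF SB[OF that(1)]] B_carrier[OF that(2)] by simp
  show ?thesis
  proof (intro subset_antisym subsetI)
   fix y assume y: "y : {y : \<iota> ` carrier A \<inter> co.invs. \<forall>s\<in>\<iota> ` S n. s ** y = \<zero>}"
   then obtain a where a: "a : carrier B" "y = \<iota> a" using invs_B by blast
   then have "a : right_annihilator B (S n)" unfolding right_annihilator_def using y e by auto
   then show "y : \<iota> ` right_annihilator B (S n)" using a(2) by blast
  next
   fix y assume "y : \<iota> ` right_annihilator B (S n)"
   then obtain a where a: "a : carrier B" "\<forall>s\<in>S n. s **\<^bsub>B\<^esub> a = \<zero>\<^bsub>B\<^esub>" "y = \<iota> a"
    unfolding right_annihilator_def by blast
   then show "y : {y : \<iota> ` carrier A \<inter> co.invs. \<forall>s\<in>\<iota> ` S n. s ** y = \<zero>}"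
    using e B_carrier B_invs by auto
  qed
 qed
 have SI: "\<iota> ` S n <= \<iota> ` carrier A \<inter> co.invs" for n using SB B_carrier B_invs by blast
 have mono: "\<iota> ` right_annihilator B (S n) <= \<iota> ` right_annihilator B (S (Suc n))" for n using S by blast
 have "\<exists>N. \<forall>n\<ge>N. \<iota> ` right_annihilator B (S n) = \<iota> ` right_annihilator B (S N)"
  using ro.invariant_annihilator_acc[of "%n. \<iota> ` S n", OF SI] mono unfolding an by blast
 then obtain N where N: "\<forall>n\<ge>N. \<iota> ` right_annihilator B (S n) = \<iota> ` right_annihilator B (S N)" by blast
 have sub: "right_annihilator B (S n) <= carrier A" for n unfolding right_annihilator_def using B_carrier by blast
 have "right_annihilator B (S n) = right_annihilator B (S N)" if "n >= N" for n
  using N that inj_on_image_eq_iff[OF inj sub sub] by blast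
 then show "\<exists>N. \<forall>n\<ge>N. right_annihilator B (S n) = right_annihilator B (S N)" by blast
qed

lemma ore_\<Sigma>: "right_ore_set A (regular_elements B)"
 unfolding right_ore_set_def
proof (intro conjI ballI)
 show "regular_elements B <= carrier A" using \<Sigma>D(1) by blast
 show "\<one>\<^bsub>A\<^esub> : regular_elements B" using ro.Reg_one co.invs_one by (simp add: \<Sigma>_iff)
 show "s **\<^bsub>A\<^esub> s' : regular_elements B" if "s : regular_elements B" "s' : regular_elements B" for s s'
  using that ro.Reg_mult[of "\<iota> s" "\<iota> s'"] co.invs_mult[of "\<iota> s" "\<iota> s'"] by (simp add: \<Sigma>_iff)
 fix a s assume a: "a : carrier A" and s: "s : regular_elements B"
 obtain x y where x: "x : \<iota> ` carrier A" "y : ro.RegI" "\<iota> a ** y = \<iota> s ** x"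
  using ro.invariant_ore[OF imageI[OF a] \<Sigma>D(4)[OF s]] by blast
 obtain c s' where c: "c : carrier A" "x = \<iota> c" "s' : regular_elements B" "y = \<iota> s'"
  using x RegI_\<Sigma> by blast
 have "\<iota> (a **\<^bsub>A\<^esub> s') = \<iota> (s **\<^bsub>A\<^esub> c)" using x(3) c a \<Sigma>D(1) s by simp
 then show "\<exists>b\<in>carrier A. \<exists>t\<in>regular_elements B. a **\<^bsub>A\<^esub> t = s **\<^bsub>A\<^esub> b"
  using c(1,3) a s \<Sigma>D(1) \<iota>_eq[of "a **\<^bsub>A\<^esub> s'" "s **\<^bsub>A\<^esub> c"] by auto
qed

text \<open>For invariant \<open>q\<close> the numerator is invariant as well, so the same fractions
  describe \<open>Q\<close> and its subring of invariants.\<close>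

lemma \<Sigma>_fraction:
 assumes "q : carrier Q"
 obtains a s where "a : carrier A" "s : regular_elements B" "q = \<iota> a ** inv (\<iota> s)"
  "q : co.invs --> a : carrier B"
proof -
 obtain y where y: "y : ro.RegI" "q ** y : \<iota> ` carrier A" using ro.invariant_denominator[OF assms] by blast
 then obtain a s where a: "a : carrier A" "q ** y = \<iota> a" "s : regular_elements B" "y = \<iota> s"
  using RegI_\<Sigma> by blast
 have "q = \<iota> a ** inv (\<iota> s)"
  using A.A.fraction_iff[OF \<Sigma>D(5)[OF a(3)], of "\<iota> a" q] assms a by simp
 moreover have "a : carrier B" if "q : co.invs"
  using co.invs_mult[of q y] that y(1) BI[OF a(1)] unfolding a(2) by blast
 ultimately show ?thesis using that a by blast
qed

lemma localization_\<Sigma>: "right_localization A (regular_elements B) \<iota> Q"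
 unfolding right_localization_def
proof (intro conjI ballI AA.A.A.ring_axioms A.A.ring_axioms h.homh)
 show "\<iota> s : Units Q" if "s : regular_elements B" for s using \<Sigma>D(5)[OF that] .
 show "\<exists>a\<in>carrier A. \<exists>s\<in>regular_elements B. q = \<iota> a ** inv (\<iota> s)" if "q : carrier Q" for q
  using \<Sigma>_fraction[OF that] by metis
 fix a assume a: "a : carrier A"
 show "\<iota> a = \<zero> \<longleftrightarrow> (\<exists>s\<in>regular_elements B. a **\<^bsub>A\<^esub> s = \<zero>\<^bsub>A\<^esub>)"
 proof
  assume "\<iota> a = \<zero>"
  moreover have "\<one>\<^bsub>A\<^esub> : regular_elements B" using ro.Reg_one co.invs_one by (simp add: \<Sigma>_iff)
  ultimately show "\<exists>s\<in>regular_elements B. a **\<^bsub>A\<^esub> s = \<zero>\<^bsub>A\<^esub>" using \<iota>_zero[OF a] a by (intro bexI[of _ "\<one>\<^bsub>A\<^esub>"]) auto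
 next
  assume "\<exists>s\<in>regular_elements B. a **\<^bsub>A\<^esub> s = \<zero>\<^bsub>A\<^esub>"
  then obtain s where "s : regular_elements A" "a **\<^bsub>A\<^esub> s = \<zero>\<^bsub>A\<^esub>" using \<Sigma>D(3) by blast
  then have "a = \<zero>\<^bsub>A\<^esub>" using a unfolding regular_elements_def by blast
  then show "\<iota> a = \<zero>" by simp
 qed
qed

abbreviation "QH \<equiv> invariant_subalgebra H Q actQ"

lemma QH_simps [simp]:
 "carrier QH = co.invs" "x **\<^bsub>QH\<^esub> y = x ** y" "x \<oplus>\<^bsub>QH\<^esub> y = x \<oplus> y" "\<one>\<^bsub>QH\<^esub> = \<one>" "\<zero>\<^bsub>QH\<^esub> = \<zero>"
 using invs_iff unfolding invariant_subalgebra_def by auto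

lemma classical_quotient_B: "classical_right_quotient_ring B \<iota> QH"
 unfolding classical_right_quotient_ring_def
proof (intro conjI ballI ring_B)
 have "subring co.invs Q"
  by (rule A.A.subringI) (use co.invs_carrier co.invs_add co.invs_mult co.invs_uminus co.invs_one in auto)
 moreover have "QH = Q\<lparr>carrier := co.invs\<rparr>"
  unfolding invariant_subalgebra_def using invs_iff by (intro arg_cong[of _ _ "%c. Q\<lparr>carrier := c\<rparr>"]) auto
 ultimately show QH: "ring QH" using A.A.subring_is_ring by metis
 show "\<iota> : ring_hom B QH" by (rule ring_hom_memI) (use B_carrier B_invs in auto)
 show "inj_on \<iota> (carrier B)" using inj B_carrier by (rule inj_on_subset[OF _ subsetI])
 have inv: "\<iota> s : Units QH & inv\<^bsub>QH\<^esub> (\<iota> s) = inv (\<iota> s)" if s: "s : regular_elements B" for s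
 proof -
  interpret QH: ring QH by (rule QH)
  note i = co.invs_carrier ro.inv_invs[OF \<Sigma>D(4)[OF s]] \<Sigma>D(5)[OF s]
  have "\<iota> s : co.invs" using \<Sigma>D(4)[OF s] by blast
  then show ?thesis
   using i QH.inv_char[of "\<iota> s" "inv (\<iota> s)"]
   unfolding Units_def[of QH] by (auto intro!: bexI[of _ "inv (\<iota> s)"])
 qed
 show "\<iota> s : Units QH" if "s : regular_elements B" for s using inv[OF that] by blast
 show "\<exists>a\<in>carrier B. \<exists>s\<in>regular_elements B. q = \<iota> a **\<^bsub>QH\<^esub> inv\<^bsub>QH\<^esub> (\<iota> s)" if q: "q : carrier QH" for q
 proof -
  have q': "q : carrier Q" "q : co.invs" using q co.invs_carrier by auto
  obtain a s where a: "a : carrier A" "s : regular_elements B" "q = \<iota> a ** inv (\<iota> s)"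
   "q : co.invs --> a : carrier B" using \<Sigma>_fraction[OF q'(1)] .
  show ?thesis using a(2-4) q'(2) inv[OF a(2)] by (intro bexI[of _ a] bexI[of _ s]) auto
 qed
qed

lemma E_ideal_meets_\<Sigma>:
 assumes "I : E_ideals H A act" shows "I \<inter> regular_elements B ~= {}"
proof -
 have I: "right_ideal I A" "I \<inter> regular_elements A ~= {}" using assms unfolding E_ideals_def by auto
 have Ic: "I <= carrier A" using AA.A.A.right_idealD(1)[OF I(1)] .
 have "\<iota> ` I \<inter> ro.Reg ~= {}" unfolding Reg_image using I(2) by blast
 then obtain x where x: "x : \<iota> ` I" "x : ro.RegI" using ro.contains_invariant_regular[OF Arid_image[OF I(1)]] by blast
 then obtain a where "a : I" "x = \<iota> a" by blast
 then show ?thesis using \<Sigma>_iff x(2) Ic by blast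
qed

end

text \<open>This reduces the uniqueness of classical quotient rings to that of
  localizations.\<close>

lemma classical_quotient_localization:
 assumes q: "classical_right_quotient_ring R j L"
 shows "right_localization R (regular_elements R) j L"
proof -
 have R: "ring R" "ring L" "j : ring_hom R L" "inj_on j (carrier R)" using q unfolding classical_right_quotient_ring_def by auto
 interpret j: ring_hom_ring R L j using R by (intro ring_hom_ringI2)
 have "j a = \<zero>\<^bsub>L\<^esub> \<longleftrightarrow> (\<exists>s\<in>regular_elements R. a **\<^bsub>R\<^esub> s = \<zero>\<^bsub>R\<^esub>)" if a: "a : carrier R" for a
 proof
  assume "j a = \<zero>\<^bsub>L\<^esub>"
  then have "a = \<zero>\<^bsub>R\<^esub>" using R(4) a unfolding inj_on_def by (metis j.R.zero_closed j.hom_zero)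
  then show "\<exists>s\<in>regular_elements R. a **\<^bsub>R\<^esub> s = \<zero>\<^bsub>R\<^esub>"
   by (intro bexI[of _ "\<one>\<^bsub>R\<^esub>"]) (auto simp: regular_elements_def)
 next
  assume "\<exists>s\<in>regular_elements R. a **\<^bsub>R\<^esub> s = \<zero>\<^bsub>R\<^esub>"
  then have "a = \<zero>\<^bsub>R\<^esub>" using a unfolding regular_elements_def by blast
  then show "j a = \<zero>\<^bsub>L\<^esub>" by simp
 qed
 then show ?thesis using q unfolding classical_right_quotient_ring_def right_localization_def by blast
qed

theorem theorem4p3:
  fixes K :: "'k ring"
    and H :: "('k, 'h) hopf"
    and A :: "('k, 'a) module"
    and Q :: "('k, 'q) module"
    and act :: "'h \<Rightarrow> 'a \<Rightarrow> 'a"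
    and actQ :: "'h \<Rightarrow> 'q \<Rightarrow> 'q"
    and \<iota> :: "'a \<Rightarrow> 'q"
    and \<Sigma> :: "'a set"
  assumes "hopf_algebra K H"
    and "finite_dimensional K H"
    and "semisimple_ring H"
    and "hopf_module_algebra K H A act"
    and "H_semiprime H A act"
    and "classical_right_quotient_ring A \<iota> Q"
    and "right_artinian Q"
    and "hopf_module_algebra K H Q actQ"
    and "\<iota> \<in> algebra_homs K A Q"
    and "\<forall>h\<in>carrier H. \<forall>a\<in>carrier A. \<iota> (act h a) = actQ h (\<iota> a)"
    and "\<Sigma> = regular_elements (invariant_subalgebra H A act)"
  shows
    "(\<forall>I. right_ideal I A \<longrightarrow>
        (essential_right_ideal (H_core H A act I) A \<longleftrightarrow> I \<inter> regular_elements A \<noteq> {})) \<and>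
     (semiprime_ring (invariant_subalgebra H A act) \<and> right_goldie (invariant_subalgebra H A act)) \<and>
     (\<Sigma> \<subseteq> regular_elements A \<and> right_ore_set A \<Sigma>) \<and>
     (right_localization A \<Sigma> \<iota> Q \<and>
      (\<forall>(L :: 'l ring) l. right_localization A \<Sigma> l L \<longrightarrow>
        (\<exists>\<phi>\<in>ring_iso L Q. \<forall>a\<in>carrier A. \<phi> (l a) = \<iota> a))) \<and>
     (classical_right_quotient_ring (invariant_subalgebra H A act) \<iota> (invariant_subalgebra H Q actQ) \<and>
      (\<forall>(B :: 'b ring) j. classical_right_quotient_ring (invariant_subalgebra H A act) j B \<longrightarrow>
        (\<exists>\<phi>\<in>ring_iso B (invariant_subalgebra H Q actQ).
           \<forall>a\<in>carrier (invariant_subalgebra H A act). \<phi> (j a) = \<iota> a))) \<and>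
     (\<forall>I\<in>E_ideals H A act. I \<inter> \<Sigma> \<noteq> {})"
proof -
 interpret H: hopf_algebra K H by fact
 from H.H.finite_dimensional_basis[OF assms(2)]
 obtain r b \<phi> where b: "\<forall>i<(r::nat). b i : carrier H" "\<forall>i<r. linear_functional K H (\<phi> i)"
  "\<forall>i<r. \<forall>j<r. \<phi> i (b j) = (if i = j then \<one>\<^bsub>K\<^esub> else \<zero>\<^bsub>K\<^esub>)"
  "\<forall>x\<in>carrier H. x = (\<Oplus>\<^bsub>H\<^esub>i\<in>{..<r}. \<phi> i x \<odot>\<^bsub>H\<^esub> b i)" .
 interpret hopf_basis K H r b \<phi> by unfold_locales (use b in blast)+
 obtain t where t: "t : carrier H" "counit H t = \<one>\<^bsub>K\<^esub>"
  "\<forall>h\<in>carrier H. h **\<^bsub>H\<^esub> t = counit H h \<odot>\<^bsub>H\<^esub> t & t **\<^bsub>H\<^esub> h = counit H h \<odot>\<^bsub>H\<^esub> t"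
  using integral_exists[OF assms(3)] .
 interpret A: hopf_module_algebra K H A act by fact
 interpret Q: hopf_module_algebra K H Q actQ by fact
 interpret O: hopf_order K H r b \<phi> Q actQ t A act \<iota>
  by unfold_locales (use assms t in blast)+
 have \<Sigma>: "\<Sigma> = regular_elements (invariant_subalgebra H A act)" by fact
 note loc = O.localization_\<Sigma>[folded \<Sigma>] and cq = O.classical_quotient_B
 have \<Sigma>c: "\<Sigma> <= carrier A" unfolding \<Sigma> using O.\<Sigma>D(1) by blast
 show ?thesis
 proof (intro conjI allI impI)
  show "essential_right_ideal (H_core H A act I) A \<longleftrightarrow> I \<inter> regular_elements A ~= {}" if "right_ideal I A" for I
   by (rule O.essential_iff[OF that])
  show "\<Sigma> <= regular_elements A" unfolding \<Sigma> using O.\<Sigma>D(3) by blast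
  show "\<exists>\<phi>\<in>ring_iso L Q. \<forall>a\<in>carrier A. \<phi> (l a) = \<iota> a" if "right_localization A \<Sigma> l L" for L :: "'l ring" and l
   by (rule right_localization_unique[OF that loc \<Sigma>c])
  show "\<exists>\<phi>\<in>ring_iso B (invariant_subalgebra H Q actQ).
    \<forall>a\<in>carrier (invariant_subalgebra H A act). \<phi> (j a) = \<iota> a"
   if "classical_right_quotient_ring (invariant_subalgebra H A act) j B" for B :: "'b ring" and j
   by (rule right_localization_unique[OF that[THEN classical_quotient_localization]
    cq[THEN classical_quotient_localization]]) (auto simp: regular_elements_def)
  show "\<forall>I\<in>E_ideals H A act. I \<inter> \<Sigma> ~= {}" unfolding \<Sigma> using O.E_ideal_meets_\<Sigma> by blast
 qed (use O.semiprime_B O.goldie_B O.ore_\<Sigma>[folded \<Sigma>] loc cq in auto)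
qed

end
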